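(* Let $p\ge N$, $0<\gamma<1$, let $0\le a\in L^{\infty}(\Omega)$ with $a\not\equiv0$, and let $f\in L^q(\Omega)$ satisfy: for every $\omega\subset\subset\Omega$ there exists $c_\omega>0$ such that $f(x)\ge c_\omega$ for a.e. $x\in\omega$. Then there exists $\mu_0>0$ such that for any $\mu\ge\mu_0$ the following holds for the problem $$-\Delta_p u+\frac{a(x)}{u^{\gamma}}=\mu f(x)\ \text{ in }\Omega,\qquad u=0\ \text{ on }\partial\Omega: \tag{P}$$ (i) if $p=N$ and $q>1$, then there exists a positive finite energy solution $u$ to (P); (ii) if $p>N$ and $q=1$, then there exists a positive finite energy solution $u$ to (P). Furthermore, $au^{-\gamma}\in L^1(\Omega)$, and there exists $t_0>0$, depending only on $\Omega,a,\gamma$ and $p$, such that $u\ge t_0\,\varphi_1^{\frac{p}{p-1+\gamma}}$ a.e. in $\Omega$.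
   Context: $\Omega\subset\mathbb{R}^N$ ($N\ge2$) is a bounded open set with smooth boundary and $\Delta_p u=\operatorname{div}(|\nabla u|^{p-2}\nabla u)$. For $k>0$, $T_k(s)=\max(-k,\min(s,k))$. Generalized gradient: if $u$ is measurable with $T_k(u)\in W^{1,1}_{\rm loc}(\Omega)$ for every $k>0$, then $\nabla u$ denotes the a.e. unique measurable vector field $v$ with $\nabla T_k(u)=v\chi_{\{|u|\le k\}}$ a.e. in $\Omega$ for every $k>0$. Solution: a nonnegative measurable function $u$ is a (distributional) solution of (P) if $T_k(u)\in W^{1,1}_0(\Omega)$ for every $k>0$, both $|\nabla u|^{p-1}$ and $au^{-\gamma}$ belong to $L^1_{\rm loc}(\Omega)$, and $$\int_\Omega|\nabla u|^{p-2}\nabla u\cdot\nabla\varphi+\int_\Omega\frac{a\varphi}{u^\gamma}=\mu\int_\Omega f\varphi\quad\text{for all }\varphi\in C^1_c(\Omega).$$ A finite energy solution is a solution that belongs to $W^{1,p}_0(\Omega)$. Positive means $u>0$ a.e. in $\Omega$. $\varphi_1\in C^1(\overline\Omega)$, $\varphi_1>0$ in $\Omega$, is a fixed first Dirichlet eigenfunction of the $p$-Laplacian: $-\Delta_p\varphi_1=\lambda_p\varphi_1^{p-1}$ in $\Omega$, $\varphi_1=0$ on $\partial\Omega$, where $\lambda_p=\min_{u\in W^{1,p}_0(\Omega),\,u\ne0}\frac{\int_\Omega|\nabla u|^p}{\int_\Omega|u|^p}$. *)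

theory Defs
  imports "HOL-Analysis.Analysis"
begin

section \<open>Classical differentiability\<close>

primrec C_k :: "nat \<Rightarrow> ('a::euclidean_space \<Rightarrow> real) \<Rightarrow> bool" where
  "C_k 0 g \<longleftrightarrow> continuous_on UNIV g"
| "C_k (Suc k) g \<longleftrightarrow> (\<forall>x. g differentiable (at x)) \<and>
     (\<forall>i\<in>Basis. C_k k (\<lambda>x. frechet_derivative g (at x) i))"

definition C_infinity :: "('a::euclidean_space \<Rightarrow> real) \<Rightarrow> bool" where
  "C_infinity g \<longleftrightarrow> (\<forall>k. C_k k g)"

definition gradient :: "('a::euclidean_space \<Rightarrow> real) \<Rightarrow> 'a \<Rightarrow> 'a" where
  "gradient g x = (THE D. GDERIV g x :> D)"

lemma gradient_eqI:
  assumes "GDERIV g x :> D"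
  shows "gradient g x = D"
  unfolding gradient_def
proof (rule the_equality)
  show "GDERIV g x :> D" by fact
  fix D' assume "GDERIV g x :> D'"
  with assms have "(\<lambda>h. h \<bullet> D') = (\<lambda>h. h \<bullet> D)"
    unfolding gderiv_def by (blast intro: has_derivative_unique)
  then show "D' = D"
    by (metis vector_eq_ldot)
qed

text \<open>Elements of \<open>C\<^sup>1\<^sub>c(\<Omega>)\<close> are identified with their extension by zero to the whole space.\<close>

definition C1_c :: "'a::euclidean_space set \<Rightarrow> ('a \<Rightarrow> real) set" where
  "C1_c \<Omega> = {\<phi>. C_k 1 \<phi> \<and> compact (closure {x. \<phi> x \<noteq> 0}) \<and> closure {x. \<phi> x \<noteq> 0} \<subseteq> \<Omega>}"

text \<open>\<open>C\<^sup>1\<close> up to the boundary: both the function and its gradient in the open set \<open>\<Omega>\<close> extend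
  continuously to the closure. Values outside the closure are irrelevant.\<close>

definition C1_closure :: "'a::euclidean_space set \<Rightarrow> ('a \<Rightarrow> real) set" where
  "C1_closure \<Omega> = {\<phi>. continuous_on (closure \<Omega>) \<phi> \<and>
     (\<exists>G. continuous_on (closure \<Omega>) G \<and> (\<forall>x\<in>\<Omega>. GDERIV \<phi> x :> G x))}"

text \<open>Near each boundary point, \<open>\<Omega>\<close> is, after a rotation of the axes, the part lying strictly
  above the graph of a \<open>C\<^sup>\<infinity>\<close> function. The unit vector \<open>e\<close> is the vertical direction and \<open>g\<close> is
  only evaluated on the hyperplane orthogonal to \<open>e\<close>; a smooth function on that hyperplane
  extends to the whole space by composition with the orthogonal projection.\<close>

definition smooth_boundary :: "'a::euclidean_space set \<Rightarrow> bool" where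
  "smooth_boundary \<Omega> \<longleftrightarrow>
     (\<forall>x0\<in>frontier \<Omega>. \<exists>r>0. \<exists>e g. norm e = 1 \<and> C_infinity g \<and>
        \<Omega> \<inter> ball x0 r = {x \<in> ball x0 r. x \<bullet> e > g (x - (x \<bullet> e) *\<^sub>R e)})"

definition compactly_contained :: "'a::topological_space set \<Rightarrow> 'a set \<Rightarrow> bool" where
  "compactly_contained \<omega> \<Omega> \<longleftrightarrow> compact (closure \<omega>) \<and> closure \<omega> \<subseteq> \<Omega>"

section \<open>Lebesgue and Sobolev spaces\<close>

text \<open>Members of these spaces are functions rather than classes modulo a.e.\ equality.\<close>

definition Lp :: "ereal \<Rightarrow> 'a::euclidean_space set \<Rightarrow> ('a \<Rightarrow> 'b::euclidean_space) set" where
  "Lp q \<Omega> = {f. f \<in> borel_measurable (lebesgue_on \<Omega>) \<and>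
     (if q = \<infinity> then \<exists>C. AE x in lebesgue_on \<Omega>. norm (f x) \<le> C
      else integrable (lebesgue_on \<Omega>) (\<lambda>x. norm (f x) powr real_of_ereal q))}"

definition L1_loc :: "'a::euclidean_space set \<Rightarrow> ('a \<Rightarrow> 'b::euclidean_space) set" where
  "L1_loc \<Omega> = {f. \<forall>K. compact K \<and> K \<subseteq> \<Omega> \<longrightarrow> integrable (lebesgue_on K) f}"

definition has_weak_gradient ::
    "'a::euclidean_space set \<Rightarrow> ('a \<Rightarrow> real) \<Rightarrow> ('a \<Rightarrow> 'a) \<Rightarrow> bool" where
  "has_weak_gradient \<Omega> u v \<longleftrightarrow> u \<in> L1_loc \<Omega> \<and> v \<in> L1_loc \<Omega> \<and>
     (\<forall>\<phi>\<in>C1_c \<Omega>. (LINT x|lebesgue_on \<Omega>. u x *\<^sub>R gradient \<phi> x)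
                 = - (LINT x|lebesgue_on \<Omega>. \<phi> x *\<^sub>R v x))"

text \<open>\<open>W\<^sup>1\<^sup>,\<^sup>p\<^sub>0(\<Omega>)\<close> is the closure of \<open>C\<^sup>1\<^sub>c(\<Omega>)\<close> in \<open>W\<^sup>1\<^sup>,\<^sup>p(\<Omega>)\<close>.\<close>

definition W1_0 :: "real \<Rightarrow> 'a::euclidean_space set \<Rightarrow> ('a \<Rightarrow> real) set" where
  "W1_0 p \<Omega> = {u. u \<in> Lp (ereal p) \<Omega> \<and>
     (\<exists>v. has_weak_gradient \<Omega> u v \<and> v \<in> Lp (ereal p) \<Omega> \<and>
       (\<exists>\<phi>::nat \<Rightarrow> 'a \<Rightarrow> real. (\<forall>n. \<phi> n \<in> C1_c \<Omega>) \<and>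
          (\<lambda>n. LINT x|lebesgue_on \<Omega>. \<bar>\<phi> n x - u x\<bar> powr p) \<longlonglongrightarrow> 0 \<and>
          (\<lambda>n. LINT x|lebesgue_on \<Omega>. norm (gradient (\<phi> n) x - v x) powr p) \<longlonglongrightarrow> 0))}"

section \<open>Solutions\<close>

definition truncate :: "real \<Rightarrow> real \<Rightarrow> real" where
  "truncate k s = max (- k) (min s k)"

text \<open>Weak gradients being unique up to null sets, the last conjunct says that every truncation
  lies in \<open>W\<^sup>1\<^sup>,\<^sup>1\<^sub>l\<^sub>o\<^sub>c(\<Omega>)\<close> and that its gradient is a.e.\ equal to the displayed field.\<close>

definition has_generalized_gradient ::
    "'a::euclidean_space set \<Rightarrow> ('a \<Rightarrow> real) \<Rightarrow> ('a \<Rightarrow> 'a) \<Rightarrow> bool" where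
  "has_generalized_gradient \<Omega> u v \<longleftrightarrow>
     u \<in> borel_measurable (lebesgue_on \<Omega>) \<and> v \<in> borel_measurable (lebesgue_on \<Omega>) \<and>
     (\<forall>k>0. has_weak_gradient \<Omega> (\<lambda>x. truncate k (u x))
              (\<lambda>x. indicat_real {y. \<bar>u y\<bar> \<le> k} x *\<^sub>R v x))"

text \<open>Solutions of \<open>- \<Delta>\<^sub>p u + a / u\<^sup>\<gamma> = \<mu> f\<close> with zero boundary values. Since \<open>0 powr (- \<gamma>) = 0\<close>
  in HOL, it is required separately that \<open>a\<close> vanishes a.e.\ where \<open>u\<close> does; mathematically this is
  part of the integrability of \<open>a u\<^sup>-\<^sup>\<gamma>\<close>, which is infinite where \<open>u = 0 < a\<close>.\<close>

definition is_solution ::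
    "real \<Rightarrow> real \<Rightarrow> 'a::euclidean_space set \<Rightarrow> ('a \<Rightarrow> real) \<Rightarrow> real \<Rightarrow> ('a \<Rightarrow> real) \<Rightarrow>
     ('a \<Rightarrow> real) \<Rightarrow> bool" where
  "is_solution p \<gamma> \<Omega> a \<mu> f u \<longleftrightarrow>
     u \<in> borel_measurable (lebesgue_on \<Omega>) \<and> (AE x in lebesgue_on \<Omega>. 0 \<le> u x) \<and>
     (\<forall>k>0. (\<lambda>x. truncate k (u x)) \<in> W1_0 1 \<Omega>) \<and>
     (AE x in lebesgue_on \<Omega>. u x = 0 \<longrightarrow> a x = 0) \<and>
     (\<lambda>x. a x * u x powr (- \<gamma>)) \<in> L1_loc \<Omega> \<and>
     (\<exists>v. has_generalized_gradient \<Omega> u v \<and>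
        (\<lambda>x. norm (v x) powr (p - 1)) \<in> L1_loc \<Omega> \<and>
        (\<forall>\<phi>\<in>C1_c \<Omega>.
           (LINT x|lebesgue_on \<Omega>. norm (v x) powr (p - 2) * (v x \<bullet> gradient \<phi> x))
             + (LINT x|lebesgue_on \<Omega>. a x * \<phi> x / u x powr \<gamma>)
           = \<mu> * (LINT x|lebesgue_on \<Omega>. f x * \<phi> x)))"

definition is_finite_energy_solution ::
    "real \<Rightarrow> real \<Rightarrow> 'a::euclidean_space set \<Rightarrow> ('a \<Rightarrow> real) \<Rightarrow> real \<Rightarrow> ('a \<Rightarrow> real) \<Rightarrow>
     ('a \<Rightarrow> real) \<Rightarrow> bool" where
  "is_finite_energy_solution p \<gamma> \<Omega> a \<mu> f u \<longleftrightarrow>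
     is_solution p \<gamma> \<Omega> a \<mu> f u \<and> u \<in> W1_0 p \<Omega>"

definition is_positive :: "'a::euclidean_space set \<Rightarrow> ('a \<Rightarrow> real) \<Rightarrow> bool" where
  "is_positive \<Omega> u \<longleftrightarrow> (AE x in lebesgue_on \<Omega>. 0 < u x)"

section \<open>First Dirichlet eigenfunctions of the p-Laplacian\<close>

definition rayleigh_quotients :: "real \<Rightarrow> 'a::euclidean_space set \<Rightarrow> real set" where
  "rayleigh_quotients p \<Omega> =
     {(LINT x|lebesgue_on \<Omega>. norm (v x) powr p) / (LINT x|lebesgue_on \<Omega>. \<bar>u x\<bar> powr p) | u v.
        u \<in> W1_0 p \<Omega> \<and> has_weak_gradient \<Omega> u v \<and> \<not> (AE x in lebesgue_on \<Omega>. u x = 0)}"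

definition is_first_eigenvalue :: "real \<Rightarrow> 'a::euclidean_space set \<Rightarrow> real \<Rightarrow> bool" where
  "is_first_eigenvalue p \<Omega> l \<longleftrightarrow>
     l \<in> rayleigh_quotients p \<Omega> \<and> (\<forall>m\<in>rayleigh_quotients p \<Omega>. l \<le> m)"

text \<open>The eigenvalue equation is understood in the distributional sense.\<close>

definition is_first_eigenfunction ::
    "real \<Rightarrow> 'a::euclidean_space set \<Rightarrow> ('a \<Rightarrow> real) \<Rightarrow> bool" where
  "is_first_eigenfunction p \<Omega> \<phi>1 \<longleftrightarrow>
     \<phi>1 \<in> C1_closure \<Omega> \<and> (\<forall>x\<in>\<Omega>. 0 < \<phi>1 x) \<and> (\<forall>x\<in>frontier \<Omega>. \<phi>1 x = 0) \<and>
     (\<exists>l. is_first_eigenvalue p \<Omega> l \<and>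
        (\<forall>\<phi>\<in>C1_c \<Omega>.
           (LINT x|lebesgue_on \<Omega>. norm (gradient \<phi>1 x) powr (p - 2) * (gradient \<phi>1 x \<bullet> gradient \<phi> x))
           = l * (LINT x|lebesgue_on \<Omega>. \<phi>1 x powr (p - 1) * \<phi> x)))"

end

theory Submission
  imports Defs
begin

text \<open>
Write \<open>A v = |v|\<^sup>p\<^sup>-\<^sup>2 v\<close>, \<open>\<beta> = p / (p - 1 + \<gamma>)\<close> and \<open>\<kappa> = (\<beta> - 1) (p - 1)\<close>. The proof traps a solution above
the explicit function \<open>w = t \<phi>\<^sup>\<beta>\<close>, where \<open>\<phi>\<close> is the given eigenfunction and \<open>l\<close> its eigenvalue.
The exponent \<open>\<beta>\<close> is the one for which \<open>\<kappa> - 1 = - \<beta> \<gamma>\<close>, so that a computation gives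
\<open>- \<Delta>\<^sub>p w + a w\<^sup>-\<^sup>\<gamma> = \<phi>\<^sup>\<kappa>\<^sup>-\<^sup>1 ((t \<beta>)\<^sup>p\<^sup>-\<^sup>1 (l \<phi>\<^sup>p - \<kappa> |\<nabla>\<phi>|\<^sup>p) + a t\<^sup>-\<^sup>\<gamma>)\<close>
(\<open>phi_powr_equation\<close>). Near the boundary \<open>\<phi>\<close> is small while \<open>|\<nabla>\<phi>|\<close> stays away from zero, by Hopf's
lemma (\<open>hopf\<close>, \<open>nondegenerate\<close>; this is where the smoothness of the boundary enters). Hence for
\<open>t\<close> large, depending only on \<open>\<Omega>\<close>, \<open>a\<close>, \<open>\<gamma>\<close>, \<open>p\<close> and \<open>\<phi>\<close>, the bracket is nonpositive there. On the remaining
compact part the bracket is bounded and \<open>f\<close> is bounded below, so \<open>\<mu> f\<close> dominates once \<open>\<mu>\<close> is large.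
Thus \<open>w\<close> is a weak subsolution (\<open>subsolution_inequality\<close>).

A solution above \<open>w\<close> is the limit of an iteration: \<open>u\<^sub>0\<close> solves \<open>- \<Delta>\<^sub>p u\<^sub>0 = \<mu> f\<close>, and \<open>u\<^sub>k\<^sub>+\<^sub>1\<close> solves
\<open>- \<Delta>\<^sub>p u\<^sub>k\<^sub>+\<^sub>1 = \<mu> f - a u\<^sub>k\<^sup>-\<^sup>\<gamma>\<close>. The right-hand side increases with \<open>u\<^sub>k\<close>, so comparison
(\<open>weak_comparison\<close>) makes the sequence decrease and keeps it above \<open>w\<close>. Uniform monotonicity of \<open>A\<close>
(this uses \<open>p \<ge> 2\<close>) turns the monotone pointwise convergence into convergence of the gradients in \<open>L\<^sup>p\<close>
(\<open>singular_problem_solvable\<close>). Each single equation is solved by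
minimising its convex energy over test functions, where Clarkson's inequality makes minimising
sequences Cauchy (\<open>weak_solution_exists\<close>).

What makes a right-hand side \<open>g\<close> admissible is a bound for \<open>\<integral> |g \<psi>|\<close> by the energy of the test
function \<open>\<psi>\<close>; such \<open>g\<close> are called dual weights. For \<open>f\<close> this is a Sobolev-type estimate, and the
hypotheses (\<open>p = N\<close>, \<open>q > 1\<close>) or (\<open>p > N\<close>, \<open>q = 1\<close>) are exactly what it needs (\<open>potential_estimate\<close>). For
the singular weight \<open>a w\<^sup>-\<^sup>\<gamma>\<close> it is read off from the subsolution inequality itself
(\<open>dual_weight_of_subsolution\<close>). Finally, testing the
equation with bounded functions of \<open>u\<close> increasing to \<open>1\<close> shows \<open>a u\<^sup>-\<^sup>\<gamma> \<in> L\<^sup>1\<close> (\<open>singular_term_integrable\<close>).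
\<close>

section \<open>Compactly supported test functions\<close>

lemma C1_c_I:
  fixes f :: "'a::euclidean_space \<Rightarrow> real"
  assumes D: "\<And>x. GDERIV f x :> D x" and cont: "continuous_on UNIV D"
    and K: "compact K" "K \<subseteq> \<Omega>" and z: "\<And>x. x \<notin> K \<Longrightarrow> f x = 0"
  shows "f \<in> C1_c \<Omega>"
proof -
  have der: "(f has_derivative (\<lambda>h. h \<bullet> D x)) (at x)" for x
    using D[of x] by (simp add: gderiv_def)
  have fd: "frechet_derivative f (at x) = (\<lambda>h. h \<bullet> D x)" for x
    using frechet_derivative_at[OF der[of x]] by simp
  have "C_k 1 f"
    using der cont by (auto simp: fd differentiable_def intro!: continuous_intros)
  moreover have "closure {x. f x \<noteq> 0} \<subseteq> K"
    by (rule closure_minimal) (use z K compact_imp_closed in auto)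
  moreover have "compact (closure {x. f x \<noteq> 0})"
    using calculation(2) K(1) by (meson bounded_subset closed_closure compact_eq_bounded_closed)
  ultimately show ?thesis
    unfolding C1_c_def using K by blast
qed

lemma C1_c_gderiv:
  assumes "f \<in> C1_c \<Omega>"
  shows "GDERIV f x :> gradient f x" and "continuous_on UNIV (gradient f)"
proof -
  have d: "f differentiable (at x)" and
    c: "\<And>i. i \<in> Basis \<Longrightarrow> continuous_on UNIV (\<lambda>x. frechet_derivative f (at x) i)" for x
    using assms by (auto simp: C1_c_def)
  have *: "GDERIV f x :> (\<Sum>i\<in>Basis. frechet_derivative f (at x) i *\<^sub>R i)" for x
  proof -
    have der: "(f has_derivative frechet_derivative f (at x)) (at x)"
      using d frechet_derivative_works by blast
    have lin: "linear (frechet_derivative f (at x))"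
      using der has_derivative_linear by blast
    have "frechet_derivative f (at x) h = h \<bullet> (\<Sum>i\<in>Basis. frechet_derivative f (at x) i *\<^sub>R i)" for h
    proof -
      have "frechet_derivative f (at x) h = frechet_derivative f (at x) (\<Sum>i\<in>Basis. (h \<bullet> i) *\<^sub>R i)"
        by (simp add: euclidean_representation)
      also have "\<dots> = (\<Sum>i\<in>Basis. (h \<bullet> i) *\<^sub>R frechet_derivative f (at x) i)"
        by (simp add: linear_sum[OF lin] linear_scale[OF lin])
      finally show ?thesis by (simp add: inner_sum_right mult.commute)
    qed
    then have "frechet_derivative f (at x) = (\<lambda>h. h \<bullet> (\<Sum>i\<in>Basis. frechet_derivative f (at x) i *\<^sub>R i))"
      by (rule ext)
    from has_derivative_eq_rhs[OF der this] show ?thesis unfolding gderiv_def .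
  qed
  have g: "gradient f = (\<lambda>x. \<Sum>i\<in>Basis. frechet_derivative f (at x) i *\<^sub>R i)"
    using gradient_eqI[OF *] by auto
  show "GDERIV f x :> gradient f x" using * by (simp add: g)
  show "continuous_on UNIV (gradient f)" unfolding g by (intro continuous_intros c) auto
qed

lemma C1_c_continuous:
  assumes "f \<in> C1_c \<Omega>" shows "continuous_on UNIV f"
  using C1_c_gderiv(1)[OF assms] unfolding gderiv_def
  by (meson continuous_at_imp_continuous_on has_derivative_continuous)

lemma gradient_zero_open:
  fixes f :: "'a::euclidean_space \<Rightarrow> real"
  assumes "open S" "x \<in> S" "\<And>y. y \<in> S \<Longrightarrow> f y = 0"
  shows "GDERIV f x :> 0"
  unfolding gderiv_def
  by (rule has_derivative_transform_within_open[OF _ assms(1,2), of "\<lambda>_. 0"]) (use assms(3) in auto)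

lemma C1_c_support:
  fixes f :: "'a::euclidean_space \<Rightarrow> real"
  assumes "f \<in> C1_c \<Omega>"
  obtains K where "compact K" "K \<subseteq> \<Omega>" "\<And>x. x \<notin> K \<Longrightarrow> f x = 0" "\<And>x. x \<notin> K \<Longrightarrow> gradient f x = 0"
proof -
  define K where "K = closure {x. f x \<noteq> 0}"
  have K: "compact K \<and> K \<subseteq> \<Omega>" using assms by (simp add: C1_c_def K_def)
  have z: "f x = 0" if "x \<notin> K" for x
  proof (rule ccontr)
    assume "f x \<noteq> 0"
    then have "x \<in> K" unfolding K_def by (intro subsetD[OF closure_subset]) simp
    with that show False by contradiction
  qed
  have "gradient f x = 0" if "x \<notin> K" for x
    by (intro gradient_eqI gradient_zero_open[of "- K"])
      (use that z K compact_imp_closed[of K] in \<open>auto simp del: mem_Collect_eq\<close>)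
  with K z show thesis using that by blast
qed

text \<open>A function that is \<open>C\<^sup>1\<close> only inside \<open>\<Omega>\<close> yields a test function as soon as it vanishes outside a
compact subset; all later test functions built from the eigenfunction or from a barrier arise in
this way.\<close>

lemma C1_c_extend:
  fixes f :: "'a::euclidean_space \<Rightarrow> real"
  assumes "open \<Omega>" and D: "\<And>x. x \<in> \<Omega> \<Longrightarrow> GDERIV f x :> H x" and H: "continuous_on \<Omega> H"
    and K: "compact K" "K \<subseteq> \<Omega>" and z: "\<And>x. x \<in> \<Omega> - K \<Longrightarrow> f x = 0"
  shows "(\<lambda>x. if x \<in> \<Omega> then f x else 0) \<in> C1_c \<Omega>" (is "?F \<in> _")
    and "gradient (\<lambda>x. if x \<in> \<Omega> then f x else 0) x = (if x \<in> \<Omega> then H x else 0)"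
proof -
  let ?D = "\<lambda>x. if x \<in> \<Omega> then H x else 0"
  have oK: "open (- K)" using K(1) compact_imp_closed by auto
  have Fz: "?F x = 0" if "x \<notin> K" for x using z that by auto
  have FD: "GDERIV ?F x :> ?D x" for x
  proof (cases "x \<in> \<Omega>")
    case True
    then have "(?F has_derivative (\<lambda>h. h \<bullet> H x)) (at x)"
      using D[OF True] unfolding gderiv_def
      by (auto intro: has_derivative_transform_within_open[OF _ \<open>open \<Omega>\<close> True])
    with True show ?thesis by (simp add: gderiv_def)
  next
    case False
    then have "GDERIV ?F x :> 0"
      by (intro gradient_zero_open[OF oK]) (use K Fz in auto)
    then show ?thesis using False by simp
  qed
  have Dz: "?D x = 0" if "x \<notin> K" for x
    using gradient_zero_open[OF oK, of x ?F] that Fz gradient_eqI[OF FD[of x]] gradient_eqI by fastforce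
  have "continuous_on (\<Omega> \<union> - K) ?D"
  proof (rule continuous_on_open_Un[OF \<open>open \<Omega>\<close> oK])
    show "continuous_on \<Omega> ?D" using H by (rule continuous_on_eq) auto
    show "continuous_on (- K) ?D" by (rule continuous_on_eq[of _ "\<lambda>_. 0"]) (use Dz in auto)
  qed
  moreover have "\<Omega> \<union> - K = UNIV" using K by auto
  ultimately have c: "continuous_on UNIV ?D" by simp
  show "?F \<in> C1_c \<Omega>" by (rule C1_c_I[OF FD c K Fz])
  show "gradient ?F x = ?D x" by (rule gradient_eqI[OF FD])
qed

lemma C1_c_add:
  assumes "f \<in> C1_c \<Omega>" "g \<in> C1_c \<Omega>"
  shows "(\<lambda>x. f x + g x) \<in> C1_c \<Omega>" "gradient (\<lambda>x. f x + g x) x = gradient f x + gradient g x"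
proof -
  have D: "GDERIV (\<lambda>x. f x + g x) x :> gradient f x + gradient g x" for x
    using assms by (intro GDERIV_add C1_c_gderiv(1))
  obtain K where K: "compact K" "K \<subseteq> \<Omega>" "\<And>x. x \<notin> K \<Longrightarrow> f x = 0"
    by (rule C1_c_support[OF assms(1)]) (rule that)
  obtain L where L: "compact L" "L \<subseteq> \<Omega>" "\<And>x. x \<notin> L \<Longrightarrow> g x = 0"
    by (rule C1_c_support[OF assms(2)]) (rule that)
  show "(\<lambda>x. f x + g x) \<in> C1_c \<Omega>"
    by (rule C1_c_I[OF D, of "K \<union> L"])
      (use K L C1_c_gderiv(2)[OF assms(1)] C1_c_gderiv(2)[OF assms(2)] in \<open>auto intro!: continuous_intros\<close>)
  show "gradient (\<lambda>x. f x + g x) x = gradient f x + gradient g x" by (rule gradient_eqI[OF D])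
qed

lemma C1_c_compose:
  assumes f: "f \<in> C1_c \<Omega>" and G: "\<And>s::real. (G has_real_derivative g s) (at s)"
    and g: "continuous_on UNIV g" and "G 0 = 0"
  shows "(\<lambda>x. G (f x)) \<in> C1_c \<Omega>" "gradient (\<lambda>x. G (f x)) x = g (f x) *\<^sub>R gradient f x"
proof -
  have D: "GDERIV (\<lambda>x. G (f x)) x :> g (f x) *\<^sub>R gradient f x" for x
    using GDERIV_DERIV_compose[OF C1_c_gderiv(1)[OF f] G] .
  have c: "continuous_on UNIV (\<lambda>x. g (f x) *\<^sub>R gradient f x)"
    by (intro continuous_intros continuous_on_compose2[OF g C1_c_continuous[OF f]] C1_c_gderiv(2)[OF f]) auto
  obtain K where K: "compact K" "K \<subseteq> \<Omega>" "\<And>x. x \<notin> K \<Longrightarrow> f x = 0"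
    by (rule C1_c_support[OF f]) (rule that)
  show "(\<lambda>x. G (f x)) \<in> C1_c \<Omega>"
    by (rule C1_c_I[OF D c K(1,2)]) (use K \<open>G 0 = 0\<close> in auto)
  show "gradient (\<lambda>x. G (f x)) x = g (f x) *\<^sub>R gradient f x" by (rule gradient_eqI[OF D])
qed

lemma C1_c_scale:
  assumes "f \<in> C1_c \<Omega>"
  shows "(\<lambda>x. c * f x) \<in> C1_c \<Omega>" "gradient (\<lambda>x. c * f x) x = c *\<^sub>R gradient f x"
  using C1_c_compose[OF assms, of "\<lambda>s. c * s" "\<lambda>_. c"]
  by (auto intro!: derivative_eq_intros)

lemma C1_c_diff:
  assumes "f \<in> C1_c \<Omega>" "g \<in> C1_c \<Omega>"
  shows "(\<lambda>x. f x - g x) \<in> C1_c \<Omega>" "gradient (\<lambda>x. f x - g x) x = gradient f x - gradient g x"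
  using C1_c_add[OF assms(1) C1_c_scale(1)[OF assms(2), of "-1"]] C1_c_scale(2)[OF assms(2), of "-1"]
  by simp_all

lemma C1_c_mult_local:
  assumes f: "f \<in> C1_c \<Omega>" and "open \<Omega>"
    and D: "\<And>x. x \<in> \<Omega> \<Longrightarrow> GDERIV h x :> H x" and H: "continuous_on \<Omega> H"
  shows "(\<lambda>x. h x * f x) \<in> C1_c \<Omega>"
    "x \<in> \<Omega> \<Longrightarrow> gradient (\<lambda>x. h x * f x) x = h x *\<^sub>R gradient f x + f x *\<^sub>R H x"
proof -
  obtain K where K: "compact K" "K \<subseteq> \<Omega>" "\<And>x. x \<notin> K \<Longrightarrow> f x = 0"
    by (rule C1_c_support[OF f]) (rule that)
  have hc: "continuous_on \<Omega> h"
    using D unfolding gderiv_def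
    by (meson continuous_at_imp_continuous_on has_derivative_continuous)
  have e: "(\<lambda>x. if x \<in> \<Omega> then h x * f x else 0) = (\<lambda>x. h x * f x)" using K by fastforce
  have GD: "GDERIV (\<lambda>x. h x * f x) x :> h x *\<^sub>R gradient f x + f x *\<^sub>R H x" if "x \<in> \<Omega>" for x
    using GDERIV_mult[OF D[OF that] C1_c_gderiv(1)[OF f]] .
  have c: "continuous_on \<Omega> (\<lambda>x. h x *\<^sub>R gradient f x + f x *\<^sub>R H x)"
    using continuous_on_subset[OF C1_c_gderiv(2)[OF f]] continuous_on_subset[OF C1_c_continuous[OF f]]
    by (intro continuous_intros hc H) auto
  show "(\<lambda>x. h x * f x) \<in> C1_c \<Omega>"
    using C1_c_extend(1)[OF \<open>open \<Omega>\<close> GD c K(1,2)] K unfolding e by auto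
  show "gradient (\<lambda>x. h x * f x) x = h x *\<^sub>R gradient f x + f x *\<^sub>R H x" if "x \<in> \<Omega>"
    by (rule gradient_eqI[OF GD[OF that]])
qed

lemma zero_in_C1_c: "(\<lambda>_. 0) \<in> C1_c \<Omega>"
  by (rule C1_c_I[of _ "\<lambda>_. 0" "{}"]) (auto simp: GDERIV_const)

lemma C1_c_bounded:
  fixes f :: "'a::euclidean_space \<Rightarrow> real"
  assumes "f \<in> C1_c \<Omega>"
  obtains B where "B > 0" "\<And>x. \<bar>f x\<bar> \<le> B" "\<And>x. norm (gradient f x) \<le> B"
proof -
  obtain K where K: "compact K" "\<And>x. x \<notin> K \<Longrightarrow> f x = 0" "\<And>x. x \<notin> K \<Longrightarrow> gradient f x = 0"
    by (rule C1_c_support[OF assms]) (rule that)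
  have 1: "bounded (f ` K)" "bounded (gradient f ` K)"
    using C1_c_continuous[OF assms] C1_c_gderiv(2)[OF assms] K(1)
    by (meson compact_continuous_image compact_imp_bounded continuous_on_subset subset_UNIV)+
  then obtain B1 B2 where B: "\<And>x. x \<in> K \<Longrightarrow> \<bar>f x\<bar> \<le> B1" "\<And>x. x \<in> K \<Longrightarrow> norm (gradient f x) \<le> B2"
    unfolding bounded_iff by force
  show thesis
  proof (rule that[of "max 1 (max B1 B2)"])
    show "\<bar>f x\<bar> \<le> max 1 (max B1 B2)" for x using B(1)[of x] K(2)[of x] by (cases "x \<in> K") auto
    show "norm (gradient f x) \<le> max 1 (max B1 B2)" for x using B(2)[of x] K(3)[of x] by (cases "x \<in> K") auto
  qed simp
qed

lemma continuous_borel_lebesgue_on: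
  fixes f :: "'a::euclidean_space \<Rightarrow> 'b::euclidean_space"
  assumes "continuous_on UNIV f" shows "f \<in> borel_measurable (lebesgue_on \<Omega>)"
proof -
  have "f \<in> borel_measurable lborel" using borel_measurable_continuous_onI[OF assms] by simp
  then show ?thesis by (intro measurable_restrict_space1 measurable_completion)
qed

lemma C1_c_measurable:
  fixes f :: "'a::euclidean_space \<Rightarrow> real"
  assumes "f \<in> C1_c \<Omega>"
  shows "f \<in> borel_measurable (lebesgue_on S)" "gradient f \<in> borel_measurable (lebesgue_on S)"
  using C1_c_continuous[OF assms] C1_c_gderiv(2)[OF assms] by (auto intro: continuous_borel_lebesgue_on)


section \<open>Integration by parts and the Poincare inequality\<close>

lemma lipschitz_of_gradient_bound:
  fixes f :: "'a::euclidean_space \<Rightarrow> real"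
  assumes D: "\<And>x. GDERIV f x :> D x" and B: "\<And>x. norm (D x) \<le> B"
  shows "\<bar>f y - f x\<bar> \<le> B * norm (y - x)"
proof -
  have "norm (f y - f x) \<le> B * norm (y - x)"
  proof (rule differentiable_bound[of UNIV f "\<lambda>x h. h \<bullet> D x"])
    show "(f has_derivative (\<lambda>h. h \<bullet> D x)) (at x within UNIV)" for x using D[of x] by (simp add: gderiv_def)
    show "onorm (\<lambda>h. h \<bullet> D x) \<le> B" for x
    proof (rule onorm_bound)
      show "0 \<le> B" using B[of x] norm_ge_zero order_trans by blast
      show "norm (h \<bullet> D x) \<le> B * norm h" for h
        using Cauchy_Schwarz_ineq2[of h "D x"] B[of x] mult_right_mono[OF B[of x] norm_ge_zero[of h]]
        by (simp add: mult.commute)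
    qed
  qed auto
  then show ?thesis by simp
qed

lemma gderiv_along_line:
  fixes f :: "'a::euclidean_space \<Rightarrow> real"
  assumes "GDERIV f (x + t *\<^sub>R e) :> D"
  shows "((\<lambda>s. f (x + s *\<^sub>R e)) has_real_derivative (e \<bullet> D)) (at t)"
proof -
  have 1: "((\<lambda>s. x + s *\<^sub>R e) has_derivative (\<lambda>s. s *\<^sub>R e)) (at t)"
    by (auto intro!: derivative_eq_intros)
  have "((\<lambda>s. f (x + s *\<^sub>R e)) has_derivative (\<lambda>s. (s *\<^sub>R e) \<bullet> D)) (at t)"
    using has_derivative_compose[OF 1] assms unfolding gderiv_def by blast
  then show ?thesis unfolding has_field_derivative_def
    by (rule has_derivative_eq_rhs) (auto simp: mult.commute)
qed

text \<open>The integral of a directional derivative vanishes because it is the limit of the integrals of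
difference quotients, and these vanish by translation invariance of Lebesgue measure.\<close>

lemma C1_c_integral_partial_lborel:
  fixes f :: "'a::euclidean_space \<Rightarrow> real"
  assumes f: "f \<in> C1_c \<Omega>"
  shows "integrable lborel (\<lambda>x. e \<bullet> gradient f x)" "(LINT x|lborel. e \<bullet> gradient f x) = 0"
proof -
  obtain B where B: "B > 0" "\<And>x. \<bar>f x\<bar> \<le> B" "\<And>x. norm (gradient f x) \<le> B"
    by (rule C1_c_bounded[OF f]) (rule that)
  obtain K where K: "compact K" "\<And>x. x \<notin> K \<Longrightarrow> f x = 0" "\<And>x. x \<notin> K \<Longrightarrow> gradient f x = 0"
    by (rule C1_c_support[OF f]) (rule that)
  obtain R where R: "\<And>x. x \<in> K \<Longrightarrow> norm x \<le> R" using compact_imp_bounded[OF K(1)] bounded_iff by blast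
  have meas: "f \<in> borel_measurable borel" "gradient f \<in> borel_measurable borel"
    using C1_c_continuous[OF f] C1_c_gderiv(2)[OF f] by (auto intro: borel_measurable_continuous_onI)
  have intind: "integrable lborel (\<lambda>x. c * indicat_real (cball (0::'a) r) x)" for c r
    by (intro integrable_mult_right integrable_real_indicator) (use emeasure_lborel_cball_finite[of "0::'a" r] in auto)
  have fz: "f x = 0" if "\<not> norm x \<le> R" for x using K(2)[of x] R[of x] that by blast
  have intf: "integrable lborel f"
    by (rule Bochner_Integration.integrable_bound[OF intind[of B R]])
      (use B meas fz in \<open>auto simp: indicator_def\<close>)
  define h where "h n x = (f (inverse (real (Suc n)) *\<^sub>R e + x) - f x) * real (Suc n)" for n x
  have tr: "(LINT x|lborel. f (c + x)) = (LINT x|lborel. f x)" "integrable lborel (\<lambda>x. f (c + x))" for c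
  proof -
    have "(LINT x|lborel. f x) = (LINT x|distr lborel borel ((+) c). f x)" by (simp add: lborel_distr_plus)
    also have "\<dots> = (LINT x|lborel. f (c + x))" by (rule integral_distr) (use meas in auto)
    finally show "(LINT x|lborel. f (c + x)) = (LINT x|lborel. f x)" by simp
    have "integrable (distr lborel borel ((+) c)) f" using intf by (simp add: lborel_distr_plus)
    then show "integrable lborel (\<lambda>x. f (c + x))" by (subst (asm) integrable_distr_eq) (use meas in auto)
  qed
  have h0: "(LINT x|lborel. h n x) = 0" for n
    unfolding h_def by (simp add: tr intf)
  have lim: "(\<lambda>n. h n x) \<longlonglongrightarrow> e \<bullet> gradient f x" for x
  proof -
    have "((\<lambda>s. f (x + s *\<^sub>R e)) has_real_derivative (e \<bullet> gradient f x)) (at 0)"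
      using gderiv_along_line[of f x 0 e "gradient f x"] C1_c_gderiv(1)[OF f] by simp
    then have L: "((\<lambda>s. (f (x + s *\<^sub>R e) - f x) / s) \<longlongrightarrow> e \<bullet> gradient f x) (at 0)"
      by (simp add: DERIV_def)
    have "filterlim (\<lambda>n. inverse (real (Suc n))) (at 0) sequentially"
      by (intro filterlim_atI LIMSEQ_inverse_real_of_nat) auto
    from filterlim_compose[OF L this] show ?thesis
      by (simp add: h_def add.commute divide_inverse)
  qed
  have bd: "norm (h n x) \<le> (B * norm e) * indicat_real (cball 0 (R + norm e)) x" for n x
  proof (cases "norm x \<le> R + norm e")
    case True
    have "\<bar>f (inverse (real (Suc n)) *\<^sub>R e + x) - f x\<bar> \<le> B * norm (inverse (real (Suc n)) *\<^sub>R e)"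
      using lipschitz_of_gradient_bound[OF C1_c_gderiv(1)[OF f] B(3), of "inverse (real (Suc n)) *\<^sub>R e + x" x]
      by simp
    then have "\<bar>f (inverse (real (Suc n)) *\<^sub>R e + x) - f x\<bar> * real (Suc n)
        \<le> (B * (inverse (real (Suc n)) * norm e)) * real (Suc n)"
      by (intro mult_right_mono) auto
    also have "\<dots> = B * norm e" by simp
    finally show ?thesis using True by (simp add: h_def abs_mult)
  next
    case False
    have "inverse (real (Suc n)) \<le> 1" by (simp add: inverse_eq_divide)
    then have "norm (inverse (real (Suc n)) *\<^sub>R e) \<le> norm e"
      using mult_right_mono[of _ 1 "norm e"] by simp
    then have "norm (inverse (real (Suc n)) *\<^sub>R e + x) > R"
      using False norm_triangle_ineq4[of "inverse (real (Suc n)) *\<^sub>R e + x" "inverse (real (Suc n)) *\<^sub>R e"] by simp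
    moreover have "norm x > R" using False norm_ge_zero[of e] by linarith
    ultimately have "inverse (real (Suc n)) *\<^sub>R e + x \<notin> K" "x \<notin> K" using R by force+
    then show ?thesis using K(2) False by (simp add: h_def)
  qed
  have hm: "h n \<in> borel_measurable lborel" for n
    unfolding h_def using meas by measurable
  have gm: "(\<lambda>x. e \<bullet> gradient f x) \<in> borel_measurable lborel" using meas by measurable
  show "integrable lborel (\<lambda>x. e \<bullet> gradient f x)"
    by (rule integrable_dominated_convergence[OF gm, of h, OF hm intind[of "B * norm e" "R + norm e"]]) (use lim bd in auto)
  have "(\<lambda>n. LINT x|lborel. h n x) \<longlonglongrightarrow> (LINT x|lborel. e \<bullet> gradient f x)"
    by (rule integral_dominated_convergence[OF gm, of h, OF hm intind[of "B * norm e" "R + norm e"]]) (use lim bd in auto)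
  then show "(LINT x|lborel. e \<bullet> gradient f x) = 0" unfolding h0 by (simp add: LIMSEQ_const_iff)
qed

lemma lebesgue_on_eq_lborel:
  fixes k :: "'a::euclidean_space \<Rightarrow> 'b::euclidean_space"
  assumes "k \<in> borel_measurable borel" "\<And>x. x \<notin> \<Omega> \<Longrightarrow> k x = 0" "\<Omega> \<in> sets lebesgue"
  shows "integrable (lebesgue_on \<Omega>) k \<longleftrightarrow> integrable lborel k"
    "(LINT x|lebesgue_on \<Omega>. k x) = (LINT x|lborel. k x)"
proof -
  have e: "(\<lambda>x. if x \<in> \<Omega> then k x else 0) = k" using assms(2) by auto
  show "integrable (lebesgue_on \<Omega>) k \<longleftrightarrow> integrable lborel k"
    using Lebesgue_Measure.integrable_restrict_UNIV[OF assms(3), of k] assms(1) unfolding e by (simp add: integrable_completion)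
  show "(LINT x|lebesgue_on \<Omega>. k x) = (LINT x|lborel. k x)"
    using Lebesgue_Measure.integral_restrict_UNIV[OF assms(3), of k] assms(1) unfolding e
    by (simp add: integral_completion)
qed

lemma bounded_integrable_lebesgue_on:
  fixes f :: "'a::euclidean_space \<Rightarrow> 'b::euclidean_space"
  assumes "\<Omega> \<in> lmeasurable" "f \<in> borel_measurable (lebesgue_on \<Omega>)" "AE x in lebesgue_on \<Omega>. norm (f x) \<le> B"
  shows "integrable (lebesgue_on \<Omega>) f"
  using finite_measure.integrable_const_bound[OF finite_measure_lebesgue_on[OF assms(1)] assms(3,2)] .

lemma open_bounded_lmeasurable: "open \<Omega> \<Longrightarrow> bounded \<Omega> \<Longrightarrow> (\<Omega>::'a::euclidean_space set) \<in> lmeasurable"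
  by (rule lmeasurable_open)

lemma C1_c_integral_partial:
  fixes f :: "'a::euclidean_space \<Rightarrow> real"
  assumes f: "f \<in> C1_c \<Omega>" and "open \<Omega>"
  shows "integrable (lebesgue_on \<Omega>) (\<lambda>x. e \<bullet> gradient f x)" "(LINT x|lebesgue_on \<Omega>. e \<bullet> gradient f x) = 0"
proof -
  have z: "e \<bullet> gradient f x = 0" if "x \<notin> \<Omega>" for x
    using C1_c_support[OF f] that by (metis inner_zero_right subsetD)
  have m: "(\<lambda>x. e \<bullet> gradient f x) \<in> borel_measurable borel"
    by (intro borel_measurable_continuous_onI continuous_intros C1_c_gderiv(2)[OF f])
  have s: "\<Omega> \<in> sets lebesgue" using \<open>open \<Omega>\<close> by simp
  show "integrable (lebesgue_on \<Omega>) (\<lambda>x. e \<bullet> gradient f x)" "(LINT x|lebesgue_on \<Omega>. e \<bullet> gradient f x) = 0"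
    using lebesgue_on_eq_lborel[OF m z s] C1_c_integral_partial_lborel[OF f] by auto
qed

lemma C1_c_integrable:
  fixes f :: "'a::euclidean_space \<Rightarrow> real"
  assumes f: "f \<in> C1_c \<Omega>" and "open \<Omega>" "bounded \<Omega>"
  shows "integrable (lebesgue_on \<Omega>) f" "integrable (lebesgue_on \<Omega>) (gradient f)"
proof -
  obtain B where B: "B > 0" "\<And>x. \<bar>f x\<bar> \<le> B" "\<And>x. norm (gradient f x) \<le> B"
    by (rule C1_c_bounded[OF f]) (rule that)
  show "integrable (lebesgue_on \<Omega>) f" "integrable (lebesgue_on \<Omega>) (gradient f)"
    using B by (auto intro!: bounded_integrable_lebesgue_on[of _ _ B] open_bounded_lmeasurable C1_c_measurable f assms)
qed

lemma C1_c_integration_by_parts: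
  fixes f g :: "'a::euclidean_space \<Rightarrow> real"
  assumes f: "f \<in> C1_c \<Omega>" and g: "g \<in> C1_c \<Omega>" and "open \<Omega>" "bounded \<Omega>"
  shows "(LINT x|lebesgue_on \<Omega>. f x *\<^sub>R gradient g x) = - (LINT x|lebesgue_on \<Omega>. g x *\<^sub>R gradient f x)"
proof -
  note fg = C1_c_mult_local[OF g \<open>open \<Omega>\<close> C1_c_gderiv(1)[OF f] continuous_on_subset[OF C1_c_gderiv(2)[OF f] subset_UNIV]]
  obtain B where B: "B > 0" "\<And>x. \<bar>f x\<bar> \<le> B" "\<And>x. norm (gradient f x) \<le> B"
    by (rule C1_c_bounded[OF f]) (rule that)
  obtain C where C: "C > 0" "\<And>x. \<bar>g x\<bar> \<le> C" "\<And>x. norm (gradient g x) \<le> C"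
    by (rule C1_c_bounded[OF g]) (rule that)
  note lm = open_bounded_lmeasurable[OF assms(3,4)]
  have i1: "integrable (lebesgue_on \<Omega>) (\<lambda>x. f x *\<^sub>R gradient g x)"
    by (rule bounded_integrable_lebesgue_on[OF lm, of _ "B * C"])
      (use B C in \<open>auto intro!: mult_mono borel_measurable_scaleR C1_c_measurable f g\<close>)
  have i2: "integrable (lebesgue_on \<Omega>) (\<lambda>x. g x *\<^sub>R gradient f x)"
    by (rule bounded_integrable_lebesgue_on[OF lm, of _ "C * B"])
      (use B C in \<open>auto intro!: mult_mono borel_measurable_scaleR C1_c_measurable f g\<close>)
  have "(LINT x|lebesgue_on \<Omega>. f x *\<^sub>R gradient g x + g x *\<^sub>R gradient f x) = 0"
  proof (rule euclidean_eqI)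
    fix i :: 'a assume "i \<in> Basis"
    have "(LINT x|lebesgue_on \<Omega>. f x *\<^sub>R gradient g x + g x *\<^sub>R gradient f x) \<bullet> i
        = (LINT x|lebesgue_on \<Omega>. i \<bullet> (f x *\<^sub>R gradient g x + g x *\<^sub>R gradient f x))"
      using i1 i2 by (subst integral_inner_left[symmetric]) (auto simp: inner_commute)
    also have "\<dots> = (LINT x|lebesgue_on \<Omega>. i \<bullet> gradient (\<lambda>x. f x * g x) x)"
      by (rule Bochner_Integration.integral_cong) (auto simp: fg(2))
    also have "\<dots> = 0" by (rule C1_c_integral_partial[OF fg(1) \<open>open \<Omega>\<close>])
    finally show "(LINT x|lebesgue_on \<Omega>. f x *\<^sub>R gradient g x + g x *\<^sub>R gradient f x) \<bullet> i = 0 \<bullet> i" by simp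
  qed
  then show ?thesis using i1 i2 by (simp add: eq_neg_iff_add_eq_0)
qed

text \<open>This crude form of Young's inequality replaces Hoelder's inequality throughout: either \<open>b \<le> e a\<close> or
\<open>a < b / e\<close>, and each case bounds one factor.\<close>

lemma young_weak:
  fixes a b e p :: real
  assumes "0 \<le> a" "0 \<le> b" "0 < e" "1 \<le> p"
  shows "a powr (p - 1) * b \<le> e * a powr p + e powr (1 - p) * b powr p"
proof (cases "b \<le> e * a")
  case True
  have "a powr (p - 1) * b \<le> a powr (p - 1) * (e * a)" using True by (intro mult_left_mono) auto
  also have "\<dots> = e * a powr p"
    using assms by (cases "a = 0") (auto simp: powr_diff)
  finally show ?thesis by (simp add: add_increasing2)
next
  case False
  then have ab: "a \<le> b / e" "b > 0" using assms by (auto simp: field_simps less_le_not_le intro: le_less_trans)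
  have "a powr (p - 1) * b \<le> (b / e) powr (p - 1) * b"
    using assms ab by (intro mult_right_mono powr_mono2) auto
  also have "\<dots> = e powr (1 - p) * b powr p"
    using assms ab by (simp add: powr_divide powr_diff field_simps)
  finally show ?thesis using assms by (simp add: add_increasing)
qed

lemma DERIV_abs_powr:
  fixes p s :: real
  assumes "p > 1"
  shows "((\<lambda>s. \<bar>s\<bar> powr p) has_real_derivative (p * \<bar>s\<bar> powr (p - 1) * sgn s)) (at s)"
proof (cases "s = 0")
  case False
  have "((\<lambda>s. \<bar>s\<bar> powr p) has_real_derivative (p * \<bar>s\<bar> powr (p - 1) * sgn s)) (at s)"
  proof (cases "s > 0")
    case True
    have "((\<lambda>s. s powr p) has_real_derivative (p * \<bar>s\<bar> powr (p - 1) * sgn s)) (at s)"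
      using True by (auto intro!: derivative_eq_intros simp: powr_diff field_simps)
    then show ?thesis
      by (rule has_field_derivative_transform_within_open[OF _ open_greaterThan[of 0]]) (use True in auto)
  next
    case F: False
    then have s: "s < 0" using False by simp
    have "((\<lambda>s. (- s) powr p) has_real_derivative (p * \<bar>s\<bar> powr (p - 1) * sgn s)) (at s)"
      using s by (auto intro!: derivative_eq_intros simp: powr_diff field_simps)
    then show ?thesis
      by (rule has_field_derivative_transform_within_open[OF _ open_lessThan[of 0]]) (use s in auto)
  qed
  then show ?thesis .
next
  case True
  have "((\<lambda>h. \<bar>h\<bar> powr p / h) \<longlongrightarrow> 0) (at 0)"
  proof (rule tendsto_rabs_zero_cancel)
    have "((\<lambda>h::real. \<bar>h\<bar> powr (p - 1)) \<longlongrightarrow> \<bar>0\<bar> powr (p - 1)) (at 0)"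
      using assms by (intro tendsto_powr' tendsto_intros) auto
    then have "((\<lambda>h::real. \<bar>h\<bar> powr (p - 1)) \<longlongrightarrow> 0) (at 0)" using assms by simp
    then show "((\<lambda>h. \<bar>\<bar>h\<bar> powr p / h\<bar>) \<longlongrightarrow> 0) (at 0)"
      by (rule Lim_transform_eventually) (auto simp: eventually_at_filter powr_diff abs_divide)
  qed
  then show ?thesis using True assms by (simp add: DERIV_def)
qed

lemma continuous_abs_powr_sgn:
  fixes p :: real
  assumes "p > 1"
  shows "continuous_on UNIV (\<lambda>s. p * \<bar>s\<bar> powr (p - 1) * sgn s)"
proof -
  have "isCont (\<lambda>s. \<bar>s\<bar> powr (p - 1) * sgn s) s" for s :: real
  proof (cases "s = 0")
    case True
    have "((\<lambda>h::real. \<bar>h\<bar> powr (p - 1)) \<longlongrightarrow> \<bar>0\<bar> powr (p - 1)) (at 0)"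
      using assms by (intro tendsto_powr' tendsto_intros) auto
    then have "((\<lambda>h::real. \<bar>h\<bar> powr (p - 1)) \<longlongrightarrow> 0) (at 0)" using assms by simp
    then have "((\<lambda>h::real. \<bar>h\<bar> powr (p - 1) * sgn h) \<longlongrightarrow> 0) (at 0)"
      by (rule tendsto_0_le[where K = 1]) (auto simp: abs_mult abs_sgn_eq)
    then show ?thesis using True by (simp add: isCont_def)
  next
    case False
    then have "isCont sgn s" by (intro isCont_sgn) auto
    moreover have "isCont (\<lambda>s. \<bar>s\<bar> powr (p - 1)) s" using False by (intro continuous_intros) auto
    ultimately show ?thesis by (rule continuous_mult[rotated])
  qed
  then have "continuous_on UNIV (\<lambda>s::real. \<bar>s\<bar> powr (p - 1) * sgn s)" by (simp add: continuous_on_eq_continuous_at)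
  from continuous_on_mult_left[OF this, of p] show ?thesis by (simp add: mult.assoc)
qed

lemma C1_c_integrable_powr:
  fixes f :: "'a::euclidean_space \<Rightarrow> real"
  assumes f: "f \<in> C1_c \<Omega>" and "open \<Omega>" "bounded \<Omega>" "r \<ge> 0"
  shows "integrable (lebesgue_on \<Omega>) (\<lambda>x. \<bar>f x\<bar> powr r)" "integrable (lebesgue_on \<Omega>) (\<lambda>x. norm (gradient f x) powr r)"
proof -
  obtain B where B: "B > 0" "\<And>x. \<bar>f x\<bar> \<le> B" "\<And>x. norm (gradient f x) \<le> B"
    by (rule C1_c_bounded[OF f]) (rule that)
  note [measurable] = C1_c_measurable[OF f]
  show "integrable (lebesgue_on \<Omega>) (\<lambda>x. \<bar>f x\<bar> powr r)" "integrable (lebesgue_on \<Omega>) (\<lambda>x. norm (gradient f x) powr r)"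
    using B \<open>r \<ge> 0\<close> by (auto intro!: bounded_integrable_lebesgue_on[of _ _ "B powr r"] open_bounded_lmeasurable assms powr_mono2 AE_I2)
qed

lemma abs_mult3_le:
  fixes a b c A B C :: real
  assumes "\<bar>a\<bar> \<le> A" "\<bar>b\<bar> \<le> B" "\<bar>c\<bar> \<le> C" "0 \<le> A" "0 \<le> B"
  shows "\<bar>a * (b * c)\<bar> \<le> A * (B * C)"
  unfolding abs_mult using assms by (intro mult_mono) auto

text \<open>Integrate \<open>|f|\<^sup>p = |f|\<^sup>p \<partial>\<^sub>e (x \<bullet> e)\<close> by parts and absorb the resulting \<open>|f|\<^sup>p\<^sup>-\<^sup>1 |\<nabla>f|\<close> with Young's
inequality; \<open>x \<bullet> e\<close> is bounded on \<open>\<Omega>\<close>.\<close>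

theorem poincare_C1_c:
  fixes \<Omega> :: "'a::euclidean_space set"
  assumes "open \<Omega>" "bounded \<Omega>" "p \<ge> 2"
  obtains C where "C > 0"
    "\<And>f. f \<in> C1_c \<Omega> \<Longrightarrow> (LINT x|lebesgue_on \<Omega>. \<bar>f x\<bar> powr p) \<le> C * (LINT x|lebesgue_on \<Omega>. norm (gradient f x) powr p)"
proof -
  obtain e :: 'a where e: "e \<in> Basis" using nonempty_Basis by blast
  obtain R where R: "R > 0" "\<And>x. x \<in> \<Omega> \<Longrightarrow> norm x \<le> R" using \<open>bounded \<Omega>\<close> bounded_pos by blast
  \<comment> \<open>This choice gives \<open>p R d = 1/2\<close>, so that half of the left-hand side is absorbed.\<close>
  define d where "d = 1 / (2 * p * R)"
  have d: "d > 0" using R assms by (simp add: d_def)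
  show thesis
  proof (rule that[of "2 * (p * R * d powr (1 - p))"])
    show "0 < 2 * (p * R * d powr (1 - p))" using R d assms by simp
    fix f assume f: "f \<in> C1_c \<Omega>"
    have p1: "p > 1" using assms by simp
    let ?g = "\<lambda>s. p * \<bar>s\<bar> powr (p - 1) * sgn s"
    have G: "(\<lambda>x. \<bar>f x\<bar> powr p) \<in> C1_c \<Omega>" "\<And>x. gradient (\<lambda>x. \<bar>f x\<bar> powr p) x = ?g (f x) *\<^sub>R gradient f x"
      using C1_c_compose[OF f DERIV_abs_powr[OF p1] continuous_abs_powr_sgn[OF p1]] assms by auto
    have xe: "GDERIV (\<lambda>x. x \<bullet> e) x :> e" for x by (simp add: gderiv_def bounded_linear_imp_has_derivative bounded_linear_inner_left)
    note F = C1_c_mult_local[OF G(1) \<open>open \<Omega>\<close> xe continuous_on_const]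
    have "0 = (LINT x|lebesgue_on \<Omega>. e \<bullet> gradient (\<lambda>x. (x \<bullet> e) * \<bar>f x\<bar> powr p) x)"
      using C1_c_integral_partial(2)[OF F(1) \<open>open \<Omega>\<close>] by simp
    moreover have "integrable (lebesgue_on \<Omega>) (\<lambda>x. e \<bullet> gradient (\<lambda>x. (x \<bullet> e) * \<bar>f x\<bar> powr p) x)"
      by (rule C1_c_integral_partial(1)[OF F(1) \<open>open \<Omega>\<close>])
    moreover
    let ?H = "\<lambda>x. p * R * d * \<bar>f x\<bar> powr p + p * R * d powr (1 - p) * norm (gradient f x) powr p"
    have pt: "\<bar>f x\<bar> powr p - e \<bullet> gradient (\<lambda>x. (x \<bullet> e) * \<bar>f x\<bar> powr p) x \<le> ?H x" if "x \<in> \<Omega>" for x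
    proof -
      have "\<bar>(x \<bullet> e) * (?g (f x) * (e \<bullet> gradient f x))\<bar>
          \<le> R * ((p * \<bar>f x\<bar> powr (p - 1)) * norm (gradient f x))"
      proof -
        have "\<bar>x \<bullet> e\<bar> \<le> R" using Cauchy_Schwarz_ineq2[of x e] e R(2)[OF that] by simp
        moreover have "\<bar>e \<bullet> gradient f x\<bar> \<le> norm (gradient f x)" using Cauchy_Schwarz_ineq2[of e "gradient f x"] e by simp
        moreover have "\<bar>?g (f x)\<bar> \<le> p * \<bar>f x\<bar> powr (p - 1)" using assms by (auto simp: abs_mult abs_sgn_eq)
        ultimately show ?thesis using R assms by (intro abs_mult3_le) auto
      qed
      also have "\<dots> \<le> R * (p * (d * \<bar>f x\<bar> powr p + d powr (1 - p) * norm (gradient f x) powr p))"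
        using young_weak[of "\<bar>f x\<bar>" "norm (gradient f x)" d p] assms R d by (simp add: mult.assoc)
      finally show ?thesis using e by (simp add: F(2)[OF that] G(2) inner_add_right algebra_simps)
    qed
    have I: "integrable (lebesgue_on \<Omega>) (\<lambda>x. \<bar>f x\<bar> powr p)" "integrable (lebesgue_on \<Omega>) (\<lambda>x. norm (gradient f x) powr p)"
      using C1_c_integrable_powr[OF f] assms by auto
    ultimately have "(LINT x|lebesgue_on \<Omega>. \<bar>f x\<bar> powr p) = (LINT x|lebesgue_on \<Omega>. \<bar>f x\<bar> powr p - e \<bullet> gradient (\<lambda>x. (x \<bullet> e) * \<bar>f x\<bar> powr p) x)"
      by (subst Bochner_Integration.integral_diff) auto
    also have "\<dots> \<le> (LINT x|lebesgue_on \<Omega>. ?H x)"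
      by (rule integral_mono) (use I pt C1_c_integral_partial(1)[OF F(1) \<open>open \<Omega>\<close>] in auto)
    also have "\<dots> = 1/2 * (LINT x|lebesgue_on \<Omega>. \<bar>f x\<bar> powr p) + p * R * d powr (1 - p) * (LINT x|lebesgue_on \<Omega>. norm (gradient f x) powr p)"
      using I R assms by (simp add: d_def)
    finally show "(LINT x|lebesgue_on \<Omega>. \<bar>f x\<bar> powr p) \<le> 2 * (p * R * d powr (1 - p)) * (LINT x|lebesgue_on \<Omega>. norm (gradient f x) powr p)"
      by simp
  qed
qed


section \<open>Convexity of the p-th power and the p-Laplacian field\<close>

lemma young_exact:
  fixes a b r :: real
  assumes "0 \<le> a" "0 \<le> b" "1 \<le> r"
  shows "a powr (r - 1) * b \<le> (1 - 1 / r) * a powr r + b powr r / r"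
proof (cases "r = 1")
  case True
  then show ?thesis using assms by (cases "a = 0") auto
next
  case False
  then have r: "r > 1" using assms by simp
  have "b * a powr (r - 1) \<le> b powr r / r + (a powr (r - 1)) powr (r / (r - 1)) / (r / (r - 1))"
    by (rule Youngs_inequality) (use r assms in \<open>auto simp: field_simps\<close>)
  also have "(a powr (r - 1)) powr (r / (r - 1)) = a powr r" using r by (simp add: powr_powr)
  finally show ?thesis using r by (simp add: field_simps)
qed

lemma powr_midpoint_le:
  fixes x y r :: real
  assumes "0 \<le> x" "0 \<le> y" "1 \<le> r"
  shows "((x + y) / 2) powr r \<le> (x powr r + y powr r) / 2"
proof -
  let ?m = "(x + y) / 2"
  have "?m powr (r - 1) * x + ?m powr (r - 1) * y \<le> 2 * ((1 - 1 / r) * ?m powr r) + (x powr r + y powr r) / r"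
    using young_exact[of ?m x r] young_exact[of ?m y r] assms by (simp add: add_divide_distrib)
  moreover have "?m powr (r - 1) * x + ?m powr (r - 1) * y = 2 * ?m powr r"
  proof (cases "?m = 0")
    case False
    then have "?m powr r = ?m powr (r - 1) * ?m" using assms by (simp add: powr_diff)
    then show ?thesis by (simp add: algebra_simps)
  qed (use assms in auto)
  ultimately have "2 * ?m powr r / r \<le> (x powr r + y powr r) / r" by (simp add: algebra_simps)
  then show ?thesis using assms by (simp add: divide_le_cancel)
qed

lemma powr_superadditive:
  fixes s t r :: real
  assumes "0 \<le> s" "0 \<le> t" "1 \<le> r"
  shows "s powr r + t powr r \<le> (s + t) powr r"
proof -
  have *: "z powr r \<le> z * (s + t) powr (r - 1)" if "0 \<le> z" "z \<le> s + t" for z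
  proof (cases "z = 0")
    case False
    then have "z powr r = z * z powr (r - 1)" using that by (simp add: powr_diff)
    then show ?thesis using that assms by (auto intro!: mult_left_mono powr_mono2)
  qed simp
  have "s powr r + t powr r \<le> s * (s + t) powr (r - 1) + t * (s + t) powr (r - 1)"
    using *[of s] *[of t] assms by simp
  also have "\<dots> = (s + t) * (s + t) powr (r - 1)" by (simp add: algebra_simps)
  also have "\<dots> = (s + t) powr r" using assms by (cases "s + t = 0") (auto simp: powr_diff)
  finally show ?thesis .
qed

text \<open>For \<open>p \<ge> 2\<close> the parallelogram law passes to the power \<open>p / 2\<close>: superadditivity handles the left-hand side,
convexity the right-hand side.\<close>

lemma clarkson:
  fixes a b :: "'a::real_inner"
  assumes "2 \<le> p"
  shows "norm ((1/2) *\<^sub>R (a + b)) powr p + norm ((1/2) *\<^sub>R (a - b)) powr p \<le> (norm a powr p + norm b powr p) / 2"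
proof -
  let ?r = "p / 2"
  have sq: "norm (x::'a) powr p = (norm x ^ 2) powr ?r" for x
    by (cases "x = 0") (auto simp: powr_powr simp flip: powr_numeral)
  have par: "norm ((1/2) *\<^sub>R (a + b)) ^ 2 + norm ((1/2) *\<^sub>R (a - b)) ^ 2 = (norm a ^ 2 + norm b ^ 2) / 2"
    by (simp add: power2_norm_eq_inner inner_simps inner_commute field_simps)
  have "norm ((1/2) *\<^sub>R (a + b)) powr p + norm ((1/2) *\<^sub>R (a - b)) powr p
      \<le> (norm ((1/2) *\<^sub>R (a + b)) ^ 2 + norm ((1/2) *\<^sub>R (a - b)) ^ 2) powr ?r"
    unfolding sq using assms by (intro powr_superadditive) auto
  also have "\<dots> \<le> ((norm a ^ 2) powr ?r + (norm b ^ 2) powr ?r) / 2"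
    unfolding par using assms by (intro powr_midpoint_le) auto
  finally show ?thesis unfolding sq .
qed

definition plap :: "real \<Rightarrow> 'a::real_inner \<Rightarrow> 'a" where
  "plap p v = norm v powr (p - 2) *\<^sub>R v"

lemma plap_zero [simp]: "plap p 0 = 0" by (simp add: plap_def)

lemma norm_plap: "norm (plap p v) = norm v powr (p - 1)"
proof (cases "v = 0")
  case False
  have "norm v powr (p - 1) = norm v powr ((p - 2) + 1)" by simp
  also have "\<dots> = norm v powr (p - 2) * norm v powr 1" by (rule powr_add)
  finally show ?thesis using False by (simp add: plap_def)
qed (simp add: plap_def)

lemma plap_inner_self: "plap p v \<bullet> v = norm v powr p"
proof (cases "v = 0")
  case False
  have "norm v powr p = norm v powr ((p - 2) + 2)" by simp
  also have "\<dots> = norm v powr (p - 2) * norm v powr 2" by (rule powr_add)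
  finally show ?thesis using False by (simp add: plap_def dot_square_norm)
qed (simp add: plap_def)

lemma plap_scaleR: "0 \<le> c \<Longrightarrow> plap p (c *\<^sub>R v) = c powr (p - 1) *\<^sub>R plap p v"
proof (cases "c = 0")
  case False
  assume "0 \<le> c"
  have "c powr (p - 1) = c powr ((p - 2) + 1)" by simp
  also have "\<dots> = c powr (p - 2) * c powr 1" by (rule powr_add)
  finally show ?thesis using False \<open>0 \<le> c\<close> by (simp add: plap_def powr_mult)
qed simp

lemma plap_continuous:
  assumes "2 \<le> p" shows "continuous_on UNIV (plap p :: 'a::real_inner \<Rightarrow> 'a)"
proof -
  have "isCont (plap p) v" for v :: 'a
  proof (cases "v = 0")
    case True
    have "((\<lambda>h::'a. norm h powr (p - 1)) \<longlongrightarrow> norm (0::'a) powr (p - 1)) (at 0)"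
      using assms by (intro tendsto_powr' tendsto_intros) auto
    then have "((\<lambda>h::'a. norm (plap p h)) \<longlongrightarrow> 0) (at 0)" using assms by (simp add: norm_plap)
    then show ?thesis using True by (simp add: isCont_def tendsto_norm_zero_iff)
  next
    case False
    then show ?thesis unfolding plap_def by (intro continuous_intros) auto
  qed
  then show ?thesis by (simp add: continuous_on_eq_continuous_at)
qed

lemma plap_gradient_inequality:
  fixes a b :: "'a::real_inner"
  assumes "2 \<le> p"
  shows "norm a powr p / p + plap p a \<bullet> (b - a) \<le> norm b powr p / p"
proof -
  have "plap p a \<bullet> b \<le> norm (plap p a) * norm b" by (rule norm_cauchy_schwarz)
  also have "\<dots> \<le> (1 - 1 / p) * norm a powr p + norm b powr p / p"
    unfolding norm_plap using young_exact[of "norm a" "norm b" p] assms by simp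
  finally show ?thesis by (simp add: inner_diff_right plap_inner_self algebra_simps)
qed

text \<open>Comparing the gradient inequality at \<open>a\<close> and at \<open>b\<close>, both evaluated at the midpoint, with Clarkson's
inequality leaves exactly the power of the difference.\<close>

lemma plap_uniformly_monotone:
  fixes a b :: "'a::real_inner"
  assumes "2 \<le> p"
  shows "4 / p * norm ((1/2) *\<^sub>R (a - b)) powr p \<le> (plap p a - plap p b) \<bullet> (a - b)"
proof -
  let ?m = "(1/2) *\<^sub>R (a + b)"
  have am: "?m - a = (1/2) *\<^sub>R (b - a)" "?m - b = (1/2) *\<^sub>R (a - b)"
    by (simp_all add: algebra_simps flip: scaleR_add_left)
  have 1: "norm a powr p / p + plap p a \<bullet> ((1/2) *\<^sub>R (b - a)) \<le> norm ?m powr p / p"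
    using plap_gradient_inequality[OF assms, of a ?m] unfolding am .
  have 2: "norm b powr p / p + plap p b \<bullet> ((1/2) *\<^sub>R (a - b)) \<le> norm ?m powr p / p"
    using plap_gradient_inequality[OF assms, of b ?m] unfolding am .
  have "(norm ?m powr p + norm ((1/2) *\<^sub>R (a - b)) powr p) / p \<le> ((norm a powr p + norm b powr p) / 2) / p"
    using clarkson[OF assms, of a b] assms by (intro divide_right_mono) auto
  then have 3: "2 * (norm ?m powr p / p) + 2 * (norm ((1/2) *\<^sub>R (a - b)) powr p / p) \<le> norm a powr p / p + norm b powr p / p"
    using assms by (simp add: field_simps)
  have 4: "plap p a \<bullet> ((1/2) *\<^sub>R (b - a)) + plap p b \<bullet> ((1/2) *\<^sub>R (a - b)) = - (((plap p a - plap p b) \<bullet> (a - b)) / 2)"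
    by (simp add: inner_simps field_simps)
  have 5: "4 / p * norm ((1/2) *\<^sub>R (a - b)) powr p = 4 * (norm ((1/2) *\<^sub>R (a - b)) powr p / p)" by simp
  show ?thesis using 1 2 3 4 unfolding 5 by argo
qed

lemma plap_strictly_monotone:
  fixes a b :: "'a::real_inner"
  assumes "2 \<le> p" "(plap p a - plap p b) \<bullet> (a - b) = 0"
  shows "a = b"
proof -
  have "4 / p * norm ((1/2) *\<^sub>R (a - b)) powr p \<le> 0" using plap_uniformly_monotone[OF assms(1), of a b] assms(2) by simp
  then have "norm ((1/2) *\<^sub>R (a - b)) powr p \<le> 0" using assms(1) by (simp add: mult_le_0_iff divide_le_0_iff)
  then have "norm ((1/2) *\<^sub>R (a - b)) powr p = 0" using powr_ge_zero[of "norm ((1/2) *\<^sub>R (a - b))" p] by linarith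
  then show ?thesis by simp
qed

section \<open>Convergence in the mean of order p\<close>

lemma ennreal_tendsto_0I:
  fixes f :: "'a \<Rightarrow> ennreal"
  assumes "\<And>e::real. 0 < e \<Longrightarrow> \<forall>\<^sub>F n in F. f n \<le> ennreal e"
  shows "(f \<longlongrightarrow> 0) F"
proof (rule order_tendstoI)
  fix a :: ennreal assume "0 < a"
  then obtain e where e: "0 < e" "ennreal e < a"
  proof (cases a rule: ennreal_cases)
    case (real r)
    then show thesis using that[of "r / 2"] \<open>0 < a\<close> by (auto simp: ennreal_less_iff)
  next
    case top
    then show thesis using that[of 1] by simp
  qed
  show "\<forall>\<^sub>F n in F. f n < a"
    using assms[OF e(1)] by eventually_elim (use e in auto)
qed auto

text \<open>The \<open>p\<close>-th power of the \<open>L\<^sup>p\<close> norm. As a nonnegative integral it is defined for every measurable function, so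
limits can be taken before integrability is known.\<close>

definition modular :: "real \<Rightarrow> 'a measure \<Rightarrow> ('a \<Rightarrow> 'b::euclidean_space) \<Rightarrow> ennreal" where
  "modular p M f = (\<integral>\<^sup>+ x. ennreal (norm (f x) powr p) \<partial>M)"

lemma modular_finite_integrable:
  assumes [measurable]: "f \<in> borel_measurable M" and "modular p M f < \<infinity>"
  shows "integrable M (\<lambda>x. norm (f x) powr p)"
  using assms(2) unfolding modular_def by (intro integrableI_bounded) auto

lemma modular_eq_integral:
  assumes "integrable M (\<lambda>x. norm (f x) powr p)"
  shows "modular p M f = ennreal (LINT x|M. norm (f x) powr p)"
  unfolding modular_def using assms by (intro nn_integral_eq_integral) auto

lemma norm_add_powr_le:
  fixes a b :: "'a::real_normed_vector"
  assumes "0 \<le> p" shows "norm (a + b) powr p \<le> 2 powr p * (norm a powr p + norm b powr p)"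
proof -
  have "norm (a + b) powr p \<le> (2 * max (norm a) (norm b)) powr p"
    using norm_triangle_ineq[of a b] assms by (intro powr_mono2) (auto simp: max_def)
  also have "\<dots> = 2 powr p * max (norm a) (norm b) powr p" by (simp add: powr_mult)
  also have "\<dots> \<le> 2 powr p * (norm a powr p + norm b powr p)" by (intro mult_left_mono) (auto simp: max_def)
  finally show ?thesis .
qed

lemma modular_mono:
  assumes "\<And>x. x \<in> space M \<Longrightarrow> norm (f x) \<le> norm (g x)" "0 \<le> p"
  shows "modular p M f \<le> modular p M g"
  unfolding modular_def using assms by (intro nn_integral_mono ennreal_leI powr_mono2) auto

lemma modular_add_le:
  assumes [measurable]: "f \<in> borel_measurable M" "g \<in> borel_measurable M" and "0 \<le> p"
  shows "modular p M (\<lambda>x. f x + g x) \<le> ennreal (2 powr p) * (modular p M f + modular p M g)"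
proof -
  have "modular p M (\<lambda>x. f x + g x) \<le> (\<integral>\<^sup>+ x. ennreal (2 powr p) * (ennreal (norm (f x) powr p) + ennreal (norm (g x) powr p)) \<partial>M)"
    unfolding modular_def using norm_add_powr_le[OF \<open>0 \<le> p\<close>]
    by (intro nn_integral_mono) (auto simp flip: ennreal_plus ennreal_mult intro!: ennreal_leI)
  also have "\<dots> = ennreal (2 powr p) * (modular p M f + modular p M g)"
    unfolding modular_def by (simp add: nn_integral_cmult nn_integral_add)
  finally show ?thesis .
qed

lemma modular_scale:
  assumes [measurable]: "f \<in> borel_measurable M"
  shows "modular p M (\<lambda>x. c *\<^sub>R f x) = ennreal (\<bar>c\<bar> powr p) * modular p M f"
  unfolding modular_def by (simp add: powr_mult ennreal_mult nn_integral_cmult)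

lemma modular_minus: "modular p M (\<lambda>x. g x - f x) = modular p M (\<lambda>x. f x - g x)"
  by (simp add: modular_def norm_minus_commute)

lemma modular_add_tendsto_zero:
  assumes [measurable]: "\<And>n. f n \<in> borel_measurable M" "\<And>n. g n \<in> borel_measurable M" and p: "0 \<le> p"
    and "(\<lambda>n. modular p M (f n)) \<longlonglongrightarrow> 0" "(\<lambda>n. modular p M (g n)) \<longlonglongrightarrow> 0"
  shows "(\<lambda>n. modular p M (\<lambda>x. f n x + g n x)) \<longlonglongrightarrow> 0"
proof (rule tendsto_sandwich[OF _ _ tendsto_const])
  have "(\<lambda>n. modular p M (f n) + modular p M (g n)) \<longlonglongrightarrow> 0"
    using tendsto_add[OF assms(4,5)] by simp
  then show "(\<lambda>n. ennreal (2 powr p) * (modular p M (f n) + modular p M (g n))) \<longlonglongrightarrow> 0"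
    using ennreal_tendsto_cmult[of "ennreal (2 powr p)"] by fastforce
qed (auto intro!: always_eventually modular_add_le p)

lemma modular_Fatou:
  assumes [measurable]: "\<And>k. h k \<in> borel_measurable M" and p: "0 < p"
    and lim: "AE x in M. (\<lambda>k. h k x) \<longlonglongrightarrow> g x"
  shows "modular p M g \<le> liminf (\<lambda>k. modular p M (h k))"
proof -
  have "modular p M g = (\<integral>\<^sup>+ x. liminf (\<lambda>k. ennreal (norm (h k x) powr p)) \<partial>M)"
    unfolding modular_def
  proof (rule nn_integral_cong_AE, use lim in eventually_elim)
    fix x assume "(\<lambda>k. h k x) \<longlonglongrightarrow> g x"
    then have "(\<lambda>k. ennreal (norm (h k x) powr p)) \<longlonglongrightarrow> ennreal (norm (g x) powr p)"
      using p by (intro tendsto_intros tendsto_powr') auto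
    from lim_imp_Liminf[OF trivial_limit_sequentially this]
    show "ennreal (norm (g x) powr p) = liminf (\<lambda>k. ennreal (norm (h k x) powr p))" by (rule sym)
  qed
  also have "\<dots> \<le> liminf (\<lambda>k. modular p M (h k))"
    unfolding modular_def by (rule nn_integral_liminf) measurable
  finally show ?thesis .
qed

lemma modular_dominated:
  assumes [measurable]: "\<And>k. h k \<in> borel_measurable M" "g \<in> borel_measurable M" and p: "0 < p"
    and lim: "AE x in M. (\<lambda>k. h k x) \<longlonglongrightarrow> g x"
    and S: "integrable M S" and b: "AE x in M. \<forall>k. norm (h k x) powr p \<le> S x"
  shows "(\<lambda>k. modular p M (\<lambda>x. h k x - g x)) \<longlonglongrightarrow> 0"
proof -
  let ?w = "\<lambda>x. 2 powr p * (S x + S x)"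
  have [measurable]: "S \<in> borel_measurable M" using S by auto
  have "(\<lambda>k. \<integral>\<^sup>+ x. ennreal (norm (h k x - g x) powr p) \<partial>M) \<longlonglongrightarrow> (\<integral>\<^sup>+ x. 0 \<partial>M)"
  proof (rule nn_integral_dominated_convergence[where w = "\<lambda>x. ennreal (?w x)"])
    show "(\<lambda>x. ennreal (?w x)) \<in> borel_measurable M" by measurable
    have iw: "integrable M ?w" using S by auto
    show "(\<integral>\<^sup>+ x. ennreal (?w x) \<partial>M) < \<infinity>"
    proof -
      have "(\<integral>\<^sup>+ x. ennreal (?w x) \<partial>M) \<le> (\<integral>\<^sup>+ x. ennreal (norm (?w x)) \<partial>M)"
        by (intro nn_integral_mono ennreal_leI) (simp add: abs_le_iff)
      also have "\<dots> < \<infinity>" using iw unfolding integrable_iff_bounded by blast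
      finally show ?thesis .
    qed
    show "AE x in M. ennreal (norm (h k x - g x) powr p) \<le> ennreal (?w x)" for k
      using lim b
    proof eventually_elim
      case (elim x)
      have "(\<lambda>k. norm (h k x) powr p) \<longlonglongrightarrow> norm (g x) powr p"
        using p elim by (intro tendsto_intros tendsto_powr') auto
      then have "norm (g x) powr p \<le> S x" using elim by (intro LIMSEQ_le_const2) auto
      have "norm (h k x + - g x) powr p \<le> 2 powr p * (norm (h k x) powr p + norm (- g x) powr p)"
        using norm_add_powr_le[of p "h k x" "- g x"] p by simp
      also have "\<dots> \<le> ?w x" using elim \<open>norm (g x) powr p \<le> S x\<close> by (intro mult_left_mono add_mono) auto
      finally show ?case by (simp add: ennreal_leI)
    qed
    show "AE x in M. (\<lambda>k. ennreal (norm (h k x - g x) powr p)) \<longlonglongrightarrow> 0"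
      using lim
    proof eventually_elim
      case (elim x)
      have "(\<lambda>k. ennreal (norm (h k x - g x) powr p)) \<longlonglongrightarrow> ennreal (norm (g x - g x) powr p)"
        using p elim by (intro tendsto_intros tendsto_powr') auto
      then show ?case using p by simp
    qed
  qed auto
  then show ?thesis by (simp add: modular_def)
qed

lemma eventually_subseq:
  assumes "\<And>k::nat. \<forall>\<^sub>F n in sequentially. P k (n::nat)"
  obtains r where "strict_mono r" "\<And>k. P k (r k)"
proof -
  have "\<exists>r. \<forall>k. P k (r k) \<and> r k < r (Suc k)"
  proof (rule dependent_nat_choice)
    show "\<exists>x. P 0 x" using assms[of 0] eventually_sequentially by auto
    show "\<exists>y. P (Suc n) y \<and> x < y" for x n
    proof -
      obtain N where "\<And>m. m \<ge> N \<Longrightarrow> P (Suc n) m" using assms[of "Suc n"] eventually_sequentially by auto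
      then show ?thesis by (intro exI[of _ "max N (Suc x)"]) auto
    qed
  qed
  then show thesis using that strict_mono_Suc_iff by blast
qed

text \<open>If the weighted modulars are summable, then the sum of the weighted powers is finite almost everywhere;
this sum dominates every term and forces the terms to zero.\<close>

lemma weighted_modular_series:
  fixes d :: "nat \<Rightarrow> 'a \<Rightarrow> 'b::euclidean_space"
  assumes [measurable]: "\<And>k. d k \<in> borel_measurable M" and c: "\<And>k. 0 \<le> c k"
    and small: "\<And>k. ennreal (c k) * modular p M (d k) \<le> ennreal ((1/2) ^ k)"
  obtains S where "integrable M S" "AE x in M. \<forall>k. c k * norm (d k x) powr p \<le> S x"
    "AE x in M. (\<lambda>k. c k * norm (d k x) powr p) \<longlonglongrightarrow> 0"
proof -
  define T where "T x = (\<Sum>k. ennreal (c k * norm (d k x) powr p))" for x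
  have [measurable]: "T \<in> borel_measurable M" unfolding T_def by measurable
  have "(\<integral>\<^sup>+ x. T x \<partial>M) = (\<Sum>k. \<integral>\<^sup>+ x. ennreal (c k * norm (d k x) powr p) \<partial>M)"
    unfolding T_def by (rule nn_integral_suminf) measurable
  also have "\<dots> = (\<Sum>k. ennreal (c k) * modular p M (d k))"
    unfolding modular_def using c by (simp add: ennreal_mult nn_integral_cmult)
  also have "\<dots> \<le> (\<Sum>k. ennreal ((1/2) ^ k))" by (intro suminf_le small) auto
  also have "\<dots> = ennreal (\<Sum>k. (1/2) ^ k)" by (intro suminf_ennreal2) (auto simp: summable_geometric)
  also have "\<dots> < \<infinity>" by simp
  finally have fin: "(\<integral>\<^sup>+ x. T x \<partial>M) < \<infinity>" .
  then have TA: "AE x in M. T x \<noteq> \<infinity>" by (intro nn_integral_PInf_AE) auto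
  show thesis
  proof (rule that[of "\<lambda>x. enn2real (T x)"])
    show "integrable M (\<lambda>x. enn2real (T x))"
    proof (rule integrableI_bounded)
      have "(\<integral>\<^sup>+ x. ennreal (norm (enn2real (T x))) \<partial>M) \<le> (\<integral>\<^sup>+ x. T x \<partial>M)"
        by (intro nn_integral_mono) (auto simp: ennreal_enn2real_if)
      then show "(\<integral>\<^sup>+ x. ennreal (norm (enn2real (T x))) \<partial>M) < \<infinity>" using fin by simp
    qed auto
    have *: "summable (\<lambda>k. c k * norm (d k x) powr p) \<and> T x = ennreal (\<Sum>k. c k * norm (d k x) powr p)"
      if "T x \<noteq> \<infinity>" for x
    proof -
      have s: "summable (\<lambda>k. c k * norm (d k x) powr p)"
        using that c unfolding T_def by (intro summable_suminf_not_top) auto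
      then show ?thesis unfolding T_def using c by (intro conjI suminf_ennreal2) auto
    qed
    show "AE x in M. \<forall>k. c k * norm (d k x) powr p \<le> enn2real (T x)"
      using TA
    proof eventually_elim
      case (elim x)
      have s: "summable (\<lambda>k. c k * norm (d k x) powr p)" using *[OF elim] by blast
      have "c k * norm (d k x) powr p \<le> (\<Sum>k. c k * norm (d k x) powr p)" for k
        using sum_le_suminf[OF s, of "{k}"] c by auto
      moreover have "0 \<le> (\<Sum>k. c k * norm (d k x) powr p)" by (intro suminf_nonneg s) (use c in auto)
      ultimately show ?case using *[OF elim] by simp
    qed
    show "AE x in M. (\<lambda>k. c k * norm (d k x) powr p) \<longlonglongrightarrow> 0"
      using TA by eventually_elim (use * summable_LIMSEQ_zero in blast)
  qed
qed

lemma norm_powr_tendsto_zero_iff: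
  assumes "(\<lambda>k. norm (d k) powr p) \<longlonglongrightarrow> (0::real)" "0 < p"
  shows "d \<longlonglongrightarrow> 0"
proof -
  have "(\<lambda>k. (norm (d k) powr p) powr (1 / p)) \<longlonglongrightarrow> 0 powr (1 / p)"
    using assms by (intro tendsto_powr' tendsto_intros assms(1)) auto
  then show ?thesis using assms by (simp add: powr_powr tendsto_norm_zero_iff)
qed

text \<open>The usual subsequence converging almost everywhere, together with an integrable bound for the
\<open>p\<close>-th powers of the differences: dominated convergence applies along it.\<close>

lemma modular_fast_subseq:
  fixes f :: "nat \<Rightarrow> 'a \<Rightarrow> 'b::euclidean_space"
  assumes [measurable]: "\<And>n. f n \<in> borel_measurable M" "g \<in> borel_measurable M"
    and lim: "(\<lambda>n. modular p M (\<lambda>x. f n x - g x)) \<longlonglongrightarrow> 0" and p: "0 < p"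
  obtains r S where "strict_mono r" "integrable M S"
    "AE x in M. \<forall>k. norm (f (r k) x - g x) powr p \<le> S x" "AE x in M. (\<lambda>k. f (r k) x) \<longlonglongrightarrow> g x"
proof -
  have "\<forall>\<^sub>F n in sequentially. modular p M (\<lambda>x. f n x - g x) \<le> ennreal ((1/2) ^ k)" for k
    using order_tendstoD(2)[OF lim, of "ennreal ((1/2)^k)"] by (auto elim!: eventually_mono simp: less_imp_le)
  then obtain r where r: "strict_mono r" "\<And>k. modular p M (\<lambda>x. f (r k) x - g x) \<le> ennreal ((1/2) ^ k)"
    by (rule eventually_subseq) (rule that)
  obtain S where S: "integrable M S" "AE x in M. \<forall>k. 1 * norm (f (r k) x - g x) powr p \<le> S x"
    "AE x in M. (\<lambda>k. 1 * norm (f (r k) x - g x) powr p) \<longlonglongrightarrow> 0"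
    by (rule weighted_modular_series[of "\<lambda>k x. f (r k) x - g x" M "\<lambda>_. 1" p])
      (use r(2) in \<open>auto intro: that\<close>)
  have "AE x in M. (\<lambda>k. f (r k) x) \<longlonglongrightarrow> g x"
    using S(3)
  proof eventually_elim
    case (elim x)
    then have "(\<lambda>k. f (r k) x - g x) \<longlonglongrightarrow> 0"
      using norm_powr_tendsto_zero_iff[OF _ p, of "\<lambda>k. f (r k) x - g x"] by simp
    then show ?case by (rule LIM_zero_cancel)
  qed
  then show thesis using that[OF r(1) S(1)] S(2) by auto
qed

text \<open>Riesz-Fischer: along a subsequence whose increments have geometrically small modular, weights growing
like \<open>2\<^sup>k\<^sup>p\<close> show that the increments are almost everywhere at most a multiple of \<open>2\<^sup>-\<^sup>k\<close>. Fatou's lemma identifies the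
limit of the full sequence.\<close>

lemma modular_complete:
  fixes f :: "nat \<Rightarrow> 'a \<Rightarrow> 'b::euclidean_space"
  assumes [measurable]: "\<And>n. f n \<in> borel_measurable M" and p: "1 \<le> p"
    and cau: "\<And>e. 0 < e \<Longrightarrow> \<exists>N. \<forall>m\<ge>N. \<forall>n\<ge>N. modular p M (\<lambda>x. f m x - f n x) \<le> ennreal e"
  obtains g where "g \<in> borel_measurable M" "(\<lambda>n. modular p M (\<lambda>x. f n x - g x)) \<longlonglongrightarrow> 0"
proof -
  define c where "c k = (2 powr p) ^ k" for k :: nat
  have cpos: "0 < c k" for k by (simp add: c_def)
  have "\<forall>\<^sub>F N in sequentially. \<forall>m\<ge>N. \<forall>n\<ge>N. modular p M (\<lambda>x. f m x - f n x) \<le> ennreal ((1/2)^k / c k)" for k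
  proof -
    have "0 < (1/2)^k / c k" using cpos[of k] by simp
    from cau[OF this] obtain N where N: "\<forall>m\<ge>N. \<forall>n\<ge>N. modular p M (\<lambda>x. f m x - f n x) \<le> ennreal ((1/2)^k / c k)"
      by blast
    show ?thesis
      using eventually_ge_at_top[of N] by eventually_elim (use N order_trans in blast)
  qed
  then obtain r where r: "strict_mono r"
    "\<And>k. \<forall>m\<ge>r k. \<forall>n\<ge>r k. modular p M (\<lambda>x. f m x - f n x) \<le> ennreal ((1/2)^k / c k)"
    by (rule eventually_subseq) (rule that)
  have small: "ennreal (c k) * modular p M (\<lambda>x. f (r (Suc k)) x - f (r k) x) \<le> ennreal ((1/2)^k)" for k
  proof -
    have "modular p M (\<lambda>x. f (r (Suc k)) x - f (r k) x) \<le> ennreal ((1/2)^k / c k)"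
      using r by (simp add: strict_mono_less_eq)
    then have "ennreal (c k) * modular p M (\<lambda>x. f (r (Suc k)) x - f (r k) x) \<le> ennreal (c k) * ennreal ((1/2)^k / c k)"
      by (rule mult_left_mono) simp
    also have "\<dots> = ennreal ((1/2)^k)" using cpos[of k] by (subst ennreal_mult'[symmetric]) (auto simp: less_imp_le)
    finally show ?thesis .
  qed
  obtain S where S: "integrable M S" "AE x in M. \<forall>k. c k * norm (f (r (Suc k)) x - f (r k) x) powr p \<le> S x"
    by (rule weighted_modular_series[of "\<lambda>k x. f (r (Suc k)) x - f (r k) x" M c p])
      (use small less_imp_le[OF cpos] in \<open>auto intro: that\<close>)
  have conv: "AE x in M. convergent (\<lambda>k. f (r k) x)"
    using S(2)
  proof eventually_elim
    case (elim x)
    let ?s = "\<bar>S x\<bar> powr (1 / p)"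
    have b: "norm (f (r (Suc k)) x - f (r k) x) \<le> ?s * (1/2) ^ k" for k
    proof -
      let ?d = "norm (f (r (Suc k)) x - f (r k) x)"
      have "(2 ^ k * ?d) powr p = c k * ?d powr p"
        by (simp add: powr_mult c_def powr_power powr_realpow[symmetric] powr_powr mult.commute)
      also have "\<dots> \<le> \<bar>S x\<bar>" using elim by (metis abs_ge_self order_trans)
      finally have "((2 ^ k * ?d) powr p) powr (1 / p) \<le> ?s" using p by (intro powr_mono2) auto
      then have "2 ^ k * ?d \<le> ?s" using p by (simp add: powr_powr)
      then show ?thesis by (simp add: field_simps)
    qed
    have "summable (\<lambda>k. f (r (Suc k)) x - f (r k) x)"
      by (rule summable_comparison_test'[of "\<lambda>k. ?s * (1/2) ^ k" 0]) (use b in \<open>auto intro!: summable_mult summable_geometric\<close>)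
    then have "convergent (\<lambda>n. \<Sum>k<n. f (r (Suc k)) x - f (r k) x)" by (simp add: summable_iff_convergent)
    then have "convergent (\<lambda>n. f (r n) x - f (r 0) x)" 
      unfolding sum_lessThan_telescope[of "\<lambda>k. f (r k) x"] .
    from convergent_add[OF this convergent_const[of "f (r 0) x"]] show ?case by simp
  qed
  define g where "g x = lim (\<lambda>k. f (r k) x)" for x
  have gm[measurable]: "g \<in> borel_measurable M" unfolding g_def by measurable
  have lim: "AE x in M. (\<lambda>k. f (r k) x) \<longlonglongrightarrow> g x"
    using conv by eventually_elim (simp add: g_def convergent_LIMSEQ_iff)
  show thesis
  proof (rule that[OF gm], rule ennreal_tendsto_0I)
    fix e :: real assume "0 < e"
    from cau[OF this] obtain N where N: "\<And>m n. N \<le> m \<Longrightarrow> N \<le> n \<Longrightarrow> modular p M (\<lambda>x. f m x - f n x) \<le> ennreal e" by blast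
    have "modular p M (\<lambda>x. f n x - g x) \<le> ennreal e" if "N \<le> n" for n
    proof -
      have "modular p M (\<lambda>x. f n x - g x) \<le> liminf (\<lambda>k. modular p M (\<lambda>x. f n x - f (r k) x))"
        by (rule modular_Fatou) (use p lim in \<open>auto intro!: tendsto_intros elim!: eventually_mono\<close>)
      also have "\<dots> \<le> ennreal e"
      proof (rule Liminf_le)
        show "\<forall>\<^sub>F k in sequentially. modular p M (\<lambda>x. f n x - f (r k) x) \<le> ennreal e"
          using eventually_ge_at_top[of N]
          by eventually_elim (use N that seq_suble[OF r(1)] order_trans in blast)
      qed simp
      finally show ?thesis .
    qed
    then show "\<forall>\<^sub>F n in sequentially. modular p M (\<lambda>x. f n x - g x) \<le> ennreal e"
      using eventually_sequentially by blast
  qed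
qed


lemma ennreal_tendsto_0_le:
  fixes f g :: "'a \<Rightarrow> ennreal"
  assumes "(g \<longlongrightarrow> 0) F" "\<And>n. f n \<le> g n"
  shows "(f \<longlongrightarrow> 0) F"
  by (rule tendsto_sandwich[OF _ _ tendsto_const assms(1)]) (use assms(2) in auto)

text \<open>Strong continuity of the pairing between \<open>L\<^sup>p\<close> and fields of growth \<open>|h|\<^sup>p\<^sup>-\<^sup>1\<close> with \<open>h\<close> in \<open>L\<^sup>p\<close>: in the crude
Young inequality the parameter multiplies the fixed modular of \<open>h\<close> and the modular of the difference
tends to zero.\<close>

lemma pairing_tendsto:
  fixes X h :: "'a \<Rightarrow> 'b::euclidean_space"
  assumes [measurable]: "X \<in> borel_measurable M" "h \<in> borel_measurable M" "\<And>n. f n \<in> borel_measurable M" "g \<in> borel_measurable M"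
    and p: "1 \<le> p" and h: "modular p M h < \<infinity>" and X: "\<And>x. x \<in> space M \<Longrightarrow> norm (X x) \<le> norm (h x) powr (p - 1)"
    and g: "modular p M g < \<infinity>" and lim: "(\<lambda>n. modular p M (\<lambda>x. f n x - g x)) \<longlonglongrightarrow> 0"
  shows "integrable M (\<lambda>x. X x \<bullet> g x)" "(\<lambda>n. LINT x|M. X x \<bullet> f n x) \<longlonglongrightarrow> (LINT x|M. X x \<bullet> g x)"
proof -
  have bd: "(\<integral>\<^sup>+ x. ennreal (norm (X x \<bullet> k x)) \<partial>M) \<le> ennreal e * modular p M h + ennreal (e powr (1 - p)) * modular p M k"
    if [measurable]: "k \<in> borel_measurable M" and e: "0 < e" for k :: "'a \<Rightarrow> 'b" and e
  proof -
    have "(\<integral>\<^sup>+ x. ennreal (norm (X x \<bullet> k x)) \<partial>M)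
        \<le> (\<integral>\<^sup>+ x. ennreal e * ennreal (norm (h x) powr p) + ennreal (e powr (1 - p)) * ennreal (norm (k x) powr p) \<partial>M)"
    proof (rule nn_integral_mono)
      fix x assume x: "x \<in> space M"
      have "norm (X x \<bullet> k x) \<le> norm (X x) * norm (k x)" using Cauchy_Schwarz_ineq2 by simp
      also have "\<dots> \<le> norm (h x) powr (p - 1) * norm (k x)" using X[OF x] by (rule mult_right_mono) simp
      also have "\<dots> \<le> e * norm (h x) powr p + e powr (1 - p) * norm (k x) powr p" by (intro young_weak e p) auto
      finally show "ennreal (norm (X x \<bullet> k x))
          \<le> ennreal e * ennreal (norm (h x) powr p) + ennreal (e powr (1 - p)) * ennreal (norm (k x) powr p)"
        using e by (auto simp flip: ennreal_plus ennreal_mult intro!: ennreal_leI)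
    qed
    also have "\<dots> = ennreal e * modular p M h + ennreal (e powr (1 - p)) * modular p M k"
      unfolding modular_def by (simp add: nn_integral_cmult nn_integral_add)
    finally show ?thesis .
  qed
  have fin: "integrable M (\<lambda>x. X x \<bullet> k x)" if [measurable]: "k \<in> borel_measurable M" and "modular p M k < \<infinity>" for k
  proof (rule integrableI_bounded)
    have "(\<integral>\<^sup>+ x. ennreal (norm (X x \<bullet> k x)) \<partial>M) \<le> ennreal 1 * modular p M h + ennreal (1 powr (1 - p)) * modular p M k"
      by (rule bd) (use that in auto)
    also have "\<dots> < \<infinity>" using h that by (simp add: ennreal_add_eq_top less_top)
    finally show "(\<integral>\<^sup>+ x. ennreal (norm (X x \<bullet> k x)) \<partial>M) < \<infinity>" .
  qed measurable
  show ig: "integrable M (\<lambda>x. X x \<bullet> g x)" by (rule fin) (use g in auto)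
  obtain P where P: "modular p M h = ennreal P" "0 \<le> P" using h by (cases "modular p M h" rule: ennreal_cases) auto
  have nz: "(\<lambda>n. \<integral>\<^sup>+ x. ennreal (norm (X x \<bullet> (f n x - g x))) \<partial>M) \<longlonglongrightarrow> 0"
  proof (rule ennreal_tendsto_0I)
    fix e :: real assume e: "0 < e"
    define d where "d = e / (2 * (P + 1))"
    have d: "0 < d" "d * P \<le> e / 2" using e P by (auto simp: d_def field_simps)
    define c where "c = e / (2 * d powr (1 - p))"
    have c: "0 < c" "d powr (1 - p) * c = e / 2" using e d by (auto simp: c_def)
    have "\<forall>\<^sub>F n in sequentially. modular p M (\<lambda>x. f n x - g x) < ennreal c"
      by (rule order_tendstoD(2)[OF lim]) (use c in auto)
    then show "\<forall>\<^sub>F n in sequentially. (\<integral>\<^sup>+ x. ennreal (norm (X x \<bullet> (f n x - g x))) \<partial>M) \<le> ennreal e"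
    proof eventually_elim
      case (elim n)
      have "(\<integral>\<^sup>+ x. ennreal (norm (X x \<bullet> (f n x - g x))) \<partial>M)
          \<le> ennreal d * modular p M h + ennreal (d powr (1 - p)) * modular p M (\<lambda>x. f n x - g x)"
        by (rule bd) (use d in auto)
      also have "\<dots> \<le> ennreal d * ennreal P + ennreal (d powr (1 - p)) * ennreal c"
        unfolding P(1) using elim by (intro add_mono mult_left_mono) auto
      also have "\<dots> = ennreal (d * P + d powr (1 - p) * c)"
        using d P c by (simp add: ennreal_mult ennreal_plus)
      also have "\<dots> \<le> ennreal e" using c d by (intro ennreal_leI) auto
      finally show ?case .
    qed
  qed
  have "\<forall>\<^sub>F n in sequentially. (\<integral>\<^sup>+ x. ennreal (norm (X x \<bullet> (f n x - g x))) \<partial>M) < 1"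
    by (rule order_tendstoD(2)[OF nz]) simp
  then have ev: "\<forall>\<^sub>F n in sequentially. integrable M (\<lambda>x. X x \<bullet> f n x)"
  proof eventually_elim
    case (elim n)
    have "integrable M (\<lambda>x. X x \<bullet> (f n x - g x))"
      by (rule integrableI_bounded) (use elim order_less_trans[OF elim] in auto)
    from Bochner_Integration.integrable_add[OF this ig] show ?case by (simp add: inner_diff_right)
  qed
  obtain N where N: "\<And>n. n \<ge> N \<Longrightarrow> integrable M (\<lambda>x. X x \<bullet> f n x)" using ev eventually_sequentially by auto
  have "(\<lambda>n. LINT x|M. X x \<bullet> f (n + N) x) \<longlonglongrightarrow> (LINT x|M. X x \<bullet> g x)"
  proof (rule tendsto_L1_int[OF _ ig])
    show "integrable M (\<lambda>x. X x \<bullet> f (n + N) x)" for n by (rule N) simp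
    show "((\<lambda>n. \<integral>\<^sup>+ x. ennreal (norm (X x \<bullet> f (n + N) x - X x \<bullet> g x)) \<partial>M) \<longlongrightarrow> 0) sequentially"
      using LIMSEQ_ignore_initial_segment[OF nz, of N] by (simp add: inner_diff_right)
  qed
  then show "(\<lambda>n. LINT x|M. X x \<bullet> f n x) \<longlonglongrightarrow> (LINT x|M. X x \<bullet> g x)" by (rule LIMSEQ_offset)
qed

section \<open>The Sobolev space with zero boundary values\<close>

locale dirichlet_domain =
  fixes \<Omega> :: "'a::euclidean_space set" and p :: real
  assumes open_\<Omega>: "open \<Omega>" and bounded_\<Omega>: "bounded \<Omega>" and p_ge_2: "2 \<le> p"
begin

abbreviation "M \<equiv> lebesgue_on \<Omega>"

lemma p_pos: "0 < p" "1 < p" "1 \<le> p" "0 \<le> p" using p_ge_2 by auto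

text \<open>The pair of a function and its weak gradient is carried along explicitly: it is a limit of pairs
\<open>(\<psi>, \<nabla>\<psi>)\<close> with test functions \<open>\<psi>\<close>, with \<open>L\<^sup>p\<close> convergence of both components.\<close>

definition sobolev0 :: "('a \<Rightarrow> real) \<Rightarrow> ('a \<Rightarrow> 'a) \<Rightarrow> bool" where
  "sobolev0 u v \<longleftrightarrow> u \<in> borel_measurable M \<and> v \<in> borel_measurable M \<and>
     (\<exists>\<phi>. (\<forall>n::nat. \<phi> n \<in> C1_c \<Omega>) \<and> (\<lambda>n. modular p M (\<lambda>x. \<phi> n x - u x)) \<longlonglongrightarrow> 0 \<and>
        (\<lambda>n. modular p M (\<lambda>x. gradient (\<phi> n) x - v x)) \<longlonglongrightarrow> 0)"

lemma sobolev0_measurable: "sobolev0 u v \<Longrightarrow> u \<in> borel_measurable M" "sobolev0 u v \<Longrightarrow> v \<in> borel_measurable M"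
  by (auto simp: sobolev0_def)

lemma sobolev0E:
  assumes "sobolev0 u v"
  obtains \<phi> where "\<And>n::nat. \<phi> n \<in> C1_c \<Omega>" "(\<lambda>n. modular p M (\<lambda>x. \<phi> n x - u x)) \<longlonglongrightarrow> 0"
    "(\<lambda>n. modular p M (\<lambda>x. gradient (\<phi> n) x - v x)) \<longlonglongrightarrow> 0"
  using assms by (auto simp: sobolev0_def)

lemma C1_c_modular_finite:
  assumes "f \<in> C1_c \<Omega>"
  shows "modular p M f < \<infinity>" "modular p M (gradient f) < \<infinity>"
proof -
  note i = C1_c_integrable_powr[OF assms open_\<Omega> bounded_\<Omega> p_pos(4)]
  show "modular p M (gradient f) < \<infinity>" using modular_eq_integral[OF i(2)] by simp
  have "integrable M (\<lambda>x. norm (f x) powr p)" using i(1) by simp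
  from modular_eq_integral[OF this] show "modular p M f < \<infinity>" by simp
qed

lemma modular_limit_finite:
  assumes [measurable]: "\<And>n. f n \<in> borel_measurable M" "g \<in> borel_measurable M"
    and fin: "\<And>n. modular p M (f n) < \<infinity>" and lim: "(\<lambda>n. modular p M (\<lambda>x. f n x - g x)) \<longlonglongrightarrow> 0"
  shows "modular p M g < \<infinity>"
proof -
  have "\<forall>\<^sub>F n in sequentially. modular p M (\<lambda>x. f n x - g x) < 1" by (rule order_tendstoD(2)[OF lim]) simp
  from eventually_happens'[OF sequentially_bot this] obtain n where n: "modular p M (\<lambda>x. f n x - g x) < 1" ..
  have "modular p M g = modular p M (\<lambda>x. f n x + (g x - f n x))" by simp
  also have "\<dots> \<le> ennreal (2 powr p) * (modular p M (f n) + modular p M (\<lambda>x. g x - f n x))"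
    by (rule modular_add_le) (use p_pos in auto)
  also have "\<dots> < \<infinity>"
    using fin[of n] n order_less_trans[OF n, of top]
    by (simp add: modular_minus[of p M g] ennreal_mult_less_top ennreal_add_eq_top less_top)
  finally show ?thesis .
qed

lemma sobolev0_finite:
  assumes "sobolev0 u v"
  shows "modular p M u < \<infinity>" "modular p M v < \<infinity>"
proof -
  note m[measurable] = sobolev0_measurable[OF assms]
  obtain \<phi> where \<phi>: "\<And>n::nat. \<phi> n \<in> C1_c \<Omega>" "(\<lambda>n. modular p M (\<lambda>x. \<phi> n x - u x)) \<longlonglongrightarrow> 0"
    "(\<lambda>n. modular p M (\<lambda>x. gradient (\<phi> n) x - v x)) \<longlonglongrightarrow> 0" by (rule sobolev0E[OF assms]) (rule that)
  note [measurable] = C1_c_measurable[OF \<phi>(1)]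
  show "modular p M u < \<infinity>"
    by (rule modular_limit_finite[OF _ _ C1_c_modular_finite(1)[OF \<phi>(1)] \<phi>(2)]) measurable
  show "modular p M v < \<infinity>"
    by (rule modular_limit_finite[OF _ _ C1_c_modular_finite(2)[OF \<phi>(1)] \<phi>(3)]) measurable
qed

lemma sobolev0_C1_c: "f \<in> C1_c \<Omega> \<Longrightarrow> sobolev0 f (gradient f)"
  unfolding sobolev0_def
  by (auto intro!: C1_c_measurable exI[of _ "\<lambda>_. f"] simp: modular_def)

lemma sobolev0_closed:
  assumes UV: "\<And>k. sobolev0 (U k) (V k)" and [measurable]: "u \<in> borel_measurable M" "v \<in> borel_measurable M"
    and u: "(\<lambda>k. modular p M (\<lambda>x. U k x - u x)) \<longlonglongrightarrow> 0" and v: "(\<lambda>k. modular p M (\<lambda>x. V k x - v x)) \<longlonglongrightarrow> 0"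
  shows "sobolev0 u v"
proof -
  note UVm[measurable] = sobolev0_measurable[OF UV]
  have "\<exists>\<psi>. \<psi> \<in> C1_c \<Omega> \<and> modular p M (\<lambda>x. \<psi> x - U k x) \<le> ennreal (1 / real (Suc k))
      \<and> modular p M (\<lambda>x. gradient \<psi> x - V k x) \<le> ennreal (1 / real (Suc k))" for k
  proof -
    obtain \<phi> where \<phi>: "\<And>n::nat. \<phi> n \<in> C1_c \<Omega>" "(\<lambda>n. modular p M (\<lambda>x. \<phi> n x - U k x)) \<longlonglongrightarrow> 0"
      "(\<lambda>n. modular p M (\<lambda>x. gradient (\<phi> n) x - V k x)) \<longlonglongrightarrow> 0" by (rule sobolev0E[OF UV]) (rule that)
    have "\<forall>\<^sub>F n in sequentially. modular p M (\<lambda>x. \<phi> n x - U k x) < ennreal (1 / real (Suc k))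
       \<and> modular p M (\<lambda>x. gradient (\<phi> n) x - V k x) < ennreal (1 / real (Suc k))"
      using order_tendstoD(2)[OF \<phi>(2), of "ennreal (1 / real (Suc k))"]
        order_tendstoD(2)[OF \<phi>(3), of "ennreal (1 / real (Suc k))"] by (simp add: eventually_conj_iff)
    from eventually_happens'[OF sequentially_bot this]
    obtain n where "modular p M (\<lambda>x. \<phi> n x - U k x) < ennreal (1 / real (Suc k))
       \<and> modular p M (\<lambda>x. gradient (\<phi> n) x - V k x) < ennreal (1 / real (Suc k))" ..
    then show ?thesis using \<phi>(1) less_imp_le by blast
  qed
  then obtain \<psi> where \<psi>: "\<And>k. \<psi> k \<in> C1_c \<Omega>" "\<And>k. modular p M (\<lambda>x. \<psi> k x - U k x) \<le> ennreal (1 / real (Suc k))"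
    "\<And>k. modular p M (\<lambda>x. gradient (\<psi> k) x - V k x) \<le> ennreal (1 / real (Suc k))" by metis
  note [measurable] = C1_c_measurable[OF \<psi>(1)]
  have z: "(\<lambda>k. ennreal (1 / real (Suc k))) \<longlonglongrightarrow> 0"
    using tendsto_ennrealI[OF LIMSEQ_inverse_real_of_nat] by (simp add: inverse_eq_divide)
  note 1 = ennreal_tendsto_0_le[OF z \<psi>(2)] and 2 = ennreal_tendsto_0_le[OF z \<psi>(3)]
  have "(\<lambda>k. modular p M (\<lambda>x. (\<psi> k x - U k x) + (U k x - u x))) \<longlonglongrightarrow> 0"
    by (rule modular_add_tendsto_zero[OF _ _ p_pos(4) 1 u]) measurable
  moreover have "(\<lambda>k. modular p M (\<lambda>x. (gradient (\<psi> k) x - V k x) + (V k x - v x))) \<longlonglongrightarrow> 0"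
    by (rule modular_add_tendsto_zero[OF _ _ p_pos(4) 2 v]) measurable
  ultimately show ?thesis unfolding sobolev0_def
    by (intro conjI exI[of _ \<psi>]) (use \<psi>(1) in simp_all)
qed

lemma sobolev0_add:
  assumes "sobolev0 u v" "sobolev0 u' v'"
  shows "sobolev0 (\<lambda>x. u x + u' x) (\<lambda>x. v x + v' x)"
proof -
  note [measurable] = sobolev0_measurable[OF assms(1)] sobolev0_measurable[OF assms(2)]
  obtain \<phi> where \<phi>: "\<And>n::nat. \<phi> n \<in> C1_c \<Omega>" "(\<lambda>n. modular p M (\<lambda>x. \<phi> n x - u x)) \<longlonglongrightarrow> 0"
    "(\<lambda>n. modular p M (\<lambda>x. gradient (\<phi> n) x - v x)) \<longlonglongrightarrow> 0" by (rule sobolev0E[OF assms(1)]) (rule that)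
  obtain \<psi> where \<psi>: "\<And>n::nat. \<psi> n \<in> C1_c \<Omega>" "(\<lambda>n. modular p M (\<lambda>x. \<psi> n x - u' x)) \<longlonglongrightarrow> 0"
    "(\<lambda>n. modular p M (\<lambda>x. gradient (\<psi> n) x - v' x)) \<longlonglongrightarrow> 0" by (rule sobolev0E[OF assms(2)]) (rule that)
  note [measurable] = C1_c_measurable[OF \<phi>(1)] C1_c_measurable[OF \<psi>(1)]
  have 1: "(\<lambda>n. modular p M (\<lambda>x. (\<phi> n x + \<psi> n x) - (u x + u' x))) \<longlonglongrightarrow> 0"
    unfolding add_diff_add by (rule modular_add_tendsto_zero[OF _ _ p_pos(4) \<phi>(2) \<psi>(2)]) measurable
  have 2: "(\<lambda>n. modular p M (\<lambda>x. gradient (\<lambda>x. \<phi> n x + \<psi> n x) x - (v x + v' x))) \<longlonglongrightarrow> 0"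
    unfolding C1_c_add(2)[OF \<phi>(1) \<psi>(1)] add_diff_add
    by (rule modular_add_tendsto_zero[OF _ _ p_pos(4) \<phi>(3) \<psi>(3)]) measurable
  show ?thesis unfolding sobolev0_def
    by (intro conjI exI[of _ "\<lambda>n x. \<phi> n x + \<psi> n x"]) (use 1 2 C1_c_add(1)[OF \<phi>(1) \<psi>(1)] in simp_all)
qed

lemma modular_scale_tendsto_zero:
  assumes [measurable]: "\<And>n. f n \<in> borel_measurable M" and "(\<lambda>n. modular p M (f n)) \<longlonglongrightarrow> 0"
  shows "(\<lambda>n. modular p M (\<lambda>x. c *\<^sub>R f n x)) \<longlonglongrightarrow> 0"
  using ennreal_tendsto_cmult[OF _ assms(2), of "ennreal (\<bar>c\<bar> powr p)"] by (simp add: modular_scale)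

lemma sobolev0_scale:
  assumes "sobolev0 u v"
  shows "sobolev0 (\<lambda>x. c * u x) (\<lambda>x. c *\<^sub>R v x)"
proof -
  note [measurable] = sobolev0_measurable[OF assms(1)]
  obtain \<phi> where \<phi>: "\<And>n::nat. \<phi> n \<in> C1_c \<Omega>" "(\<lambda>n. modular p M (\<lambda>x. \<phi> n x - u x)) \<longlonglongrightarrow> 0"
    "(\<lambda>n. modular p M (\<lambda>x. gradient (\<phi> n) x - v x)) \<longlonglongrightarrow> 0" by (rule sobolev0E[OF assms(1)]) (rule that)
  note [measurable] = C1_c_measurable[OF \<phi>(1)]
  have 1: "(\<lambda>n. modular p M (\<lambda>x. c * \<phi> n x - c * u x)) \<longlonglongrightarrow> 0"
    using modular_scale_tendsto_zero[OF _ \<phi>(2), of c] by (simp add: algebra_simps)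
  have 2: "(\<lambda>n. modular p M (\<lambda>x. gradient (\<lambda>x. c * \<phi> n x) x - c *\<^sub>R v x)) \<longlonglongrightarrow> 0"
    unfolding C1_c_scale(2)[OF \<phi>(1)]
    using modular_scale_tendsto_zero[OF _ \<phi>(3), of c] by (simp add: scaleR_diff_right)
  show ?thesis unfolding sobolev0_def
    by (intro conjI exI[of _ "\<lambda>n x. c * \<phi> n x"]) (use 1 2 C1_c_scale(1)[OF \<phi>(1)] in simp_all)
qed

lemma sobolev0_diff:
  assumes "sobolev0 u v" "sobolev0 u' v'"
  shows "sobolev0 (\<lambda>x. u x - u' x) (\<lambda>x. v x - v' x)"
  using sobolev0_add[OF assms(1) sobolev0_scale[OF assms(2), of "-1"]] by simp

lemma poincare_modular:
  obtains C where "C \<ge> 0" "\<And>f. f \<in> C1_c \<Omega> \<Longrightarrow> modular p M f \<le> ennreal C * modular p M (gradient f)"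
proof -
  obtain C where C: "C > 0" "\<And>f. f \<in> C1_c \<Omega> \<Longrightarrow> (LINT x|M. \<bar>f x\<bar> powr p) \<le> C * (LINT x|M. norm (gradient f x) powr p)"
    by (rule poincare_C1_c[OF open_\<Omega> bounded_\<Omega> p_ge_2]) (rule that)
  show thesis
  proof (rule that[of C])
    fix f assume f: "f \<in> C1_c \<Omega>"
    note i = C1_c_integrable_powr[OF f open_\<Omega> bounded_\<Omega> p_pos(4)]
    have "integrable M (\<lambda>x. norm (f x) powr p)" using i(1) by simp
    from modular_eq_integral[OF this] modular_eq_integral[OF i(2)] C(2)[OF f] C(1)
    show "modular p M f \<le> ennreal C * modular p M (gradient f)"
      by (simp flip: ennreal_mult)
  qed (use C in auto)
qed

lemma sobolev0_zero_gradient: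
  assumes "sobolev0 u v" "AE x in M. v x = 0"
  shows "AE x in M. u x = 0"
proof -
  note [measurable] = sobolev0_measurable[OF assms(1)]
  obtain \<phi> where \<phi>: "\<And>n::nat. \<phi> n \<in> C1_c \<Omega>" "(\<lambda>n. modular p M (\<lambda>x. \<phi> n x - u x)) \<longlonglongrightarrow> 0"
    "(\<lambda>n. modular p M (\<lambda>x. gradient (\<phi> n) x - v x)) \<longlonglongrightarrow> 0" by (rule sobolev0E[OF assms(1)]) (rule that)
  note [measurable] = C1_c_measurable[OF \<phi>(1)]
  obtain C where C: "C \<ge> 0" "\<And>f. f \<in> C1_c \<Omega> \<Longrightarrow> modular p M f \<le> ennreal C * modular p M (gradient f)"
    by (rule poincare_modular) (rule that)
  have "modular p M (\<lambda>x. gradient (\<phi> n) x - v x) = modular p M (gradient (\<phi> n))" for n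
    unfolding modular_def by (rule nn_integral_cong_AE) (use assms(2) in \<open>auto elim!: eventually_mono\<close>)
  then have "(\<lambda>n. modular p M (gradient (\<phi> n))) \<longlonglongrightarrow> 0" using \<phi>(3) by simp
  then have "(\<lambda>n. ennreal C * modular p M (gradient (\<phi> n))) \<longlonglongrightarrow> 0"
    using ennreal_tendsto_cmult[of "ennreal C"] by fastforce
  then have "(\<lambda>n. modular p M (\<phi> n)) \<longlonglongrightarrow> 0"
    by (rule ennreal_tendsto_0_le) (rule C(2)[OF \<phi>(1)])
  moreover have "(\<lambda>n. modular p M (\<lambda>x. u x - \<phi> n x)) \<longlonglongrightarrow> 0" using \<phi>(2) by (simp only: modular_minus)
  ultimately have "(\<lambda>n. modular p M (\<lambda>x. \<phi> n x + (u x - \<phi> n x))) \<longlonglongrightarrow> 0"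
    by (intro modular_add_tendsto_zero p_pos) measurable
  then have "(\<lambda>n::nat. modular p M u) \<longlonglongrightarrow> 0" by simp
  then have "modular p M u = 0" by (simp add: LIMSEQ_const_iff)
  then have "AE x in M. ennreal (norm (u x) powr p) = 0"
    unfolding modular_def by (subst (asm) nn_integral_0_iff_AE) auto
  then show ?thesis by eventually_elim (auto simp: ennreal_eq_0_iff powr_eq_0_iff)
qed

lemma gradient_Cauchy_limit:
  assumes \<phi>: "\<And>n::nat. \<phi> n \<in> C1_c \<Omega>"
    and cau: "\<And>e. 0 < e \<Longrightarrow> \<exists>N. \<forall>m\<ge>N. \<forall>n\<ge>N. modular p M (\<lambda>x. gradient (\<phi> m) x - gradient (\<phi> n) x) \<le> ennreal e"
  obtains u v where "sobolev0 u v" "(\<lambda>n. modular p M (\<lambda>x. \<phi> n x - u x)) \<longlonglongrightarrow> 0"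
    "(\<lambda>n. modular p M (\<lambda>x. gradient (\<phi> n) x - v x)) \<longlonglongrightarrow> 0"
proof -
  obtain C where C: "C \<ge> 0" "\<And>f. f \<in> C1_c \<Omega> \<Longrightarrow> modular p M f \<le> ennreal C * modular p M (gradient f)"
    by (rule poincare_modular) (rule that)
  have cau': "\<exists>N. \<forall>m\<ge>N. \<forall>n\<ge>N. modular p M (\<lambda>x. \<phi> m x - \<phi> n x) \<le> ennreal e" if e: "0 < e" for e
  proof -
    have "0 < e / (C + 1)" using e C by simp
    from cau[OF this] obtain N where N: "\<And>m n. m \<ge> N \<Longrightarrow> n \<ge> N \<Longrightarrow> modular p M (\<lambda>x. gradient (\<phi> m) x - gradient (\<phi> n) x) \<le> ennreal (e / (C + 1))"
      by blast
    have "modular p M (\<lambda>x. \<phi> m x - \<phi> n x) \<le> ennreal e" if "m \<ge> N" "n \<ge> N" for m n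
    proof -
      have "gradient (\<lambda>x. \<phi> m x - \<phi> n x) = (\<lambda>x. gradient (\<phi> m) x - gradient (\<phi> n) x)"
        by (rule ext) (rule C1_c_diff(2)[OF \<phi> \<phi>])
      then have "modular p M (\<lambda>x. \<phi> m x - \<phi> n x) \<le> ennreal C * modular p M (\<lambda>x. gradient (\<phi> m) x - gradient (\<phi> n) x)"
        using C(2)[OF C1_c_diff(1)[OF \<phi> \<phi>], of m n] by simp
      also have "\<dots> \<le> ennreal C * ennreal (e / (C + 1))" by (intro mult_left_mono N that) simp
      also have "\<dots> = ennreal (C * (e / (C + 1)))" using C e by (intro ennreal_mult[symmetric]) auto
      also have "\<dots> \<le> ennreal e" using C e by (intro ennreal_leI) (simp add: field_simps)
      finally show ?thesis .
    qed
    then show ?thesis by blast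
  qed
  note [measurable] = C1_c_measurable[OF \<phi>]
  obtain u where u: "u \<in> borel_measurable M" "(\<lambda>n. modular p M (\<lambda>x. \<phi> n x - u x)) \<longlonglongrightarrow> 0"
    by (rule modular_complete[of \<phi> M p]) (use cau' p_pos in \<open>auto intro: that\<close>)
  obtain v where v: "v \<in> borel_measurable M" "(\<lambda>n. modular p M (\<lambda>x. gradient (\<phi> n) x - v x)) \<longlonglongrightarrow> 0"
    by (rule modular_complete[of "\<lambda>n. gradient (\<phi> n)" M p]) (use cau p_pos in \<open>auto intro: that\<close>)
  show thesis by (rule that[of u v]) (use u v \<phi> in \<open>auto simp: sobolev0_def\<close>)
qed

text \<open>The approximants of \<open>G \<circ> u\<close> are themselves of the form \<open>G \<circ> \<psi>\<close> with test functions \<open>\<psi>\<close>. In particular they are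
nonnegative when \<open>G\<close> is, which is what testing an inequality requires.\<close>

lemma sobolev0_chain_approx:
  assumes uv: "sobolev0 u v" and G: "\<And>s::real. (G has_real_derivative g s) (at s)"
    and g: "continuous_on UNIV g" and G0: "G 0 = 0" and L: "\<And>s. \<bar>g s\<bar> \<le> L"
  obtains \<phi> where "\<And>n::nat. \<phi> n \<in> C1_c \<Omega>" "\<And>n. (\<lambda>x. G (\<phi> n x)) \<in> C1_c \<Omega>"
    "(\<lambda>n. modular p M (\<lambda>x. G (\<phi> n x) - G (u x))) \<longlonglongrightarrow> 0"
    "(\<lambda>n. modular p M (\<lambda>x. gradient (\<lambda>x. G (\<phi> n x)) x - g (u x) *\<^sub>R v x)) \<longlonglongrightarrow> 0"
proof -
  note [measurable] = sobolev0_measurable[OF uv]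
  obtain \<phi> where \<phi>: "\<And>n::nat. \<phi> n \<in> C1_c \<Omega>" "(\<lambda>n. modular p M (\<lambda>x. \<phi> n x - u x)) \<longlonglongrightarrow> 0"
    "(\<lambda>n. modular p M (\<lambda>x. gradient (\<phi> n) x - v x)) \<longlonglongrightarrow> 0" by (rule sobolev0E[OF uv]) (rule that)
  note [measurable] = C1_c_measurable[OF \<phi>(1)]
  have [measurable]: "g \<in> borel_measurable borel" by (rule borel_measurable_continuous_onI[OF g])
  have Gc: "continuous_on UNIV G" using G by (meson DERIV_isCont continuous_at_imp_continuous_on)
  have [measurable]: "G \<in> borel_measurable borel" by (rule borel_measurable_continuous_onI[OF Gc])
  have L0: "0 \<le> L" using L[of 0] by simp
  have Lip: "\<bar>G a - G b\<bar> \<le> L * \<bar>a - b\<bar>" for a b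
  proof -
    have "norm (G a - G b) \<le> L * norm (a - b)"
      by (rule field_differentiable_bound[of UNIV G g]) (use G L in auto)
    then show ?thesis by simp
  qed
  obtain r S where r: "strict_mono r" and ae: "AE x in M. (\<lambda>k. \<phi> (r k) x) \<longlonglongrightarrow> u x"
    by (rule modular_fast_subseq[OF _ _ \<phi>(2) p_pos(1)]) (auto intro: that)
  have sub: "(\<lambda>k. modular p M (\<lambda>x. \<phi> (r k) x - u x)) \<longlonglongrightarrow> 0" "(\<lambda>k. modular p M (\<lambda>x. gradient (\<phi> (r k)) x - v x)) \<longlonglongrightarrow> 0"
    using LIMSEQ_subseq_LIMSEQ[OF \<phi>(2) r] LIMSEQ_subseq_LIMSEQ[OF \<phi>(3) r] by (auto simp: o_def)
  note C = C1_c_compose[OF \<phi>(1) G g G0]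
  show thesis
  proof (rule that[of "\<lambda>k. \<phi> (r k)"])
    have "(\<lambda>k. modular p M (\<lambda>x. L *\<^sub>R (\<phi> (r k) x - u x))) \<longlonglongrightarrow> 0"
      by (rule modular_scale_tendsto_zero[OF _ sub(1)]) measurable
    then show "(\<lambda>k. modular p M (\<lambda>x. G (\<phi> (r k) x) - G (u x))) \<longlonglongrightarrow> 0"
      by (rule ennreal_tendsto_0_le)
        (use Lip L0 p_pos in \<open>auto intro!: modular_mono simp: abs_mult\<close>)
    \<comment> \<open>The error splits as \<open>g(\<psi>) (\<nabla>\<psi> - v) + (g(\<psi>) - g(u)) v\<close>; the second part is handled by dominated convergence.\<close>
    have 1: "(\<lambda>k. modular p M (\<lambda>x. g (\<phi> (r k) x) *\<^sub>R (gradient (\<phi> (r k)) x - v x))) \<longlonglongrightarrow> 0"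
    proof (rule ennreal_tendsto_0_le)
      show "(\<lambda>k. modular p M (\<lambda>x. L *\<^sub>R (gradient (\<phi> (r k)) x - v x))) \<longlonglongrightarrow> 0"
        by (rule modular_scale_tendsto_zero[OF _ sub(2)]) measurable
    qed (use L L0 p_pos in \<open>auto intro!: modular_mono mult_right_mono\<close>)
    have iv: "integrable M (\<lambda>x. norm (v x) powr p)"
      by (rule modular_finite_integrable) (use sobolev0_finite[OF uv] in auto)
    have 2: "(\<lambda>k. modular p M (\<lambda>x. g (\<phi> (r k) x) *\<^sub>R v x - g (u x) *\<^sub>R v x)) \<longlonglongrightarrow> 0"
    proof (rule modular_dominated[where S = "\<lambda>x. L powr p * norm (v x) powr p"])
      show "AE x in M. (\<lambda>k. g (\<phi> (r k) x) *\<^sub>R v x) \<longlonglongrightarrow> g (u x) *\<^sub>R v x"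
        using ae
      proof eventually_elim
        case (elim x)
        have "isCont g (u x)" using g by (simp add: continuous_on_eq_continuous_at)
        from isCont_tendsto_compose[OF this elim] show ?case by (intro tendsto_intros)
      qed
      show "AE x in M. \<forall>k. norm (g (\<phi> (r k) x) *\<^sub>R v x) powr p \<le> L powr p * norm (v x) powr p"
        using L p_pos by (intro AE_I2 allI) (auto simp: powr_mult intro!: mult_right_mono powr_mono2)
    qed (use iv p_pos in auto)
    have "(\<lambda>k. modular p M (\<lambda>x. g (\<phi> (r k) x) *\<^sub>R (gradient (\<phi> (r k)) x - v x) + (g (\<phi> (r k) x) *\<^sub>R v x - g (u x) *\<^sub>R v x))) \<longlonglongrightarrow> 0"
      by (rule modular_add_tendsto_zero[OF _ _ p_pos(4) 1 2]) auto
    then show "(\<lambda>k. modular p M (\<lambda>x. gradient (\<lambda>x. G (\<phi> (r k) x)) x - g (u x) *\<^sub>R v x)) \<longlonglongrightarrow> 0"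
      unfolding C(2) by (simp add: scaleR_diff_right)
  qed (use \<phi>(1) C(1) in auto)
qed

lemma sobolev0_chain:
  assumes uv: "sobolev0 u v" and G: "\<And>s::real. (G has_real_derivative g s) (at s)"
    and g: "continuous_on UNIV g" and G0: "G 0 = 0" and L: "\<And>s. \<bar>g s\<bar> \<le> L"
  shows "sobolev0 (\<lambda>x. G (u x)) (\<lambda>x. g (u x) *\<^sub>R v x)"
proof -
  note [measurable] = sobolev0_measurable[OF uv]
  have [measurable]: "g \<in> borel_measurable borel" by (rule borel_measurable_continuous_onI[OF g])
  have Gc: "continuous_on UNIV G" using G by (meson DERIV_isCont continuous_at_imp_continuous_on)
  have [measurable]: "G \<in> borel_measurable borel" by (rule borel_measurable_continuous_onI[OF Gc])
  obtain \<phi> where \<phi>: "\<And>n. (\<lambda>x. G (\<phi> n x)) \<in> C1_c \<Omega>"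
    "(\<lambda>n::nat. modular p M (\<lambda>x. G (\<phi> n x) - G (u x))) \<longlonglongrightarrow> 0"
    "(\<lambda>n. modular p M (\<lambda>x. gradient (\<lambda>x. G (\<phi> n x)) x - g (u x) *\<^sub>R v x)) \<longlonglongrightarrow> 0"
    by (rule sobolev0_chain_approx[OF assms]) (rule that)
  show ?thesis unfolding sobolev0_def
    by (intro conjI exI[of _ "\<lambda>n x. G (\<phi> n x)"]) (use \<phi> in simp_all)
qed

text \<open>Pointwise limits of \<open>C\<^sup>1\<close> functions with uniformly bounded derivatives may have a discontinuous \<open>h\<close>; this gives
the chain rule for truncations, including the correct value of the gradient on level sets.\<close>

lemma sobolev0_chain_limit:
  assumes uv: "sobolev0 u v" and G: "\<And>n s::real. (G n has_real_derivative g n s) (at s)"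
    and g: "\<And>n::nat. continuous_on UNIV (g n)" and G0: "\<And>n. G n 0 = 0" and L: "\<And>n s. \<bar>g n s\<bar> \<le> L"
    and Gl: "\<And>s. (\<lambda>n. G n s) \<longlonglongrightarrow> H s" and gl: "\<And>s. (\<lambda>n. g n s) \<longlonglongrightarrow> h s"
  shows "sobolev0 (\<lambda>x. H (u x)) (\<lambda>x. h (u x) *\<^sub>R v x)"
proof -
  note [measurable] = sobolev0_measurable[OF uv]
  have gm[measurable]: "g n \<in> borel_measurable borel" for n by (rule borel_measurable_continuous_onI[OF g])
  have Gm[measurable]: "G n \<in> borel_measurable borel" for n
    using G by (intro borel_measurable_continuous_onI) (meson DERIV_isCont continuous_at_imp_continuous_on)
  have [measurable]: "H \<in> borel_measurable borel" by (rule borel_measurable_LIMSEQ_metric[OF Gm Gl])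
  have [measurable]: "h \<in> borel_measurable borel" by (rule borel_measurable_LIMSEQ_metric[OF gm gl])
  have Lip: "\<bar>G n a\<bar> \<le> L * \<bar>a\<bar>" for n a
  proof -
    have "norm (G n a - G n 0) \<le> L * norm (a - 0)"
      by (rule field_differentiable_bound[of UNIV "G n" "g n"]) (use G L in auto)
    then show ?thesis using G0 by simp
  qed
  have i: "integrable M (\<lambda>x. norm (v x) powr p)" "integrable M (\<lambda>x. norm (u x) powr p)"
    by (rule modular_finite_integrable; use sobolev0_finite[OF uv] in simp)+
  have L0: "0 \<le> L" using L[of 0 0] by simp
  have iS: "integrable M (\<lambda>x. (L * norm (v x)) powr p)" "integrable M (\<lambda>x. (L * norm (u x)) powr p)"
    using i by (simp_all add: powr_mult)
  have lim1: "(\<lambda>k. modular p M (\<lambda>x. G k (u x) - H (u x))) \<longlonglongrightarrow> 0"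
  proof (rule modular_dominated[OF _ _ p_pos(1) _ iS(2)])
    show "AE x in M. \<forall>k. norm (G k (u x)) powr p \<le> (L * norm (u x)) powr p"
      using Lip p_pos by (intro AE_I2 allI powr_mono2) auto
  qed (use Gl in auto)
  have lim2: "(\<lambda>k. modular p M (\<lambda>x. g k (u x) *\<^sub>R v x - h (u x) *\<^sub>R v x)) \<longlonglongrightarrow> 0"
  proof (rule modular_dominated[OF _ _ p_pos(1) _ iS(1)])
    show "AE x in M. \<forall>k. norm (g k (u x) *\<^sub>R v x) powr p \<le> (L * norm (v x)) powr p"
      using L p_pos by (intro AE_I2 allI powr_mono2) (auto intro!: mult_right_mono)
    show "AE x in M. (\<lambda>k. g k (u x) *\<^sub>R v x) \<longlonglongrightarrow> h (u x) *\<^sub>R v x"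
      by (intro AE_I2 tendsto_scaleR gl tendsto_const)
  qed measurable
  show ?thesis
    by (rule sobolev0_closed[OF sobolev0_chain[OF uv G g G0 L] _ _ lim1 lim2]) measurable
qed

end


section \<open>Dual weights and weak solutions\<close>

context dirichlet_domain
begin

text \<open>Functions that act by integration as bounded functionals on the Sobolev space, in absolute value. The affine
form of the bound is equivalent to boundedness by scaling \<open>\<phi>\<close>, and is stable under Young-type arguments.\<close>

definition dual_weight :: "('a \<Rightarrow> real) \<Rightarrow> bool" where
  "dual_weight g \<longleftrightarrow> g \<in> borel_measurable M \<and> (\<exists>C\<ge>0. \<forall>\<phi>\<in>C1_c \<Omega>.
     (\<integral>\<^sup>+ x. ennreal \<bar>g x * \<phi> x\<bar> \<partial>M) \<le> ennreal C * (1 + modular p M (gradient \<phi>)))"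

lemma dual_weight_measurable: "dual_weight g \<Longrightarrow> g \<in> borel_measurable M"
  by (simp add: dual_weight_def)

text \<open>Applying the bound to \<open>K \<phi>\<close>. Choosing \<open>K\<close> large makes the constant term small, which yields continuity of the
functional; choosing \<open>K\<close> small makes the energy term small, which yields coercivity of energies.\<close>

lemma dual_weight_scaled:
  assumes "dual_weight g"
  obtains C where "0 \<le> C" "\<And>K \<phi>. 0 < K \<Longrightarrow> \<phi> \<in> C1_c \<Omega> \<Longrightarrow>
    (\<integral>\<^sup>+ x. ennreal \<bar>g x * \<phi> x\<bar> \<partial>M) \<le> ennreal (C / K) + ennreal (C * K powr (p - 1)) * modular p M (gradient \<phi>)"
proof -
  have [measurable]: "g \<in> borel_measurable M" using assms by (simp add: dual_weight_def)
  obtain C where C: "0 \<le> C" "\<And>\<phi>. \<phi> \<in> C1_c \<Omega> \<Longrightarrow>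
     (\<integral>\<^sup>+ x. ennreal \<bar>g x * \<phi> x\<bar> \<partial>M) \<le> ennreal C * (1 + modular p M (gradient \<phi>))"
    using assms by (auto simp: dual_weight_def)
  show thesis
  proof (rule that[OF C(1)])
    fix K :: real and \<phi> assume K: "0 < K" and \<phi>: "\<phi> \<in> C1_c \<Omega>"
    note [measurable] = C1_c_measurable[OF \<phi>]
    have g: "gradient (\<lambda>x. K * \<phi> x) = (\<lambda>x. K *\<^sub>R gradient \<phi> x)" by (rule ext) (rule C1_c_scale(2)[OF \<phi>])
    have "(\<integral>\<^sup>+ x. ennreal \<bar>g x * \<phi> x\<bar> \<partial>M) = (\<integral>\<^sup>+ x. ennreal (1 / K) * ennreal \<bar>g x * (K * \<phi> x)\<bar> \<partial>M)"
      using K by (intro nn_integral_cong) (simp add: abs_mult flip: ennreal_mult)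
    also have "\<dots> = ennreal (1 / K) * (\<integral>\<^sup>+ x. ennreal \<bar>g x * (K * \<phi> x)\<bar> \<partial>M)"
      by (rule nn_integral_cmult) measurable
    also have "\<dots> \<le> ennreal (1 / K) * (ennreal C * (1 + ennreal (K powr p) * modular p M (gradient \<phi>)))"
      using C(2)[OF C1_c_scale(1)[OF \<phi>, of K]] K unfolding g modular_scale[OF C1_c_measurable(2)[OF \<phi>]]
      by (intro mult_left_mono) auto
    also have "\<dots> = ennreal (1 / K) * ennreal C + (ennreal (1 / K) * ennreal C * ennreal (K powr p)) * modular p M (gradient \<phi>)"
      by (simp add: distrib_left mult.assoc)
    also have "ennreal (1 / K) * ennreal C = ennreal (C / K)" using K C(1) by (simp flip: ennreal_mult)
    also have "ennreal (C / K) * ennreal (K powr p) = ennreal (C * K powr (p - 1))"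
      using K C(1) by (simp add: powr_diff flip: ennreal_mult)
    finally show "(\<integral>\<^sup>+ x. ennreal \<bar>g x * \<phi> x\<bar> \<partial>M) \<le> ennreal (C / K) + ennreal (C * K powr (p - 1)) * modular p M (gradient \<phi>)" .
  qed
qed

lemma dual_weight_mono:
  assumes "dual_weight g" "f \<in> borel_measurable M" "AE x in M. \<bar>f x\<bar> \<le> \<bar>g x\<bar>"
  shows "dual_weight f"
proof -
  obtain C where C: "0 \<le> C" "\<And>\<phi>. \<phi> \<in> C1_c \<Omega> \<Longrightarrow>
     (\<integral>\<^sup>+ x. ennreal \<bar>g x * \<phi> x\<bar> \<partial>M) \<le> ennreal C * (1 + modular p M (gradient \<phi>))"
    using assms by (auto simp: dual_weight_def)
  have "(\<integral>\<^sup>+ x. ennreal \<bar>f x * \<phi> x\<bar> \<partial>M) \<le> ennreal C * (1 + modular p M (gradient \<phi>))" if "\<phi> \<in> C1_c \<Omega>" for \<phi>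
  proof -
    have "(\<integral>\<^sup>+ x. ennreal \<bar>f x * \<phi> x\<bar> \<partial>M) \<le> (\<integral>\<^sup>+ x. ennreal \<bar>g x * \<phi> x\<bar> \<partial>M)"
      using assms(3) by (intro nn_integral_mono_AE) (auto elim!: eventually_mono intro!: ennreal_leI mult_right_mono simp: abs_mult)
    then show ?thesis using C(2)[OF that] by (rule order_trans)
  qed
  then show ?thesis unfolding dual_weight_def using assms(2) C(1) by blast
qed

lemma dual_weight_add:
  assumes "dual_weight g" "dual_weight f"
  shows "dual_weight (\<lambda>x. g x + f x)"
proof -
  have [measurable]: "g \<in> borel_measurable M" "f \<in> borel_measurable M" using assms by (auto simp: dual_weight_def)
  obtain C where C: "0 \<le> C" "\<And>\<phi>. \<phi> \<in> C1_c \<Omega> \<Longrightarrow>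
     (\<integral>\<^sup>+ x. ennreal \<bar>g x * \<phi> x\<bar> \<partial>M) \<le> ennreal C * (1 + modular p M (gradient \<phi>))"
    using assms by (auto simp: dual_weight_def)
  obtain D where D: "0 \<le> D" "\<And>\<phi>. \<phi> \<in> C1_c \<Omega> \<Longrightarrow>
     (\<integral>\<^sup>+ x. ennreal \<bar>f x * \<phi> x\<bar> \<partial>M) \<le> ennreal D * (1 + modular p M (gradient \<phi>))"
    using assms by (auto simp: dual_weight_def)
  have "(\<integral>\<^sup>+ x. ennreal \<bar>(g x + f x) * \<phi> x\<bar> \<partial>M) \<le> ennreal (C + D) * (1 + modular p M (gradient \<phi>))" if \<phi>: "\<phi> \<in> C1_c \<Omega>" for \<phi>
  proof -
    note [measurable] = C1_c_measurable[OF \<phi>]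
    have "(\<integral>\<^sup>+ x. ennreal \<bar>(g x + f x) * \<phi> x\<bar> \<partial>M) \<le> (\<integral>\<^sup>+ x. ennreal \<bar>g x * \<phi> x\<bar> + ennreal \<bar>f x * \<phi> x\<bar> \<partial>M)"
      by (intro nn_integral_mono) (auto simp: distrib_right simp flip: ennreal_plus intro!: ennreal_leI)
    also have "\<dots> = (\<integral>\<^sup>+ x. ennreal \<bar>g x * \<phi> x\<bar> \<partial>M) + (\<integral>\<^sup>+ x. ennreal \<bar>f x * \<phi> x\<bar> \<partial>M)"
      by (rule nn_integral_add) measurable
    also have "\<dots> \<le> ennreal C * (1 + modular p M (gradient \<phi>)) + ennreal D * (1 + modular p M (gradient \<phi>))"
      by (intro add_mono C D \<phi>)
    also have "\<dots> = ennreal (C + D) * (1 + modular p M (gradient \<phi>))"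
      using C(1) D(1) by (simp add: distrib_right)
    finally show ?thesis .
  qed
  then show ?thesis unfolding dual_weight_def using C(1) D(1) by (intro conjI exI[of _ "C + D"]) auto
qed

lemma dual_weight_scale:
  assumes "dual_weight g" shows "dual_weight (\<lambda>x. c * g x)"
proof -
  have [measurable]: "g \<in> borel_measurable M" using assms by (auto simp: dual_weight_def)
  obtain C where C: "0 \<le> C" "\<And>\<phi>. \<phi> \<in> C1_c \<Omega> \<Longrightarrow>
     (\<integral>\<^sup>+ x. ennreal \<bar>g x * \<phi> x\<bar> \<partial>M) \<le> ennreal C * (1 + modular p M (gradient \<phi>))"
    using assms by (auto simp: dual_weight_def)
  have "(\<integral>\<^sup>+ x. ennreal \<bar>(c * g x) * \<phi> x\<bar> \<partial>M) \<le> ennreal (\<bar>c\<bar> * C) * (1 + modular p M (gradient \<phi>))" if \<phi>: "\<phi> \<in> C1_c \<Omega>" for \<phi>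
  proof -
    note [measurable] = C1_c_measurable[OF \<phi>]
    have "(\<integral>\<^sup>+ x. ennreal \<bar>(c * g x) * \<phi> x\<bar> \<partial>M) = (\<integral>\<^sup>+ x. ennreal \<bar>c\<bar> * ennreal \<bar>g x * \<phi> x\<bar> \<partial>M)"
      by (intro nn_integral_cong) (simp add: abs_mult mult.assoc flip: ennreal_mult)
    also have "\<dots> = ennreal \<bar>c\<bar> * (\<integral>\<^sup>+ x. ennreal \<bar>g x * \<phi> x\<bar> \<partial>M)"
      by (rule nn_integral_cmult) measurable
    also have "\<dots> \<le> ennreal \<bar>c\<bar> * (ennreal C * (1 + modular p M (gradient \<phi>)))"
      by (intro mult_left_mono C \<phi>) auto
    finally show ?thesis using C(1) by (simp add: ennreal_mult mult.assoc)
  qed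
  then show ?thesis unfolding dual_weight_def using C(1) by (intro conjI exI[of _ "\<bar>c\<bar> * C"]) auto
qed

lemma dual_weight_integrable:
  assumes g: "dual_weight g" and \<phi>: "\<phi> \<in> C1_c \<Omega>"
  shows "integrable M (\<lambda>x. g x * \<phi> x)"
proof (rule integrableI_bounded)
  note [measurable] = C1_c_measurable[OF \<phi>] dual_weight_measurable[OF g]
  show "(\<lambda>x. g x * \<phi> x) \<in> borel_measurable M" by measurable
  obtain C where C: "0 \<le> C" "\<And>\<phi>. \<phi> \<in> C1_c \<Omega> \<Longrightarrow>
     (\<integral>\<^sup>+ x. ennreal \<bar>g x * \<phi> x\<bar> \<partial>M) \<le> ennreal C * (1 + modular p M (gradient \<phi>))"
    using assms by (auto simp: dual_weight_def)
  have "ennreal C * (1 + modular p M (gradient \<phi>)) < \<infinity>"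
    using C1_c_modular_finite(2)[OF \<phi>] by (simp add: ennreal_mult_less_top ennreal_add_eq_top less_top)
  with C(2)[OF \<phi>] show "(\<integral>\<^sup>+ x. ennreal (norm (g x * \<phi> x)) \<partial>M) < \<infinity>" by simp
qed

text \<open>The functional extends to the Sobolev space and is still given by integration: Fatou's lemma along an almost everywhere
convergent subsequence identifies the limit of the Cauchy sequence \<open>g \<phi>\<^sub>n\<close> in \<open>L\<^sup>1\<close>.\<close>

lemma dual_weight_pairing:
  assumes g: "dual_weight g" and [measurable]: "u \<in> borel_measurable M" "v \<in> borel_measurable M"
    and \<phi>: "\<And>n::nat. \<phi> n \<in> C1_c \<Omega>" "(\<lambda>n. modular p M (\<lambda>x. \<phi> n x - u x)) \<longlonglongrightarrow> 0"
    "(\<lambda>n. modular p M (\<lambda>x. gradient (\<phi> n) x - v x)) \<longlonglongrightarrow> 0"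
  shows "integrable M (\<lambda>x. g x * u x)" "(\<lambda>n. LINT x|M. g x * \<phi> n x) \<longlonglongrightarrow> (LINT x|M. g x * u x)"
proof -
  note [measurable] = C1_c_measurable[OF \<phi>(1)] dual_weight_measurable[OF g]
  obtain C where C: "0 \<le> C" "\<And>K \<phi>. 0 < K \<Longrightarrow> \<phi> \<in> C1_c \<Omega> \<Longrightarrow>
    (\<integral>\<^sup>+ x. ennreal \<bar>g x * \<phi> x\<bar> \<partial>M) \<le> ennreal (C / K) + ennreal (C * K powr (p - 1)) * modular p M (gradient \<phi>)"
    by (rule dual_weight_scaled[OF g]) (rule that)
  obtain r S where r: "strict_mono r" and ae: "AE x in M. (\<lambda>k. \<phi> (r k) x) \<longlonglongrightarrow> u x"
    by (rule modular_fast_subseq[OF _ _ \<phi>(2) p_pos(1)]) (auto intro: that)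
  have z: "(\<lambda>n. \<integral>\<^sup>+ x. ennreal (norm (g x * \<phi> n x - g x * u x)) \<partial>M) \<longlonglongrightarrow> 0"
  proof (rule ennreal_tendsto_0I)
    fix e :: real assume e: "0 < e"
    define K where "K = 2 * (C + 1) / e"
    have K: "0 < K" "C / K \<le> e / 2" using e C(1) by (auto simp: K_def field_simps)
    define Q where "Q = C * K powr (p - 1) + 1"
    have Q: "0 < Q" using C(1) by (simp add: Q_def add_nonneg_pos)
    define d where "d = e / (4 * 2 powr p * Q)"
    have d: "0 < d" "Q * (2 powr p * (d + d)) = e / 2" using e Q by (auto simp: d_def field_simps)
    have "\<forall>\<^sub>F n in sequentially. modular p M (\<lambda>x. gradient (\<phi> n) x - v x) < ennreal d"
      by (rule order_tendstoD(2)[OF \<phi>(3)]) (use d in auto)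
    then obtain N where N: "\<And>n. n \<ge> N \<Longrightarrow> modular p M (\<lambda>x. gradient (\<phi> n) x - v x) < ennreal d"
      using eventually_sequentially by auto
    have two: "(\<integral>\<^sup>+ x. ennreal \<bar>g x * (\<phi> n x - \<phi> m x)\<bar> \<partial>M) \<le> ennreal e" if "n \<ge> N" "m \<ge> N" for n m
    proof -
      have ge: "gradient (\<lambda>x. \<phi> n x - \<phi> m x) = (\<lambda>x. gradient (\<phi> n) x - gradient (\<phi> m) x)"
        by (rule ext) (rule C1_c_diff(2)[OF \<phi>(1) \<phi>(1)])
      have "modular p M (gradient (\<lambda>x. \<phi> n x - \<phi> m x))
          = modular p M (\<lambda>x. (gradient (\<phi> n) x - v x) + (v x - gradient (\<phi> m) x))" unfolding ge by simp
      also have "\<dots> \<le> ennreal (2 powr p) * (modular p M (\<lambda>x. gradient (\<phi> n) x - v x) + modular p M (\<lambda>x. v x - gradient (\<phi> m) x))"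
        by (rule modular_add_le[OF _ _ p_pos(4)]) measurable
      also have "\<dots> \<le> ennreal (2 powr p) * (ennreal d + ennreal d)"
        using N[OF that(1)] N[OF that(2)] unfolding modular_minus[of p M v] by (intro mult_left_mono add_mono) auto
      also have "\<dots> = ennreal (2 powr p * (d + d))" using d by (simp flip: ennreal_plus ennreal_mult)
      finally have m: "modular p M (gradient (\<lambda>x. \<phi> n x - \<phi> m x)) \<le> ennreal (2 powr p * (d + d))" .
      have "(\<integral>\<^sup>+ x. ennreal \<bar>g x * (\<phi> n x - \<phi> m x)\<bar> \<partial>M)
          \<le> ennreal (C / K) + ennreal (C * K powr (p - 1)) * modular p M (gradient (\<lambda>x. \<phi> n x - \<phi> m x))"
        by (rule C(2)[OF K(1) C1_c_diff(1)[OF \<phi>(1) \<phi>(1)]])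
      also have "\<dots> \<le> ennreal (e / 2) + ennreal Q * ennreal (2 powr p * (d + d))"
        using K m by (intro add_mono mult_mono ennreal_leI) (auto simp: Q_def)
      also have "\<dots> = ennreal (e / 2 + Q * (2 powr p * (d + d)))" using d Q e by (simp flip: ennreal_plus ennreal_mult)
      also have "\<dots> = ennreal e" unfolding d(2) by simp
      finally show ?thesis .
    qed
    have "(\<integral>\<^sup>+ x. ennreal (norm (g x * \<phi> n x - g x * u x)) \<partial>M) \<le> ennreal e" if "n \<ge> N" for n
    proof -
      have "(\<integral>\<^sup>+ x. ennreal (norm (g x * \<phi> n x - g x * u x)) \<partial>M)
          = (\<integral>\<^sup>+ x. liminf (\<lambda>k. ennreal \<bar>g x * (\<phi> n x - \<phi> (r k) x)\<bar>) \<partial>M)"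
      proof (rule nn_integral_cong_AE, use ae in eventually_elim)
        fix x assume "(\<lambda>k. \<phi> (r k) x) \<longlonglongrightarrow> u x"
        then have "(\<lambda>k. ennreal \<bar>g x * (\<phi> n x - \<phi> (r k) x)\<bar>) \<longlonglongrightarrow> ennreal \<bar>g x * (\<phi> n x - u x)\<bar>"
          by (intro tendsto_intros)
        from lim_imp_Liminf[OF trivial_limit_sequentially this]
        show "ennreal (norm (g x * \<phi> n x - g x * u x)) = liminf (\<lambda>k. ennreal \<bar>g x * (\<phi> n x - \<phi> (r k) x)\<bar>)"
          by (simp add: right_diff_distrib)
      qed
      also have "\<dots> \<le> liminf (\<lambda>k. \<integral>\<^sup>+ x. ennreal \<bar>g x * (\<phi> n x - \<phi> (r k) x)\<bar> \<partial>M)"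
        by (rule nn_integral_liminf) measurable
      also have "\<dots> \<le> ennreal e"
      proof (rule Liminf_le)
        show "\<forall>\<^sub>F k in sequentially. (\<integral>\<^sup>+ x. ennreal \<bar>g x * (\<phi> n x - \<phi> (r k) x)\<bar> \<partial>M) \<le> ennreal e"
          using eventually_ge_at_top[of N]
          by eventually_elim (use two that seq_suble[OF r(1)] order_trans in blast)
      qed simp
      finally show ?thesis .
    qed
    then show "\<forall>\<^sub>F n in sequentially. (\<integral>\<^sup>+ x. ennreal (norm (g x * \<phi> n x - g x * u x)) \<partial>M) \<le> ennreal e"
      using eventually_sequentially by blast
  qed
  show ig: "integrable M (\<lambda>x. g x * u x)"
  proof -
    have "\<forall>\<^sub>F n in sequentially. (\<integral>\<^sup>+ x. ennreal (norm (g x * \<phi> n x - g x * u x)) \<partial>M) < 1"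
      by (rule order_tendstoD(2)[OF z]) simp
    from eventually_happens'[OF sequentially_bot this] obtain n
      where n: "(\<integral>\<^sup>+ x. ennreal (norm (g x * \<phi> n x - g x * u x)) \<partial>M) < 1" ..
    have "integrable M (\<lambda>x. g x * \<phi> n x - g x * u x)"
      by (rule integrableI_bounded) (use order_less_trans[OF n, of \<infinity>] in auto)
    from Bochner_Integration.integrable_diff[OF dual_weight_integrable[OF g \<phi>(1)[of n]] this] show ?thesis by simp
  qed
  show "(\<lambda>n. LINT x|M. g x * \<phi> n x) \<longlonglongrightarrow> (LINT x|M. g x * u x)"
    by (rule tendsto_L1_int[OF dual_weight_integrable[OF g \<phi>(1)] ig z])
qed

lemma dual_weight_sobolev0_integrable:
  assumes "dual_weight g" "sobolev0 u v"
  shows "integrable M (\<lambda>x. g x * u x)"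
  using assms(2) dual_weight_pairing(1)[OF assms(1) sobolev0_measurable[OF assms(2)]] by (auto elim!: sobolev0E)

lemma plap_measurable[measurable]: "plap p \<in> borel_measurable (borel :: 'a measure)"
  by (rule borel_measurable_continuous_onI[OF plap_continuous[OF p_ge_2]])

text \<open>Passage to the limit in the nonlinear term. Convergence holds along a subsequence on which the \<open>p\<close>-th powers are
dominated; this suffices whenever the limit of the other side of an equation is known.\<close>

lemma plap_subseq_limit:
  fixes V :: "nat \<Rightarrow> 'a \<Rightarrow> 'a"
  assumes [measurable]: "\<And>k. V k \<in> borel_measurable M" "v \<in> borel_measurable M"
    and lim: "(\<lambda>k. modular p M (\<lambda>x. V k x - v x)) \<longlonglongrightarrow> 0" and fin: "modular p M v < \<infinity>"
    and \<psi>: "\<psi> \<in> C1_c \<Omega>"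
  obtains r where "strict_mono r"
    "(\<lambda>k. LINT x|M. plap p (V (r k) x) \<bullet> gradient \<psi> x) \<longlonglongrightarrow> (LINT x|M. plap p (v x) \<bullet> gradient \<psi> x)"
    "\<And>k. integrable M (\<lambda>x. plap p (V (r k) x) \<bullet> gradient \<psi> x)"
proof -
  note [measurable] = C1_c_measurable[OF \<psi>]
  obtain B where B: "0 < B" "\<And>x. norm (gradient \<psi> x) \<le> B" by (rule C1_c_bounded[OF \<psi>]) (rule that)
  obtain r S where r: "strict_mono r" "integrable M S" "AE x in M. \<forall>k. norm (V (r k) x - v x) powr p \<le> S x"
    "AE x in M. (\<lambda>k. V (r k) x) \<longlonglongrightarrow> v x"
    by (rule modular_fast_subseq[OF _ _ lim p_pos(1)]) (auto intro: that)
  have iv: "integrable M (\<lambda>x. norm (v x) powr p)" by (rule modular_finite_integrable) (use fin in auto)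
  let ?w = "\<lambda>x. (1 + 2 powr p * (S x + norm (v x) powr p)) * B"
  have i1: "integrable M (\<lambda>_. 1::real)"
    using finite_measure.integrable_const[OF finite_measure_lebesgue_on[OF open_bounded_lmeasurable[OF open_\<Omega> bounded_\<Omega>]]] .
  have iw: "integrable M ?w" using r(2) iv i1 by auto
  have bd: "AE x in M. norm (plap p (V (r k) x) \<bullet> gradient \<psi> x) \<le> ?w x" for k
    using r(3)
  proof eventually_elim
    case (elim x)
    let ?a = "norm (V (r k) x)"
    have "?a powr (p - 1) \<le> 1 + ?a powr p"
    proof (cases "?a \<le> 1")
      case True
      then have "?a powr (p - 1) \<le> 1" using p_pos by (simp add: powr_le1)
      then show ?thesis by (simp add: add_increasing2)
    next
      case False
      then have "?a powr (p - 1) \<le> ?a powr p" by (intro powr_mono) auto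
      then show ?thesis by simp
    qed
    also have "?a powr p \<le> 2 powr p * (norm (V (r k) x - v x) powr p + norm (v x) powr p)"
      using norm_add_powr_le[OF p_pos(4), of "V (r k) x - v x" "v x"] by simp
    also have "\<dots> \<le> 2 powr p * (S x + norm (v x) powr p)" using elim by (intro mult_left_mono add_mono) auto
    finally have a: "?a powr (p - 1) \<le> 1 + 2 powr p * (S x + norm (v x) powr p)" by simp
    have "norm (plap p (V (r k) x) \<bullet> gradient \<psi> x) \<le> ?a powr (p - 1) * norm (gradient \<psi> x)"
      using Cauchy_Schwarz_ineq2[of "plap p (V (r k) x)" "gradient \<psi> x"] by (simp add: norm_plap)
    also have "\<dots> \<le> ?w x" using order_trans[OF powr_ge_zero a] a B by (intro mult_mono) auto
    finally show ?case .
  qed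
  have ptw: "AE x in M. (\<lambda>k. plap p (V (r k) x) \<bullet> gradient \<psi> x) \<longlonglongrightarrow> plap p (v x) \<bullet> gradient \<psi> x"
    using r(4)
  proof eventually_elim
    case (elim x)
    have "isCont (plap p) (v x)" using plap_continuous[OF p_ge_2, where ?'a = 'a] by (simp add: continuous_on_eq_continuous_at)
    from isCont_tendsto_compose[OF this elim] show ?case by (intro tendsto_intros)
  qed
  show thesis
  proof (rule that[OF r(1)])
    show "(\<lambda>k. LINT x|M. plap p (V (r k) x) \<bullet> gradient \<psi> x) \<longlonglongrightarrow> (LINT x|M. plap p (v x) \<bullet> gradient \<psi> x)"
      by (rule integral_dominated_convergence[OF _ _ iw ptw bd]) measurable
    show "integrable M (\<lambda>x. plap p (V (r k) x) \<bullet> gradient \<psi> x)" for k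
      by (rule Bochner_Integration.integrable_bound[OF iw])
        (measurable, use bd[of k] in \<open>auto elim!: eventually_mono\<close>)
  qed
qed

lemma plap_integrable:
  assumes "sobolev0 u v" "sobolev0 w z"
  shows "integrable M (\<lambda>x. plap p (v x) \<bullet> z x)"
proof -
  note [measurable] = sobolev0_measurable[OF assms(1)] sobolev0_measurable[OF assms(2)]
  show ?thesis
    by (rule pairing_tendsto(1)[of _ _ v "\<lambda>_. z"])
      (use sobolev0_finite[OF assms(1)] sobolev0_finite[OF assms(2)] p_pos in \<open>auto simp: modular_def norm_plap\<close>)
qed

definition weak_solution :: "('a \<Rightarrow> 'a) \<Rightarrow> ('a \<Rightarrow> real) \<Rightarrow> bool" where
  "weak_solution v g \<longleftrightarrow> (\<forall>\<psi>\<in>C1_c \<Omega>. (LINT x|M. plap p (v x) \<bullet> gradient \<psi> x) = (LINT x|M. g x * \<psi> x))"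

lemma weak_solution_test_sobolev0:
  assumes uv: "sobolev0 u v" and g: "dual_weight g" and eq: "weak_solution v g" and wz: "sobolev0 w z"
  shows "(LINT x|M. plap p (v x) \<bullet> z x) = (LINT x|M. g x * w x)"
proof -
  note [measurable] = sobolev0_measurable[OF uv] sobolev0_measurable[OF wz]
  obtain \<phi> where \<phi>: "\<And>n::nat. \<phi> n \<in> C1_c \<Omega>" "(\<lambda>n. modular p M (\<lambda>x. \<phi> n x - w x)) \<longlonglongrightarrow> 0"
    "(\<lambda>n. modular p M (\<lambda>x. gradient (\<phi> n) x - z x)) \<longlonglongrightarrow> 0" by (rule sobolev0E[OF wz]) (rule that)
  note [measurable] = C1_c_measurable[OF \<phi>(1)]
  have "(\<lambda>n. LINT x|M. plap p (v x) \<bullet> gradient (\<phi> n) x) \<longlonglongrightarrow> (LINT x|M. plap p (v x) \<bullet> z x)"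
    by (rule pairing_tendsto(2)[of _ _ v])
      (use sobolev0_finite[OF uv] sobolev0_finite[OF wz] p_pos \<phi>(3) in \<open>auto simp: norm_plap\<close>)
  moreover have "(\<lambda>n. LINT x|M. g x * \<phi> n x) \<longlonglongrightarrow> (LINT x|M. g x * w x)"
    by (rule dual_weight_pairing(2)[OF g _ _ \<phi>]) measurable
  moreover have "(LINT x|M. plap p (v x) \<bullet> gradient (\<phi> n) x) = (LINT x|M. g x * \<phi> n x)" for n
    using eq \<phi>(1) by (simp add: weak_solution_def)
  ultimately show ?thesis using LIMSEQ_unique by simp
qed

end


section \<open>Existence for a fixed right-hand side\<close>

context dirichlet_domain
begin

lemma modular_half_diff:
  fixes V W :: "'a \<Rightarrow> 'a"
  assumes [measurable]: "V \<in> borel_measurable M" "W \<in> borel_measurable M"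
    and i: "integrable M (\<lambda>x. norm ((1/2) *\<^sub>R (V x - W x)) powr p)"
    and le: "(LINT x|M. norm ((1/2) *\<^sub>R (V x - W x)) powr p) \<le> c"
  shows "modular p M (\<lambda>x. V x - W x) \<le> ennreal (2 powr p * c)"
proof -
  have "modular p M (\<lambda>x. V x - W x) = modular p M (\<lambda>x. 2 *\<^sub>R ((1/2) *\<^sub>R (V x - W x)))" by simp
  also have "\<dots> = ennreal (2 powr p) * modular p M (\<lambda>x. (1/2) *\<^sub>R (V x - W x))"
    by (subst modular_scale) auto
  also have "\<dots> \<le> ennreal (2 powr p) * ennreal c"
    unfolding modular_eq_integral[OF i] using le by (intro mult_left_mono ennreal_leI) auto
  also have "\<dots> = ennreal (2 powr p * c)"
    by (subst ennreal_mult'') (use order_trans[OF Bochner_Integration.integral_nonneg le] in auto)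
  finally show ?thesis .
qed

lemma sobolev0_integrable_powr:
  assumes "sobolev0 u v"
  shows "integrable M (\<lambda>x. norm (v x) powr p)"
  by (rule modular_finite_integrable) (use sobolev0_finite[OF assms] sobolev0_measurable[OF assms] in auto)

lemma energy_arith:
  fixes m S D gk gn Ak An s :: real
  assumes "m \<le> S - (gk + gn) / 2" "Ak - gk + (An - gn) \<le> 2 * m + s" "S + D \<le> (Ak + An) / 2"
  shows "D \<le> s / 2"
  using assms by (simp add: field_simps)

text \<open>Minimise \<open>E(\<phi>) = \<integral> |\<nabla>\<phi>|\<^sup>p / p - \<integral> g \<phi>\<close> over test functions. By Clarkson's inequality the gradients of a minimising
sequence are Cauchy, so the sequence converges in the Sobolev space. The equation is obtained without differentiating
\<open>E\<close>: convexity bounds \<open>E(\<phi>\<^sub>n + t\<^sub>n \<psi>) - E(\<phi>\<^sub>n)\<close> from above by a multiple of \<open>t\<^sub>n\<close>, and almost minimality bounds it from below.\<close>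

theorem weak_solution_exists:
  assumes g: "dual_weight g"
  obtains u v where "sobolev0 u v" "weak_solution v g"
proof -
  have gm[measurable]: "g \<in> borel_measurable M" by (rule dual_weight_measurable[OF g])
  define E where "E \<phi> = (LINT x|M. norm (gradient \<phi> x) powr p) / p - (LINT x|M. g x * \<phi> x)" for \<phi>
  obtain C where C: "0 \<le> C" "\<And>K \<phi>. 0 < K \<Longrightarrow> \<phi> \<in> C1_c \<Omega> \<Longrightarrow>
    (\<integral>\<^sup>+ x. ennreal \<bar>g x * \<phi> x\<bar> \<partial>M) \<le> ennreal (C / K) + ennreal (C * K powr (p - 1)) * modular p M (gradient \<phi>)"
    by (rule dual_weight_scaled[OF g]) (rule that)
  \<comment> \<open>With this \<open>K\<close> the functional costs at most the share \<open>1/p\<close> of the energy, so \<open>E\<close> is bounded below.\<close>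
  define K where "K = (1 / (p * (C + 1))) powr (1 / (p - 1))"
  have K: "0 < K" unfolding K_def using p_pos C(1) by simp
  have "K powr (p - 1) = 1 / (p * (C + 1))" unfolding K_def using p_pos C(1) by (simp add: powr_powr)
  then have "C * K powr (p - 1) = C / (C + 1) / p" by (simp add: field_simps)
  also have "\<dots> \<le> 1 / p" using C(1) p_pos by (intro divide_right_mono) auto
  finally have CK: "C * K powr (p - 1) \<le> 1 / p" .
  have ip: "integrable M (\<lambda>x. norm (gradient \<phi> x) powr p)" if "\<phi> \<in> C1_c \<Omega>" for \<phi>
    using C1_c_integrable_powr(2)[OF that open_\<Omega> bounded_\<Omega> p_pos(4)] .
  have ig: "integrable M (\<lambda>x. g x * \<phi> x)" if "\<phi> \<in> C1_c \<Omega>" for \<phi> by (rule dual_weight_integrable[OF g that])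
  have lower: "- (C / K) \<le> E \<phi>" if \<phi>: "\<phi> \<in> C1_c \<Omega>" for \<phi>
  proof -
    let ?P = "LINT x|M. norm (gradient \<phi> x) powr p"
    have P0: "0 \<le> ?P" by (rule Bochner_Integration.integral_nonneg) simp
    have "ennreal (LINT x|M. \<bar>g x * \<phi> x\<bar>) = (\<integral>\<^sup>+ x. ennreal \<bar>g x * \<phi> x\<bar> \<partial>M)"
      using ig[OF \<phi>] by (intro nn_integral_eq_integral[symmetric]) auto
    also have "\<dots> \<le> ennreal (C / K) + ennreal (C * K powr (p - 1)) * modular p M (gradient \<phi>)" by (rule C(2)[OF K \<phi>])
    also have "\<dots> = ennreal (C / K + C * K powr (p - 1) * ?P)"
      unfolding modular_eq_integral[OF ip[OF \<phi>]] using C(1) K P0 by (simp add: ennreal_mult)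
    finally have "(LINT x|M. \<bar>g x * \<phi> x\<bar>) \<le> C / K + C * K powr (p - 1) * ?P"
      using C(1) K P0 by (subst (asm) ennreal_le_iff) auto
    also have "\<dots> \<le> C / K + 1 / p * ?P" using CK P0 by (intro add_mono mult_right_mono) auto
    finally have "(LINT x|M. \<bar>g x * \<phi> x\<bar>) \<le> C / K + ?P / p" by simp
    moreover have "(LINT x|M. g x * \<phi> x) \<le> (LINT x|M. \<bar>g x * \<phi> x\<bar>)" using ig[OF \<phi>] by (intro integral_mono) auto
    ultimately show ?thesis by (simp add: E_def)
  qed
  define m where "m = Inf (E ` C1_c \<Omega>)"
  have bdd: "bdd_below (E ` C1_c \<Omega>)" using lower by (auto intro!: bdd_belowI)
  have mle: "m \<le> E \<phi>" if "\<phi> \<in> C1_c \<Omega>" for \<phi> unfolding m_def using bdd that by (intro cINF_lower)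
  have ne: "E ` C1_c \<Omega> \<noteq> {}" using zero_in_C1_c by blast
  have "\<exists>\<phi>\<in>C1_c \<Omega>. E \<phi> < m + 1 / real (Suc n)" for n
    using cInf_lessD[OF ne, of "m + 1 / real (Suc n)"] unfolding m_def by auto
  then obtain \<phi> where \<phi>: "\<And>n::nat. \<phi> n \<in> C1_c \<Omega>" "\<And>n. E (\<phi> n) < m + 1 / real (Suc n)" by metis
  note [measurable] = C1_c_measurable[OF \<phi>(1)]
  have close: "modular p M (\<lambda>x. gradient (\<phi> k) x - gradient (\<phi> n) x) \<le> ennreal (2 powr p * (p * (1 / real (Suc k) + 1 / real (Suc n))))" for k n
  proof (rule modular_half_diff)
    let ?s = "\<lambda>x. (1/2) * (\<phi> k x + \<phi> n x)"
    have s: "?s \<in> C1_c \<Omega>" by (rule C1_c_scale(1)[OF C1_c_add(1)[OF \<phi>(1) \<phi>(1)]])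
    have sg: "gradient ?s x = (1/2) *\<^sub>R (gradient (\<phi> k) x + gradient (\<phi> n) x)" for x
      by (simp only: C1_c_scale(2)[OF C1_c_add(1)[OF \<phi>(1) \<phi>(1)]] C1_c_add(2)[OF \<phi>(1) \<phi>(1)])
    have sgd: "gradient (\<lambda>x. (1/2) * (\<phi> k x - \<phi> n x)) x = (1/2) *\<^sub>R (gradient (\<phi> k) x - gradient (\<phi> n) x)" for x
      by (simp only: C1_c_scale(2)[OF C1_c_diff(1)[OF \<phi>(1) \<phi>(1)]] C1_c_diff(2)[OF \<phi>(1) \<phi>(1)])
    show idd: "integrable M (\<lambda>x. norm ((1/2) *\<^sub>R (gradient (\<phi> k) x - gradient (\<phi> n) x)) powr p)"
      using ip[OF C1_c_scale(1)[OF C1_c_diff(1)[OF \<phi>(1) \<phi>(1)]], of "1/2" k n] unfolding sgd .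
    note is' = ip[OF s, unfolded sg]
    have "(LINT x|M. norm ((1/2) *\<^sub>R (gradient (\<phi> k) x + gradient (\<phi> n) x)) powr p)
         + (LINT x|M. norm ((1/2) *\<^sub>R (gradient (\<phi> k) x - gradient (\<phi> n) x)) powr p)
        = (LINT x|M. norm ((1/2) *\<^sub>R (gradient (\<phi> k) x + gradient (\<phi> n) x)) powr p
         + norm ((1/2) *\<^sub>R (gradient (\<phi> k) x - gradient (\<phi> n) x)) powr p)"
      by (rule Bochner_Integration.integral_add[symmetric, OF is' idd])
    also have "\<dots> \<le> (LINT x|M. (norm (gradient (\<phi> k) x) powr p + norm (gradient (\<phi> n) x) powr p) / 2)"
      by (rule integral_mono) (use is' idd ip[OF \<phi>(1)] clarkson[OF p_ge_2] in auto)
    also have "\<dots> = ((LINT x|M. norm (gradient (\<phi> k) x) powr p) + (LINT x|M. norm (gradient (\<phi> n) x) powr p)) / 2"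
      using ip[OF \<phi>(1)] by simp
    finally have 1: "(LINT x|M. norm ((1/2) *\<^sub>R (gradient (\<phi> k) x + gradient (\<phi> n) x)) powr p)
         + (LINT x|M. norm ((1/2) *\<^sub>R (gradient (\<phi> k) x - gradient (\<phi> n) x)) powr p)
        \<le> ((LINT x|M. norm (gradient (\<phi> k) x) powr p) + (LINT x|M. norm (gradient (\<phi> n) x) powr p)) / 2" .
    have 2: "(LINT x|M. g x * ?s x) = ((LINT x|M. g x * \<phi> k x) + (LINT x|M. g x * \<phi> n x)) / 2"
    proof -
      have "(LINT x|M. g x * ?s x) = (LINT x|M. (g x * \<phi> k x + g x * \<phi> n x) / 2)"
        by (rule Bochner_Integration.integral_cong) (auto simp: field_simps)
      then show ?thesis using ig[OF \<phi>(1)] by simp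
    qed
    have half_swap: "(A + B) / 2 / p = (A / p + B / p) / 2" for A B using p_pos by (simp add: field_simps)
    have "m \<le> E ?s" by (rule mle[OF s])
    then have h1: "m \<le> (LINT x|M. norm ((1/2) *\<^sub>R (gradient (\<phi> k) x + gradient (\<phi> n) x)) powr p) / p
       - ((LINT x|M. g x * \<phi> k x) + (LINT x|M. g x * \<phi> n x)) / 2"
      unfolding E_def sg 2 .
    have h2: "E (\<phi> k) + E (\<phi> n) \<le> 2 * m + (1 / real (Suc k) + 1 / real (Suc n))" using \<phi>(2)[of k] \<phi>(2)[of n] by linarith
    have h3: "(LINT x|M. norm ((1/2) *\<^sub>R (gradient (\<phi> k) x + gradient (\<phi> n) x)) powr p) / p
         + (LINT x|M. norm ((1/2) *\<^sub>R (gradient (\<phi> k) x - gradient (\<phi> n) x)) powr p) / p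
        \<le> ((LINT x|M. norm (gradient (\<phi> k) x) powr p) / p + (LINT x|M. norm (gradient (\<phi> n) x) powr p) / p) / 2"
      using divide_right_mono[OF 1, of p] p_pos unfolding half_swap add_divide_distrib[of _ _ p] by simp
    have "(LINT x|M. norm ((1/2) *\<^sub>R (gradient (\<phi> k) x - gradient (\<phi> n) x)) powr p) / p
       \<le> (1 / real (Suc k) + 1 / real (Suc n)) / 2"
      by (rule energy_arith[OF h1 h2[unfolded E_def] h3])
    also have "\<dots> \<le> 1 / real (Suc k) + 1 / real (Suc n)"
    proof -
      have half: "z / 2 \<le> z" if "0 \<le> z" for z :: real using that by simp
      show ?thesis by (rule half) (intro add_nonneg_nonneg; simp)
    qed
    finally show "(LINT x|M. norm ((1/2) *\<^sub>R (gradient (\<phi> k) x - gradient (\<phi> n) x)) powr p) \<le> p * (1 / real (Suc k) + 1 / real (Suc n))"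
      using p_pos by (simp only: pos_divide_le_eq mult.commute)
  qed measurable
  have cau: "\<exists>N. \<forall>k\<ge>N. \<forall>n\<ge>N. modular p M (\<lambda>x. gradient (\<phi> k) x - gradient (\<phi> n) x) \<le> ennreal e" if e: "0 < e" for e
  proof -
    define d where "d = e / (2 * (2 powr p * p))"
    have d: "0 < d" "2 powr p * (p * (d + d)) = e" using e p_pos by (auto simp: d_def)
    obtain N where N: "1 / real (Suc N) < d" using d(1) by (metis nat_approx_posE)
    have "modular p M (\<lambda>x. gradient (\<phi> k) x - gradient (\<phi> n) x) \<le> ennreal e" if "k \<ge> N" "n \<ge> N" for k n
    proof -
      have "1 / real (Suc j) \<le> d" if "j \<ge> N" for j
        using N that frac_le[of 1 1 "real (Suc N)" "real (Suc j)"] by simp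
      then have "2 powr p * (p * (1 / real (Suc k) + 1 / real (Suc n))) \<le> 2 powr p * (p * (d + d))"
        using that p_pos by (intro mult_left_mono add_mono) auto
      with close[of k n] show ?thesis unfolding d(2) by (meson ennreal_leI order_trans)
    qed
    then show ?thesis by blast
  qed
  obtain u v where uv: "sobolev0 u v" and conv: "(\<lambda>n. modular p M (\<lambda>x. \<phi> n x - u x)) \<longlonglongrightarrow> 0"
    "(\<lambda>n. modular p M (\<lambda>x. gradient (\<phi> n) x - v x)) \<longlonglongrightarrow> 0"
    by (rule gradient_Cauchy_limit[OF \<phi>(1) cau]) (auto intro: that)
  note uvm[measurable] = sobolev0_measurable[OF uv]
  have ineq: "(LINT x|M. g x * \<psi> x) \<le> (LINT x|M. plap p (v x) \<bullet> gradient \<psi> x)" if \<psi>: "\<psi> \<in> C1_c \<Omega>" for \<psi>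
  proof -
    note [measurable] = C1_c_measurable[OF \<psi>]
    \<comment> \<open>The defect of \<open>\<phi>\<^sub>n\<close> from the infimum is below \<open>1/(n+1) = t\<^sub>n\<^sup>2\<close>, hence still negligible after division by \<open>t\<^sub>n\<close>.\<close>
    define t where "t n = inverse (sqrt (real (Suc n)))" for n
    have t: "0 < t n" "t n * t n = 1 / real (Suc n)" for n
      by (simp_all add: t_def divide_inverse flip: inverse_mult_distrib)
    have tlim: "t \<longlonglongrightarrow> 0" unfolding t_def
      using tendsto_real_sqrt[OF LIMSEQ_inverse_real_of_nat] by (simp add: real_sqrt_inverse)
    define V where "V n x = gradient (\<phi> n) x + t n *\<^sub>R gradient \<psi> x" for n x
    have Vm[measurable]: "V n \<in> borel_measurable M" for n unfolding V_def by measurable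
    have tm: "(\<lambda>n. modular p M (\<lambda>x. t n *\<^sub>R gradient \<psi> x)) \<longlonglongrightarrow> 0"
    proof -
      have "(\<lambda>n. \<bar>t n\<bar> powr p) \<longlonglongrightarrow> \<bar>0\<bar> powr p" using p_pos by (intro tendsto_powr' tendsto_rabs tlim tendsto_const) auto
      then have "(\<lambda>n. ennreal (\<bar>t n\<bar> powr p)) \<longlonglongrightarrow> 0" using p_pos tendsto_ennrealI by fastforce
      from ennreal_tendsto_cmult[OF _ this, of "modular p M (gradient \<psi>)"] C1_c_modular_finite(2)[OF \<psi>]
      have "(\<lambda>n. modular p M (gradient \<psi>) * ennreal (\<bar>t n\<bar> powr p)) \<longlonglongrightarrow> 0" by simp
      then show ?thesis by (simp add: modular_scale mult.commute)
    qed
    have Vlim: "(\<lambda>n. modular p M (\<lambda>x. V n x - v x)) \<longlonglongrightarrow> 0"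
    proof -
      have "(\<lambda>n. modular p M (\<lambda>x. (gradient (\<phi> n) x - v x) + t n *\<^sub>R gradient \<psi> x)) \<longlonglongrightarrow> 0"
        by (rule modular_add_tendsto_zero[OF _ _ p_pos(4) conv(2) tm]) measurable
      then show ?thesis by (simp add: V_def algebra_simps)
    qed
    obtain r where r: "strict_mono r" and rl: "(\<lambda>k. LINT x|M. plap p (V (r k) x) \<bullet> gradient \<psi> x) \<longlonglongrightarrow> (LINT x|M. plap p (v x) \<bullet> gradient \<psi> x)"
      and ri: "\<And>k. integrable M (\<lambda>x. plap p (V (r k) x) \<bullet> gradient \<psi> x)"
      by (rule plap_subseq_limit[OF Vm uvm(2) Vlim sobolev0_finite(2)[OF uv] \<psi>]) (rule that)
    have step: "(LINT x|M. g x * \<psi> x) - t (r k) \<le> (LINT x|M. plap p (V (r k) x) \<bullet> gradient \<psi> x)" for k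
    proof -
      let ?n = "r k"
      let ?w = "\<lambda>x. \<phi> ?n x + t ?n * \<psi> x"
      have w: "?w \<in> C1_c \<Omega>" by (rule C1_c_add(1)[OF \<phi>(1) C1_c_scale(1)[OF \<psi>]])
      have wg: "gradient ?w x = V ?n x" for x
        by (simp only: C1_c_add(2)[OF \<phi>(1) C1_c_scale(1)[OF \<psi>]] C1_c_scale(2)[OF \<psi>] V_def)
      have iw: "integrable M (\<lambda>x. norm (V ?n x) powr p)" using ip[OF w] unfolding wg .
      have "(LINT x|M. norm (V ?n x) powr p / p - norm (gradient (\<phi> ?n) x) powr p / p) \<le> (LINT x|M. t ?n * (plap p (V ?n x) \<bullet> gradient \<psi> x))"
      proof (rule integral_mono)
        fix x
        have "norm (V ?n x) powr p / p + plap p (V ?n x) \<bullet> (gradient (\<phi> ?n) x - V ?n x) \<le> norm (gradient (\<phi> ?n) x) powr p / p"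
          by (rule plap_gradient_inequality[OF p_ge_2])
        then show "norm (V ?n x) powr p / p - norm (gradient (\<phi> ?n) x) powr p / p \<le> t ?n * (plap p (V ?n x) \<bullet> gradient \<psi> x)"
          by (simp add: V_def)
      qed (use iw ip[OF \<phi>(1)] ri in auto)
      then have "(LINT x|M. norm (V ?n x) powr p) / p - (LINT x|M. norm (gradient (\<phi> ?n) x) powr p) / p
         \<le> t ?n * (LINT x|M. plap p (V ?n x) \<bullet> gradient \<psi> x)"
        using iw ip[OF \<phi>(1)] by simp
      moreover have "(LINT x|M. g x * ?w x) = (LINT x|M. g x * \<phi> ?n x) + t ?n * (LINT x|M. g x * \<psi> x)"
      proof -
        have "(LINT x|M. g x * ?w x) = (LINT x|M. g x * \<phi> ?n x + t ?n * (g x * \<psi> x))"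
          by (rule Bochner_Integration.integral_cong) (auto simp: algebra_simps)
        then show ?thesis using ig[OF \<phi>(1)] ig[OF \<psi>] by simp
      qed
      moreover have "E (\<phi> ?n) \<le> E ?w + t ?n * t ?n" using mle[OF w] \<phi>(2)[of ?n] unfolding t(2) by linarith
      ultimately have "t ?n * ((LINT x|M. g x * \<psi> x) - t ?n) \<le> t ?n * (LINT x|M. plap p (V ?n x) \<bullet> gradient \<psi> x)"
        unfolding E_def wg by (simp add: algebra_simps)
      then show ?thesis using t(1)[of ?n] by simp
    qed
    have "(\<lambda>k. (LINT x|M. g x * \<psi> x) - t (r k)) \<longlonglongrightarrow> (LINT x|M. g x * \<psi> x) - 0"
      using LIMSEQ_subseq_LIMSEQ[OF tlim r] by (intro tendsto_intros) (simp add: o_def)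
    from LIMSEQ_le[OF this rl] step show ?thesis by auto
  qed
  have "weak_solution v g" unfolding weak_solution_def
  proof
    fix \<psi> assume \<psi>: "\<psi> \<in> C1_c \<Omega>"
    have "(LINT x|M. g x * (-1 * \<psi> x)) \<le> (LINT x|M. plap p (v x) \<bullet> gradient (\<lambda>x. -1 * \<psi> x) x)"
      by (rule ineq[OF C1_c_scale(1)[OF \<psi>]])
    then have "- (LINT x|M. g x * \<psi> x) \<le> - (LINT x|M. plap p (v x) \<bullet> gradient \<psi> x)"
      unfolding C1_c_scale(2)[OF \<psi>] by simp
    then show "(LINT x|M. plap p (v x) \<bullet> gradient \<psi> x) = (LINT x|M. g x * \<psi> x)" using ineq[OF \<psi>] by linarith
  qed
  with uv show thesis by (rule that)
qed

end

section \<open>A smooth positive part and the comparison principle\<close>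

text \<open>A \<open>C\<^sup>1\<close> approximation of the positive part that vanishes exactly on the nonpositive half-line and has derivative
in \<open>[0, 1)\<close>, positive exactly where the positive part is. For comparison a single \<open>d\<close> suffices; letting
\<open>d\<close> tend to zero recovers the positive part and the indicator of \<open>(0, \<infinity>)\<close>.\<close>

definition spos :: "real \<Rightarrow> real \<Rightarrow> real" where "spos d s = sqrt ((max s 0)\<^sup>2 + d\<^sup>2) - d"
definition spos' :: "real \<Rightarrow> real \<Rightarrow> real" where "spos' d s = max s 0 / sqrt ((max s 0)\<^sup>2 + d\<^sup>2)"

lemma DERIV_max0_square: "((\<lambda>s::real. (max s 0)\<^sup>2) has_real_derivative 2 * max s 0) (at s)"
proof -
  consider "s > 0" | "s < 0" | "s = 0" by linarith
  then show ?thesis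
  proof cases
    case 1
    have "((\<lambda>s::real. s\<^sup>2) has_real_derivative 2 * max s 0) (at s)" using 1 by (auto intro!: derivative_eq_intros)
    then show ?thesis by (rule has_field_derivative_transform_within_open[OF _ open_greaterThan[of 0]]) (use 1 in auto)
  next
    case 2
    have "((\<lambda>s::real. 0) has_real_derivative 2 * max s 0) (at s)" using 2 by auto
    then show ?thesis by (rule has_field_derivative_transform_within_open[OF _ open_lessThan[of 0]]) (use 2 in auto)
  next
    case 3
    have "((\<lambda>h::real. max h 0) \<longlongrightarrow> max 0 0) (at 0)" by (intro tendsto_intros)
    then have L: "((\<lambda>h::real. max h 0) \<longlongrightarrow> 0) (at 0)" by simp
    have "((\<lambda>h::real. (max h 0)\<^sup>2 / h) \<longlongrightarrow> 0) (at 0)"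
      by (rule Lim_transform_eventually[OF L]) (auto simp: eventually_at_filter max_def power2_eq_square)
    then show ?thesis using 3 by (simp add: DERIV_def)
  qed
qed

lemma spos_DERIV: "0 < d \<Longrightarrow> (spos d has_real_derivative spos' d s) (at s)"
proof -
  assume d: "0 < d"
  have div_eq: "inverse r / 2 * (2 * y) - 0 = y / r" for r y :: real
    by (cases "r = 0") (simp_all add: field_simps)
  have pos: "0 < (max s 0)\<^sup>2 + d\<^sup>2" using d by (simp add: add_nonneg_pos)
  have "((\<lambda>s. (max s 0)\<^sup>2 + d\<^sup>2) has_real_derivative 2 * max s 0) (at s)"
    using DERIV_add[OF DERIV_max0_square DERIV_const] by simp
  from DERIV_diff[OF DERIV_chain2[OF DERIV_real_sqrt[OF pos] this] DERIV_const[of d]]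
  have "((\<lambda>s. sqrt ((max s 0)\<^sup>2 + d\<^sup>2) - d) has_real_derivative
      (inverse (sqrt ((max s 0)\<^sup>2 + d\<^sup>2)) / 2 * (2 * max s 0) - 0)) (at s)" .
  moreover have "inverse (sqrt ((max s 0)\<^sup>2 + d\<^sup>2)) / 2 * (2 * max s 0) - 0 = spos' d s"
    unfolding spos'_def by (rule div_eq)
  moreover have "(\<lambda>s. sqrt ((max s 0)\<^sup>2 + d\<^sup>2) - d) = spos d" by (rule ext) (simp add: spos_def)
  ultimately show ?thesis by (simp only:)
qed

lemma spos_simps: "0 < d \<Longrightarrow> spos d 0 = 0" "0 < d \<Longrightarrow> continuous_on UNIV (spos' d)"
  "0 < d \<Longrightarrow> 0 \<le> spos' d s" "0 < d \<Longrightarrow> spos' d s \<le> 1" "0 < d \<Longrightarrow> 0 \<le> spos d s"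
  "0 < d \<Longrightarrow> s \<le> 0 \<Longrightarrow> spos d s = 0" "0 < d \<Longrightarrow> s \<le> 0 \<Longrightarrow> spos' d s = 0"
  "0 < d \<Longrightarrow> 0 < s \<Longrightarrow> 0 < spos' d s" "0 < d \<Longrightarrow> 0 < s \<Longrightarrow> 0 < spos d s"
  "0 < d \<Longrightarrow> \<bar>spos d s - max s 0\<bar> \<le> d"
proof -
  assume d: "0 < d"
  have pos: "0 < (max t 0)\<^sup>2 + d\<^sup>2" for t using d by (simp add: add_nonneg_pos)
  show "spos d 0 = 0" using d by (simp add: spos_def)
  show "continuous_on UNIV (spos' d)" unfolding spos'_def
    using pos by (intro continuous_intros) (auto simp: less_imp_neq[THEN not_sym])
  show "0 \<le> spos' d s" by (simp add: spos'_def)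
  have "max s 0 \<le> sqrt ((max s 0)\<^sup>2 + d\<^sup>2)" by (rule real_le_rsqrt) simp
  then show "spos' d s \<le> 1" using pos[of s] by (simp add: spos'_def divide_le_eq)
  have l: "d \<le> sqrt ((max s 0)\<^sup>2 + d\<^sup>2)" by (rule real_le_rsqrt) simp
  then show "0 \<le> spos d s" by (simp add: spos_def)
  show "spos d s = 0" if "s \<le> 0" using that d by (simp add: spos_def max_def)
  show "spos' d s = 0" if "s \<le> 0" using that by (simp add: spos'_def max_def)
  show "0 < spos' d s" if "0 < s" using that pos[of s] by (simp add: spos'_def)
  show "0 < spos d s" if "0 < s"
  proof -
    have "sqrt (d\<^sup>2) < sqrt ((max s 0)\<^sup>2 + d\<^sup>2)" using that by (intro real_sqrt_less_mono) simp
    then show ?thesis using d by (simp add: spos_def)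
  qed
  have "sqrt ((max s 0)\<^sup>2 + d\<^sup>2) \<le> max s 0 + d"
    using d by (intro real_le_lsqrt) (auto simp: power2_eq_square algebra_simps)
  with \<open>max s 0 \<le> sqrt ((max s 0)\<^sup>2 + d\<^sup>2)\<close> show "\<bar>spos d s - max s 0\<bar> \<le> d" using d l by (simp add: spos_def abs_le_iff)
qed

context dirichlet_domain
begin

text \<open>Test the difference of the two inequalities with the smooth positive part of \<open>u\<^sub>1 - u\<^sub>2\<close>. Since the derivative of the
latter is positive where \<open>u\<^sub>1 > u\<^sub>2\<close>, strict monotonicity gives equal gradients there. So the smooth positive part has
zero gradient and vanishes by the Poincare inequality.\<close>

theorem weak_comparison:
  assumes 1: "sobolev0 u1 v1" and 2: "sobolev0 u2 v2"
    and le: "\<And>\<psi>. \<psi> \<in> C1_c \<Omega> \<Longrightarrow> (\<And>x. 0 \<le> \<psi> x) \<Longrightarrow>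
      (LINT x|M. plap p (v1 x) \<bullet> gradient \<psi> x) \<le> (LINT x|M. plap p (v2 x) \<bullet> gradient \<psi> x)"
  shows "AE x in M. u1 x \<le> u2 x"
proof -
  note [measurable] = sobolev0_measurable[OF 1] sobolev0_measurable[OF 2]
  let ?u = "\<lambda>x. u1 x - u2 x" and ?v = "\<lambda>x. v1 x - v2 x"
  note uv = sobolev0_diff[OF 1 2]
  note sp = spos_DERIV[OF zero_less_one] spos_simps(2)[OF zero_less_one] spos_simps(1)[OF zero_less_one]
  have bd: "\<bar>spos' 1 s\<bar> \<le> 1" for s using spos_simps(3,4)[of 1 s] by simp
  obtain \<phi> where \<phi>: "\<And>n. (\<lambda>x. spos 1 (\<phi> n x)) \<in> C1_c \<Omega>"
    "(\<lambda>n::nat. modular p M (\<lambda>x. spos 1 (\<phi> n x) - spos 1 (?u x))) \<longlonglongrightarrow> 0"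
    "(\<lambda>n. modular p M (\<lambda>x. gradient (\<lambda>x. spos 1 (\<phi> n x)) x - spos' 1 (?u x) *\<^sub>R ?v x)) \<longlonglongrightarrow> 0"
    by (rule sobolev0_chain_approx[OF uv sp bd]) (rule that)
  note G = sobolev0_chain[OF uv sp bd]
  note [measurable] = C1_c_measurable[OF \<phi>(1)] sobolev0_measurable[OF G]
  have lim: "(\<lambda>n. LINT x|M. plap p (w x) \<bullet> gradient (\<lambda>x. spos 1 (\<phi> n x)) x) \<longlonglongrightarrow> (LINT x|M. plap p (w x) \<bullet> (spos' 1 (?u x) *\<^sub>R ?v x))"
    if w: "sobolev0 z w" for w z
  proof -
    note [measurable] = sobolev0_measurable[OF w]
    show ?thesis
      by (rule pairing_tendsto(2)[of _ _ w])
        (use sobolev0_finite[OF w] sobolev0_finite[OF G] p_pos \<phi>(3) in \<open>auto simp: norm_plap\<close>)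
  qed
  have "(LINT x|M. plap p (v1 x) \<bullet> (spos' 1 (?u x) *\<^sub>R ?v x)) \<le> (LINT x|M. plap p (v2 x) \<bullet> (spos' 1 (?u x) *\<^sub>R ?v x))"
    by (rule LIMSEQ_le[OF lim[OF 1] lim[OF 2]]) (use le[OF \<phi>(1)] spos_simps(5) in auto)
  moreover
  let ?I = "\<lambda>x. (plap p (v1 x) - plap p (v2 x)) \<bullet> (spos' 1 (?u x) *\<^sub>R ?v x)"
  have Ieq: "?I = (\<lambda>x. plap p (v1 x) \<bullet> (spos' 1 (?u x) *\<^sub>R ?v x) - plap p (v2 x) \<bullet> (spos' 1 (?u x) *\<^sub>R ?v x))"
    by (simp only: inner_diff_left)
  have iI: "integrable M ?I" unfolding Ieq
    by (rule Bochner_Integration.integrable_diff[OF plap_integrable[OF 1 G] plap_integrable[OF 2 G]])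
  have "(LINT x|M. ?I x) = (LINT x|M. plap p (v1 x) \<bullet> (spos' 1 (?u x) *\<^sub>R ?v x)) - (LINT x|M. plap p (v2 x) \<bullet> (spos' 1 (?u x) *\<^sub>R ?v x))"
    unfolding Ieq by (rule Bochner_Integration.integral_diff[OF plap_integrable[OF 1 G] plap_integrable[OF 2 G]])
  ultimately have le0: "(LINT x|M. ?I x) \<le> 0" by linarith
  have I: "?I x = spos' 1 (?u x) * ((plap p (v1 x) - plap p (v2 x)) \<bullet> ?v x)" for x by simp
  have mono: "0 \<le> (plap p (v1 x) - plap p (v2 x)) \<bullet> ?v x" for x
    by (rule order_trans[OF _ plap_uniformly_monotone[OF p_ge_2]]) (use p_pos in auto)
  have Inn: "0 \<le> ?I x" for x unfolding I using mono spos_simps(3)[of 1] by (intro mult_nonneg_nonneg) auto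
  have "(LINT x|M. ?I x) = 0" by (rule antisym[OF le0 Bochner_Integration.integral_nonneg]) (rule Inn)
  then have "AE x in M. ?I x = 0" using integral_nonneg_eq_0_iff_AE[OF iI] Inn by auto
  then have "AE x in M. spos' 1 (?u x) *\<^sub>R ?v x = 0"
  proof eventually_elim
    case (elim x)
    show ?case
    proof (rule ccontr)
      assume n: "spos' 1 (?u x) *\<^sub>R ?v x \<noteq> 0"
      then have "(plap p (v1 x) - plap p (v2 x)) \<bullet> ?v x = 0" using elim unfolding I by auto
      from plap_strictly_monotone[OF p_ge_2 this] have "?v x = 0" by simp
      then show False using n by simp
    qed
  qed
  from sobolev0_zero_gradient[OF G this] show ?thesis
  proof eventually_elim
    case (elim x)
    then show ?case using spos_simps(9)[of 1 "?u x"] by (cases "u1 x \<le> u2 x") auto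
  qed
qed

end


section \<open>Monotone iteration for the singular equation\<close>

context dirichlet_domain
begin

lemma finite_M: "finite_measure M"
  by (rule finite_measure_lebesgue_on[OF open_bounded_lmeasurable[OF open_\<Omega> bounded_\<Omega>]])

lemma weak_solution_mono:
  assumes 1: "sobolev0 u1 v1" "dual_weight g1" "weak_solution v1 g1"
    and 2: "sobolev0 u2 v2" "dual_weight g2" "weak_solution v2 g2"
    and le: "AE x in M. g1 x \<le> g2 x"
  shows "AE x in M. u1 x \<le> u2 x"
proof (rule weak_comparison[OF 1(1) 2(1)])
  fix \<psi> assume \<psi>: "\<psi> \<in> C1_c \<Omega>" and nn: "\<And>x. 0 \<le> \<psi> x"
  have "(LINT x|M. g1 x * \<psi> x) \<le> (LINT x|M. g2 x * \<psi> x)"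
    by (rule integral_mono_AE[OF dual_weight_integrable[OF 1(2) \<psi>] dual_weight_integrable[OF 2(2) \<psi>]])
      (use le nn in \<open>auto elim!: eventually_mono intro: mult_right_mono\<close>)
  then show "(LINT x|M. plap p (v1 x) \<bullet> gradient \<psi> x) \<le> (LINT x|M. plap p (v2 x) \<bullet> gradient \<psi> x)"
    using 1(3) 2(3) \<psi> by (simp add: weak_solution_def)
qed

text \<open>Testing the difference of two equations with the difference of their solutions controls the gradients by a quantity
that sees only pointwise values; this is how monotone convergence of the iterates yields strong convergence.\<close>

lemma weak_solution_stability:
  assumes 1: "sobolev0 u1 v1" "dual_weight g1" "weak_solution v1 g1"
    and 2: "sobolev0 u2 v2" "dual_weight g2" "weak_solution v2 g2"
  shows "modular p M (\<lambda>x. v1 x - v2 x) \<le> ennreal (2 powr p * (p / 4 * (LINT x|M. (g1 x - g2 x) * (u1 x - u2 x))))"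
proof (rule modular_half_diff)
  note D = sobolev0_diff[OF 1(1) 2(1)]
  show "v1 \<in> borel_measurable M" "v2 \<in> borel_measurable M"
    using sobolev0_measurable[OF 1(1)] sobolev0_measurable[OF 2(1)] by auto
  have idd: "integrable M (\<lambda>x. norm ((1/2) *\<^sub>R (v1 x - v2 x)) powr p)"
    using sobolev0_integrable_powr[OF sobolev0_scale[OF D, of "1/2"]] .
  then show "integrable M (\<lambda>x. norm ((1/2) *\<^sub>R (v1 x - v2 x)) powr p)" .
  note i1 = plap_integrable[OF 1(1) D] and i2 = plap_integrable[OF 2(1) D]
  note j1 = dual_weight_sobolev0_integrable[OF 1(2) D] and j2 = dual_weight_sobolev0_integrable[OF 2(2) D]
  have "4 / p * (LINT x|M. norm ((1/2) *\<^sub>R (v1 x - v2 x)) powr p) = (LINT x|M. 4 / p * norm ((1/2) *\<^sub>R (v1 x - v2 x)) powr p)"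
    by simp
  also have "\<dots> \<le> (LINT x|M. plap p (v1 x) \<bullet> (v1 x - v2 x) - plap p (v2 x) \<bullet> (v1 x - v2 x))"
    by (rule integral_mono) (use idd i1 i2 plap_uniformly_monotone[OF p_ge_2] in \<open>auto simp: inner_diff_left\<close>)
  also have "\<dots> = (LINT x|M. plap p (v1 x) \<bullet> (v1 x - v2 x)) - (LINT x|M. plap p (v2 x) \<bullet> (v1 x - v2 x))"
    by (rule Bochner_Integration.integral_diff[OF i1 i2])
  also have "\<dots> = (LINT x|M. g1 x * (u1 x - u2 x)) - (LINT x|M. g2 x * (u1 x - u2 x))"
    by (simp only: weak_solution_test_sobolev0[OF 1 D] weak_solution_test_sobolev0[OF 2 D])
  also have "\<dots> = (LINT x|M. (g1 x - g2 x) * (u1 x - u2 x))"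
    using j1 j2 by (simp only: left_diff_distrib Bochner_Integration.integral_diff)
  finally show "(LINT x|M. norm ((1/2) *\<^sub>R (v1 x - v2 x)) powr p) \<le> p / 4 * (LINT x|M. (g1 x - g2 x) * (u1 x - u2 x))"
    using p_pos by (simp add: field_simps)
qed

text \<open>The singular term is evaluated at the previous iterate. As \<open>s\<^sup>-\<^sup>\<gamma>\<close> decreases in \<open>s\<close>, the solution operator is monotone, so
starting from the supersolution with right-hand side \<open>F\<close> the iterates decrease; the subsolution \<open>w\<close> stays below them and
provides the common bound \<open>a w\<^sup>-\<^sup>\<gamma>\<close> for the singular terms.\<close>

theorem singular_problem_solvable:
  fixes a w F :: "'a \<Rightarrow> real"
  assumes F: "dual_weight F" and am[measurable]: "a \<in> borel_measurable M" and a0: "AE x in M. 0 \<le> a x"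
    and w: "sobolev0 w z" and wpos: "\<And>x. x \<in> \<Omega> \<Longrightarrow> 0 < w x" and \<gamma>: "0 < \<gamma>"
    and h: "dual_weight (\<lambda>x. a x * w x powr (- \<gamma>))"
    and sub: "\<And>\<psi>. \<psi> \<in> C1_c \<Omega> \<Longrightarrow> (\<And>x. 0 \<le> \<psi> x) \<Longrightarrow>
      (LINT x|M. plap p (z x) \<bullet> gradient \<psi> x) \<le> (LINT x|M. (F x - a x * w x powr (- \<gamma>)) * \<psi> x)"
  obtains u v where "sobolev0 u v" "AE x in M. w x \<le> u x" "dual_weight (\<lambda>x. a x * u x powr (- \<gamma>))"
    "weak_solution v (\<lambda>x. F x - a x * u x powr (- \<gamma>))"
proof -
  let ?h = "\<lambda>x. a x * w x powr (- \<gamma>)"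
  note [measurable] = dual_weight_measurable[OF F] sobolev0_measurable[OF w]
  have h0: "AE x in M. 0 \<le> ?h x" using a0 by eventually_elim simp
  have powle: "AE x in M. 0 \<le> a x * t x powr (- \<gamma>) \<and> a x * t x powr (- \<gamma>) \<le> ?h x"
    if "AE x in M. w x \<le> t x" for t
    using that a0 AE_space
  proof eventually_elim
    case (elim x)
    then have "t x powr (- \<gamma>) \<le> w x powr (- \<gamma>)" using wpos[of x] \<gamma> by (intro powr_mono2') auto
    then show ?case using elim by (auto intro: mult_left_mono)
  qed
  have dual_b: "dual_weight (\<lambda>x. a x * t x powr (- \<gamma>))"
    if [measurable]: "t \<in> borel_measurable M" and "AE x in M. w x \<le> t x" for t
  proof (rule dual_weight_mono[OF h])
    show "AE x in M. \<bar>a x * t x powr (- \<gamma>)\<bar> \<le> \<bar>?h x\<bar>" using powle[OF that(2)] by eventually_elim auto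
  qed measurable
  have dual_g: "dual_weight (\<lambda>x. F x - a x * t x powr (- \<gamma>))"
    if "t \<in> borel_measurable M" and "AE x in M. w x \<le> t x" for t
    using dual_weight_add[OF F dual_weight_scale[OF dual_b[OF that], of "-1"]] by simp
  have above: "AE x in M. w x \<le> t x"
    if t: "sobolev0 t s" "weak_solution s g" "dual_weight g" and le: "AE x in M. F x - ?h x \<le> g x" for t s g
  proof (rule weak_comparison[OF w t(1)])
    fix \<psi> assume \<psi>: "\<psi> \<in> C1_c \<Omega>" and nn: "\<And>x. 0 \<le> \<psi> x"
    have dw: "dual_weight (\<lambda>x. F x - ?h x)" by (rule dual_g) auto
    have "(LINT x|M. plap p (z x) \<bullet> gradient \<psi> x) \<le> (LINT x|M. (F x - ?h x) * \<psi> x)" by (rule sub[OF \<psi> nn])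
    also have "\<dots> \<le> (LINT x|M. g x * \<psi> x)"
      by (rule integral_mono_AE[OF dual_weight_integrable[OF dw \<psi>] dual_weight_integrable[OF t(3) \<psi>]])
        (use le nn in \<open>auto elim!: eventually_mono intro: mult_right_mono\<close>)
    finally show "(LINT x|M. plap p (z x) \<bullet> gradient \<psi> x) \<le> (LINT x|M. plap p (s x) \<bullet> gradient \<psi> x)"
      using t(2) \<psi> by (simp add: weak_solution_def)
  qed
  obtain U0 V0 where UV0: "sobolev0 U0 V0" "weak_solution V0 F" by (rule weak_solution_exists[OF F]) (rule that)
  have wU0: "AE x in M. w x \<le> U0 x"
    by (rule above[OF UV0 F]) (use h0 in \<open>auto elim!: eventually_mono\<close>)
  \<comment> \<open>A stage of the iteration is a pair of a function and its gradient, chosen by dependent choice.\<close>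
  define P where "P n q \<longleftrightarrow> sobolev0 (fst q) (snd q) \<and> (AE x in M. w x \<le> fst q x) \<and> (n = 0 \<longrightarrow> q = (U0, V0))"
    for n :: nat and q :: "('a \<Rightarrow> real) \<times> ('a \<Rightarrow> 'a)"
  define Q where "Q n q q' \<longleftrightarrow> weak_solution (snd q') (\<lambda>x. F x - a x * fst q x powr (- \<gamma>))"
    for n :: nat and q q' :: "('a \<Rightarrow> real) \<times> ('a \<Rightarrow> 'a)"
  have "\<exists>f. \<forall>n. P n (f n) \<and> Q n (f n) (f (Suc n))"
  proof (rule dependent_nat_choice)
    show "\<exists>q. P 0 q" using UV0 wU0 by (intro exI[of _ "(U0, V0)"]) (auto simp: P_def)
    fix q n assume "P n q"
    then have q: "sobolev0 (fst q) (snd q)" "AE x in M. w x \<le> fst q x" by (auto simp: P_def)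
    note dg = dual_g[OF sobolev0_measurable(1)[OF q(1)] q(2)]
    obtain t s where ts: "sobolev0 t s" "weak_solution s (\<lambda>x. F x - a x * fst q x powr (- \<gamma>))"
      by (rule weak_solution_exists[OF dg]) (rule that)
    have "AE x in M. F x - ?h x \<le> F x - a x * fst q x powr (- \<gamma>)" using powle[OF q(2)] by eventually_elim auto
    then have "AE x in M. w x \<le> t x" by (rule above[OF ts dg])
    then show "\<exists>q'. P (Suc n) q' \<and> Q n q q'"
      using ts by (intro exI[of _ "(t, s)"]) (auto simp: P_def Q_def)
  qed
  then obtain f where f: "\<And>n. P n (f n)" "\<And>n. Q n (f n) (f (Suc n))" by blast
  define U where "U n = fst (f n)" for n
  define V where "V n = snd (f n)" for n
  define g where "g n = (case n of 0 \<Rightarrow> F | Suc k \<Rightarrow> (\<lambda>x. F x - a x * U k x powr (- \<gamma>)))" for n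
  have UV: "sobolev0 (U n) (V n)" and wU: "AE x in M. w x \<le> U n x" for n
    using f(1)[of n] by (auto simp: P_def U_def V_def)
  note Um[measurable] = sobolev0_measurable[OF UV]
  have f0: "f 0 = (U0, V0)" using f(1)[of 0] by (simp add: P_def)
  have sol: "weak_solution (V n) (g n)" for n
    using UV0 f(2) by (cases n) (simp_all add: g_def V_def U_def f0 Q_def)
  have dg: "dual_weight (g n)" for n
    using F dual_g[OF Um(1) wU] by (cases n) (simp_all add: g_def)
  have Fg: "AE x in M. 0 \<le> F x - g n x \<and> F x - g n x \<le> ?h x" for n
  proof (cases n)
    case 0
    show ?thesis using h0 by eventually_elim (simp add: g_def 0)
  next
    case (Suc k)
    show ?thesis using powle[OF wU[of k]] by eventually_elim (simp add: g_def Suc)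
  qed
  have dec: "AE x in M. U (Suc n) x \<le> U n x" for n
  proof (induction n)
    case 0
    have "AE x in M. g (Suc 0) x \<le> g 0 x" using Fg[of "Suc 0"] by eventually_elim (simp add: g_def)
    then show ?case by (rule weak_solution_mono[OF UV dg sol UV dg sol])
  next
    case (Suc n)
    have "AE x in M. g (Suc (Suc n)) x \<le> g (Suc n) x"
      using Suc wU[of "Suc n"] a0 AE_space
    proof eventually_elim
      case (elim x)
      then have "U n x powr (- \<gamma>) \<le> U (Suc n) x powr (- \<gamma>)" using wpos[of x] \<gamma> by (intro powr_mono2') auto
      then show ?case using elim by (simp add: g_def mult_left_mono)
    qed
    then show ?case by (rule weak_solution_mono[OF UV dg sol UV dg sol])
  qed
  have all: "AE x in M. (\<forall>n. U (Suc n) x \<le> U n x) \<and> (\<forall>n. w x \<le> U n x)"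
    using dec wU by (simp add: AE_all_countable)
  define u where "u x = lim (\<lambda>n. U n x)" for x
  have um[measurable]: "u \<in> borel_measurable M" unfolding u_def by measurable
  have conv: "AE x in M. (\<lambda>n. U n x) \<longlonglongrightarrow> u x \<and> (\<forall>n. w x \<le> u x \<and> u x \<le> U n x \<and> U n x \<le> U 0 x) \<and> decseq (\<lambda>n. U n x)"
    using all
  proof eventually_elim
    case (elim x)
    have d: "decseq (\<lambda>n. U n x)" using elim by (simp add: decseq_Suc_iff)
    have "convergent (\<lambda>n. U n x)" using d elim by (auto intro!: Bseq_monoseq_convergent decseq_bounded decseq_imp_monoseq)
    then have l: "(\<lambda>n. U n x) \<longlonglongrightarrow> u x" by (simp add: u_def convergent_LIMSEQ_iff)
    have "w x \<le> u x" using elim by (intro LIMSEQ_le_const[OF l]) auto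
    moreover have "u x \<le> U n x" for n by (rule decseq_ge[OF d l])
    moreover have "U n x \<le> U 0 x" for n using d by (simp add: decseq_def)
    ultimately show ?case using l d by blast
  qed
  have wu: "AE x in M. w x \<le> u x" using conv by eventually_elim blast
  have ihU: "integrable M (\<lambda>x. ?h x * U 0 x)" and ihw: "integrable M (\<lambda>x. ?h x * w x)"
    by (rule dual_weight_sobolev0_integrable[OF h UV], rule dual_weight_sobolev0_integrable[OF h w])
  \<comment> \<open>This sequence bounds the distance of the gradients of all later iterates, and it tends to zero by dominated convergence.\<close>
  define d where "d n = (LINT x|M. ?h x * (U n x - u x))" for n
  have bd: "AE x in M. norm (?h x * (U n x - u x)) \<le> ?h x * U 0 x - ?h x * w x" for n
    using conv h0
  proof eventually_elim
    case (elim x)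
    then have "\<bar>U n x - u x\<bar> \<le> U 0 x - w x" by (smt (verit))
    then have "?h x * \<bar>U n x - u x\<bar> \<le> ?h x * (U 0 x - w x)" using elim by (intro mult_left_mono) auto
    moreover have "norm (?h x * (U n x - u x)) = ?h x * \<bar>U n x - u x\<bar>"
    proof -
      have "norm (A * B) = A * \<bar>B\<bar>" if "0 \<le> A" for A B :: real using that by (simp add: abs_mult)
      from this[OF elim(2)] show ?thesis .
    qed
    ultimately show ?case by (simp only: right_diff_distrib)
  qed
  have iw: "integrable M (\<lambda>x. ?h x * U 0 x - ?h x * w x)" using ihU ihw by auto
  have "d \<longlonglongrightarrow> (LINT x|M. 0)" unfolding d_def
  proof (rule integral_dominated_convergence[OF _ _ iw _ bd])
    show "AE x in M. (\<lambda>n. ?h x * (U n x - u x)) \<longlonglongrightarrow> 0"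
      using conv by eventually_elim (auto intro!: tendsto_mult_right_zero simp: LIM_zero_iff)
  qed measurable
  then have d0: "d \<longlonglongrightarrow> 0" by simp
  have idn: "integrable M (\<lambda>x. ?h x * (U n x - u x))" for n
    by (rule Bochner_Integration.integrable_bound[OF iw]) (measurable, use bd[of n] in \<open>auto elim!: eventually_mono\<close>)
  have close: "modular p M (\<lambda>x. V k x - V j x) \<le> ennreal (2 powr p * (p / 4 * d k))" if "k \<le> j" for k j
  proof -
    have "(LINT x|M. (g k x - g j x) * (U k x - U j x)) \<le> d k"
      unfolding d_def
    proof (rule integral_mono_AE[OF _ idn])
      show "integrable M (\<lambda>x. (g k x - g j x) * (U k x - U j x))"
        using dual_weight_sobolev0_integrable[OF dual_weight_add[OF dg dual_weight_scale[OF dg, of "-1"]] sobolev0_diff[OF UV UV], of k j k j] by simp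
      show "AE x in M. (g k x - g j x) * (U k x - U j x) \<le> ?h x * (U k x - u x)"
        using Fg[of k] Fg[of j] conv h0
      proof eventually_elim
        case (elim x)
        have "0 \<le> U k x - U j x" using elim(3) that by (simp add: decseq_def)
        moreover have "g k x - g j x \<le> ?h x" using elim by linarith
        ultimately have "(g k x - g j x) * (U k x - U j x) \<le> ?h x * (U k x - U j x)" by (intro mult_right_mono)
        also have "\<dots> \<le> ?h x * (U k x - u x)" using elim by (intro mult_left_mono) auto
        finally show ?case .
      qed
    qed
    then have "2 powr p * (p / 4 * (LINT x|M. (g k x - g j x) * (U k x - U j x))) \<le> 2 powr p * (p / 4 * d k)"
      using p_pos by (intro mult_left_mono) auto
    with weak_solution_stability[OF UV dg sol UV dg sol, of k j] show ?thesis
      by (meson ennreal_leI order_trans)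
  qed
  have lim: "(\<lambda>k. 2 powr p * (p / 4 * d k)) \<longlonglongrightarrow> 0"
    using d0 by (intro tendsto_mult_right_zero)
  have cau: "\<exists>N. \<forall>m\<ge>N. \<forall>n\<ge>N. modular p M (\<lambda>x. V m x - V n x) \<le> ennreal e" if e: "0 < e" for e
  proof -
    obtain N where N: "\<And>n. n \<ge> N \<Longrightarrow> 2 powr p * (p / 4 * d n) < e"
      using order_tendstoD(2)[OF lim e] eventually_sequentially by auto
    have 1: "modular p M (\<lambda>x. V m x - V n x) \<le> ennreal e" if "m \<ge> N" "m \<le> n" for m n
      using order_trans[OF close[OF that(2)] ennreal_leI[OF less_imp_le[OF N[OF that(1)]]]] .
    have "modular p M (\<lambda>x. V m x - V n x) \<le> ennreal e" if "m \<ge> N" "n \<ge> N" for m n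
      using 1[of m n] 1[of n m] that modular_minus[of p M "V m" "V n"] by (cases "m \<le> n") auto
    then show ?thesis by blast
  qed
  obtain v where vm[measurable]: "v \<in> borel_measurable M" and vl: "(\<lambda>n. modular p M (\<lambda>x. V n x - v x)) \<longlonglongrightarrow> 0"
    by (rule modular_complete[OF Um(2) p_pos(3) cau]) (auto intro: that)
  have "(\<lambda>n. modular p M (\<lambda>x. U n x - u x)) \<longlonglongrightarrow> 0"
  proof (rule modular_dominated[OF Um(1) um p_pos(1)])
    have "integrable M (\<lambda>x. norm (U 0 x) powr p)" "integrable M (\<lambda>x. norm (w x) powr p)"
      by (rule modular_finite_integrable; use sobolev0_finite[OF UV] sobolev0_finite[OF w] in simp)+
    then show "integrable M (\<lambda>x. norm (U 0 x) powr p + norm (w x) powr p)" by auto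
    show "AE x in M. \<forall>k. norm (U k x) powr p \<le> norm (U 0 x) powr p + norm (w x) powr p"
      using conv AE_space
    proof eventually_elim
      case (elim x)
      show ?case
      proof
        fix k
        have "norm (U k x) \<le> norm (U 0 x)" using elim wpos[of x] by (smt (verit) real_norm_def space_lebesgue_on)
        then have "norm (U k x) powr p \<le> norm (U 0 x) powr p" using p_pos by (intro powr_mono2) auto
        then show "norm (U k x) powr p \<le> norm (U 0 x) powr p + norm (w x) powr p" by (simp add: add_increasing2)
      qed
    qed
    show "AE x in M. (\<lambda>n. U n x) \<longlonglongrightarrow> u x" using conv by eventually_elim blast
  qed
  then have uv: "sobolev0 u v" by (rule sobolev0_closed[OF UV um vm _ vl])
  have "weak_solution v (\<lambda>x. F x - a x * u x powr (- \<gamma>))"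
    unfolding weak_solution_def
  proof
    fix \<psi> assume \<psi>: "\<psi> \<in> C1_c \<Omega>"
    note [measurable] = C1_c_measurable[OF \<psi>] dual_weight_measurable[OF dg]
    obtain r where r: "strict_mono r"
      and rl: "(\<lambda>k. LINT x|M. plap p (V (r k) x) \<bullet> gradient \<psi> x) \<longlonglongrightarrow> (LINT x|M. plap p (v x) \<bullet> gradient \<psi> x)"
      by (rule plap_subseq_limit[OF Um(2) vm vl sobolev0_finite(2)[OF uv] \<psi>]) (rule that)
    have glim: "AE x in M. (\<lambda>n. g n x) \<longlonglongrightarrow> F x - a x * u x powr (- \<gamma>)"
      using conv AE_space
    proof eventually_elim
      case (elim x)
      then have "0 < u x" using wpos[of x] by force
      then have "(\<lambda>n. F x - a x * U n x powr (- \<gamma>)) \<longlonglongrightarrow> F x - a x * u x powr (- \<gamma>)"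
        using elim by (intro tendsto_intros) auto
      then have "(\<lambda>n. g (Suc n) x) \<longlonglongrightarrow> F x - a x * u x powr (- \<gamma>)" by (simp add: g_def)
      then show ?case by (rule LIMSEQ_imp_Suc)
    qed
    have "(\<lambda>n. LINT x|M. g n x * \<psi> x) \<longlonglongrightarrow> (LINT x|M. (F x - a x * u x powr (- \<gamma>)) * \<psi> x)"
    proof (rule integral_dominated_convergence[where w = "\<lambda>x. \<bar>F x * \<psi> x\<bar> + \<bar>?h x * \<psi> x\<bar>"])
      show "integrable M (\<lambda>x. \<bar>F x * \<psi> x\<bar> + \<bar>?h x * \<psi> x\<bar>)"
        using dual_weight_integrable[OF F \<psi>] dual_weight_integrable[OF h \<psi>] by auto
      show "AE x in M. (\<lambda>n. g n x * \<psi> x) \<longlonglongrightarrow> (F x - a x * u x powr (- \<gamma>)) * \<psi> x"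
        using glim by eventually_elim (intro tendsto_intros)
      show "AE x in M. norm (g n x * \<psi> x) \<le> \<bar>F x * \<psi> x\<bar> + \<bar>?h x * \<psi> x\<bar>" for n
        using Fg[of n]
      proof eventually_elim
        case (elim x)
        then have "\<bar>g n x\<bar> \<le> \<bar>F x\<bar> + \<bar>?h x\<bar>" by linarith
        then have "\<bar>g n x\<bar> * \<bar>\<psi> x\<bar> \<le> (\<bar>F x\<bar> + \<bar>?h x\<bar>) * \<bar>\<psi> x\<bar>" by (rule mult_right_mono) simp
        then show ?case by (simp add: abs_mult distrib_right)
      qed
    qed measurable
    from LIMSEQ_subseq_LIMSEQ[OF this r]
    have "(\<lambda>k. LINT x|M. g (r k) x * \<psi> x) \<longlonglongrightarrow> (LINT x|M. (F x - a x * u x powr (- \<gamma>)) * \<psi> x)" by (simp add: o_def)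
    moreover have "(LINT x|M. plap p (V (r k) x) \<bullet> gradient \<psi> x) = (LINT x|M. g (r k) x * \<psi> x)" for k
      using sol \<psi> by (simp add: weak_solution_def)
    ultimately show "(LINT x|M. plap p (v x) \<bullet> gradient \<psi> x) = (LINT x|M. (F x - a x * u x powr (- \<gamma>)) * \<psi> x)"
      using rl LIMSEQ_unique by simp
  qed
  then show thesis by (rule that[OF uv wu dual_b[OF um wu]])
qed

end


section \<open>Regularity of the singular term and the notion of solution\<close>

context dirichlet_domain
begin

text \<open>Test with \<open>u\<^sup>2 / (d\<^sup>2 + u\<^sup>2)\<close>: it is increasing in \<open>u \<ge> 0\<close>, so the gradient term is nonnegative and can be dropped, which bounds
the singular term by the norm of \<open>F\<close> in \<open>L\<^sup>1\<close> uniformly in \<open>d\<close>. Let \<open>d\<close> tend to zero.\<close>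

lemma singular_term_integrable:
  assumes uv: "sobolev0 u v" and F: "dual_weight F" and iF: "integrable M F"
    and b: "dual_weight (\<lambda>x. a x * u x powr (- \<gamma>))" and a0: "AE x in M. 0 \<le> a x" and upos: "AE x in M. 0 < u x"
    and sol: "weak_solution v (\<lambda>x. F x - a x * u x powr (- \<gamma>))"
  shows "integrable M (\<lambda>x. a x * u x powr (- \<gamma>))"
proof -
  let ?b = "\<lambda>x. a x * u x powr (- \<gamma>)"
  note [measurable] = dual_weight_measurable[OF b] sobolev0_measurable[OF uv] dual_weight_measurable[OF F]
  have b0: "AE x in M. 0 \<le> ?b x" using a0 by eventually_elim simp
  define \<zeta> where "\<zeta> d s = s\<^sup>2 / (d\<^sup>2 + s\<^sup>2)" for d s :: real
  define \<zeta>' where "\<zeta>' d s = 2 * s * d\<^sup>2 / (d\<^sup>2 + s\<^sup>2)\<^sup>2" for d s :: real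
  have pos: "0 < d\<^sup>2 + s\<^sup>2" if "0 < d" for d s :: real using that by (simp add: add_pos_nonneg)
  have der: "(\<zeta> d has_real_derivative \<zeta>' d s) (at s)" if d: "0 < d" for d s
    unfolding \<zeta>_def[abs_def] \<zeta>'_def using pos[OF d, of s]
    by (auto intro!: derivative_eq_intros simp: power2_eq_square algebra_simps)
  have cont: "continuous_on UNIV (\<zeta>' d)" if d: "0 < d" for d
    unfolding \<zeta>'_def using pos[OF d] by (intro continuous_intros) (metis less_irrefl power_eq_0_iff)
  have bd: "\<bar>\<zeta>' d s\<bar> \<le> 1 / d" if d: "0 < d" for d s
  proof -
    have "2 * \<bar>s\<bar> * d \<le> d\<^sup>2 + s\<^sup>2" using sum_squares_bound[of "\<bar>s\<bar>" d] by (simp add: add.commute)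
    moreover have "d\<^sup>2 \<le> d\<^sup>2 + s\<^sup>2" by simp
    ultimately have "(2 * \<bar>s\<bar> * d) * d\<^sup>2 \<le> (d\<^sup>2 + s\<^sup>2) * (d\<^sup>2 + s\<^sup>2)" using pos[OF d, of s] by (intro mult_mono) auto
    then have "2 * \<bar>s\<bar> * d\<^sup>2 * d \<le> (d\<^sup>2 + s\<^sup>2)\<^sup>2" by (simp add: power2_eq_square ac_simps)
    then show ?thesis using pos[OF d, of s] d by (simp add: \<zeta>'_def abs_mult field_simps)
  qed
  have z0: "\<zeta> d 0 = 0" for d by (simp add: \<zeta>_def)
  have z1: "0 \<le> \<zeta> d s \<and> \<zeta> d s \<le> 1" if "0 < d" for d s using pos[OF that, of s] that by (simp add: \<zeta>_def divide_le_eq_1)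
  have key: "(\<integral>\<^sup>+ x. ennreal (?b x * \<zeta> d (u x)) \<partial>M) \<le> ennreal (LINT x|M. \<bar>F x\<bar>)" if d: "0 < d" for d
  proof -
    note G = sobolev0_chain[OF uv der[OF d] cont[OF d] z0 bd[OF d]]
    note dg = dual_weight_add[OF F dual_weight_scale[OF b, of "-1"]]
    note [measurable] = sobolev0_measurable[OF G]
    have "(LINT x|M. plap p (v x) \<bullet> (\<zeta>' d (u x) *\<^sub>R v x)) = (LINT x|M. (F x - ?b x) * \<zeta> d (u x))"
      by (rule weak_solution_test_sobolev0[OF uv _ sol G]) (use dg in simp)
    moreover have "0 \<le> (LINT x|M. plap p (v x) \<bullet> (\<zeta>' d (u x) *\<^sub>R v x))"
    proof (rule integral_nonneg_AE)
      show "AE x in M. 0 \<le> plap p (v x) \<bullet> (\<zeta>' d (u x) *\<^sub>R v x)"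
        using upos by eventually_elim (simp add: plap_inner_self \<zeta>'_def)
    qed
    moreover have iF': "integrable M (\<lambda>x. F x * \<zeta> d (u x))" and ib: "integrable M (\<lambda>x. ?b x * \<zeta> d (u x))"
      by (rule dual_weight_sobolev0_integrable[OF F G], rule dual_weight_sobolev0_integrable[OF b G])
    moreover have "(LINT x|M. (F x - ?b x) * \<zeta> d (u x)) = (LINT x|M. F x * \<zeta> d (u x)) - (LINT x|M. ?b x * \<zeta> d (u x))"
      using iF' ib by (simp only: left_diff_distrib Bochner_Integration.integral_diff)
    moreover have "(LINT x|M. F x * \<zeta> d (u x)) \<le> (LINT x|M. \<bar>F x\<bar>)"
    proof (rule integral_mono[OF iF'])
      show "F x * \<zeta> d (u x) \<le> \<bar>F x\<bar>" for x
      proof -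
        have "F x * \<zeta> d (u x) \<le> \<bar>F x\<bar> * \<zeta> d (u x)" using z1[OF d, of "u x"] by (intro mult_right_mono) auto
        also have "\<dots> \<le> \<bar>F x\<bar> * 1" using z1[OF d, of "u x"] by (intro mult_left_mono) auto
        finally show ?thesis by simp
      qed
    qed (use iF in auto)
    ultimately have "(LINT x|M. ?b x * \<zeta> d (u x)) \<le> (LINT x|M. \<bar>F x\<bar>)" by linarith
    moreover have "(\<integral>\<^sup>+ x. ennreal (?b x * \<zeta> d (u x)) \<partial>M) = ennreal (LINT x|M. ?b x * \<zeta> d (u x))"
      by (rule nn_integral_eq_integral[OF ib]) (use b0 z1[OF d] in \<open>auto elim!: eventually_mono\<close>)
    ultimately show ?thesis by (simp add: ennreal_leI)
  qed
  define t where "t n = 1 / real (Suc n)" for n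
  have t: "0 < t n" "t \<longlonglongrightarrow> 0" for n
    unfolding t_def using LIMSEQ_inverse_real_of_nat by (auto simp: inverse_eq_divide)
  have "(\<integral>\<^sup>+ x. ennreal (?b x) \<partial>M) = (\<integral>\<^sup>+ x. liminf (\<lambda>n. ennreal (?b x * \<zeta> (t n) (u x))) \<partial>M)"
  proof (rule nn_integral_cong_AE, use upos in eventually_elim)
    fix x assume u: "0 < u x"
    have "(\<lambda>n. \<zeta> (t n) (u x)) \<longlonglongrightarrow> (u x)\<^sup>2 / (0\<^sup>2 + (u x)\<^sup>2)"
      unfolding \<zeta>_def using u by (intro tendsto_intros t(2)) auto
    then have "(\<lambda>n. ennreal (?b x * \<zeta> (t n) (u x))) \<longlonglongrightarrow> ennreal (?b x * 1)"
      using u by (intro tendsto_ennrealI tendsto_mult tendsto_const) simp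
    from lim_imp_Liminf[OF trivial_limit_sequentially this]
    show "ennreal (?b x) = liminf (\<lambda>n. ennreal (?b x * \<zeta> (t n) (u x)))" by simp
  qed
  also have "\<dots> \<le> liminf (\<lambda>n. \<integral>\<^sup>+ x. ennreal (?b x * \<zeta> (t n) (u x)) \<partial>M)"
    unfolding \<zeta>_def by (rule nn_integral_liminf) measurable
  also have "\<dots> \<le> ennreal (LINT x|M. \<bar>F x\<bar>)"
    by (rule Liminf_le) (use key[OF t(1)] in auto)
  also have "\<dots> < \<infinity>" by simp
  finally have fin: "(\<integral>\<^sup>+ x. ennreal (?b x) \<partial>M) < \<infinity>" .
  have "(\<integral>\<^sup>+ x. ennreal (norm (?b x)) \<partial>M) = (\<integral>\<^sup>+ x. ennreal (?b x) \<partial>M)"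
    by (rule nn_integral_cong_AE) (use b0 in eventually_elim, simp)
  with fin show ?thesis by (intro integrableI_bounded) auto
qed

text \<open>On a set of finite measure \<open>L\<^sup>p\<close> convergence implies convergence of every lower order; with order one this puts the
truncations into the space required of a distributional solution.\<close>

lemma powr_lower_exponent:
  fixes x d r :: real
  assumes "0 \<le> x" "0 < d" "1 \<le> r" "r \<le> p"
  shows "x powr r \<le> d powr r + d powr (r - p) * x powr p"
proof (cases "x \<le> d")
  case True
  then have "x powr r \<le> d powr r" using assms by (intro powr_mono2) auto
  then show ?thesis by (simp add: add_increasing2)
next
  case False
  then have x: "0 < x" using assms by simp
  have "x powr r = x powr (r - p) * x powr p" using x by (simp flip: powr_add)
  also have "\<dots> \<le> d powr (r - p) * x powr p" using assms False by (intro mult_right_mono powr_mono2') auto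
  finally show ?thesis by (simp add: add_increasing)
qed

lemma modular_lower_exponent:
  assumes [measurable]: "f \<in> borel_measurable M" and d: "0 < d" and r: "1 \<le> r" "r \<le> p"
  shows "modular r M f \<le> ennreal (d powr r * measure M \<Omega>) + ennreal (d powr (r - p)) * modular p M f"
proof -
  have "modular r M f \<le> (\<integral>\<^sup>+ x. ennreal (d powr r) + ennreal (d powr (r - p)) * ennreal (norm (f x) powr p) \<partial>M)"
    unfolding modular_def using powr_lower_exponent[OF _ d r]
    by (intro nn_integral_mono) (auto simp flip: ennreal_plus ennreal_mult intro!: ennreal_leI)
  also have "\<dots> = ennreal (d powr r) * emeasure M \<Omega> + ennreal (d powr (r - p)) * modular p M f"
    unfolding modular_def by (subst nn_integral_add) (auto simp: nn_integral_cmult)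
  also have "emeasure M \<Omega> = ennreal (measure M \<Omega>)" by (rule finite_measure.emeasure_eq_measure[OF finite_M])
  finally show ?thesis by (simp add: ennreal_mult)
qed

lemma modular_lower_exponent_finite:
  assumes "f \<in> borel_measurable M" "1 \<le> r" "r \<le> p" "modular p M f < \<infinity>"
  shows "modular r M f < \<infinity>"
  by (rule order.strict_trans1[OF modular_lower_exponent[OF assms(1) zero_less_one assms(2,3)]])
    (use assms(4) in \<open>simp add: ennreal_add_eq_top less_top\<close>)

lemma modular_lower_exponent_tendsto:
  assumes [measurable]: "\<And>n. f n \<in> borel_measurable M" and r: "1 \<le> r" "r \<le> p"
    and lim: "(\<lambda>n::nat. modular p M (f n)) \<longlonglongrightarrow> 0"
  shows "(\<lambda>n. modular r M (f n)) \<longlonglongrightarrow> 0"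
proof (rule ennreal_tendsto_0I)
  fix e :: real assume e: "0 < e"
  define m where "m = measure M \<Omega>"
  have m: "0 \<le> m" by (simp add: m_def)
  define d where "d = (e / (2 * (m + 1))) powr (1 / r)"
  have d: "0 < d" using e m by (simp add: d_def)
  have dr: "d powr r = e / (2 * (m + 1))" unfolding d_def using e m r by (simp add: powr_powr)
  have "e / 2 * (m / (m + 1)) \<le> e / 2 * 1" using e m by (intro mult_left_mono) auto
  then have dm: "d powr r * m \<le> e / 2" unfolding dr by simp
  define c where "c = e / (2 * d powr (r - p))"
  have c: "0 < c" "d powr (r - p) * c = e / 2" using e d by (auto simp: c_def)
  have "\<forall>\<^sub>F n in sequentially. modular p M (f n) < ennreal c" by (rule order_tendstoD(2)[OF lim]) (use c in auto)
  then show "\<forall>\<^sub>F n in sequentially. modular r M (f n) \<le> ennreal e"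
  proof eventually_elim
    case (elim n)
    have "modular r M (f n) \<le> ennreal (d powr r * m) + ennreal (d powr (r - p)) * modular p M (f n)"
      unfolding m_def by (rule modular_lower_exponent[OF _ d r]) measurable
    also have "\<dots> \<le> ennreal (e / 2) + ennreal (d powr (r - p)) * ennreal c"
      using elim dm by (intro add_mono mult_left_mono ennreal_leI) auto
    also have "\<dots> = ennreal (e / 2 + d powr (r - p) * c)" using c e by (simp flip: ennreal_mult ennreal_plus)
    also have "\<dots> = ennreal e" unfolding c(2) by simp
    finally show ?case .
  qed
qed

lemma bounded_pairing_tendsto:
  fixes X g :: "'a \<Rightarrow> 'b::euclidean_space"
  assumes "X \<in> borel_measurable M" "\<And>x. norm (X x) \<le> B" "0 < B"
    and "\<And>n. f n \<in> borel_measurable M" "g \<in> borel_measurable M" "modular p M g < \<infinity>"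
    and "(\<lambda>n. modular p M (\<lambda>x. f n x - g x)) \<longlonglongrightarrow> 0"
  shows "(\<lambda>n. LINT x|M. X x \<bullet> f n x) \<longlonglongrightarrow> (LINT x|M. X x \<bullet> g x)"
proof -
  obtain e :: 'b where e: "e \<in> Basis" using nonempty_Basis by blast
  define c where "c = B powr (1 / (p - 1))"
  have c: "norm (c *\<^sub>R e) powr (p - 1) = B" using assms(3) e p_pos by (simp add: c_def powr_powr)
  have "modular p M (\<lambda>x. c *\<^sub>R e) = ennreal (norm (c *\<^sub>R e) powr p) * emeasure M \<Omega>"
    unfolding modular_def by simp
  also have "\<dots> < \<infinity>" using finite_measure.emeasure_finite[OF finite_M, of \<Omega>] by (simp add: ennreal_mult_less_top less_top)
  finally have fin: "modular p M (\<lambda>x. c *\<^sub>R e) < \<infinity>" .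
  show ?thesis
    by (rule pairing_tendsto(2)[OF assms(1) _ assms(4,5) p_pos(3) fin _ assms(6,7)]) (use c assms(2) in auto)
qed

lemma integrable_subset_L1_loc:
  fixes f :: "'a \<Rightarrow> 'b::euclidean_space"
  assumes "integrable M f"
  shows "f \<in> L1_loc \<Omega>"
  unfolding L1_loc_def
proof (intro CollectI allI impI)
  fix K assume K: "compact K \<and> K \<subseteq> \<Omega>"
  have sK: "K \<in> sets lebesgue" using K by (simp add: borel_compact)
  have sO: "\<Omega> \<in> sets lebesgue" using open_\<Omega> by simp
  have "integrable lebesgue (\<lambda>x. if x \<in> \<Omega> then f x else 0)"
    using Lebesgue_Measure.integrable_restrict_UNIV[OF sO, of f] assms by simp
  from integrable_mult_indicator[OF sK this]
  have "integrable lebesgue (\<lambda>x. indicator K x *\<^sub>R (if x \<in> \<Omega> then f x else 0))" .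
  moreover have "(\<lambda>x. indicator K x *\<^sub>R (if x \<in> \<Omega> then f x else 0)) = (\<lambda>x. if x \<in> K then f x else 0)"
    using K by (intro ext) (auto simp: indicator_def)
  ultimately show "integrable (lebesgue_on K) f"
    using Lebesgue_Measure.integrable_restrict_UNIV[OF sK, of f] by simp
qed

lemma modular_1_integrable:
  fixes f :: "'a \<Rightarrow> 'b::euclidean_space"
  assumes [measurable]: "f \<in> borel_measurable M" and "modular 1 M f < \<infinity>"
  shows "integrable M f"
  by (rule integrableI_bounded) (use assms(2) in \<open>auto simp: modular_def\<close>)

lemma sobolev0_L1:
  assumes "sobolev0 u v" shows "integrable M u" "integrable M v"
  using modular_1_integrable modular_lower_exponent_finite[OF _ order_refl p_pos(3)]
    sobolev0_finite[OF assms] sobolev0_measurable[OF assms] by auto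

lemma sobolev0_weak_gradient:
  assumes uv: "sobolev0 u v"
  shows "has_weak_gradient \<Omega> u v"
  unfolding has_weak_gradient_def
proof (intro conjI ballI)
  show "u \<in> L1_loc \<Omega>" "v \<in> L1_loc \<Omega>" using integrable_subset_L1_loc sobolev0_L1[OF uv] by auto
  fix \<psi> assume \<psi>: "\<psi> \<in> C1_c \<Omega>"
  note m[measurable] = sobolev0_measurable[OF uv] C1_c_measurable[OF \<psi>]
  obtain B where B: "0 < B" "\<And>x. \<bar>\<psi> x\<bar> \<le> B" "\<And>x. norm (gradient \<psi> x) \<le> B" by (rule C1_c_bounded[OF \<psi>]) (rule that)
  obtain \<phi> where \<phi>: "\<And>n::nat. \<phi> n \<in> C1_c \<Omega>" "(\<lambda>n. modular p M (\<lambda>x. \<phi> n x - u x)) \<longlonglongrightarrow> 0"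
    "(\<lambda>n. modular p M (\<lambda>x. gradient (\<phi> n) x - v x)) \<longlonglongrightarrow> 0" by (rule sobolev0E[OF uv]) (rule that)
  note [measurable] = C1_c_measurable[OF \<phi>(1)]
  have bdd: "integrable M (\<lambda>x. f x *\<^sub>R g x)"
    if "integrable M g" "f \<in> borel_measurable M" "\<And>x. \<bar>f x\<bar> \<le> B" for f :: "'a \<Rightarrow> real" and g :: "'a \<Rightarrow> 'a"
    by (rule Bochner_Integration.integrable_bound[of M "\<lambda>x. B *\<^sub>R g x"])
      (use that B in \<open>auto intro!: borel_measurable_scaleR borel_measurable_integrable mult_right_mono AE_I2\<close>)
  have bdd': "integrable M (\<lambda>x. f x *\<^sub>R g x)"
    if "integrable M f" "g \<in> borel_measurable M" "\<And>x. norm (g x) \<le> B" for f :: "'a \<Rightarrow> real" and g :: "'a \<Rightarrow> 'a"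
  proof (rule Bochner_Integration.integrable_bound[of M "\<lambda>x. B * f x"])
    show "AE x in M. norm (f x *\<^sub>R g x) \<le> norm (B * f x)"
    proof (rule AE_I2)
      fix x
      have "\<bar>f x\<bar> * norm (g x) \<le> \<bar>f x\<bar> * B" by (rule mult_left_mono[OF that(3)]) simp
      then show "norm (f x *\<^sub>R g x) \<le> norm (B * f x)" using B(1) by (simp add: abs_mult mult.commute)
    qed
  qed (use that in \<open>auto intro!: borel_measurable_scaleR borel_measurable_integrable\<close>)
  show "(LINT x|M. u x *\<^sub>R gradient \<psi> x) = - (LINT x|M. \<psi> x *\<^sub>R v x)"
  proof (rule euclidean_eqI)
    fix i :: 'a assume i: "i \<in> Basis"
    have bi: "\<bar>gradient \<psi> x \<bullet> i\<bar> \<le> B" for x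
      using Basis_le_norm[OF i, of "gradient \<psi> x"] B(3)[of x] by linarith
    have l1: "(\<lambda>n. LINT x|M. (gradient \<psi> x \<bullet> i) \<bullet> \<phi> n x) \<longlonglongrightarrow> (LINT x|M. (gradient \<psi> x \<bullet> i) \<bullet> u x)"
      by (rule bounded_pairing_tendsto[OF _ _ B(1) _ _ _ \<phi>(2)]) (use bi sobolev0_finite[OF uv] in auto)
    have l2: "(\<lambda>n. LINT x|M. (\<psi> x *\<^sub>R i) \<bullet> gradient (\<phi> n) x) \<longlonglongrightarrow> (LINT x|M. (\<psi> x *\<^sub>R i) \<bullet> v x)"
      by (rule bounded_pairing_tendsto[OF _ _ B(1) _ _ _ \<phi>(3)]) (use B i sobolev0_finite[OF uv] in auto)
    have eq: "(LINT x|M. (gradient \<psi> x \<bullet> i) \<bullet> \<phi> n x) = - (LINT x|M. (\<psi> x *\<^sub>R i) \<bullet> gradient (\<phi> n) x)" for n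
    proof -
      note I = C1_c_integrable[OF \<phi>(1) open_\<Omega> bounded_\<Omega>, of n]
      have "(LINT x|M. \<phi> n x *\<^sub>R gradient \<psi> x) \<bullet> i = - ((LINT x|M. \<psi> x *\<^sub>R gradient (\<phi> n) x) \<bullet> i)"
        unfolding C1_c_integration_by_parts[OF \<phi>(1) \<psi> open_\<Omega> bounded_\<Omega>] by simp
      moreover have "(LINT x|M. \<phi> n x *\<^sub>R gradient \<psi> x) \<bullet> i = (LINT x|M. (gradient \<psi> x \<bullet> i) \<bullet> \<phi> n x)"
        using bdd'[OF I(1) m(4) B(3)] by (subst integral_inner_left[symmetric]) (auto simp: mult.commute)
      moreover have "(LINT x|M. \<psi> x *\<^sub>R gradient (\<phi> n) x) \<bullet> i = (LINT x|M. (\<psi> x *\<^sub>R i) \<bullet> gradient (\<phi> n) x)"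
        using bdd[OF I(2) m(3) B(2)] by (subst integral_inner_left[symmetric]) (auto simp: inner_commute)
      ultimately show ?thesis by simp
    qed
    have "(LINT x|M. (gradient \<psi> x \<bullet> i) \<bullet> u x) = - (LINT x|M. (\<psi> x *\<^sub>R i) \<bullet> v x)"
      using LIMSEQ_unique[OF l1] tendsto_minus[OF l2] unfolding eq by simp
    moreover have "(LINT x|M. u x *\<^sub>R gradient \<psi> x) \<bullet> i = (LINT x|M. (gradient \<psi> x \<bullet> i) \<bullet> u x)"
      using bdd'[OF sobolev0_L1(1)[OF uv] m(4) B(3)] by (subst integral_inner_left[symmetric]) (auto simp: mult.commute)
    moreover have "(LINT x|M. \<psi> x *\<^sub>R v x) \<bullet> i = (LINT x|M. (\<psi> x *\<^sub>R i) \<bullet> v x)"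
      using bdd[OF sobolev0_L1(2)[OF uv] m(3) B(2)] by (subst integral_inner_left[symmetric]) (auto simp: inner_commute)
    ultimately show "(LINT x|M. u x *\<^sub>R gradient \<psi> x) \<bullet> i = (- (LINT x|M. \<psi> x *\<^sub>R v x)) \<bullet> i" by simp
  qed
qed

lemma modular_LINT_tendsto:
  assumes "(\<lambda>n::nat. modular r M (f n)) \<longlonglongrightarrow> 0" "\<And>n. f n \<in> borel_measurable M"
  shows "(\<lambda>n. LINT x|M. norm (f n x) powr r) \<longlonglongrightarrow> 0"
proof -
  have "(LINT x|M. norm (f n x) powr r) = enn2real (modular r M (f n))" for n
    unfolding modular_def by (rule integral_eq_nn_integral) (use assms(2)[of n] in auto)
  then show ?thesis using tendsto_enn2real[of _ 0] assms(1) by simp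
qed

lemma sobolev0_W1_0:
  assumes uv: "sobolev0 u v" and r: "1 \<le> r" "r \<le> p"
  shows "u \<in> W1_0 r \<Omega>"
proof -
  note [measurable] = sobolev0_measurable[OF uv]
  obtain \<phi> where \<phi>: "\<And>n::nat. \<phi> n \<in> C1_c \<Omega>" "(\<lambda>n. modular p M (\<lambda>x. \<phi> n x - u x)) \<longlonglongrightarrow> 0"
    "(\<lambda>n. modular p M (\<lambda>x. gradient (\<phi> n) x - v x)) \<longlonglongrightarrow> 0" by (rule sobolev0E[OF uv]) (rule that)
  note [measurable] = C1_c_measurable[OF \<phi>(1)]
  have Lu: "u \<in> Lp (ereal r) \<Omega>"
    unfolding Lp_def
    using modular_finite_integrable[OF _ modular_lower_exponent_finite[OF _ r sobolev0_finite(1)[OF uv]]] by simp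
  have Lv: "v \<in> Lp (ereal r) \<Omega>"
    unfolding Lp_def
    using modular_finite_integrable[OF _ modular_lower_exponent_finite[OF _ r sobolev0_finite(2)[OF uv]]] by simp
  have 1: "(\<lambda>n. LINT x|M. norm (\<phi> n x - u x) powr r) \<longlonglongrightarrow> 0"
    by (rule modular_LINT_tendsto[OF modular_lower_exponent_tendsto[OF _ r \<phi>(2)]]) measurable
  have 2: "(\<lambda>n. LINT x|M. norm (gradient (\<phi> n) x - v x) powr r) \<longlonglongrightarrow> 0"
    by (rule modular_LINT_tendsto[OF modular_lower_exponent_tendsto[OF _ r \<phi>(3)]]) measurable
  show ?thesis unfolding W1_0_def
  proof (intro CollectI conjI exI[of _ v] exI[of _ \<phi>] allI)
    show "has_weak_gradient \<Omega> u v" by (rule sobolev0_weak_gradient[OF uv])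
  qed (use Lu Lv \<phi>(1) 1 2 in simp_all)
qed

text \<open>\<open>T\<^sub>k(s) = s - (s - k)\<^sup>+ + (- s - k)\<^sup>+\<close>. The derivative of the smooth positive part vanishes at zero, so the derivatives of the
approximations tend to \<open>1\<close> on the whole closed interval \<open>[-k, k]\<close>, end points included.\<close>

lemma sobolev0_truncate:
  assumes uv: "sobolev0 u v" and k: "0 < k"
  shows "sobolev0 (\<lambda>x. truncate k (u x)) (\<lambda>x. indicat_real {y. \<bar>u y\<bar> \<le> k} x *\<^sub>R v x)"
proof -
  define t where "t n = 1 / real (Suc n)" for n
  have t: "0 < t n" "t \<longlonglongrightarrow> 0" for n
    unfolding t_def using LIMSEQ_inverse_real_of_nat by (auto simp: inverse_eq_divide)
  define G where "G n s = s - spos (t n) (s - k) + spos (t n) (- s - k)" for n s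
  define g where "g n s = 1 - spos' (t n) (s - k) - spos' (t n) (- s - k)" for n s
  have splim: "(\<lambda>n. spos (t n) s) \<longlonglongrightarrow> max s 0" for s
  proof -
    have "(\<lambda>n. spos (t n) s - max s 0) \<longlonglongrightarrow> 0"
      by (rule Lim_null_comparison[OF _ t(2)]) (use spos_simps(10)[OF t(1)] in auto)
    then show ?thesis by (rule LIM_zero_cancel)
  qed
  have sp'lim: "(\<lambda>n. spos' (t n) s) \<longlonglongrightarrow> (if 0 < s then 1 else 0)" for s
  proof (cases "0 < s")
    case True
    then have "(\<lambda>n. spos' (t n) s) \<longlonglongrightarrow> max s 0 / sqrt ((max s 0)\<^sup>2 + 0\<^sup>2)"
      unfolding spos'_def by (intro tendsto_intros t(2)) auto
    then show ?thesis using True by simp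
  qed (use spos_simps(7)[OF t(1)] in simp)
  have "sobolev0 (\<lambda>x. u x - max (u x - k) 0 + max (- u x - k) 0)
     (\<lambda>x. (1 - (if 0 < u x - k then 1 else 0) - (if 0 < - u x - k then 1 else 0)) *\<^sub>R v x)"
  proof (rule sobolev0_chain_limit[OF uv, where G = G and g = g and L = 3])
    show "(G n has_real_derivative g n s) (at s)" for n s
    proof -
      have 1: "((\<lambda>s. spos (t n) (s - k)) has_real_derivative spos' (t n) (s - k) * 1) (at s)"
        by (rule DERIV_chain2[OF spos_DERIV[OF t(1)]]) (auto intro!: derivative_eq_intros)
      have 2: "((\<lambda>s. spos (t n) (- s - k)) has_real_derivative spos' (t n) (- s - k) * (-1)) (at s)"
        by (rule DERIV_chain2[OF spos_DERIV[OF t(1)]]) (auto intro!: derivative_eq_intros)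
      show ?thesis unfolding G_def[abs_def] g_def
        by (rule DERIV_cong[OF DERIV_add[OF DERIV_diff[OF DERIV_ident 1] 2]]) simp
    qed
    show "continuous_on UNIV (g n)" for n unfolding g_def
      by (intro continuous_intros continuous_on_compose2[OF spos_simps(2)[OF t(1)]]) auto
    show "G n 0 = 0" for n using k spos_simps(6)[OF t(1)] by (simp add: G_def)
    show "\<bar>g n s\<bar> \<le> 3" for n s
      using spos_simps(3,4)[OF t(1)[of n], of "s - k"] spos_simps(3,4)[OF t(1)[of n], of "- s - k"] unfolding g_def by linarith
    show "(\<lambda>n. G n s) \<longlonglongrightarrow> s - max (s - k) 0 + max (- s - k) 0" for s
      unfolding G_def by (intro tendsto_intros splim)
    show "(\<lambda>n. g n s) \<longlonglongrightarrow> 1 - (if 0 < s - k then 1 else 0) - (if 0 < - s - k then 1 else 0)" for s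
      unfolding g_def by (intro tendsto_intros sp'lim)
  qed
  moreover have "u x - max (u x - k) 0 + max (- u x - k) 0 = truncate k (u x)" for x
    using k unfolding truncate_def by (auto simp: max_def min_def)
  moreover have "1 - (if 0 < u x - k then 1 else 0) - (if 0 < - u x - k then 1 else 0) = indicat_real {y. \<bar>u y\<bar> \<le> k} x" for x
    using k by (auto simp: indicator_def)
  ultimately show ?thesis by simp
qed

lemma sobolev0_generalized_gradient:
  assumes "sobolev0 u v" shows "has_generalized_gradient \<Omega> u v"
  unfolding has_generalized_gradient_def
  using sobolev0_measurable[OF assms] sobolev0_weak_gradient[OF sobolev0_truncate[OF assms]] by blast

theorem finite_energy_solution:
  assumes uv: "sobolev0 u v" and f: "dual_weight f" and iF: "integrable M f"
    and b: "dual_weight (\<lambda>x. a x * u x powr (- \<gamma>))" and a0: "AE x in M. 0 \<le> a x" and upos: "AE x in M. 0 < u x"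
    and sol: "weak_solution v (\<lambda>x. \<mu> * f x - a x * u x powr (- \<gamma>))"
  shows "is_finite_energy_solution p \<gamma> \<Omega> a \<mu> f u" "(\<lambda>x. a x * u x powr (- \<gamma>)) \<in> Lp 1 \<Omega>"
proof -
  have ib: "integrable M (\<lambda>x. a x * u x powr (- \<gamma>))"
    by (rule singular_term_integrable[OF uv dual_weight_scale[OF f] _ b a0 upos sol]) (use iF in auto)
  note [measurable] = sobolev0_measurable[OF uv]
  have "integrable M (\<lambda>x. norm (v x) powr (p - 1))"
  proof (cases "p - 1 \<ge> 1")
    case True
    show ?thesis
      by (rule modular_finite_integrable[OF _ modular_lower_exponent_finite[OF _ True _ sobolev0_finite(2)[OF uv]]]) auto
  qed (use p_ge_2 in auto)
  then have vL: "(\<lambda>x. norm (v x) powr (p - 1)) \<in> L1_loc \<Omega>" by (rule integrable_subset_L1_loc)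
  have eq: "(LINT x|M. norm (v x) powr (p - 2) * (v x \<bullet> gradient \<phi> x)) + (LINT x|M. a x * \<phi> x / u x powr \<gamma>)
      = \<mu> * (LINT x|M. f x * \<phi> x)" if \<phi>: "\<phi> \<in> C1_c \<Omega>" for \<phi>
  proof -
    have "(LINT x|M. norm (v x) powr (p - 2) * (v x \<bullet> gradient \<phi> x)) = (LINT x|M. plap p (v x) \<bullet> gradient \<phi> x)"
      by (simp add: plap_def)
    also have "\<dots> = (LINT x|M. (\<mu> * f x - a x * u x powr (- \<gamma>)) * \<phi> x)" using sol \<phi> by (simp add: weak_solution_def)
    also have "\<dots> = (LINT x|M. \<mu> * (f x * \<phi> x) - a x * u x powr (- \<gamma>) * \<phi> x)"
      by (rule Bochner_Integration.integral_cong) (auto simp: algebra_simps)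
    also have "\<dots> = \<mu> * (LINT x|M. f x * \<phi> x) - (LINT x|M. a x * u x powr (- \<gamma>) * \<phi> x)"
      using dual_weight_integrable[OF f \<phi>] dual_weight_integrable[OF b \<phi>] by (subst Bochner_Integration.integral_diff) auto
    also have "(LINT x|M. a x * u x powr (- \<gamma>) * \<phi> x) = (LINT x|M. a x * \<phi> x / u x powr \<gamma>)"
      by (rule Bochner_Integration.integral_cong) (auto simp: powr_minus divide_inverse)
    finally show ?thesis by simp
  qed
  have "is_solution p \<gamma> \<Omega> a \<mu> f u"
    unfolding is_solution_def
  proof (intro conjI)
    show "u \<in> borel_measurable M" by measurable
    show "AE x in M. 0 \<le> u x" using upos by eventually_elim simp
    show "\<forall>k>0. (\<lambda>x. truncate k (u x)) \<in> W1_0 1 \<Omega>"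
      using sobolev0_W1_0[OF sobolev0_truncate[OF uv] order_refl p_pos(3)] by blast
    show "AE x in M. u x = 0 \<longrightarrow> a x = 0" using upos by eventually_elim simp
    show "(\<lambda>x. a x * u x powr (- \<gamma>)) \<in> L1_loc \<Omega>" by (rule integrable_subset_L1_loc[OF ib])
    show "\<exists>v. has_generalized_gradient \<Omega> u v \<and> (\<lambda>x. norm (v x) powr (p - 1)) \<in> L1_loc \<Omega> \<and>
        (\<forall>\<phi>\<in>C1_c \<Omega>. (LINT x|M. norm (v x) powr (p - 2) * (v x \<bullet> gradient \<phi> x))
             + (LINT x|M. a x * \<phi> x / u x powr \<gamma>) = \<mu> * (LINT x|M. f x * \<phi> x))"
      using sobolev0_generalized_gradient[OF uv] vL eq by blast
  qed
  then show "is_finite_energy_solution p \<gamma> \<Omega> a \<mu> f u"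
    unfolding is_finite_energy_solution_def using sobolev0_W1_0[OF uv p_pos(3) order_refl] by blast
  have "integrable M (\<lambda>x. norm (a x * u x powr (- \<gamma>)) powr 1)" using ib by simp
  then show "(\<lambda>x. a x * u x powr (- \<gamma>)) \<in> Lp 1 \<Omega>"
    unfolding Lp_def using borel_measurable_integrable[OF ib] by simp
qed

end


section \<open>A potential estimate\<close>

lemma nn_integral_lborel_affine:
  fixes f :: "'a::euclidean_space \<Rightarrow> ennreal"
  assumes [measurable]: "f \<in> borel_measurable borel" and "c \<noteq> 0"
  shows "(\<integral>\<^sup>+ z. f z \<partial>lborel) = ennreal (\<bar>c\<bar> ^ DIM('a)) * (\<integral>\<^sup>+ z. f (x + c *\<^sub>R z) \<partial>lborel)"
proof -
  have "(\<integral>\<^sup>+ z. f z \<partial>lborel) = (\<integral>\<^sup>+ z. f z \<partial>density (distr lborel borel (\<lambda>z. x + c *\<^sub>R z)) (\<lambda>_. ennreal (\<bar>c\<bar> ^ DIM('a))))"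
    using lborel_affine[OF assms(2), of x] by simp
  also have "\<dots> = (\<integral>\<^sup>+ z. ennreal (\<bar>c\<bar> ^ DIM('a)) * f z \<partial>distr lborel borel (\<lambda>z. x + c *\<^sub>R z))"
    by (rule nn_integral_density) auto
  also have "\<dots> = (\<integral>\<^sup>+ z. ennreal (\<bar>c\<bar> ^ DIM('a)) * f (x + c *\<^sub>R z) \<partial>lborel)"
    by (rule nn_integral_distr) auto
  also have "\<dots> = ennreal (\<bar>c\<bar> ^ DIM('a)) * (\<integral>\<^sup>+ z. f (x + c *\<^sub>R z) \<partial>lborel)"
    by (rule nn_integral_cmult) auto
  finally show ?thesis .
qed

lemma C1_c_line_bound:
  fixes \<phi> :: "'a::euclidean_space \<Rightarrow> real"
  assumes \<phi>: "\<phi> \<in> C1_c \<Omega>" and R: "0 \<le> R" and z: "\<phi> (x + R *\<^sub>R z) = 0"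
  shows "ennreal \<bar>\<phi> x\<bar> \<le> ennreal (norm z) * (\<integral>\<^sup>+ t. ennreal (norm (gradient \<phi> (x + t *\<^sub>R z))) * indicator {0..R} t \<partial>lborel)"
proof -
  let ?h = "\<lambda>t. z \<bullet> gradient \<phi> (x + t *\<^sub>R z)"
  have gc: "continuous_on UNIV (\<lambda>t. gradient \<phi> (x + t *\<^sub>R z))"
    by (intro continuous_on_compose2[OF C1_c_gderiv(2)[OF \<phi>]] continuous_intros) auto
  then have hc: "continuous_on UNIV ?h" by (intro continuous_intros)
  have [measurable]: "(\<lambda>t. gradient \<phi> (x + t *\<^sub>R z)) \<in> borel_measurable borel" by (rule borel_measurable_continuous_onI[OF gc])
  have "(LINT t|lborel. ?h t * indicator {0..R} t) = \<phi> (x + R *\<^sub>R z) - \<phi> (x + 0 *\<^sub>R z)"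
    by (rule integral_FTC_Icc_real[OF R])
      (use gderiv_along_line[OF C1_c_gderiv(1)[OF \<phi>]] hc in \<open>auto simp: continuous_on_eq_continuous_at\<close>)
  then have "\<bar>\<phi> x\<bar> = norm (LINT t|lborel. ?h t * indicator {0..R} t)" using z by simp
  also have "ennreal (norm (LINT t|lborel. ?h t * indicator {0..R} t)) \<le> (\<integral>\<^sup>+ t. ennreal (norm (?h t * indicator {0..R} t)) \<partial>lborel)"
  proof (rule integral_norm_bound_ennreal)
    have "integrable lborel (\<lambda>t. indicator {0..R} t *\<^sub>R ?h t)"
      by (rule borel_integrable_compact[OF _ continuous_on_subset[OF hc]]) auto
    then show "integrable lborel (\<lambda>t. ?h t * indicator {0..R} t)" by (simp add: mult.commute)
  qed
  finally have "ennreal \<bar>\<phi> x\<bar> \<le> (\<integral>\<^sup>+ t. ennreal (norm (?h t * indicator {0..R} t)) \<partial>lborel)" .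
  also have "\<dots> \<le> (\<integral>\<^sup>+ t. ennreal (norm z) * (ennreal (norm (gradient \<phi> (x + t *\<^sub>R z))) * indicator {0..R} t) \<partial>lborel)"
    using Cauchy_Schwarz_ineq2[of z] by (intro nn_integral_mono) (auto simp: indicator_def simp flip: ennreal_mult intro!: ennreal_leI)
  also have "\<dots> = ennreal (norm z) * (\<integral>\<^sup>+ t. ennreal (norm (gradient \<phi> (x + t *\<^sub>R z))) * indicator {0..R} t \<partial>lborel)"
    by (rule nn_integral_cmult) measurable
  finally show ?thesis .
qed

lemma nn_integral_powr_finite:
  fixes e R :: real
  assumes "-1 < e" "0 \<le> R"
  shows "(\<integral>\<^sup>+ t. ennreal (t powr e) * indicator {0..R} t \<partial>lborel) < \<infinity>"
proof -
  have "((\<lambda>t. t powr e) has_integral (R powr (e + 1) / (e + 1))) {0..R}"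
    by (rule has_integral_powr_from_0) (use assms in auto)
  from nn_integral_has_integral_lebesgue'[OF _ this]
  have "(\<integral>\<^sup>+ t. ennreal (t powr e) * indicator {0..R} t \<partial>lborel) = ennreal (R powr (e + 1) / (e + 1))"
    by simp
  then show ?thesis by simp
qed

text \<open>The pointwise inequality behind the estimate. With \<open>K = G\<^sup>q\<^sup>-\<^sup>1 t\<^sup>-\<^sup>\<theta>\<close> either \<open>s \<le> K\<close> or \<open>s \<le> K\<^sup>1\<^sup>-\<^sup>p s\<^sup>p\<close>; the power \<open>G\<^sup>q\<^sup>\<alpha>\<close> that
remains in front of \<open>s\<^sup>p\<close> is sublinear in \<open>G\<^sup>q\<close> and is bounded by an affine function of \<open>t\<^sup>N G\<^sup>q\<close>. The factor \<open>t\<^sup>N\<close> is later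
cancelled by averaging over a region of size \<open>t\<close>.\<close>

lemma potential_young:
  fixes G s t q p \<theta> N :: real
  assumes G: "0 \<le> G" and s: "0 \<le> s" and t: "0 < t" and q: "1 \<le> q" and p: "1 < p"
    and \<delta>: "0 \<le> 1 - (q - 1) * (p - 1)"
  defines "\<alpha> \<equiv> (1 - (q - 1) * (p - 1)) / q"
  shows "G * s \<le> t powr (-\<theta>) * G powr q + t powr (\<theta> * (p - 1) - N * \<alpha>) * (1 + t powr N * G powr q) * s powr p"
proof (cases "G = 0 \<or> s = 0")
  case True
  then show ?thesis using G s by (auto intro!: add_nonneg_nonneg mult_nonneg_nonneg)
next
  case False
  then have G: "0 < G" and s: "0 < s" using assms by auto
  define K where "K = G powr (q - 1) * t powr (-\<theta>)"
  have K: "0 < K" using G t by (simp add: K_def)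
  have "s \<le> K + K powr (1 - p) * s powr p"
  proof (cases "s \<le> K")
    case True
    then show ?thesis by (simp add: add_increasing2)
  next
    case False
    have "s = s powr (1 - p) * s powr p" using s by (simp flip: powr_add)
    also have "\<dots> \<le> K powr (1 - p) * s powr p" using False K p by (intro mult_right_mono powr_mono2') auto
    finally show ?thesis using K by simp
  qed
  then have "G * s \<le> G * K + G * K powr (1 - p) * s powr p"
    using G by (metis distrib_left mult.assoc mult_left_mono less_imp_le)
  also have "G * K = t powr (-\<theta>) * G powr q" using G by (simp add: K_def powr_diff)
  also have "G * K powr (1 - p) = t powr (\<theta> * (p - 1)) * G powr (q * \<alpha>)"
  proof -
    have "K powr (1 - p) = G powr ((q - 1) * (1 - p)) * t powr (\<theta> * (p - 1))"
      unfolding K_def using G t by (simp add: powr_mult powr_powr algebra_simps)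
    moreover have "G * G powr ((q - 1) * (1 - p)) = G powr (q * \<alpha>)"
    proof -
      have "q * \<alpha> = 1 - (q - 1) * (p - 1)" unfolding \<alpha>_def using q by simp
      also have "\<dots> = 1 + (q - 1) * (1 - p)" by (simp add: algebra_simps)
      finally have "q * \<alpha> = 1 + (q - 1) * (1 - p)" .
      then have "G powr (q * \<alpha>) = G powr 1 * G powr ((q - 1) * (1 - p))" by (simp only: powr_add)
      then show ?thesis using G by simp
    qed
    ultimately show ?thesis by (simp add: mult.assoc mult.left_commute)
  qed
  also have "G powr (q * \<alpha>) \<le> t powr (- (N * \<alpha>)) * (1 + t powr N * G powr q)"
  proof -
    let ?y = "t powr N * G powr q"
    have \<alpha>: "0 \<le> \<alpha>" "\<alpha> \<le> 1"
    proof -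
      show "0 \<le> \<alpha>" unfolding \<alpha>_def using \<delta> q by simp
      have "1 - (q - 1) * (p - 1) \<le> 1" using q p by simp
      then show "\<alpha> \<le> 1" unfolding \<alpha>_def using q by (simp add: divide_le_eq)
    qed
    have y: "0 < ?y" using t G by simp
    have "?y powr \<alpha> \<le> 1 + ?y"
    proof (cases "?y \<le> 1")
      case True
      then have "?y powr \<alpha> \<le> 1" using y \<alpha> by (intro powr_le1) auto
      then show ?thesis using y by linarith
    next
      case False
      then have "?y powr \<alpha> \<le> ?y powr 1" using \<alpha> by (intro powr_mono) auto
      then show ?thesis using y by simp
    qed
    moreover have "?y powr \<alpha> = t powr (N * \<alpha>) * G powr (q * \<alpha>)" using t G by (simp add: powr_mult powr_powr)
    ultimately have "t powr (- (N * \<alpha>)) * (t powr (N * \<alpha>) * G powr (q * \<alpha>)) \<le> t powr (- (N * \<alpha>)) * (1 + ?y)"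
      by (intro mult_left_mono) auto
    moreover have "t powr (- (N * \<alpha>)) * (t powr (N * \<alpha>) * G powr (q * \<alpha>)) = G powr (q * \<alpha>)"
      using t by (simp flip: mult.assoc powr_add)
    ultimately show ?thesis by simp
  qed
  then have "t powr (-\<theta>) * G powr q + t powr (\<theta> * (p - 1)) * G powr (q * \<alpha>) * s powr p
     \<le> t powr (-\<theta>) * G powr q + t powr (\<theta> * (p - 1)) * (t powr (- (N * \<alpha>)) * (1 + t powr N * G powr q)) * s powr p"
    by (intro add_left_mono mult_right_mono mult_left_mono) auto
  also have "t powr (\<theta> * (p - 1)) * (t powr (- (N * \<alpha>)) * (1 + t powr N * G powr q)) = t powr (\<theta> * (p - 1) - N * \<alpha>) * (1 + t powr N * G powr q)"
    by (simp flip: mult.assoc powr_add)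
  finally show ?thesis .
qed


text \<open>Bound \<open>|\<phi>(x)|\<close> by the integral of \<open>|\<nabla>\<phi>|\<close> along the segment from \<open>x\<close> to \<open>x + R z\<close>, which ends outside \<open>\<Omega>\<close>, and average
over \<open>z\<close> in a ball \<open>Z\<close> that avoids the origin. At parameter \<open>t\<close> the average over \<open>z\<close> sees a region of volume \<open>t\<^sup>N\<close>, so
\<open>\<integral>\<^sub>Z |\<nabla>\<phi>(x + t z)|\<^sup>p dz\<close> is at most \<open>t\<^sup>-\<^sup>N\<close> times the energy. The remaining integral over \<open>t\<close> near zero is finite exactly
because of the condition relating the dimension, \<open>p\<close> and \<open>q\<close>; it is met by \<open>q = 1\<close> when \<open>p > N\<close> and by every
\<open>q > 1\<close> with \<open>(q - 1) (p - 1) \<le> 1\<close> when \<open>p = N\<close>.\<close>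

lemma potential_estimate:
  fixes \<Omega> :: "'a::euclidean_space set" and g :: "'a \<Rightarrow> real"
  assumes "bounded \<Omega>" and g[measurable]: "g \<in> borel_measurable borel"
    and q: "1 \<le> q" and p: "1 < p" and \<delta>: "0 \<le> 1 - (q - 1) * (p - 1)"
    and dim: "real DIM('a) * (1 - (q - 1) * (p - 1)) < p * q"
    and gq: "(\<integral>\<^sup>+ x. ennreal (\<bar>g x\<bar> powr q) \<partial>lborel) < \<infinity>"
  obtains C where "0 \<le> C" "\<And>\<phi>. \<phi> \<in> C1_c \<Omega> \<Longrightarrow>
    (\<integral>\<^sup>+ x. ennreal \<bar>g x * \<phi> x\<bar> \<partial>lborel) \<le> ennreal C * (1 + (\<integral>\<^sup>+ x. ennreal (norm (gradient \<phi> x) powr p) \<partial>lborel))"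
proof -
  define N where "N = real DIM('a)"
  define \<alpha> where "\<alpha> = (1 - (q - 1) * (p - 1)) / q"
  have N\<alpha>: "N * \<alpha> < p" using dim q by (simp add: \<alpha>_def N_def divide_less_eq)
  \<comment> \<open>Both powers of \<open>t\<close> must be integrable at zero, so \<open>\<theta>\<close> lies strictly between \<open>(N \<alpha> - 1) / (p - 1)\<close> and \<open>1\<close>; take the midpoint.\<close>
  define \<theta> where "\<theta> = (1 + (N * \<alpha> - 1) / (p - 1)) / 2"
  have q1: "(N * \<alpha> - 1) / (p - 1) < 1" using N\<alpha> p by (simp add: divide_less_eq)
  then have \<theta>1: "-1 < -\<theta>" unfolding \<theta>_def by simp
  have "y < (1 + y) / 2" if "y < 1" for y :: real using that by simp
  from this[OF q1] have "(N * \<alpha> - 1) / (p - 1) < \<theta>" unfolding \<theta>_def .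
  then have \<theta>2: "-1 < \<theta> * (p - 1) - N * \<alpha>" using p by (simp add: divide_less_eq)
  define e2 where "e2 = \<theta> * (p - 1) - N * \<alpha>"
  obtain r where r: "0 < r" "\<And>x. x \<in> \<Omega> \<Longrightarrow> norm x < r"
    using \<open>bounded \<Omega>\<close> bounded_pos_less by blast
  \<comment> \<open>Directions in \<open>Z\<close> have length at least one, so a step \<open>R z\<close> leaves the ball of radius \<open>r\<close> that contains \<open>\<Omega>\<close>.\<close>
  define R where "R = 2 * r"
  have R: "0 < R" using r by (simp add: R_def)
  obtain e :: 'a where e: "e \<in> Basis" using nonempty_Basis by blast
  define Z where "Z = cball (2 *\<^sub>R e) (1::real)"
  have [measurable]: "Z \<in> sets borel" by (simp add: Z_def)
  have Z: "1 \<le> norm z" "norm z \<le> 3" if "z \<in> Z" for z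
  proof -
    have "norm (2 *\<^sub>R e - z) \<le> 1" using that by (simp add: Z_def dist_norm)
    moreover have "norm (2 *\<^sub>R e) = 2" using e by simp
    ultimately show "1 \<le> norm z" "norm z \<le> 3"
      using norm_triangle_ineq2[of "2 *\<^sub>R e" z] norm_triangle_ineq2[of z "2 *\<^sub>R e"] by (auto simp: norm_minus_commute)
  qed
  define c where "c = measure lborel Z"
  have c: "emeasure lborel Z = ennreal c" "0 < c"
  proof -
    show "emeasure lborel Z = ennreal c" unfolding c_def Z_def
      by (rule emeasure_eq_ennreal_measure) (use emeasure_lborel_cball_finite[of "2 *\<^sub>R e" 1] in auto)
    show "0 < c" unfolding c_def Z_def by (simp add: content_cball_pos)
  qed
  define F where "F x = \<bar>g x\<bar> powr q" for x
  have Fm[measurable]: "F \<in> borel_measurable borel" unfolding F_def by measurable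
  obtain A where A: "(\<integral>\<^sup>+ x. ennreal (F x) \<partial>lborel) = ennreal A" "0 \<le> A"
    using gq unfolding F_def by (cases "\<integral>\<^sup>+ x. ennreal (\<bar>g x\<bar> powr q) \<partial>lborel" rule: ennreal_cases) auto
  obtain K1 where K1: "(\<integral>\<^sup>+ t. ennreal (t powr (-\<theta>)) * indicator {0..R} t \<partial>lborel) = ennreal K1" "0 \<le> K1"
    using nn_integral_powr_finite[OF \<theta>1, of R] R
    by (cases "\<integral>\<^sup>+ t. ennreal (t powr (-\<theta>)) * indicator {0..R} t \<partial>lborel" rule: ennreal_cases) auto
  obtain K2 where K2: "(\<integral>\<^sup>+ t. ennreal (t powr e2) * indicator {0..R} t \<partial>lborel) = ennreal K2" "0 \<le> K2"
    using nn_integral_powr_finite[OF \<theta>2, of R] R unfolding e2_def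
    by (cases "\<integral>\<^sup>+ t. ennreal (t powr (\<theta> * (p - 1) - N * \<alpha>)) * indicator {0..R} t \<partial>lborel" rule: ennreal_cases) auto
  define C where "C = 3 * (K1 * (c * A) + K2 * (c + A)) / c"
  have C0: "0 \<le> C" using K1 K2 A c by (simp add: C_def)
  show thesis
  proof (rule that[OF C0])
    fix \<phi> :: "'a \<Rightarrow> real" assume \<phi>: "\<phi> \<in> C1_c \<Omega>"
    define s where "s y = norm (gradient \<phi> y)" for y
    have [measurable]: "\<phi> \<in> borel_measurable borel" "gradient \<phi> \<in> borel_measurable borel"
      by (rule borel_measurable_continuous_onI[OF C1_c_continuous[OF \<phi>]], rule borel_measurable_continuous_onI[OF C1_c_gderiv(2)[OF \<phi>]])
    have sm[measurable]: "s \<in> borel_measurable borel" unfolding s_def by measurable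
    define P where "P = (\<integral>\<^sup>+ y. ennreal (s y powr p) \<partial>lborel)"
    define H where "H x z t = ennreal (\<bar>g x\<bar> * s (x + t *\<^sub>R z)) * indicator Z z * indicator {0..R} t" for x z and t :: real
    have line: "ennreal \<bar>\<phi> x\<bar> * indicator Z z \<le> 3 * (\<integral>\<^sup>+ t. ennreal (s (x + t *\<^sub>R z)) * indicator {0..R} t \<partial>lborel) * indicator Z z" for x z
    proof (cases "z \<in> Z \<and> x \<in> \<Omega>")
      case True
      have "\<phi> (x + R *\<^sub>R z) = 0"
      proof -
        have "R * 1 \<le> R * norm z" using Z(1)[of z] True R by (intro mult_left_mono) auto
        then have "R \<le> norm (R *\<^sub>R z)" using R by simp
        then have "r \<le> norm (x + R *\<^sub>R z)"
          using r(2)[of x] True norm_triangle_ineq4[of "x + R *\<^sub>R z" x] unfolding R_def by simp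
        then have "x + R *\<^sub>R z \<notin> \<Omega>" using r(2) by force
        then show ?thesis using C1_c_support[OF \<phi>] by (metis subsetD)
      qed
      from C1_c_line_bound[OF \<phi> less_imp_le[OF R] this]
      have "ennreal \<bar>\<phi> x\<bar> \<le> ennreal (norm z) * (\<integral>\<^sup>+ t. ennreal (s (x + t *\<^sub>R z)) * indicator {0..R} t \<partial>lborel)" unfolding s_def .
      also have "\<dots> \<le> ennreal 3 * (\<integral>\<^sup>+ t. ennreal (s (x + t *\<^sub>R z)) * indicator {0..R} t \<partial>lborel)"
        using Z(2)[of z] True by (intro mult_right_mono ennreal_leI) auto
      finally show ?thesis using True by simp
    next
      case False
      moreover have "\<phi> x = 0" if "x \<notin> \<Omega>" using C1_c_support[OF \<phi>] that by (metis subsetD)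
      ultimately show ?thesis by (cases "z \<in> Z") auto
    qed
    have xz: "(\<integral>\<^sup>+ z. ennreal (s (x + t *\<^sub>R z) powr p) * indicator Z z \<partial>lborel) \<le> ennreal (t powr (-N)) * P" if "0 < t" for x t
    proof -
      have "P = ennreal (\<bar>t\<bar> ^ DIM('a)) * (\<integral>\<^sup>+ z. ennreal (s (x + t *\<^sub>R z) powr p) \<partial>lborel)"
        unfolding P_def using that by (intro nn_integral_lborel_affine) auto
      then have "ennreal (t powr (-N)) * P = ennreal (t powr (-N)) * ennreal (t powr N) * (\<integral>\<^sup>+ z. ennreal (s (x + t *\<^sub>R z) powr p) \<partial>lborel)"
        using that by (simp add: N_def powr_realpow mult.assoc)
      also have "ennreal (t powr (-N)) * ennreal (t powr N) = 1"
        using that by (simp flip: ennreal_mult powr_add)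
      finally have "ennreal (t powr (-N)) * P = (\<integral>\<^sup>+ z. ennreal (s (x + t *\<^sub>R z) powr p) \<partial>lborel)" by simp
      moreover have "(\<integral>\<^sup>+ z. ennreal (s (x + t *\<^sub>R z) powr p) * indicator Z z \<partial>lborel) \<le> (\<integral>\<^sup>+ z. ennreal (s (x + t *\<^sub>R z) powr p) \<partial>lborel)"
        by (intro nn_integral_mono) (simp add: indicator_def)
      ultimately show ?thesis by simp
    qed
    have tr: "(\<integral>\<^sup>+ x. ennreal (s (x + t *\<^sub>R z) powr p) \<partial>lborel) = P" for t z
      unfolding P_def using nn_integral_lborel_affine[of "\<lambda>y. ennreal (s y powr p)" 1 "t *\<^sub>R z"] by (simp add: add.commute)
    have slice: "(\<integral>\<^sup>+ x. \<integral>\<^sup>+ z. H x z t \<partial>lborel \<partial>lborel)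
      \<le> (ennreal (t powr (-\<theta>)) * indicator {0..R} t) * ennreal (c * A) + (ennreal (t powr e2) * indicator {0..R} t) * (ennreal (c + A) * P)" if t: "t \<noteq> 0" for t
    proof (cases "t \<in> {0..R}")
      case False
      then show ?thesis by (simp add: H_def)
    next
      case True
      with t have tp: "0 < t" by simp
      let ?B = "\<lambda>x z. ennreal (t powr (-\<theta>)) * ennreal (F x) * indicator Z z
           + ennreal (t powr e2) * (ennreal (s (x + t *\<^sub>R z) powr p) * indicator Z z)
           + ennreal (t powr e2) * (ennreal (t powr N) * ennreal (F x)) * (ennreal (s (x + t *\<^sub>R z) powr p) * indicator Z z)"
      have H: "H x z t \<le> ?B x z" for x z
      proof (cases "z \<in> Z")
        case True
        have "\<bar>g x\<bar> * s (x + t *\<^sub>R z) \<le> t powr (-\<theta>) * F x + t powr e2 * (1 + t powr N * F x) * s (x + t *\<^sub>R z) powr p"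
          unfolding F_def e2_def \<alpha>_def by (rule potential_young) (use tp q p \<delta> in \<open>auto simp: s_def\<close>)
        also have "\<dots> = t powr (-\<theta>) * F x + t powr e2 * s (x + t *\<^sub>R z) powr p + t powr e2 * (t powr N * F x) * s (x + t *\<^sub>R z) powr p"
          by (simp add: algebra_simps)
        finally have "ennreal (\<bar>g x\<bar> * s (x + t *\<^sub>R z)) \<le> ennreal (t powr (-\<theta>) * F x + t powr e2 * s (x + t *\<^sub>R z) powr p + t powr e2 * (t powr N * F x) * s (x + t *\<^sub>R z) powr p)"
          by (rule ennreal_leI)
        also have "\<dots> = ?B x z" using True by (simp add: F_def ennreal_mult ennreal_plus)
        finally show ?thesis using True \<open>t \<in> {0..R}\<close> by (simp add: H_def)
      qed (simp add: H_def)
      have "(\<integral>\<^sup>+ x. \<integral>\<^sup>+ z. H x z t \<partial>lborel \<partial>lborel) \<le> (\<integral>\<^sup>+ x. \<integral>\<^sup>+ z. ?B x z \<partial>lborel \<partial>lborel)"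
        by (intro nn_integral_mono H)
      also have "\<dots> = (\<integral>\<^sup>+ x. ennreal (t powr (-\<theta>)) * ennreal (F x) * ennreal c
           + ennreal (t powr e2) * (\<integral>\<^sup>+ z. ennreal (s (x + t *\<^sub>R z) powr p) * indicator Z z \<partial>lborel)
           + ennreal (t powr e2) * (ennreal (t powr N) * ennreal (F x)) * (\<integral>\<^sup>+ z. ennreal (s (x + t *\<^sub>R z) powr p) * indicator Z z \<partial>lborel) \<partial>lborel)"
        by (intro nn_integral_cong) (simp add: nn_integral_add nn_integral_cmult c(1))
      also have "\<dots> \<le> (\<integral>\<^sup>+ x. ennreal (t powr (-\<theta>)) * ennreal (F x) * ennreal c
           + ennreal (t powr e2) * (\<integral>\<^sup>+ z. ennreal (s (x + t *\<^sub>R z) powr p) * indicator Z z \<partial>lborel)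
           + ennreal (t powr e2) * (ennreal (t powr N) * ennreal (F x)) * (ennreal (t powr (-N)) * P) \<partial>lborel)"
        by (intro nn_integral_mono add_left_mono mult_left_mono xz tp) auto
      also have "\<dots> = ennreal (t powr (-\<theta>)) * ennreal A * ennreal c
           + ennreal (t powr e2) * (\<integral>\<^sup>+ x. \<integral>\<^sup>+ z. ennreal (s (x + t *\<^sub>R z) powr p) * indicator Z z \<partial>lborel \<partial>lborel)
           + ennreal (t powr e2) * (ennreal (t powr N) * ennreal A) * (ennreal (t powr (-N)) * P)"
        by (simp add: nn_integral_add nn_integral_cmult nn_integral_multc A(1))
      also have "(\<integral>\<^sup>+ x. \<integral>\<^sup>+ z. ennreal (s (x + t *\<^sub>R z) powr p) * indicator Z z \<partial>lborel \<partial>lborel)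
          = (\<integral>\<^sup>+ z. \<integral>\<^sup>+ x. ennreal (s (x + t *\<^sub>R z) powr p) * indicator Z z \<partial>lborel \<partial>lborel)"
        by (rule lborel_pair.Fubini'[symmetric]) measurable
      also have "\<dots> = (\<integral>\<^sup>+ z. P * indicator Z z \<partial>lborel)" by (simp add: nn_integral_multc tr)
      also have "\<dots> = P * ennreal c" by (simp add: nn_integral_cmult c(1))
      also have "ennreal (t powr e2) * (ennreal (t powr N) * ennreal A) * (ennreal (t powr (-N)) * P)
          = ennreal (t powr e2) * (ennreal (t powr N) * ennreal (t powr (-N))) * (ennreal A * P)"
        by (simp only: ac_simps)
      also have "ennreal (t powr N) * ennreal (t powr (-N)) = 1" using tp by (simp flip: ennreal_mult powr_add)
      also have "ennreal (t powr (-\<theta>)) * ennreal A * ennreal c + ennreal (t powr e2) * (P * ennreal c) + ennreal (t powr e2) * 1 * (ennreal A * P)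
         = ennreal (t powr (-\<theta>)) * ennreal (c * A) + ennreal (t powr e2) * (ennreal (c + A) * P)"
        using c A by (simp add: ennreal_mult ennreal_plus distrib_left distrib_right ac_simps)
      finally show ?thesis using True by simp
    qed
    have gm: "(\<integral>\<^sup>+ x. ennreal \<bar>g x * \<phi> x\<bar> \<partial>lborel) * ennreal c = (\<integral>\<^sup>+ x. \<integral>\<^sup>+ z. ennreal \<bar>g x * \<phi> x\<bar> * indicator Z z \<partial>lborel \<partial>lborel)"
      by (simp add: nn_integral_cmult c(1) nn_integral_multc)
    also have "\<dots> \<le> (\<integral>\<^sup>+ x. \<integral>\<^sup>+ z. 3 * (\<integral>\<^sup>+ t. H x z t \<partial>lborel) \<partial>lborel \<partial>lborel)"
    proof (intro nn_integral_mono)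
      fix x z
      have "ennreal \<bar>g x * \<phi> x\<bar> * indicator Z z = ennreal \<bar>g x\<bar> * (ennreal \<bar>\<phi> x\<bar> * indicator Z z)"
        by (simp add: abs_mult ennreal_mult mult.assoc)
      also have "\<dots> \<le> ennreal \<bar>g x\<bar> * (3 * (\<integral>\<^sup>+ t. ennreal (s (x + t *\<^sub>R z)) * indicator {0..R} t \<partial>lborel) * indicator Z z)"
        by (intro mult_left_mono line) simp
      also have "\<dots> = 3 * ((ennreal \<bar>g x\<bar> * indicator Z z) * (\<integral>\<^sup>+ t. ennreal (s (x + t *\<^sub>R z)) * indicator {0..R} t \<partial>lborel))"
        by (simp only: ac_simps)
      also have "(ennreal \<bar>g x\<bar> * indicator Z z) * (\<integral>\<^sup>+ t. ennreal (s (x + t *\<^sub>R z)) * indicator {0..R} t \<partial>lborel)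
         = (\<integral>\<^sup>+ t. (ennreal \<bar>g x\<bar> * indicator Z z) * (ennreal (s (x + t *\<^sub>R z)) * indicator {0..R} t) \<partial>lborel)"
        by (rule nn_integral_cmult[symmetric]) measurable
      also have "\<dots> = (\<integral>\<^sup>+ t. H x z t \<partial>lborel)"
        by (intro nn_integral_cong) (simp add: H_def ennreal_mult s_def ac_simps)
      finally show "ennreal \<bar>g x * \<phi> x\<bar> * indicator Z z \<le> 3 * (\<integral>\<^sup>+ t. H x z t \<partial>lborel)" .
    qed
    also have "\<dots> = 3 * (\<integral>\<^sup>+ x. \<integral>\<^sup>+ z. \<integral>\<^sup>+ t. H x z t \<partial>lborel \<partial>lborel \<partial>lborel)"
      unfolding H_def by (simp add: nn_integral_cmult)
    also have "(\<integral>\<^sup>+ x. \<integral>\<^sup>+ z. \<integral>\<^sup>+ t. H x z t \<partial>lborel \<partial>lborel \<partial>lborel) = (\<integral>\<^sup>+ x. \<integral>\<^sup>+ t. \<integral>\<^sup>+ z. H x z t \<partial>lborel \<partial>lborel \<partial>lborel)"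
      unfolding H_def by (intro nn_integral_cong lborel_pair.Fubini'[symmetric]) measurable
    also have "\<dots> = (\<integral>\<^sup>+ t. \<integral>\<^sup>+ x. \<integral>\<^sup>+ z. H x z t \<partial>lborel \<partial>lborel \<partial>lborel)"
      unfolding H_def by (rule lborel_pair.Fubini'[symmetric]) measurable
    also have "\<dots> \<le> (\<integral>\<^sup>+ t. (ennreal (t powr (-\<theta>)) * indicator {0..R} t) * ennreal (c * A) + (ennreal (t powr e2) * indicator {0..R} t) * (ennreal (c + A) * P) \<partial>lborel)"
      by (intro nn_integral_mono_AE eventually_mono[OF AE_lborel_singleton[of 0]]) (use slice in auto)
    also have "\<dots> = ennreal K1 * ennreal (c * A) + ennreal K2 * (ennreal (c + A) * P)"
      by (simp add: nn_integral_add nn_integral_multc K1(1) K2(1))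
    also have "\<dots> \<le> ennreal (K1 * (c * A) + K2 * (c + A)) * (1 + P)"
    proof -
      have "ennreal K1 * ennreal (c * A) + ennreal K2 * (ennreal (c + A) * P) = ennreal (K1 * (c * A)) * 1 + ennreal (K2 * (c + A)) * P"
        using K1 K2 c A by (simp add: ennreal_mult mult.assoc)
      also have "\<dots> \<le> ennreal (K1 * (c * A) + K2 * (c + A)) * 1 + ennreal (K1 * (c * A) + K2 * (c + A)) * P"
        using K1 K2 c A by (intro add_mono mult_right_mono ennreal_leI) auto
      finally show ?thesis by (simp add: distrib_left)
    qed
    finally have "(\<integral>\<^sup>+ x. ennreal \<bar>g x * \<phi> x\<bar> \<partial>lborel) * ennreal c \<le> 3 * (ennreal (K1 * (c * A) + K2 * (c + A)) * (1 + P))"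
      by (simp add: mult_left_mono)
    then have "(\<integral>\<^sup>+ x. ennreal \<bar>g x * \<phi> x\<bar> \<partial>lborel) * ennreal c * ennreal (1 / c) \<le> 3 * (ennreal (K1 * (c * A) + K2 * (c + A)) * (1 + P)) * ennreal (1 / c)"
      by (rule mult_right_mono) simp
    moreover have "ennreal c * ennreal (1 / c) = 1" using c(2) by (simp flip: ennreal_mult)
    moreover have "3 * (ennreal (K1 * (c * A) + K2 * (c + A)) * (1 + P)) * ennreal (1 / c) = ennreal C * (1 + P)"
    proof -
      have "ennreal C = ennreal 3 * ennreal (K1 * (c * A) + K2 * (c + A)) * ennreal (1 / c)"
      proof -
        have "0 \<le> K1 * (c * A) + K2 * (c + A)" using K1 K2 c A by simp
        then have "ennreal 3 * ennreal (K1 * (c * A) + K2 * (c + A)) = ennreal (3 * (K1 * (c * A) + K2 * (c + A)))"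
          by (intro ennreal_mult[symmetric]) auto
        also have "\<dots> * ennreal (1 / c) = ennreal (3 * (K1 * (c * A) + K2 * (c + A)) * (1 / c))"
          using K1 K2 c A by (intro ennreal_mult[symmetric]) auto
        also have "\<dots> = ennreal C" by (simp add: C_def)
        finally show ?thesis by (rule sym)
      qed
      then show ?thesis by (simp add: ac_simps)
    qed
    ultimately have "(\<integral>\<^sup>+ x. ennreal \<bar>g x * \<phi> x\<bar> \<partial>lborel) \<le> ennreal C * (1 + P)" by (simp add: mult.assoc)
    then show "(\<integral>\<^sup>+ x. ennreal \<bar>g x * \<phi> x\<bar> \<partial>lborel) \<le> ennreal C * (1 + (\<integral>\<^sup>+ x. ennreal (norm (gradient \<phi> x) powr p) \<partial>lborel))"
      unfolding P_def s_def .
  qed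
qed

context dirichlet_domain
begin

theorem Lq_dual_weight:
  assumes f: "f \<in> borel_measurable M" and fq: "integrable M (\<lambda>x. \<bar>f x\<bar> powr q)"
    and q: "1 \<le> q" and \<delta>: "0 \<le> 1 - (q - 1) * (p - 1)" and dim: "real DIM('a) * (1 - (q - 1) * (p - 1)) < p * q"
  shows "dual_weight f"
proof -
  have sO: "\<Omega> \<in> sets lebesgue" using open_\<Omega> by simp
  let ?f = "\<lambda>x. if x \<in> \<Omega> then f x else 0"
  have "?f \<in> borel_measurable lebesgue" using borel_measurable_if_I[OF f sO] .
  then obtain g where g[measurable]: "g \<in> borel_measurable lborel" and ae: "AE x in lborel. ?f x = g x"
    using completion_ex_borel_measurable_real by blast
  have gb[measurable]: "g \<in> borel_measurable borel" using g by simp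
  have aeM: "AE x in M. f x = g x"
    using AE_completion[OF ae] sO by (subst AE_restrict_space_iff) (auto elim!: eventually_mono)
  have nnM: "(\<integral>\<^sup>+ x. k x \<partial>M) = (\<integral>\<^sup>+ x. k x * indicator \<Omega> x \<partial>lborel)" for k :: "'a \<Rightarrow> ennreal"
    using nn_integral_restrict_space[of \<Omega> lebesgue k] sO by (simp add: nn_integral_completion)
  have gq: "(\<integral>\<^sup>+ x. ennreal (\<bar>g x\<bar> powr q) \<partial>lborel) < \<infinity>"
  proof -
    have "(\<integral>\<^sup>+ x. ennreal (\<bar>g x\<bar> powr q) \<partial>lborel) = (\<integral>\<^sup>+ x. ennreal (\<bar>f x\<bar> powr q) * indicator \<Omega> x \<partial>lborel)"
      by (rule nn_integral_cong_AE) (use ae in eventually_elim, auto simp: indicator_def)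
    also have "\<dots> = (\<integral>\<^sup>+ x. ennreal (\<bar>f x\<bar> powr q) \<partial>M)" by (rule nnM[symmetric])
    also have "\<dots> < \<infinity>" using fq by (simp add: integrable_iff_bounded)
    finally show ?thesis .
  qed
  obtain C where C: "0 \<le> C" "\<And>\<phi>. \<phi> \<in> C1_c \<Omega> \<Longrightarrow>
    (\<integral>\<^sup>+ x. ennreal \<bar>g x * \<phi> x\<bar> \<partial>lborel) \<le> ennreal C * (1 + (\<integral>\<^sup>+ x. ennreal (norm (gradient \<phi> x) powr p) \<partial>lborel))"
    by (rule potential_estimate[OF bounded_\<Omega> gb q p_pos(2) \<delta> dim gq]) (rule that)
  have "(\<integral>\<^sup>+ x. ennreal \<bar>f x * \<phi> x\<bar> \<partial>M) \<le> ennreal C * (1 + modular p M (gradient \<phi>))" if \<phi>: "\<phi> \<in> C1_c \<Omega>" for \<phi>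
  proof -
    have z: "\<phi> x = 0" "gradient \<phi> x = 0" if "x \<notin> \<Omega>" for x
      using C1_c_support[OF \<phi>] that by (metis subsetD)+
    have "(\<integral>\<^sup>+ x. ennreal \<bar>f x * \<phi> x\<bar> \<partial>M) = (\<integral>\<^sup>+ x. ennreal \<bar>g x * \<phi> x\<bar> \<partial>M)"
      by (rule nn_integral_cong_AE) (use aeM in eventually_elim, simp)
    also have "\<dots> = (\<integral>\<^sup>+ x. ennreal \<bar>g x * \<phi> x\<bar> \<partial>lborel)"
      unfolding nnM by (intro nn_integral_cong) (use z(1) in \<open>auto simp: indicator_def\<close>)
    also have "\<dots> \<le> ennreal C * (1 + (\<integral>\<^sup>+ x. ennreal (norm (gradient \<phi> x) powr p) \<partial>lborel))" by (rule C(2)[OF \<phi>])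
    also have "(\<integral>\<^sup>+ x. ennreal (norm (gradient \<phi> x) powr p) \<partial>lborel) = modular p M (gradient \<phi>)"
      unfolding modular_def nnM by (intro nn_integral_cong) (use z(2) in \<open>auto simp: indicator_def\<close>)
    finally show ?thesis .
  qed
  then show ?thesis unfolding dual_weight_def using f C(1) by blast
qed

end


section \<open>Interior balls of a smooth domain\<close>

lemma differentiable_at_pointwise_lipschitz:
  fixes f :: "'a::euclidean_space \<Rightarrow> 'b::euclidean_space"
  assumes "f differentiable (at x)"
  obtains L d where "0 < d" "0 \<le> L" "\<And>y. norm (y - x) < d \<Longrightarrow> norm (f y - f x) \<le> L * norm (y - x)"
proof -
  obtain f' where f': "(f has_derivative f') (at x)" using assms differentiable_def by blast
  then have bl: "bounded_linear f'" and app: "\<forall>e>0. \<exists>d>0. \<forall>y. norm (y - x) < d \<longrightarrow> norm (f y - f x - f' (y - x)) \<le> e * norm (y - x)"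
    by (auto simp: has_derivative_at_alt)
  obtain K where K: "0 < K" "\<And>h. norm (f' h) \<le> norm h * K" using bounded_linear.pos_bounded[OF bl] by blast
  obtain d where d: "0 < d" "\<And>y. norm (y - x) < d \<Longrightarrow> norm (f y - f x - f' (y - x)) \<le> 1 * norm (y - x)"
    using app zero_less_one by blast
  show thesis
  proof (rule that[of d "1 + K"])
    fix y assume y: "norm (y - x) < d"
    have "norm (f y - f x) = norm ((f y - f x - f' (y - x)) + f' (y - x))" by simp
    also have "\<dots> \<le> norm (f y - f x - f' (y - x)) + norm (f' (y - x))" by (rule norm_triangle_ineq)
    also have "\<dots> \<le> 1 * norm (y - x) + norm (y - x) * K" by (intro add_mono d(2) y K)
    finally show "norm (f y - f x) \<le> (1 + K) * norm (y - x)" by (simp add: algebra_simps)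
  qed (use d K in auto)
qed

text \<open>The gradient is differentiable at \<open>y0\<close>, hence Lipschitz at that point, and the mean value inequality applied to
\<open>g\<close> minus its linearisation gives a quadratic remainder.\<close>

lemma C_2_quadratic_remainder:
  fixes g :: "'a::euclidean_space \<Rightarrow> real"
  assumes "C_k 2 g"
  obtains D L d where "0 < d" "0 \<le> L"
    "\<And>y. norm (y - y0) < d \<Longrightarrow> \<bar>g y - g y0 - D \<bullet> (y - y0)\<bar> \<le> L * (norm (y - y0))\<^sup>2"
proof -
  have 2: "(2::nat) = Suc (Suc 0)" by simp
  have gd: "g differentiable (at x)" and pd: "\<And>i. i \<in> Basis \<Longrightarrow> (\<lambda>x. frechet_derivative g (at x) i) differentiable (at x)" for x
    using assms unfolding 2 by auto
  define D where "D x = (\<Sum>i\<in>Basis. frechet_derivative g (at x) i *\<^sub>R i)" for x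
  have gD: "(g has_derivative (\<lambda>h. D x \<bullet> h)) (at x)" for x
  proof -
    have der: "(g has_derivative frechet_derivative g (at x)) (at x)" using gd frechet_derivative_works by blast
    have lin: "linear (frechet_derivative g (at x))" using der has_derivative_linear by blast
    have "frechet_derivative g (at x) h = D x \<bullet> h" for h
    proof -
      have "frechet_derivative g (at x) h = frechet_derivative g (at x) (\<Sum>i\<in>Basis. (h \<bullet> i) *\<^sub>R i)"
        by (simp add: euclidean_representation)
      also have "\<dots> = (\<Sum>i\<in>Basis. (h \<bullet> i) *\<^sub>R frechet_derivative g (at x) i)"
        by (simp add: linear_sum[OF lin] linear_scale[OF lin])
      finally show ?thesis by (simp add: D_def inner_sum_left inner_sum_right mult.commute inner_commute)
    qed
    then have "frechet_derivative g (at x) = (\<lambda>h. D x \<bullet> h)" by (rule ext)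
    from has_derivative_eq_rhs[OF der this] show ?thesis .
  qed
  have "D differentiable (at y0)"
    unfolding D_def[abs_def]
  proof (intro differentiable_sum ballI)
    show "(\<lambda>x. frechet_derivative g (at x) i *\<^sub>R i) differentiable (at y0)" if "i \<in> Basis" for i
      using pd[OF that, of y0] bounded_linear.has_derivative[OF bounded_linear_scaleR_left]
      unfolding differentiable_def by blast
  qed simp
  then obtain L d where L: "0 < d" "0 \<le> L" "\<And>y. norm (y - y0) < d \<Longrightarrow> norm (D y - D y0) \<le> L * norm (y - y0)"
    by (rule differentiable_at_pointwise_lipschitz) (rule that)
  show thesis
  proof (rule that[OF L(1,2)])
    fix y assume y: "norm (y - y0) < d"
    let ?k = "\<lambda>z. g z - D y0 \<bullet> z"
    have "norm (?k y - ?k y0) \<le> (L * norm (y - y0)) * norm (y - y0)"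
    proof (rule differentiable_bound[of "cball y0 (norm (y - y0))" ?k "\<lambda>z h. D z \<bullet> h - D y0 \<bullet> h"])
      fix z assume z: "z \<in> cball y0 (norm (y - y0))"
      show "(?k has_derivative (\<lambda>h. D z \<bullet> h - D y0 \<bullet> h)) (at z within cball y0 (norm (y - y0)))"
        using has_derivative_at_withinI[OF gD[of z]] by (intro has_derivative_diff bounded_linear_imp_has_derivative bounded_linear_inner_right)
      have "norm (z - y0) \<le> norm (y - y0)" using z by (simp add: dist_norm norm_minus_commute)
      then have "norm (D z - D y0) \<le> L * norm (y - y0)"
        using L(3)[of z] y mult_left_mono[OF _ L(2), of "norm (z - y0)" "norm (y - y0)"] by linarith
      then show "onorm (\<lambda>h. D z \<bullet> h - D y0 \<bullet> h) \<le> L * norm (y - y0)"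
        by (intro onorm_bound)
          (auto simp: inner_diff_left[symmetric] L(2) intro!: order_trans[OF Cauchy_Schwarz_ineq2] mult_right_mono)
    qed (auto simp: dist_norm norm_minus_commute)
    then show "\<bar>g y - g y0 - D y0 \<bullet> (y - y0)\<bar> \<le> L * (norm (y - y0))\<^sup>2"
      by (simp add: inner_diff_right power2_eq_square algebra_simps)
  qed
qed

text \<open>In the local coordinates \<open>\<Omega>\<close> is the region where \<open>F(x) = x \<bullet> e - g(Px)\<close> is positive, with \<open>P\<close> the projection along \<open>e\<close>. The quadratic
lower bound \<open>F(x0 + h) \<ge> n \<bullet> h - L |h|\<^sup>2\<close> is positive on a small ball that touches \<open>x0\<close> in the direction \<open>n\<close>. The vector
\<open>n\<close> does not vanish since its component along \<open>e\<close> is one.\<close>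

lemma interior_ball:
  fixes \<Omega> :: "'a::euclidean_space set"
  assumes "open \<Omega>" "smooth_boundary \<Omega>" and x0: "x0 \<in> frontier \<Omega>"
  obtains y \<rho> where "0 < \<rho>" "ball y \<rho> \<subseteq> \<Omega>" "norm (x0 - y) = \<rho>"
proof -
  obtain r e g where r: "0 < r" and e: "norm e = 1" and g: "C_infinity g"
    and eq: "\<Omega> \<inter> ball x0 r = {x \<in> ball x0 r. x \<bullet> e > g (x - (x \<bullet> e) *\<^sub>R e)}"
  proof -
    from assms(2)[unfolded smooth_boundary_def] x0
    have "\<exists>r>0. \<exists>e g. norm e = 1 \<and> C_infinity g \<and> \<Omega> \<inter> ball x0 r = {x \<in> ball x0 r. x \<bullet> e > g (x - (x \<bullet> e) *\<^sub>R e)}"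
      by (rule bspec)
    then show thesis by (elim exE conjE) (rule that)
  qed
  define P where "P x = x - (x \<bullet> e) *\<^sub>R e" for x :: 'a
  define F where "F x = x \<bullet> e - g (P x)" for x
  have mem: "x \<in> \<Omega> \<longleftrightarrow> 0 < F x" if "norm (x - x0) < r" for x
  proof -
    have "x \<in> \<Omega> \<inter> ball x0 r \<longleftrightarrow> x \<in> {x \<in> ball x0 r. x \<bullet> e > g (x - (x \<bullet> e) *\<^sub>R e)}" by (simp only: eq)
    then show ?thesis using that by (simp add: F_def P_def dist_norm norm_minus_commute)
  qed
  have gc: "continuous_on UNIV g" using g[unfolded C_infinity_def, rule_format, of 0] by simp
  have Fc: "continuous_on UNIV F"
    unfolding F_def P_def by (intro continuous_intros continuous_on_compose2[OF gc]) auto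
  have F0: "F x0 = 0"
  proof (rule antisym)
    have "x0 \<notin> \<Omega>" using x0 \<open>open \<Omega>\<close> by (simp add: frontier_def interior_open)
    then show "F x0 \<le> 0" using mem[of x0] r by simp
    show "0 \<le> F x0"
    proof (rule ccontr)
      assume "\<not> 0 \<le> F x0"
      then have neg: "F x0 < 0" by simp
      have "open {x. F x < 0}" by (rule open_Collect_less[OF Fc continuous_on_const])
      then have "open ({x. F x < 0} \<inter> ball x0 r)" by auto
      moreover have "x0 \<in> {x. F x < 0} \<inter> ball x0 r" using neg r by simp
      moreover have "x0 \<in> closure \<Omega>" using x0 by (simp add: frontier_def)
      ultimately obtain x where "x \<in> \<Omega>" "F x < 0" "x \<in> ball x0 r"
        unfolding closure_iff_nhds_not_empty by blast
      then show False using mem[of x] by (simp add: dist_norm norm_minus_commute)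
    qed
  qed
  have "C_k 2 g" using g by (simp add: C_infinity_def)
  then obtain D L d where D: "0 < d" "0 \<le> L"
    "\<And>y. norm (y - P x0) < d \<Longrightarrow> \<bar>g y - g (P x0) - D \<bullet> (y - P x0)\<bar> \<le> L * (norm (y - P x0))\<^sup>2"
    by (rule C_2_quadratic_remainder) (rule that)
  have ee: "e \<bullet> e = 1" using e by (simp add: dot_square_norm)
  define n where "n = e - P D"
  have ne: "n \<bullet> e = 1" unfolding n_def P_def by (simp add: inner_diff_left ee)
  have n0: "0 < norm n" using ne by auto
  have nP: "n \<bullet> h = h \<bullet> e - D \<bullet> P h" for h
    unfolding n_def P_def by (simp add: inner_diff_left inner_diff_right inner_commute)
  have Ple: "norm (P h) \<le> norm h" for h
  proof -
    have "(norm (P h))\<^sup>2 = (norm h)\<^sup>2 - (h \<bullet> e)\<^sup>2"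
      unfolding P_def power2_norm_eq_inner by (simp add: inner_diff_left inner_diff_right inner_commute ee power2_eq_square)
    then have "(norm (P h))\<^sup>2 \<le> (norm h)\<^sup>2" by simp
    then show ?thesis by (rule power2_le_imp_le) simp
  qed
  have Flow: "n \<bullet> h - L * (norm h)\<^sup>2 \<le> F (x0 + h)" if "norm h < d" for h
  proof -
    have Ph: "P (x0 + h) - P x0 = P h" unfolding P_def by (simp add: inner_add_left algebra_simps)
    have "g (P (x0 + h)) - g (P x0) - D \<bullet> P h \<le> L * (norm (P h))\<^sup>2"
      using D(3)[of "P (x0 + h)"] Ple[of h] that unfolding Ph by (simp add: abs_le_iff)
    also have "\<dots> \<le> L * (norm h)\<^sup>2" using D(2) Ple[of h] by (intro mult_left_mono power_mono) auto
    finally have "g (P (x0 + h)) - g (P x0) - D \<bullet> P h \<le> L * (norm h)\<^sup>2" .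
    moreover have "F (x0 + h) = F x0 + h \<bullet> e - (g (P (x0 + h)) - g (P x0))" unfolding F_def by (simp add: inner_add_left)
    ultimately show ?thesis using nP[of h] F0 by linarith
  qed
  define \<rho> where "\<rho> = min (min r d / 3) (norm n / (2 * (L + 1)))"
  have \<rho>: "0 < \<rho>" "2 * \<rho> < r" "2 * \<rho> < d" "2 * \<rho> * (L + 1) \<le> norm n"
  proof -
    show p: "0 < \<rho>" using r D n0 by (simp add: \<rho>_def)
    have "\<rho> \<le> min r d / 3" unfolding \<rho>_def by (rule min.cobounded1)
    then show "2 * \<rho> < r" "2 * \<rho> < d" using r D(1) p by (auto simp: min_def split: if_splits)
    have "\<rho> \<le> norm n / (2 * (L + 1))" unfolding \<rho>_def by (rule min.cobounded2)
    then show "2 * \<rho> * (L + 1) \<le> norm n" using D(2) by (simp add: field_simps)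
  qed
  define y where "y = x0 + (\<rho> / norm n) *\<^sub>R n"
  show thesis
  proof (rule that[of \<rho> y])
    show "norm (x0 - y) = \<rho>" using \<rho>(1) n0 by (simp add: y_def)
    show "ball y \<rho> \<subseteq> \<Omega>"
    proof
      fix x assume x: "x \<in> ball y \<rho>"
      define h where "h = x - x0"
      have "norm (h - (\<rho> / norm n) *\<^sub>R n) < \<rho>" using x by (simp add: h_def y_def dist_norm norm_minus_commute algebra_simps)
      then have "(norm (h - (\<rho> / norm n) *\<^sub>R n))\<^sup>2 < \<rho>\<^sup>2" by (intro power_strict_mono) auto
      moreover have "(norm (h - (\<rho> / norm n) *\<^sub>R n))\<^sup>2 = (norm h)\<^sup>2 - 2 * (\<rho> / norm n) * (n \<bullet> h) + \<rho>\<^sup>2"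
      proof -
        have "(norm (h - (\<rho> / norm n) *\<^sub>R n))\<^sup>2 = (norm h)\<^sup>2 - 2 * (\<rho> / norm n) * (n \<bullet> h) + (\<rho> / norm n)\<^sup>2 * (norm n)\<^sup>2"
          unfolding power2_norm_eq_inner by (simp add: inner_diff_left inner_diff_right inner_commute power2_eq_square algebra_simps)
        moreover have "(\<rho> / norm n)\<^sup>2 * (norm n)\<^sup>2 = \<rho>\<^sup>2" using n0 by (simp add: power_divide)
        ultimately show ?thesis by simp
      qed
      ultimately have hn: "(norm h)\<^sup>2 < 2 * (\<rho> / norm n) * (n \<bullet> h)" by simp
      have hlt: "norm h < 2 * \<rho>"
      proof -
        have "norm h \<le> norm (h - (\<rho> / norm n) *\<^sub>R n) + norm ((\<rho> / norm n) *\<^sub>R n)"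
          using norm_triangle_ineq[of "h - (\<rho> / norm n) *\<^sub>R n" "(\<rho> / norm n) *\<^sub>R n"] by simp
        also have "norm ((\<rho> / norm n) *\<^sub>R n) = \<rho>" using \<rho>(1) n0 by simp
        finally show ?thesis using \<open>norm (h - (\<rho> / norm n) *\<^sub>R n) < \<rho>\<close> by simp
      qed
      have "norm n * (norm h)\<^sup>2 < 2 * \<rho> * (n \<bullet> h)" using hn n0 by (simp add: field_simps)
      moreover have "(2 * \<rho> * (L + 1)) * (norm h)\<^sup>2 \<le> norm n * (norm h)\<^sup>2" by (intro mult_right_mono \<rho>(4)) auto
      ultimately have "2 * \<rho> * ((L + 1) * (norm h)\<^sup>2) < 2 * \<rho> * (n \<bullet> h)" by (simp add: mult.assoc)
      then have "(L + 1) * (norm h)\<^sup>2 < n \<bullet> h" using \<rho>(1) by simp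
      moreover have "L * (norm h)\<^sup>2 \<le> (L + 1) * (norm h)\<^sup>2" by (intro mult_right_mono) auto
      ultimately have "0 < F (x0 + h)" using Flow[of h] hlt \<rho>(3) by linarith
      then show "x \<in> \<Omega>" using mem[of x] hlt \<rho>(2) by (simp add: h_def)
    qed
  qed (use \<rho> in auto)
qed

section \<open>The Hopf boundary lemma\<close>

lemma AE_zero_continuous:
  fixes \<psi> :: "'a::euclidean_space \<Rightarrow> real"
  assumes "open A" "continuous_on UNIV \<psi>" "AE x in lebesgue_on A. \<psi> x = 0" "x \<in> A"
  shows "\<psi> x = 0"
proof (rule ccontr)
  assume nz: "\<psi> x \<noteq> 0"
  let ?S = "A \<inter> {x. \<psi> x \<noteq> 0}"
  have "open {x. \<psi> x \<noteq> 0}" using open_Collect_neq[OF assms(2) continuous_on_const] .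
  then have oS: "open ?S" using assms(1) by (rule open_Int[rotated])
  have sA: "A \<in> sets lebesgue" using assms(1) by simp
  have "AE x in lebesgue. x \<in> A \<longrightarrow> \<psi> x = 0" using assms(3) sA by (subst (asm) AE_restrict_space_iff) auto
  then have "AE x in lebesgue. x \<notin> ?S" by eventually_elim auto
  then have "?S \<in> null_sets lebesgue" using oS by (subst AE_iff_null_sets) auto
  then have "negligible ?S" by (simp add: negligible_iff_null_sets)
  then show False using open_not_negligible[OF oS] nz assms(4) by blast
qed

lemma GDERIV_dist_powr:
  fixes x y :: "'a::euclidean_space"
  assumes "x \<noteq> y"
  shows "GDERIV (\<lambda>x. norm (x - y) powr r) x :> (r * norm (x - y) powr (r - 1)) *\<^sub>R sgn (x - y)"
proof -
  have "((\<lambda>x. x - y) has_derivative (\<lambda>h. h)) (at x)" by (auto intro!: derivative_eq_intros)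
  moreover have "(norm has_derivative (\<lambda>h. h \<bullet> sgn (x - y))) (at (x - y))"
    using GDERIV_norm[of "x - y"] assms by (simp add: gderiv_def)
  ultimately have "GDERIV (\<lambda>x. norm (x - y)) x :> sgn (x - y)"
    unfolding gderiv_def by (rule has_derivative_compose)
  moreover have "DERIV (\<lambda>s. s powr r) (norm (x - y)) :> r * norm (x - y) powr (r - 1)"
    by (rule has_real_derivative_powr) (use assms in simp)
  ultimately show ?thesis by (rule GDERIV_DERIV_compose)
qed

text \<open>The field \<open>- |x - y|\<^sup>-\<^sup>m (x - y)\<close> has divergence \<open>(m - N) |x - y|\<^sup>-\<^sup>m\<close>, which is nonnegative once \<open>m\<close> is at least the
dimension \<open>N\<close>. Such fields arise from radial barriers.\<close>

lemma radial_field_subsolution: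
  fixes y :: "'a::euclidean_space"
  assumes A: "open A" "bounded A" "y \<notin> A" and m: "real DIM('a) \<le> m" and \<psi>: "\<psi> \<in> C1_c A" and nn: "\<And>x. 0 \<le> \<psi> x"
  shows "0 \<le> (LINT x|lebesgue_on A. norm (x - y) powr (-m) * ((x - y) \<bullet> gradient \<psi> x))"
proof -
  have ne: "x \<noteq> y" if "x \<in> A" for x using A(3) that by auto
  define H where "H i x = norm (x - y) powr (-m) *\<^sub>R i + ((x - y) \<bullet> i) *\<^sub>R ((- m * norm (x - y) powr (-m - 1)) *\<^sub>R sgn (x - y))" for i x
  have der: "GDERIV (\<lambda>x. norm (x - y) powr (-m) * ((x - y) \<bullet> i)) x :> H i x" if "x \<in> A" for i x
  proof -
    have 2: "GDERIV (\<lambda>x. (x - y) \<bullet> i) x :> i"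
      unfolding gderiv_def by (auto intro!: derivative_eq_intros)
    show ?thesis unfolding H_def by (rule GDERIV_mult[OF GDERIV_dist_powr[OF ne[OF that]] 2])
  qed
  have cont: "continuous_on A (H i)" for i
    unfolding H_def sgn_div_norm using ne by (intro continuous_intros) auto
  have F: "(\<lambda>x. norm (x - y) powr (-m) * ((x - y) \<bullet> i) * \<psi> x) \<in> C1_c A"
    "\<And>x. x \<in> A \<Longrightarrow> gradient (\<lambda>x. norm (x - y) powr (-m) * ((x - y) \<bullet> i) * \<psi> x) x
      = (norm (x - y) powr (-m) * ((x - y) \<bullet> i)) *\<^sub>R gradient \<psi> x + \<psi> x *\<^sub>R H i x" for i
    using C1_c_mult_local[OF \<psi> A(1) _ cont[of i], of "\<lambda>x. norm (x - y) powr (-m) * ((x - y) \<bullet> i)"] der by auto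
  let ?k = "\<lambda>i x. norm (x - y) powr (-m) * ((x - y) \<bullet> i)"
  have pt: "(\<Sum>i\<in>Basis. i \<bullet> gradient (\<lambda>x. ?k i x * \<psi> x) x)
     = norm (x - y) powr (-m) * ((x - y) \<bullet> gradient \<psi> x) + (real DIM('a) - m) * norm (x - y) powr (-m) * \<psi> x" if x: "x \<in> A" for x
  proof -
    let ?z = "x - y"
    have z: "0 < norm ?z" using ne[OF x] by simp
    have "i \<bullet> gradient (\<lambda>x. ?k i x * \<psi> x) x = norm ?z powr (-m) * ((?z \<bullet> i) * (gradient \<psi> x \<bullet> i))
       + \<psi> x * (norm ?z powr (-m) - m * norm ?z powr (-m - 1) / norm ?z * ((?z \<bullet> i) * (?z \<bullet> i)))" if "i \<in> Basis" for i
      unfolding F(2)[OF x] H_def using that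
      by (simp add: inner_add_right sgn_div_norm inner_commute algebra_simps divide_inverse)
    then have "(\<Sum>i\<in>Basis. i \<bullet> gradient (\<lambda>x. ?k i x * \<psi> x) x)
       = norm ?z powr (-m) * (\<Sum>i\<in>Basis. (?z \<bullet> i) * (gradient \<psi> x \<bullet> i))
       + \<psi> x * (real DIM('a) * norm ?z powr (-m) - m * norm ?z powr (-m - 1) / norm ?z * (\<Sum>i\<in>Basis. (?z \<bullet> i) * (?z \<bullet> i)))"
      by (simp add: sum.distrib sum_distrib_left[symmetric] sum_subtractf sum_divide_distrib[symmetric])
    also have "(\<Sum>i\<in>Basis. (?z \<bullet> i) * (gradient \<psi> x \<bullet> i)) = ?z \<bullet> gradient \<psi> x" by (rule euclidean_inner[symmetric])
    also have "(\<Sum>i\<in>Basis. (?z \<bullet> i) * (?z \<bullet> i)) = norm ?z * norm ?z"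
      unfolding euclidean_inner[symmetric] by (simp add: dot_square_norm power2_eq_square)
    also have "m * norm ?z powr (-m - 1) / norm ?z * (norm ?z * norm ?z) = m * norm ?z powr (-m)"
      using z by (simp add: powr_diff)
    finally show ?thesis by (simp add: algebra_simps)
  qed
  have int: "integrable (lebesgue_on A) (\<lambda>x. \<Sum>i\<in>Basis. i \<bullet> gradient (\<lambda>x. ?k i x * \<psi> x) x)"
    by (intro Bochner_Integration.integrable_sum C1_c_integral_partial(1)[OF F(1) A(1)])
  have zero: "(LINT x|lebesgue_on A. (\<Sum>i\<in>Basis. i \<bullet> gradient (\<lambda>x. ?k i x * \<psi> x) x)) = 0"
    using C1_c_integral_partial[OF F(1) A(1)] by (subst Bochner_Integration.integral_sum) (auto intro!: sum.neutral)
  have i2: "integrable (lebesgue_on A) (\<lambda>x. (real DIM('a) - m) * norm (x - y) powr (-m) * \<psi> x)"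
  proof -
    have "(\<lambda>x. norm (x - y) powr (-m) * \<psi> x) \<in> C1_c A"
    proof (rule C1_c_mult_local(1)[OF \<psi> A(1)])
      show "GDERIV (\<lambda>x. norm (x - y) powr (-m)) x :> (- m * norm (x - y) powr (-m - 1)) *\<^sub>R sgn (x - y)" if "x \<in> A" for x
        by (rule GDERIV_dist_powr[OF ne[OF that]])
      show "continuous_on A (\<lambda>x. (- m * norm (x - y) powr (-m - 1)) *\<^sub>R sgn (x - y))"
        unfolding sgn_div_norm using ne by (intro continuous_intros) auto
    qed
    from integrable_mult_right[OF C1_c_integrable(1)[OF this A(1,2)], of "real DIM('a) - m"]
    show ?thesis by (simp add: mult.assoc)
  qed
  have eq: "norm (x - y) powr (-m) * ((x - y) \<bullet> gradient \<psi> x)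
     = (\<Sum>i\<in>Basis. i \<bullet> gradient (\<lambda>x. ?k i x * \<psi> x) x) - (real DIM('a) - m) * norm (x - y) powr (-m) * \<psi> x" if "x \<in> A" for x
    using pt[OF that] by simp
  have "(LINT x|lebesgue_on A. norm (x - y) powr (-m) * ((x - y) \<bullet> gradient \<psi> x))
     = (LINT x|lebesgue_on A. (\<Sum>i\<in>Basis. i \<bullet> gradient (\<lambda>x. ?k i x * \<psi> x) x) - (real DIM('a) - m) * norm (x - y) powr (-m) * \<psi> x)"
    by (rule Bochner_Integration.integral_cong[OF refl]) (use eq in auto)
  also have "\<dots> = - (LINT x|lebesgue_on A. (real DIM('a) - m) * norm (x - y) powr (-m) * \<psi> x)"
    using Bochner_Integration.integral_diff[OF int i2] zero by simp
  also have "\<dots> = (LINT x|lebesgue_on A. (m - real DIM('a)) * norm (x - y) powr (-m) * \<psi> x)"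
    by (subst Bochner_Integration.integral_minus[symmetric]) (auto intro!: Bochner_Integration.integral_cong simp: algebra_simps)
  also have "0 \<le> \<dots>" using m nn by (intro Bochner_Integration.integral_nonneg mult_nonneg_nonneg) auto
  finally show ?thesis .
qed


lemma C1_c_mono: "A \<subseteq> B \<Longrightarrow> f \<in> C1_c A \<Longrightarrow> f \<in> C1_c B"
  unfolding C1_c_def by blast

lemma continuous_compact_support_integrable:
  fixes k :: "'a::euclidean_space \<Rightarrow> 'b::euclidean_space"
  assumes "open \<Omega>" "bounded \<Omega>" and k: "continuous_on \<Omega> k" and K: "compact K" "K \<subseteq> \<Omega>" and z: "\<And>x. x \<in> \<Omega> - K \<Longrightarrow> k x = 0"
  shows "integrable (lebesgue_on \<Omega>) k"
proof -
  have "bounded (k ` K)" by (intro compact_imp_bounded compact_continuous_image continuous_on_subset[OF k] K)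
  then obtain B where B: "\<And>x. x \<in> K \<Longrightarrow> norm (k x) \<le> B" unfolding bounded_iff by blast
  have "norm (k x) \<le> \<bar>B\<bar>" if "x \<in> \<Omega>" for x
    using B[of x] z[of x] that by (cases "x \<in> K") auto
  then show ?thesis
    using continuous_imp_measurable_on_sets_lebesgue[OF k] \<open>open \<Omega>\<close>
    by (intro bounded_integrable_lebesgue_on[of _ _ "\<bar>B\<bar>"] open_bounded_lmeasurable assms AE_I2) auto
qed

lemma C1_c_local_integrable:
  assumes "open \<Omega>" "bounded \<Omega>" and \<psi>: "\<psi> \<in> C1_c \<Omega>"
  shows "continuous_on \<Omega> k \<Longrightarrow> integrable (lebesgue_on \<Omega>) (\<lambda>x. k x * \<psi> x)"
    "continuous_on \<Omega> V \<Longrightarrow> integrable (lebesgue_on \<Omega>) (\<lambda>x. V x \<bullet> gradient \<psi> x)"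
proof -
  obtain K where K: "compact K" "K \<subseteq> \<Omega>" "\<And>x. x \<notin> K \<Longrightarrow> \<psi> x = 0" "\<And>x. x \<notin> K \<Longrightarrow> gradient \<psi> x = 0"
    by (rule C1_c_support[OF \<psi>]) (rule that)
  note c = continuous_on_subset[OF C1_c_continuous[OF \<psi>] subset_UNIV] continuous_on_subset[OF C1_c_gderiv(2)[OF \<psi>] subset_UNIV]
  show "continuous_on \<Omega> k \<Longrightarrow> integrable (lebesgue_on \<Omega>) (\<lambda>x. k x * \<psi> x)"
    by (rule continuous_compact_support_integrable[OF assms(1,2) _ K(1,2)]) (use K c in \<open>auto intro!: continuous_intros\<close>)
  show "continuous_on \<Omega> V \<Longrightarrow> integrable (lebesgue_on \<Omega>) (\<lambda>x. V x \<bullet> gradient \<psi> x)"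
    by (rule continuous_compact_support_integrable[OF assms(1,2) _ K(1,2)]) (use K c in \<open>auto intro!: continuous_intros\<close>)
qed

lemma (in dirichlet_domain) plap_continuous_on: "continuous_on S V \<Longrightarrow> continuous_on S (\<lambda>x. plap p (V x :: 'a))"
  by (rule continuous_on_compose2[OF plap_continuous[OF p_ge_2]]) auto

text \<open>A positive function of class \<open>C\<^sup>1\<close> up to the boundary, with gradient \<open>G\<close>, which vanishes on the boundary and is
\<open>p\<close>-superharmonic. These are the properties of the eigenfunction that comparison with barriers uses.\<close>

locale p_superharmonic = dirichlet_domain \<Omega> p for \<Omega> :: "'a::euclidean_space set" and p +
  fixes \<phi> :: "'a \<Rightarrow> real" and G :: "'a \<Rightarrow> 'a"
  assumes dim_p: "real DIM('a) \<le> p"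
    and phi_cont: "continuous_on (closure \<Omega>) \<phi>" and G_cont: "continuous_on (closure \<Omega>) G"
    and phi_gderiv: "\<And>x. x \<in> \<Omega> \<Longrightarrow> GDERIV \<phi> x :> G x"
    and phi_pos: "\<And>x. x \<in> \<Omega> \<Longrightarrow> 0 < \<phi> x" and phi_frontier: "\<And>x. x \<in> frontier \<Omega> \<Longrightarrow> \<phi> x = 0"
    and superharmonic: "\<And>\<psi>. \<psi> \<in> C1_c \<Omega> \<Longrightarrow> (\<And>x. 0 \<le> \<psi> x) \<Longrightarrow> 0 \<le> (LINT x|lebesgue_on \<Omega>. plap p (G x) \<bullet> gradient \<psi> x)"
begin

lemma closure_cases: "x \<in> closure \<Omega> \<Longrightarrow> x \<in> \<Omega> \<or> x \<in> frontier \<Omega>"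
  using open_\<Omega> by (auto simp: frontier_def interior_open)

lemma phi_nonneg: "x \<in> closure \<Omega> \<Longrightarrow> 0 \<le> \<phi> x"
  using closure_cases phi_pos phi_frontier by (metis less_imp_le order_refl)

lemma phi_cont_\<Omega>: "continuous_on \<Omega> \<phi>" and G_cont_\<Omega>: "continuous_on \<Omega> G"
  using continuous_on_subset[OF phi_cont closure_subset] continuous_on_subset[OF G_cont closure_subset] by auto

text \<open>On the annulus between the radii \<open>\<rho>/2\<close> and \<open>\<rho>\<close>, compare with \<open>c b\<close> where \<open>b(x) = |x - y|\<^sup>-\<^sup>2 - \<rho>\<^sup>-\<^sup>2\<close>. Its \<open>p\<close>-Laplacian field is a positive multiple
of \<open>- |x - y|\<^sup>-\<^sup>m (x - y)\<close> with \<open>m = 3 p - 2\<close>, so \<open>c b\<close> is \<open>p\<close>-subharmonic. Testing with the square of \<open>(c b - \<phi> - \<epsilon>)\<^sup>+\<close>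
keeps the whole argument among classical \<open>C\<^sup>1\<close> functions with compact support in the annulus.\<close>

lemma barrier_lower_bound:
  assumes \<rho>: "0 < \<rho>" and ball: "ball y \<rho> \<subseteq> \<Omega>"
  obtains c where "0 < c"
    "\<And>x. \<rho> / 2 < norm (x - y) \<Longrightarrow> norm (x - y) < \<rho> \<Longrightarrow> c * (norm (x - y) powr (-2) - \<rho> powr (-2)) \<le> \<phi> x"
proof -
  define A where "A = ball y \<rho> - cball y (\<rho> / 2)"
  have oA: "open A" unfolding A_def by auto
  have bA: "bounded A" unfolding A_def by (rule bounded_diff) simp
  have A: "x \<in> A \<longleftrightarrow> \<rho> / 2 < norm (x - y) \<and> norm (x - y) < \<rho>" for x
    by (auto simp: A_def dist_norm norm_minus_commute)
  have AO: "A \<subseteq> \<Omega>" using ball unfolding A_def by blast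
  have yA: "y \<notin> A" using \<rho> by (simp add: A)
  have ne: "x \<noteq> y" if "x \<in> A" for x using that yA by blast
  interpret A: dirichlet_domain A p by unfold_locales (use oA bA p_ge_2 in auto)
  obtain e :: 'a where e: "norm e = 1" using nonempty_Basis norm_Basis by blast
  have sph: "sphere y (\<rho> / 2) \<subseteq> \<Omega>" using ball \<rho> by (auto simp: subset_iff)
  have "y + (\<rho> / 2) *\<^sub>R e \<in> sphere y (\<rho> / 2)" using e \<rho> by (simp add: dist_norm)
  then have "sphere y (\<rho> / 2) \<noteq> {}" by blast
  then obtain x1 where x1: "x1 \<in> sphere y (\<rho> / 2)" "\<And>x. x \<in> sphere y (\<rho> / 2) \<Longrightarrow> \<phi> x1 \<le> \<phi> x"
    using continuous_attains_inf[OF compact_sphere _ continuous_on_subset[OF phi_cont_\<Omega> sph]] by blast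
  \<comment> \<open>On the inner sphere \<open>b = 3 / \<rho>\<^sup>2\<close>, so \<open>c b\<close> equals there the minimum of \<open>\<phi>\<close>.\<close>
  define c where "c = \<phi> x1 * \<rho>\<^sup>2 / 3"
  have c: "0 < c" using x1(1) sph phi_pos \<rho> by (auto simp: c_def)
  define b where "b x = norm (x - y) powr (-2) - \<rho> powr (-2)" for x
  define B where "B x = (- 2 * norm (x - y) powr (-3)) *\<^sub>R sgn (x - y)" for x
  have bB: "GDERIV b x :> B x" if "x \<in> A" for x
    using GDERIV_diff[OF GDERIV_dist_powr[OF ne[OF that], of "-2"] GDERIV_const] unfolding b_def[abs_def] B_def by simp
  have Bc: "continuous_on A B" unfolding B_def sgn_div_norm using ne by (intro continuous_intros) auto
  have inner: "c * b x = \<phi> x1" if "norm (x - y) = \<rho> / 2" for x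
  proof -
    have p2: "z powr (-2) = 1 / z\<^sup>2" if "0 < z" for z :: real using that by (simp add: powr_minus divide_inverse)
    have "b x = 1 / (\<rho> / 2)\<^sup>2 - 1 / \<rho>\<^sup>2" using \<rho> unfolding b_def that by (simp only: p2 half_gt_zero)
    also have "\<dots> = 3 / \<rho>\<^sup>2" using \<rho> by (simp add: power_divide field_simps)
    finally show ?thesis using \<rho> by (simp add: c_def)
  qed
  have outer: "b x = 0" if "norm (x - y) = \<rho>" for x using that by (simp add: b_def)
  have cl: "cball y \<rho> \<subseteq> closure \<Omega>" using closure_mono[OF ball] \<rho> by simp
  have main: "c * b x \<le> \<phi> x + \<epsilon>" if x: "x \<in> A" and \<epsilon>: "0 < \<epsilon>" for x \<epsilon>
  proof -
    define S where "S = cball y \<rho> - ball y (\<rho> / 2)"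
    have S: "compact S" unfolding S_def by (intro compact_diff) auto
    have Sn: "x \<in> S \<longleftrightarrow> \<rho> / 2 \<le> norm (x - y) \<and> norm (x - y) \<le> \<rho>" for x
      by (auto simp: S_def dist_norm norm_minus_commute)
    have hc: "continuous_on S (\<lambda>x. c * b x - \<phi> x)"
    proof -
      have "continuous_on S \<phi>" by (rule continuous_on_subset[OF phi_cont]) (use cl in \<open>auto simp: S_def\<close>)
      moreover have "continuous_on S b" unfolding b_def by (intro continuous_intros) (use Sn \<rho> in auto)
      ultimately show ?thesis by (intro continuous_intros)
    qed
    define K where "K = S \<inter> (\<lambda>x. c * b x - \<phi> x) -` {\<epsilon>..}"
    have "closed K" unfolding K_def
      by (rule continuous_closed_preimage[OF hc compact_imp_closed[OF S] closed_atLeast])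
    then have "compact (S \<inter> K)" by (rule compact_Int_closed[OF S])
    moreover have "S \<inter> K = K" by (auto simp: K_def)
    ultimately have K: "compact K" by simp
    have KA: "K \<subseteq> A"
    proof
      fix z assume z: "z \<in> K"
      then have zS: "z \<in> S" and ze: "\<epsilon> \<le> c * b z - \<phi> z" by (auto simp: K_def)
      have "norm (z - y) \<noteq> \<rho>"
      proof
        assume "norm (z - y) = \<rho>"
        moreover have "0 \<le> \<phi> z" by (rule phi_nonneg) (use zS cl in \<open>auto simp: S_def\<close>)
        ultimately show False using outer ze \<epsilon> by simp
      qed
      moreover have "norm (z - y) \<noteq> \<rho> / 2"
      proof
        assume h: "norm (z - y) = \<rho> / 2"
        then have "\<phi> x1 \<le> \<phi> z" by (intro x1(2)) (simp add: dist_norm norm_minus_commute)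
        then show False using inner[OF h] ze \<epsilon> by simp
      qed
      ultimately show "z \<in> A" using zS Sn A by force
    qed
    let ?f = "\<lambda>x. (max (c * b x - \<phi> x - \<epsilon>) 0)\<^sup>2"
    let ?H = "\<lambda>x. (2 * max (c * b x - \<phi> x - \<epsilon>) 0) *\<^sub>R (c *\<^sub>R B x - G x)"
    have fD: "GDERIV ?f x :> ?H x" if "x \<in> A" for x
    proof -
      have "GDERIV (\<lambda>x. c * b x) x :> c *\<^sub>R B x"
        using GDERIV_DERIV_compose[OF bB[OF that], of "\<lambda>s. c * s" c] by (auto intro!: derivative_eq_intros)
      then have "GDERIV (\<lambda>x. c * b x - \<phi> x - \<epsilon>) x :> c *\<^sub>R B x - G x - 0"
        using that AO by (intro GDERIV_diff GDERIV_const phi_gderiv) auto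
      from GDERIV_DERIV_compose[OF this DERIV_max0_square] show ?thesis by simp
    qed
    have bc: "continuous_on A b" unfolding b_def by (intro continuous_intros) (use ne in auto)
    note pc = continuous_on_subset[OF phi_cont_\<Omega> AO] and gc = continuous_on_subset[OF G_cont_\<Omega> AO]
    have Hc: "continuous_on A ?H" by (intro continuous_intros bc pc gc Bc)
    have fz: "?f x = 0" if "x \<in> A - K" for x
    proof -
      have "x \<in> S" using that A Sn by auto
      then have "c * b x - \<phi> x < \<epsilon>" using that by (auto simp: K_def)
      then show ?thesis by simp
    qed
    define \<psi> where "\<psi> = (\<lambda>x. if x \<in> A then ?f x else 0)"
    have \<psi>: "\<psi> \<in> C1_c A" "\<And>x. gradient \<psi> x = (if x \<in> A then ?H x else 0)"
      unfolding \<psi>_def by (rule C1_c_extend[OF oA fD Hc K KA fz]; assumption)+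
    have \<psi>nn: "0 \<le> \<psi> x" for x by (simp add: \<psi>_def)
    have sets: "A \<in> sets lebesgue" "\<Omega> \<in> sets lebesgue" using oA open_\<Omega> by auto
    have "(LINT x|M. plap p (G x) \<bullet> gradient \<psi> x) = (LINT x|M. (if x \<in> A then plap p (G x) \<bullet> gradient \<psi> x else 0))"
      by (rule Bochner_Integration.integral_cong) (auto simp: \<psi>(2))
    also have "\<dots> = (LINT x|A.M. plap p (G x) \<bullet> gradient \<psi> x)"
      by (rule Lebesgue_Measure.integral_restrict[OF AO sets])
    finally have 1: "0 \<le> (LINT x|A.M. plap p (G x) \<bullet> gradient \<psi> x)"
      using superharmonic[OF C1_c_mono[OF AO \<psi>(1)] \<psi>nn] by simp
    have cB: "plap p (c *\<^sub>R B x) = (- ((2 * c) powr (p - 1))) *\<^sub>R (norm (x - y) powr (- (3 * p - 2)) *\<^sub>R (x - y))" if "x \<in> A" for x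
    proof -
      let ?r = "norm (x - y)"
      have r: "0 < ?r" using ne[OF that] by simp
      have "c *\<^sub>R B x = (2 * c * ?r powr (-3)) *\<^sub>R (- sgn (x - y))" by (simp add: B_def)
      moreover have "0 \<le> 2 * c * ?r powr (-3)" using c by simp
      ultimately have "plap p (c *\<^sub>R B x) = (2 * c * ?r powr (-3)) powr (p - 1) *\<^sub>R plap p (- sgn (x - y))"
        by (simp only: plap_scaleR)
      also have "plap p (- sgn (x - y)) = - sgn (x - y)" using r by (simp add: plap_def norm_sgn)
      also have "(2 * c * ?r powr (-3)) powr (p - 1) = (2 * c) powr (p - 1) * ?r powr (-3 * (p - 1))"
        using c by (simp add: powr_mult powr_powr)
      also have "sgn (x - y) = ?r powr (-1) *\<^sub>R (x - y)" using r by (simp add: sgn_div_norm powr_minus)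
      also have "((2 * c) powr (p - 1) * ?r powr (-3 * (p - 1))) *\<^sub>R (- (?r powr (-1) *\<^sub>R (x - y)))
         = (- ((2 * c) powr (p - 1))) *\<^sub>R ((?r powr (-3 * (p - 1)) * ?r powr (-1)) *\<^sub>R (x - y))" by simp
      also have "?r powr (-3 * (p - 1)) * ?r powr (-1) = ?r powr (- (3 * p - 2))"
      proof -
        have "-3 * (p - 1) + (-1) = - (3 * p - 2)" by simp
        then show ?thesis by (simp only: powr_add[symmetric])
      qed
      finally show ?thesis .
    qed
    have m: "real DIM('a) \<le> 3 * p - 2" using dim_p p_ge_2 by linarith
    note rad = radial_field_subsolution[OF oA bA yA m \<psi>(1) \<psi>nn]
    let ?k = "- ((2 * c) powr (p - 1))"
    have cBe: "plap p (c *\<^sub>R B x) \<bullet> gradient \<psi> x = ?k * (norm (x - y) powr (- (3 * p - 2)) * ((x - y) \<bullet> gradient \<psi> x))" if "x \<in> A" for x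
      unfolding cB[OF that] by simp
    have i2: "integrable A.M (\<lambda>x. plap p (c *\<^sub>R B x) \<bullet> gradient \<psi> x)"
      by (rule C1_c_local_integrable(2)[OF oA bA \<psi>(1)]) (intro A.plap_continuous_on continuous_intros Bc)
    have i1: "integrable A.M (\<lambda>x. plap p (G x) \<bullet> gradient \<psi> x)"
      by (rule C1_c_local_integrable(2)[OF oA bA \<psi>(1)]) (intro A.plap_continuous_on gc)
    have "(LINT x|A.M. plap p (c *\<^sub>R B x) \<bullet> gradient \<psi> x) = (LINT x|A.M. ?k * (norm (x - y) powr (- (3 * p - 2)) * ((x - y) \<bullet> gradient \<psi> x)))"
      by (rule Bochner_Integration.integral_cong[OF refl]) (use cBe in auto)
    also have "\<dots> = ?k * (LINT x|A.M. norm (x - y) powr (- (3 * p - 2)) * ((x - y) \<bullet> gradient \<psi> x))" by simp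
    also have "\<dots> \<le> 0" using rad by (intro mult_nonpos_nonneg) auto
    finally have 2: "(LINT x|A.M. plap p (c *\<^sub>R B x) \<bullet> gradient \<psi> x) \<le> 0" .
    let ?D = "\<lambda>x. (plap p (c *\<^sub>R B x) - plap p (G x)) \<bullet> gradient \<psi> x"
    have iD: "integrable A.M ?D" unfolding inner_diff_left by (rule Bochner_Integration.integrable_diff[OF i2 i1])
    have Dnn: "0 \<le> ?D x" for x
    proof -
      have "0 \<le> (plap p (c *\<^sub>R B x) - plap p (G x)) \<bullet> (c *\<^sub>R B x - G x)"
        by (rule order_trans[OF _ plap_uniformly_monotone[OF p_ge_2]]) (use p_pos in auto)
      then show ?thesis unfolding \<psi>(2) by (simp add: mult_nonneg_nonneg)
    qed
    have "(LINT x|A.M. ?D x) \<le> 0" unfolding inner_diff_left Bochner_Integration.integral_diff[OF i2 i1] using 1 2 by linarith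
    then have "(LINT x|A.M. ?D x) = 0" by (intro antisym Bochner_Integration.integral_nonneg Dnn)
    then have "AE x in A.M. ?D x = 0" using integral_nonneg_eq_0_iff_AE[OF iD] Dnn by auto
    then have "AE x in A.M. gradient \<psi> x = 0"
    proof eventually_elim
      case (elim x)
      show ?case
      proof (rule ccontr)
        assume n: "gradient \<psi> x \<noteq> 0"
        then have xA: "x \<in> A" and mx: "max (c * b x - \<phi> x - \<epsilon>) 0 \<noteq> 0" and ne': "c *\<^sub>R B x - G x \<noteq> 0"
          unfolding \<psi>(2) by (auto split: if_splits)
        then have "(plap p (c *\<^sub>R B x) - plap p (G x)) \<bullet> (c *\<^sub>R B x - G x) = 0" using elim unfolding \<psi>(2) by auto
        from plap_strictly_monotone[OF p_ge_2 this] ne' show False by simp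
      qed
    qed
    from A.sobolev0_zero_gradient[OF A.sobolev0_C1_c[OF \<psi>(1)] this]
    have "\<psi> x = 0" by (rule AE_zero_continuous[OF oA C1_c_continuous[OF \<psi>(1)] _ x])
    then have "max (c * b x - \<phi> x - \<epsilon>) 0 = 0" using x by (simp add: \<psi>_def)
    then show ?thesis by (simp add: max_def split: if_splits)
  qed
  have "c * b x \<le> \<phi> x" if "x \<in> A" for x
    by (rule field_le_epsilon) (rule main[OF that])
  with c show thesis unfolding A b_def by (intro that) auto
qed

text \<open>Along the inner normal the barrier grows at least linearly from the boundary point. A vanishing
gradient there would, by continuity of \<open>G\<close> up to the boundary and the mean value theorem, force slower growth.\<close>

lemma hopf:
  assumes sb: "smooth_boundary \<Omega>" and x0: "x0 \<in> frontier \<Omega>"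
  shows "G x0 \<noteq> 0"
proof
  assume G0: "G x0 = 0"
  obtain y \<rho> where \<rho>: "0 < \<rho>" and ball: "ball y \<rho> \<subseteq> \<Omega>" and x0y: "norm (x0 - y) = \<rho>"
    by (rule interior_ball[OF open_\<Omega> sb x0]) (rule that)
  obtain c where c: "0 < c"
    "\<And>x. \<rho> / 2 < norm (x - y) \<Longrightarrow> norm (x - y) < \<rho> \<Longrightarrow> c * (norm (x - y) powr (-2) - \<rho> powr (-2)) \<le> \<phi> x"
    by (rule barrier_lower_bound[OF \<rho> ball]) (rule that)
  define \<nu> where "\<nu> = (1 / \<rho>) *\<^sub>R (y - x0)"
  have \<nu>: "norm \<nu> = 1" using x0y \<rho> by (simp add: \<nu>_def norm_minus_commute)
  have dist: "norm (x0 + s *\<^sub>R \<nu> - y) = \<rho> - s" if "s \<le> \<rho>" for s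
  proof -
    have "y - x0 = \<rho> *\<^sub>R \<nu>" using \<rho> by (simp add: \<nu>_def)
    then have "x0 + s *\<^sub>R \<nu> - y = (s - \<rho>) *\<^sub>R \<nu>" by (simp add: algebra_simps)
    then show ?thesis using \<nu> that by simp
  qed
  have in\<Omega>: "x0 + s *\<^sub>R \<nu> \<in> \<Omega>" if "0 < s" "s \<le> \<rho>" for s
    using ball dist[OF that(2)] that by (auto simp: subset_iff dist_norm norm_minus_commute)
  define k where "k = c / \<rho> ^ 3"
  have k: "0 < k" using c \<rho> by (simp add: k_def)
  have low: "k * s \<le> \<phi> (x0 + s *\<^sub>R \<nu>)" if s: "0 < s" "s < \<rho> / 2" for s
  proof -
    have d: "norm (x0 + s *\<^sub>R \<nu> - y) = \<rho> - s" using s \<rho> by (intro dist) simp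
    have "c * ((\<rho> - s) powr (-2) - \<rho> powr (-2)) \<le> \<phi> (x0 + s *\<^sub>R \<nu>)"
      using c(2)[of "x0 + s *\<^sub>R \<nu>"] s \<rho> unfolding d by simp
    moreover have "s / \<rho> ^ 3 \<le> (\<rho> - s) powr (-2) - \<rho> powr (-2)"
    proof -
      have p2: "z powr (-2) = 1 / z\<^sup>2" if "0 < z" for z :: real using that by (simp add: powr_minus divide_inverse)
      have "(\<rho> - s) powr (-2) - \<rho> powr (-2) = (\<rho>\<^sup>2 - (\<rho> - s)\<^sup>2) / ((\<rho> - s)\<^sup>2 * \<rho>\<^sup>2)"
        using s \<rho> by (simp add: p2 diff_frac_eq)
      moreover have "s / \<rho> ^ 3 = (s * \<rho>) / (\<rho>\<^sup>2 * \<rho>\<^sup>2)" using \<rho> by (simp add: power2_eq_square power3_eq_cube)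
      moreover have "(s * \<rho>) / (\<rho>\<^sup>2 * \<rho>\<^sup>2) \<le> (\<rho>\<^sup>2 - (\<rho> - s)\<^sup>2) / ((\<rho> - s)\<^sup>2 * \<rho>\<^sup>2)"
      proof (rule frac_le)
        have "s * s \<le> s * \<rho>" using s \<rho> by (intro mult_left_mono) auto
        then show "s * \<rho> \<le> \<rho>\<^sup>2 - (\<rho> - s)\<^sup>2" by (simp add: power2_eq_square algebra_simps)
        then show "0 \<le> \<rho>\<^sup>2 - (\<rho> - s)\<^sup>2" using s \<rho> by (meson mult_pos_pos less_imp_le order_trans)
        show "0 < (\<rho> - s)\<^sup>2 * \<rho>\<^sup>2" using s \<rho> by simp
        show "(\<rho> - s)\<^sup>2 * \<rho>\<^sup>2 \<le> \<rho>\<^sup>2 * \<rho>\<^sup>2" using s \<rho> by (intro mult_right_mono power_mono) auto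
      qed
      ultimately show ?thesis by simp
    qed
    ultimately have "c * (s / \<rho> ^ 3) \<le> \<phi> (x0 + s *\<^sub>R \<nu>)"
      using mult_left_mono[of "s / \<rho> ^ 3" "(\<rho> - s) powr (-2) - \<rho> powr (-2)" c] c(1) by linarith
    then show ?thesis by (simp add: k_def)
  qed
  have x0c: "x0 \<in> closure \<Omega>" using x0 by (simp add: frontier_def)
  have "\<exists>d>0. \<forall>x\<in>closure \<Omega>. dist x x0 < d \<longrightarrow> dist (G x) (G x0) < k / 2"
    using G_cont x0c k unfolding continuous_on_iff by (meson half_gt_zero)
  then obtain d where d: "0 < d" "\<And>x. x \<in> closure \<Omega> \<Longrightarrow> dist x x0 < d \<Longrightarrow> norm (G x) < k / 2"
    using G0 by (auto simp: dist_norm)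
  define s where "s = min (d / 2) (\<rho> / 4)"
  have s: "0 < s" "s < d" "s < \<rho> / 2" using d(1) \<rho> by (auto simp: s_def min_def)
  let ?h = "\<lambda>t. \<phi> (x0 + t *\<^sub>R \<nu>)"
  have inc: "x0 + t *\<^sub>R \<nu> \<in> closure \<Omega>" if "0 \<le> t" "t \<le> s" for t
    using in\<Omega>[of t] x0c that s closure_subset by (cases "t = 0") auto
  have hc: "continuous_on {0..s} ?h"
    by (rule continuous_on_compose2[OF phi_cont]) (use inc in \<open>auto intro!: continuous_intros\<close>)
  have hd: "(?h has_real_derivative (\<nu> \<bullet> G (x0 + t *\<^sub>R \<nu>))) (at t)" if "0 < t" "t < s" for t
    by (rule gderiv_along_line[OF phi_gderiv[OF in\<Omega>]]) (use that s in auto)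
  obtain l t where t: "0 < t" "t < s" "(?h has_real_derivative l) (at t)" "?h s - ?h 0 = (s - 0) * l"
    using MVT[OF s(1) hc] hd real_differentiable_def by blast
  have l: "l = \<nu> \<bullet> G (x0 + t *\<^sub>R \<nu>)" using DERIV_unique[OF t(3) hd[OF t(1,2)]] .
  have "dist (x0 + t *\<^sub>R \<nu>) x0 < d" using t s \<nu> by (simp add: dist_norm)
  then have "norm (G (x0 + t *\<^sub>R \<nu>)) < k / 2" using d(2) inc[of t] t by simp
  then have "l \<le> k / 2" unfolding l using norm_cauchy_schwarz[of \<nu> "G (x0 + t *\<^sub>R \<nu>)"] \<nu> by simp
  then have "?h s \<le> s * (k / 2)" using t(4) phi_frontier[OF x0] s(1) mult_left_mono[of l "k/2" s] by simp
  then have "k * s \<le> k * s / 2" using low[OF s(1,3)] by (simp add: mult.commute)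
  then show False using k s(1) by simp
qed

lemma nondegenerate:
  assumes sb: "smooth_boundary \<Omega>"
  obtains m where "0 < m" "\<And>x. x \<in> \<Omega> \<Longrightarrow> m \<le> max (\<phi> x) (norm (G x))"
proof (cases "closure \<Omega> = {}")
  case True
  then show thesis using that[of 1] by simp
next
  case False
  have comp: "compact (closure \<Omega>)" using bounded_\<Omega> by simp
  have "continuous_on (closure \<Omega>) (\<lambda>x. max (\<phi> x) (norm (G x)))" by (intro continuous_intros phi_cont G_cont)
  from continuous_attains_inf[OF comp False this]
  obtain z where z: "z \<in> closure \<Omega>" "\<And>x. x \<in> closure \<Omega> \<Longrightarrow> max (\<phi> z) (norm (G z)) \<le> max (\<phi> x) (norm (G x))" by blast
  have "0 < max (\<phi> z) (norm (G z))"
    using closure_cases[OF z(1)] phi_pos[of z] hopf[OF sb, of z] by (auto simp: less_max_iff_disj)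
  then show thesis by (rule that) (use z(2) closure_subset in blast)
qed

end


section \<open>Powers of the eigenfunction as subsolutions\<close>

lemma C1_c_smooth_abs:
  fixes \<phi> :: "'a::euclidean_space \<Rightarrow> real"
  assumes \<phi>: "\<phi> \<in> C1_c \<Omega>" and d: "0 < d"
  defines "\<psi> \<equiv> \<lambda>x. spos d (\<phi> x) + spos d (- \<phi> x)"
  shows "\<psi> \<in> C1_c \<Omega>" "0 \<le> \<psi> x" "\<bar>\<psi> x - \<bar>\<phi> x\<bar>\<bar> \<le> 2 * d" "norm (gradient \<psi> x) \<le> norm (gradient \<phi> x)"
proof -
  have D: "((\<lambda>s. spos d s + spos d (- s)) has_real_derivative spos' d s - spos' d (- s)) (at s)" for s
    using DERIV_add[OF spos_DERIV[OF d] DERIV_chain2[OF spos_DERIV[OF d] DERIV_minus[OF DERIV_ident]]] by simp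
  have C: "continuous_on UNIV (\<lambda>s. spos' d s - spos' d (- s))"
    by (intro continuous_intros spos_simps(2)[OF d] continuous_on_compose2[OF spos_simps(2)[OF d]]) auto
  note E = C1_c_compose[OF \<phi> D C]
  show "\<psi> \<in> C1_c \<Omega>" unfolding \<psi>_def by (rule E(1)) (simp add: spos_simps(1)[OF d])
  show "0 \<le> \<psi> x" unfolding \<psi>_def using spos_simps(5)[OF d] by (intro add_nonneg_nonneg)
  show "\<bar>\<psi> x - \<bar>\<phi> x\<bar>\<bar> \<le> 2 * d"
    using spos_simps(10)[OF d, of "\<phi> x"] spos_simps(10)[OF d, of "- \<phi> x"] unfolding \<psi>_def by (auto simp: max_def abs_if split: if_splits)
  have g: "gradient \<psi> x = (spos' d (\<phi> x) - spos' d (- \<phi> x)) *\<^sub>R gradient \<phi> x"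
    unfolding \<psi>_def by (rule E(2)) (simp add: spos_simps(1)[OF d])
  have "\<bar>spos' d (\<phi> x) - spos' d (- \<phi> x)\<bar> \<le> 1"
    using spos_simps(3,4)[OF d, of "\<phi> x"] spos_simps(3,4)[OF d, of "- \<phi> x"] by linarith
  from mult_right_mono[OF this norm_ge_zero] show "norm (gradient \<psi> x) \<le> norm (gradient \<phi> x)" unfolding g by simp
qed

context dirichlet_domain
begin

text \<open>For nonnegative test functions the inequality itself reads \<open>\<integral> h \<psi> \<le> \<integral> F \<psi> - \<integral> A(z) \<bullet> \<nabla>\<psi>\<close>, and the right-hand side is controlled by the
energy of \<open>\<psi>\<close>. A general test function is reduced to this case by smoothing its absolute value, which does not
increase the gradient.\<close>

lemma dual_weight_of_subsolution:
  assumes w: "sobolev0 w z" and h[measurable]: "h \<in> borel_measurable M" and h0: "AE x in M. 0 \<le> h x"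
    and ih: "\<And>\<psi>. \<psi> \<in> C1_c \<Omega> \<Longrightarrow> integrable M (\<lambda>x. h x * \<psi> x)" and F: "dual_weight F"
    and sub: "\<And>\<psi>. \<psi> \<in> C1_c \<Omega> \<Longrightarrow> (\<And>x. 0 \<le> \<psi> x) \<Longrightarrow>
      (LINT x|M. plap p (z x) \<bullet> gradient \<psi> x) \<le> (LINT x|M. (F x - h x) * \<psi> x)"
  shows "dual_weight h"
proof -
  note [measurable] = sobolev0_measurable[OF w] dual_weight_measurable[OF F]
  obtain C where C: "0 \<le> C" "\<And>\<phi>. \<phi> \<in> C1_c \<Omega> \<Longrightarrow>
     (\<integral>\<^sup>+ x. ennreal \<bar>F x * \<phi> x\<bar> \<partial>M) \<le> ennreal C * (1 + modular p M (gradient \<phi>))"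
    using F by (auto simp: dual_weight_def)
  define Z where "Z = (LINT x|M. norm (z x) powr p)"
  have iz: "integrable M (\<lambda>x. norm (z x) powr p)" by (rule sobolev0_integrable_powr[OF w])
  have Z0: "0 \<le> Z" unfolding Z_def by (rule Bochner_Integration.integral_nonneg) simp
  have nn: "(\<integral>\<^sup>+ x. ennreal (h x * \<psi> x) \<partial>M) \<le> ennreal (C + Z + 1) * (1 + modular p M (gradient \<psi>))"
    if \<psi>: "\<psi> \<in> C1_c \<Omega>" and pos: "\<And>x. 0 \<le> \<psi> x" for \<psi>
  proof -
    define P where "P = (LINT x|M. norm (gradient \<psi> x) powr p)"
    have ip: "integrable M (\<lambda>x. norm (gradient \<psi> x) powr p)"
      by (rule C1_c_integrable_powr(2)[OF \<psi> open_\<Omega> bounded_\<Omega> p_pos(4)])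
    have P0: "0 \<le> P" unfolding P_def by (rule Bochner_Integration.integral_nonneg) simp
    have mP: "modular p M (gradient \<psi>) = ennreal P" unfolding P_def by (rule modular_eq_integral[OF ip])
    have iF: "integrable M (\<lambda>x. F x * \<psi> x)" by (rule dual_weight_integrable[OF F \<psi>])
    have "(LINT x|M. (F x - h x) * \<psi> x) = (LINT x|M. F x * \<psi> x) - (LINT x|M. h x * \<psi> x)"
      unfolding left_diff_distrib by (rule Bochner_Integration.integral_diff[OF iF ih[OF \<psi>]])
    then have 1: "(LINT x|M. h x * \<psi> x) \<le> (LINT x|M. F x * \<psi> x) - (LINT x|M. plap p (z x) \<bullet> gradient \<psi> x)"
      using sub[OF \<psi> pos] by linarith
    have 2: "(LINT x|M. F x * \<psi> x) \<le> C * (1 + P)"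
    proof -
      have "ennreal (LINT x|M. \<bar>F x * \<psi> x\<bar>) = (\<integral>\<^sup>+ x. ennreal \<bar>F x * \<psi> x\<bar> \<partial>M)"
        using iF by (intro nn_integral_eq_integral[symmetric]) auto
      also have "\<dots> \<le> ennreal C * (1 + ennreal P)" using C(2)[OF \<psi>] unfolding mP .
      also have "\<dots> = ennreal (C * (1 + P))" using C(1) P0 by (simp add: ennreal_mult)
      finally have "(LINT x|M. \<bar>F x * \<psi> x\<bar>) \<le> C * (1 + P)" using C(1) P0 by (subst (asm) ennreal_le_iff) auto
      moreover have "(LINT x|M. F x * \<psi> x) \<le> (LINT x|M. \<bar>F x * \<psi> x\<bar>)" using iF by (intro integral_mono) auto
      ultimately show ?thesis by linarith
    qed
    have 3: "- (LINT x|M. plap p (z x) \<bullet> gradient \<psi> x) \<le> Z + P"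
    proof -
      have "- (LINT x|M. plap p (z x) \<bullet> gradient \<psi> x) = (LINT x|M. - (plap p (z x) \<bullet> gradient \<psi> x))" by simp
      also have "\<dots> \<le> (LINT x|M. norm (z x) powr p + norm (gradient \<psi> x) powr p)"
      proof (rule integral_mono)
        fix x
        have "- (plap p (z x) \<bullet> gradient \<psi> x) \<le> norm (z x) powr (p - 1) * norm (gradient \<psi> x)"
          using Cauchy_Schwarz_ineq2[of "plap p (z x)" "gradient \<psi> x"] by (simp add: norm_plap abs_le_iff)
        also have "\<dots> \<le> 1 * norm (z x) powr p + 1 powr (1 - p) * norm (gradient \<psi> x) powr p"
          by (rule young_weak) (use p_pos in auto)
        finally show "- (plap p (z x) \<bullet> gradient \<psi> x) \<le> norm (z x) powr p + norm (gradient \<psi> x) powr p" by simp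
      qed (use plap_integrable[OF w sobolev0_C1_c[OF \<psi>]] iz ip in auto)
      also have "\<dots> = Z + P" unfolding Z_def P_def using iz ip by simp
      finally show ?thesis .
    qed
    have "(LINT x|M. h x * \<psi> x) \<le> C * (1 + P) + (Z + P)" using 1 2 3 by linarith
    also have "\<dots> \<le> (C + Z + 1) * (1 + P)" using C(1) Z0 P0 by (simp add: algebra_simps)
    finally have "ennreal (LINT x|M. h x * \<psi> x) \<le> ennreal ((C + Z + 1) * (1 + P))" by (rule ennreal_leI)
    moreover have "ennreal ((C + Z + 1) * (1 + P)) = ennreal (C + Z + 1) * (1 + modular p M (gradient \<psi>))"
      unfolding mP using C(1) Z0 P0 by (simp add: ennreal_mult)
    moreover have "(\<integral>\<^sup>+ x. ennreal (h x * \<psi> x) \<partial>M) = ennreal (LINT x|M. h x * \<psi> x)"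
      by (rule nn_integral_eq_integral[OF ih[OF \<psi>]]) (use h0 pos in \<open>auto elim!: eventually_mono\<close>)
    ultimately show ?thesis by simp
  qed
  have "(\<integral>\<^sup>+ x. ennreal \<bar>h x * \<phi> x\<bar> \<partial>M) \<le> ennreal (C + Z + 1) * (1 + modular p M (gradient \<phi>))" if \<phi>: "\<phi> \<in> C1_c \<Omega>" for \<phi>
  proof -
    define t where "t n = inverse (real (Suc n))" for n
    have t: "0 < t n" "t \<longlonglongrightarrow> 0" for n unfolding t_def by (simp, rule LIMSEQ_inverse_real_of_nat)
    define \<psi> where "\<psi> n x = spos (t n) (\<phi> x) + spos (t n) (- \<phi> x)" for n x
    note S = C1_c_smooth_abs[OF \<phi> t(1), folded \<psi>_def]
    have lim: "(\<lambda>n. \<psi> n x) \<longlonglongrightarrow> \<bar>\<phi> x\<bar>" for x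
    proof (rule LIM_zero_cancel, rule Lim_null_comparison)
      show "\<forall>\<^sub>F n in sequentially. norm (\<psi> n x - \<bar>\<phi> x\<bar>) \<le> 2 * t n" using S(3) by (intro always_eventually) simp
      show "(\<lambda>n. 2 * t n) \<longlonglongrightarrow> 0" using t(2) by (rule tendsto_mult_right_zero)
    qed
    note [measurable] = C1_c_measurable[OF S(1)]
    have "(\<integral>\<^sup>+ x. ennreal \<bar>h x * \<phi> x\<bar> \<partial>M) = (\<integral>\<^sup>+ x. liminf (\<lambda>n. ennreal (h x * \<psi> n x)) \<partial>M)"
    proof (rule nn_integral_cong_AE, use h0 in eventually_elim)
      fix x assume "0 \<le> h x"
      have "(\<lambda>n. ennreal (h x * \<psi> n x)) \<longlonglongrightarrow> ennreal (h x * \<bar>\<phi> x\<bar>)" by (intro tendsto_ennrealI tendsto_mult tendsto_const lim)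
      from lim_imp_Liminf[OF trivial_limit_sequentially this] \<open>0 \<le> h x\<close>
      show "ennreal \<bar>h x * \<phi> x\<bar> = liminf (\<lambda>n. ennreal (h x * \<psi> n x))" by (simp add: abs_mult)
    qed
    also have "\<dots> \<le> liminf (\<lambda>n. \<integral>\<^sup>+ x. ennreal (h x * \<psi> n x) \<partial>M)" by (rule nn_integral_liminf) measurable
    also have "\<dots> \<le> ennreal (C + Z + 1) * (1 + modular p M (gradient \<phi>))"
    proof (rule Liminf_le)
      have "(\<integral>\<^sup>+ x. ennreal (h x * \<psi> n x) \<partial>M) \<le> ennreal (C + Z + 1) * (1 + modular p M (gradient \<phi>))" for n
      proof -
        have "(\<integral>\<^sup>+ x. ennreal (h x * \<psi> n x) \<partial>M) \<le> ennreal (C + Z + 1) * (1 + modular p M (gradient (\<psi> n)))"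
          by (rule nn[OF S(1) S(2)])
        also have "\<dots> \<le> ennreal (C + Z + 1) * (1 + modular p M (gradient \<phi>))"
          by (intro mult_left_mono add_left_mono modular_mono S(4) p_pos) auto
        finally show ?thesis .
      qed
      then show "\<forall>\<^sub>F n in sequentially. (\<integral>\<^sup>+ x. ennreal (h x * \<psi> n x) \<partial>M) \<le> ennreal (C + Z + 1) * (1 + modular p M (gradient \<phi>))"
        by (intro always_eventually allI)
    qed simp
    finally show ?thesis .
  qed
  then show ?thesis unfolding dual_weight_def using h C(1) Z0 by (intro conjI exI[of _ "C + Z + 1"]) auto
qed

end

context p_superharmonic
begin

lemma superlevel_compact: "compact {x \<in> \<Omega>. d \<le> \<phi> x}" if d: "0 < d"
proof -
  have cc: "compact (closure \<Omega>)" using bounded_\<Omega> by simp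
  have "closed (closure \<Omega> \<inter> \<phi> -` {d..})" by (rule continuous_closed_preimage[OF phi_cont closed_closure closed_atLeast])
  then have "compact (closure \<Omega> \<inter> (closure \<Omega> \<inter> \<phi> -` {d..}))" by (rule compact_Int_closed[OF cc])
  moreover have "closure \<Omega> \<inter> (closure \<Omega> \<inter> \<phi> -` {d..}) = {x \<in> \<Omega>. d \<le> \<phi> x}"
  proof (intro equalityI subsetI)
    fix x assume x: "x \<in> closure \<Omega> \<inter> (closure \<Omega> \<inter> \<phi> -` {d..})"
    then have "x \<notin> frontier \<Omega>" using phi_frontier[of x] d by auto
    then show "x \<in> {x \<in> \<Omega>. d \<le> \<phi> x}" using closure_cases[of x] x by auto
  next
    fix x assume "x \<in> {x \<in> \<Omega>. d \<le> \<phi> x}"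
    then show "x \<in> closure \<Omega> \<inter> (closure \<Omega> \<inter> \<phi> -` {d..})" using subsetD[OF closure_subset, of x \<Omega>] by simp
  qed
  ultimately show ?thesis by simp
qed

lemma phi_powr_gderiv: "x \<in> \<Omega> \<Longrightarrow> GDERIV (\<lambda>x. \<phi> x powr r) x :> (r * \<phi> x powr (r - 1)) *\<^sub>R G x"
  by (rule GDERIV_DERIV_compose[OF phi_gderiv has_real_derivative_powr[OF phi_pos]])

lemma phi_powr_cont: "continuous_on \<Omega> (\<lambda>x. \<phi> x powr r)"
  by (intro continuous_intros phi_cont_\<Omega>) (use phi_pos in force)

lemma bounds:
  obtains B where "0 < B" "\<And>x. x \<in> \<Omega> \<Longrightarrow> \<phi> x \<le> B" "\<And>x. x \<in> \<Omega> \<Longrightarrow> norm (G x) \<le> B"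
proof -
  have cc: "compact (closure \<Omega>)" using bounded_\<Omega> by simp
  have "bounded (\<phi> ` closure \<Omega>)" "bounded (G ` closure \<Omega>)"
    by (intro compact_imp_bounded compact_continuous_image phi_cont G_cont cc)+
  then obtain B1 B2 where B: "\<And>x. x \<in> closure \<Omega> \<Longrightarrow> norm (\<phi> x) \<le> B1" "\<And>x. x \<in> closure \<Omega> \<Longrightarrow> norm (G x) \<le> B2"
    unfolding bounded_iff by blast
  show thesis
  proof (rule that[of "max 1 (max B1 B2)"])
    fix x assume "x \<in> \<Omega>"
    then have x: "x \<in> closure \<Omega>" using closure_subset by blast
    show "\<phi> x \<le> max 1 (max B1 B2)" using B(1)[OF x] by auto
    show "norm (G x) \<le> max 1 (max B1 B2)" using B(2)[OF x] by auto
  qed simp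
qed

text \<open>Cutting off the values below \<open>d\<close> with the smooth positive part gives functions supported in a superlevel set of \<open>\<phi>\<close>,
which is compact in \<open>\<Omega>\<close>.\<close>

lemma phi_powr_sobolev0:
  assumes \<beta>: "1 < \<beta>" and t: "0 < t"
  shows "sobolev0 (\<lambda>x. t * \<phi> x powr \<beta>) (\<lambda>x. (t * \<beta> * \<phi> x powr (\<beta> - 1)) *\<^sub>R G x)" (is "sobolev0 ?w ?z")
proof -
  obtain B where B: "0 < B" "\<And>x. x \<in> \<Omega> \<Longrightarrow> \<phi> x \<le> B" "\<And>x. x \<in> \<Omega> \<Longrightarrow> norm (G x) \<le> B" by (rule bounds) (rule that)
  define W where "W = t * B powr \<beta> + t * \<beta> * B powr (\<beta> - 1) * B"
  have W: "0 \<le> ?w x" "?w x \<le> W" "norm (?z x) \<le> W" if "x \<in> \<Omega>" for x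
  proof -
    have nn: "0 \<le> t * \<beta> * B powr (\<beta> - 1) * B" "0 \<le> t * B powr \<beta>" using t \<beta> B by auto
    have "?w x \<le> t * B powr \<beta>" using B(2)[OF that] phi_pos[OF that] t \<beta> by (intro mult_left_mono powr_mono2) auto
    then show "?w x \<le> W" using nn unfolding W_def by linarith
    have "norm (?z x) = t * \<beta> * \<phi> x powr (\<beta> - 1) * norm (G x)" using t \<beta> by simp
    also have "\<dots> \<le> t * \<beta> * B powr (\<beta> - 1) * B"
      using B(2,3)[OF that] phi_pos[OF that] B(1) t \<beta> by (intro mult_mono mult_left_mono powr_mono2) auto
    finally show "norm (?z x) \<le> W" using nn unfolding W_def by linarith
    show "0 \<le> ?w x" using t by simp
  qed
  have wc: "continuous_on \<Omega> ?w" by (intro continuous_intros phi_powr_cont)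
  have zc: "continuous_on \<Omega> ?z" by (intro continuous_intros phi_powr_cont G_cont_\<Omega>)
  have sO: "\<Omega> \<in> sets lebesgue" using open_\<Omega> by simp
  have wm[measurable]: "?w \<in> borel_measurable M" by (rule continuous_imp_measurable_on_sets_lebesgue[OF wc sO])
  have zm[measurable]: "?z \<in> borel_measurable M" by (rule continuous_imp_measurable_on_sets_lebesgue[OF zc sO])
  have wD: "GDERIV ?w x :> ?z x" if "x \<in> \<Omega>" for x
  proof -
    have "GDERIV (\<lambda>x. t * \<phi> x powr \<beta>) x :> t *\<^sub>R ((\<beta> * \<phi> x powr (\<beta> - 1)) *\<^sub>R G x)"
      by (rule GDERIV_DERIV_compose[OF phi_powr_gderiv[OF that], of "\<lambda>s. t * s" t]) (auto intro!: derivative_eq_intros)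
    then show ?thesis by (simp add: mult.assoc)
  qed
  define d where "d n = inverse (real (Suc n))" for n
  have d: "0 < d n" "d \<longlonglongrightarrow> 0" "d n \<le> 1" for n
    unfolding d_def by (simp, rule LIMSEQ_inverse_real_of_nat, simp add: inverse_le_1_iff)
  define K where "K n = {x \<in> \<Omega>. (d n / t) powr (1 / \<beta>) \<le> \<phi> x}" for n
  have K: "compact (K n)" "K n \<subseteq> \<Omega>" for n
    unfolding K_def using d(1)[of n] t by (auto intro!: superlevel_compact)
  have out: "?w x - d n \<le> 0" if "x \<in> \<Omega> - K n" for x n
  proof -
    have "\<phi> x < (d n / t) powr (1 / \<beta>)" using that by (auto simp: K_def)
    then have "\<phi> x powr \<beta> \<le> ((d n / t) powr (1 / \<beta>)) powr \<beta>" using that phi_pos[of x] \<beta> by (intro powr_mono2) auto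
    also have "\<dots> = d n / t" using \<beta> d(1)[of n] t by (simp add: powr_powr)
    finally show ?thesis using t by (simp add: field_simps)
  qed
  define f where "f n x = spos (d n) (?w x - d n)" for n x
  define H where "H n x = spos' (d n) (?w x - d n) *\<^sub>R ?z x" for n x
  have fD: "GDERIV (f n) x :> H n x" if "x \<in> \<Omega>" for x n
  proof -
    have "GDERIV (\<lambda>x. ?w x - d n) x :> ?z x - 0" by (intro GDERIV_diff GDERIV_const wD that)
    from GDERIV_DERIV_compose[OF this spos_DERIV[OF d(1)]] show ?thesis unfolding f_def H_def by simp
  qed
  have Hc: "continuous_on \<Omega> (H n)" for n
    unfolding H_def by (intro continuous_on_scaleR continuous_on_compose2[OF spos_simps(2)[OF d(1)]] zc continuous_intros wc) auto
  have fz: "f n x = 0" if "x \<in> \<Omega> - K n" for n x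
    unfolding f_def by (rule spos_simps(6)[OF d(1) out[OF that]])
  define \<eta> where "\<eta> n x = (if x \<in> \<Omega> then f n x else 0)" for n x
  have \<eta>: "\<eta> n \<in> C1_c \<Omega>" "gradient (\<eta> n) x = (if x \<in> \<Omega> then H n x else 0)" for n x
    unfolding \<eta>_def by (rule C1_c_extend[OF open_\<Omega> fD Hc K fz]; assumption)+
  note [measurable] = C1_c_measurable[OF \<eta>(1)]
  have iW: "integrable M (\<lambda>_. (W + 2) powr p)" using finite_measure.integrable_const[OF finite_M] .
  have W0: "0 \<le> W" unfolding W_def using t \<beta> B by auto
  have splim: "(\<lambda>n. \<eta> n x) \<longlonglongrightarrow> ?w x" if "x \<in> \<Omega>" for x
  proof (rule LIM_zero_cancel, rule Lim_null_comparison)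
    show "\<forall>\<^sub>F n in sequentially. norm (\<eta> n x - ?w x) \<le> 2 * d n"
    proof (intro always_eventually allI)
      fix n
      have "\<bar>max (?w x - d n) 0 - ?w x\<bar> \<le> d n" using W(1)[OF that] d(1)[of n] by (simp add: max_def abs_if)
      then show "norm (\<eta> n x - ?w x) \<le> 2 * d n"
        using spos_simps(10)[OF d(1)[of n], of "?w x - d n"] that unfolding \<eta>_def f_def by simp
    qed
    show "(\<lambda>n. 2 * d n) \<longlonglongrightarrow> 0" using d(2) by (rule tendsto_mult_right_zero)
  qed
  have glim: "(\<lambda>n. gradient (\<eta> n) x) \<longlonglongrightarrow> ?z x" if "x \<in> \<Omega>" for x
  proof -
    have w: "0 < ?w x" using t phi_pos[OF that] by simp
    have "(\<lambda>n. spos' (d n) (?w x - d n)) \<longlonglongrightarrow> max (?w x - 0) 0 / sqrt ((max (?w x - 0) 0)\<^sup>2 + 0\<^sup>2)"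
      unfolding spos'_def using w by (intro tendsto_intros d(2)) auto
    then have "(\<lambda>n. spos' (d n) (?w x - d n)) \<longlonglongrightarrow> 1" using t phi_pos[OF that] by simp
    then have "(\<lambda>n. H n x) \<longlonglongrightarrow> 1 *\<^sub>R ?z x" unfolding H_def by (intro tendsto_intros)
    then show ?thesis unfolding \<eta>(2) using that by simp
  qed
  have 1: "(\<lambda>n. modular p M (\<lambda>x. \<eta> n x - ?w x)) \<longlonglongrightarrow> 0"
  proof (rule modular_dominated[OF _ wm p_pos(1) _ iW])
    show "AE x in M. (\<lambda>n. \<eta> n x) \<longlonglongrightarrow> ?w x" by (rule AE_I2) (use splim in simp)
    show "AE x in M. \<forall>n. norm (\<eta> n x) powr p \<le> (W + 2) powr p"
    proof (intro AE_I2 allI powr_mono2)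
      fix x n assume "x \<in> space M"
      then have x: "x \<in> \<Omega>" by simp
      have "\<bar>max (?w x - d n) 0\<bar> \<le> W" using W(1,2)[OF x] d(1)[of n] W0 by (simp add: max_def)
      then have "\<bar>spos (d n) (?w x - d n)\<bar> \<le> W + 2"
        using spos_simps(10)[OF d(1)[of n], of "?w x - d n"] d(3)[of n] by linarith
      then show "norm (\<eta> n x) \<le> W + 2" using x unfolding \<eta>_def f_def by simp
    qed (use p_pos in auto)
  qed measurable
  have 2: "(\<lambda>n. modular p M (\<lambda>x. gradient (\<eta> n) x - ?z x)) \<longlonglongrightarrow> 0"
  proof (rule modular_dominated[OF _ zm p_pos(1) _ iW])
    show "AE x in M. (\<lambda>n. gradient (\<eta> n) x) \<longlonglongrightarrow> ?z x" by (rule AE_I2) (use glim in simp)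
    show "AE x in M. \<forall>n. norm (gradient (\<eta> n) x) powr p \<le> (W + 2) powr p"
    proof (intro AE_I2 allI powr_mono2)
      fix x n assume "x \<in> space M"
      then have x: "x \<in> \<Omega>" by simp
      have s: "\<bar>spos' (d n) (?w x - d n)\<bar> \<le> 1" using spos_simps(3,4)[OF d(1)[of n], of "?w x - d n"] by simp
      have "norm (gradient (\<eta> n) x) = \<bar>spos' (d n) (?w x - d n)\<bar> * norm (?z x)" unfolding \<eta>(2) H_def using x by (simp only: if_True norm_scaleR)
      also have "\<dots> \<le> 1 * W" using W(3)[OF x] s W0 by (intro mult_mono) auto
      finally show "norm (gradient (\<eta> n) x) \<le> W + 2" by simp
    qed (use p_pos in auto)
  qed measurable
  show ?thesis unfolding sobolev0_def using wm zm \<eta>(1) 1 2 by blast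
qed

text \<open>Test the eigenvalue equation with \<open>\<phi>\<^sup>\<kappa> \<psi>\<close>.\<close>

lemma phi_powr_equation:
  assumes \<beta>: "1 < \<beta>" and t: "0 < t"
    and eigen: "\<And>\<psi>. \<psi> \<in> C1_c \<Omega> \<Longrightarrow> (LINT x|M. plap p (G x) \<bullet> gradient \<psi> x) = l * (LINT x|M. \<phi> x powr (p - 1) * \<psi> x)"
    and \<psi>: "\<psi> \<in> C1_c \<Omega>"
  defines "\<kappa> \<equiv> (\<beta> - 1) * (p - 1)"
  shows "(LINT x|M. plap p ((t * \<beta> * \<phi> x powr (\<beta> - 1)) *\<^sub>R G x) \<bullet> gradient \<psi> x)
    = (LINT x|M. ((t * \<beta>) powr (p - 1) * \<phi> x powr (\<kappa> - 1) * (l * \<phi> x powr p - \<kappa> * norm (G x) powr p)) * \<psi> x)"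
    "integrable M (\<lambda>x. ((t * \<beta>) powr (p - 1) * \<phi> x powr (\<kappa> - 1) * (l * \<phi> x powr p - \<kappa> * norm (G x) powr p)) * \<psi> x)"
proof -
  have Kc: "continuous_on \<Omega> (\<lambda>x. (\<kappa> * \<phi> x powr (\<kappa> - 1)) *\<^sub>R G x)" by (intro continuous_intros phi_powr_cont G_cont_\<Omega>)
  have X: "(\<lambda>x. \<phi> x powr \<kappa> * \<psi> x) \<in> C1_c \<Omega>"
    "\<And>x. x \<in> \<Omega> \<Longrightarrow> gradient (\<lambda>x. \<phi> x powr \<kappa> * \<psi> x) x = \<phi> x powr \<kappa> *\<^sub>R gradient \<psi> x + \<psi> x *\<^sub>R ((\<kappa> * \<phi> x powr (\<kappa> - 1)) *\<^sub>R G x)"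
    using C1_c_mult_local[OF \<psi> open_\<Omega> _ Kc, of "\<lambda>x. \<phi> x powr \<kappa>"] phi_powr_gderiv by auto
  have Gp: "continuous_on \<Omega> (\<lambda>x. norm (G x) powr p)"
    using p_pos by (intro continuous_on_powr' continuous_intros G_cont_\<Omega>) auto
  note loc = C1_c_local_integrable[OF open_\<Omega> bounded_\<Omega> \<psi>]
  have i1: "integrable M (\<lambda>x. \<phi> x powr \<kappa> * (plap p (G x) \<bullet> gradient \<psi> x))"
    using loc(2)[of "\<lambda>x. \<phi> x powr \<kappa> *\<^sub>R plap p (G x)"] by (simp add: continuous_on_scaleR phi_powr_cont plap_continuous_on G_cont_\<Omega>)
  have i2: "integrable M (\<lambda>x. (\<kappa> * \<phi> x powr (\<kappa> - 1) * norm (G x) powr p) * \<psi> x)"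
    by (rule loc(1)) (intro continuous_intros phi_powr_cont Gp)
  have i3: "integrable M (\<lambda>x. (\<phi> x powr (p - 1) * \<phi> x powr \<kappa>) * \<psi> x)"
    by (rule loc(1)) (intro continuous_intros phi_powr_cont)
  show "integrable M (\<lambda>x. ((t * \<beta>) powr (p - 1) * \<phi> x powr (\<kappa> - 1) * (l * \<phi> x powr p - \<kappa> * norm (G x) powr p)) * \<psi> x)"
    by (rule loc(1)) (intro continuous_intros phi_powr_cont Gp)
  have "(LINT x|M. \<phi> x powr \<kappa> * (plap p (G x) \<bullet> gradient \<psi> x)) + (LINT x|M. (\<kappa> * \<phi> x powr (\<kappa> - 1) * norm (G x) powr p) * \<psi> x)
     = (LINT x|M. \<phi> x powr \<kappa> * (plap p (G x) \<bullet> gradient \<psi> x) + (\<kappa> * \<phi> x powr (\<kappa> - 1) * norm (G x) powr p) * \<psi> x)"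
    by (rule Bochner_Integration.integral_add[OF i1 i2, symmetric])
  also have "\<dots> = (LINT x|M. plap p (G x) \<bullet> gradient (\<lambda>x. \<phi> x powr \<kappa> * \<psi> x) x)"
    by (rule Bochner_Integration.integral_cong[OF refl]) (simp add: X(2) inner_add_right plap_inner_self)
  also have "\<dots> = l * (LINT x|M. (\<phi> x powr (p - 1) * \<phi> x powr \<kappa>) * \<psi> x)"
    using eigen[OF X(1)] by (simp add: mult.assoc)
  finally have A: "(LINT x|M. \<phi> x powr \<kappa> * (plap p (G x) \<bullet> gradient \<psi> x))
     = l * (LINT x|M. (\<phi> x powr (p - 1) * \<phi> x powr \<kappa>) * \<psi> x) - (LINT x|M. (\<kappa> * \<phi> x powr (\<kappa> - 1) * norm (G x) powr p) * \<psi> x)" by simp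
  have "(LINT x|M. plap p ((t * \<beta> * \<phi> x powr (\<beta> - 1)) *\<^sub>R G x) \<bullet> gradient \<psi> x)
     = (LINT x|M. (t * \<beta>) powr (p - 1) * (\<phi> x powr \<kappa> * (plap p (G x) \<bullet> gradient \<psi> x)))"
  proof (rule Bochner_Integration.integral_cong[OF refl])
    fix x
    have "0 \<le> t * \<beta> * \<phi> x powr (\<beta> - 1)" using t \<beta> by simp
    then show "plap p ((t * \<beta> * \<phi> x powr (\<beta> - 1)) *\<^sub>R G x) \<bullet> gradient \<psi> x = (t * \<beta>) powr (p - 1) * (\<phi> x powr \<kappa> * (plap p (G x) \<bullet> gradient \<psi> x))"
      using t \<beta> by (simp add: plap_scaleR powr_mult powr_powr \<kappa>_def)
  qed
  also have "\<dots> = (t * \<beta>) powr (p - 1) * (l * (LINT x|M. (\<phi> x powr (p - 1) * \<phi> x powr \<kappa>) * \<psi> x) - (LINT x|M. (\<kappa> * \<phi> x powr (\<kappa> - 1) * norm (G x) powr p) * \<psi> x))"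
    by (simp add: A)
  also have "\<dots> = (LINT x|M. (t * \<beta>) powr (p - 1) * (l * ((\<phi> x powr (p - 1) * \<phi> x powr \<kappa>) * \<psi> x) - (\<kappa> * \<phi> x powr (\<kappa> - 1) * norm (G x) powr p) * \<psi> x))"
    using i2 i3 by simp
  also have "\<dots> = (LINT x|M. ((t * \<beta>) powr (p - 1) * \<phi> x powr (\<kappa> - 1) * (l * \<phi> x powr p - \<kappa> * norm (G x) powr p)) * \<psi> x)"
  proof (rule Bochner_Integration.integral_cong[OF refl])
    fix x assume "x \<in> space M"
    have "\<phi> x powr (p - 1) * \<phi> x powr \<kappa> = \<phi> x powr (\<kappa> - 1) * \<phi> x powr p" 
    proof -
      have e: "p - 1 + \<kappa> = \<kappa> - 1 + p" by simp
      show ?thesis by (simp only: powr_add[symmetric] e)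
    qed
    then show "(t * \<beta>) powr (p - 1) * (l * ((\<phi> x powr (p - 1) * \<phi> x powr \<kappa>) * \<psi> x) - (\<kappa> * \<phi> x powr (\<kappa> - 1) * norm (G x) powr p) * \<psi> x)
       = ((t * \<beta>) powr (p - 1) * \<phi> x powr (\<kappa> - 1) * (l * \<phi> x powr p - \<kappa> * norm (G x) powr p)) * \<psi> x"
      by (simp add: algebra_simps)
  qed
  finally show "(LINT x|M. plap p ((t * \<beta> * \<phi> x powr (\<beta> - 1)) *\<^sub>R G x) \<bullet> gradient \<psi> x)
    = (LINT x|M. ((t * \<beta>) powr (p - 1) * \<phi> x powr (\<kappa> - 1) * (l * \<phi> x powr p - \<kappa> * norm (G x) powr p)) * \<psi> x)" .
qed

end


section \<open>The existence theorem\<close>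

context p_superharmonic
begin

text \<open>The superlevel sets of \<open>\<phi>\<close> form a countable exhaustion of \<open>\<Omega>\<close> by compactly contained sets.\<close>

lemma superlevel_exhaustion:
  assumes "\<forall>\<omega>. compactly_contained \<omega> \<Omega> \<longrightarrow> (\<exists>c>0. AE x in M. x \<in> \<omega> \<longrightarrow> c \<le> f x)"
  shows "AE x in M. 0 \<le> (f x :: real)"
proof -
  have cc: "compactly_contained {x \<in> \<Omega>. 1 / real (Suc n) \<le> \<phi> x} \<Omega>" for n
    using superlevel_compact[of "1 / real (Suc n)"] by (auto simp: compactly_contained_def compact_imp_closed closure_closed)
  have "AE x in M. x \<in> {x \<in> \<Omega>. 1 / real (Suc n) \<le> \<phi> x} \<longrightarrow> 0 \<le> f x" for n
  proof -
    from assms[rule_format, OF cc[of n]] obtain c where c: "0 < c" "AE x in M. x \<in> {x \<in> \<Omega>. 1 / real (Suc n) \<le> \<phi> x} \<longrightarrow> c \<le> f x"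
      by blast
    from c(2) show ?thesis by eventually_elim (use c(1) in auto)
  qed
  then have "AE x in M. \<forall>n. x \<in> {x \<in> \<Omega>. 1 / real (Suc n) \<le> \<phi> x} \<longrightarrow> 0 \<le> f x" by (intro AE_all_countable[THEN iffD2] allI)
  then show ?thesis using AE_space
  proof eventually_elim
    case (elim x)
    then have x: "x \<in> \<Omega>" by simp
    obtain n where "1 / real (Suc n) < \<phi> x" using nat_approx_posE[OF phi_pos[OF x]] .
    then show ?case using spec[OF elim(1), of n] x by simp
  qed
qed

text \<open>Where \<open>\<phi> < \<delta>\<close> the gradient of \<open>\<phi>\<close> is at least \<open>m\<close> in norm, and its term absorbs both the eigenvalue term (by the choice of
\<open>\<delta>\<close>) and the singular term (by the choice of \<open>t\<close>). Where \<open>\<phi> \<ge> \<delta>\<close> all terms are bounded and \<open>f\<close> has a positive lower bound. The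
constant \<open>t\<close> is chosen before \<open>f\<close>; only \<open>\<mu>0\<close> depends on \<open>f\<close>.\<close>

lemma subsolution_inequality:
  assumes sb: "smooth_boundary \<Omega>" and \<gamma>: "0 < \<gamma>" "\<gamma> < 1" and l: "0 \<le> l"
    and aC: "AE x in M. 0 \<le> a x \<and> a x \<le> Ca"
  defines "\<beta> \<equiv> p / (p - 1 + \<gamma>)"
  defines "\<kappa> \<equiv> (\<beta> - 1) * (p - 1)"
  obtains t where "0 < t"
    "\<And>f. \<forall>\<omega>. compactly_contained \<omega> \<Omega> \<longrightarrow> (\<exists>c>0. AE x in M. x \<in> \<omega> \<longrightarrow> c \<le> f x) \<Longrightarrow>
      \<exists>\<mu>0>0. \<forall>\<mu>\<ge>\<mu>0. AE x in M. (t * \<beta>) powr (p - 1) * \<phi> x powr (\<kappa> - 1) * (l * \<phi> x powr p - \<kappa> * norm (G x) powr p)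
         \<le> \<mu> * f x - a x * (t * \<phi> x powr \<beta>) powr (- \<gamma>)"
proof -
  have den: "0 < p - 1 + \<gamma>" using \<gamma> p_ge_2 by simp
  have \<beta>: "1 < \<beta>" unfolding \<beta>_def using \<gamma> den by (simp add: less_divide_eq)
  have \<kappa>: "0 < \<kappa>" unfolding \<kappa>_def using \<beta> p_ge_2 by simp
  have \<kappa>\<beta>: "\<kappa> - 1 = - (\<beta> * \<gamma>)"
  proof -
    have "\<beta> * (p - 1 + \<gamma>) = p" unfolding \<beta>_def using den by simp
    then show ?thesis unfolding \<kappa>_def by (simp add: algebra_simps)
  qed
  obtain m where m: "0 < m" "\<And>x. x \<in> \<Omega> \<Longrightarrow> m \<le> max (\<phi> x) (norm (G x))" by (rule nondegenerate[OF sb]) (rule that)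
  obtain B where B: "0 < B" "\<And>x. x \<in> \<Omega> \<Longrightarrow> \<phi> x \<le> B" "\<And>x. x \<in> \<Omega> \<Longrightarrow> norm (G x) \<le> B" by (rule bounds) (rule that)
  \<comment> \<open>Half of the gradient term: one copy of \<open>q\<close> for the eigenvalue term and one for the singular term.\<close>
  define q where "q = \<kappa> * m powr p / 2"
  have q: "0 < q" using \<kappa> m(1) by (simp add: q_def)
  define \<delta> where "\<delta> = min (m / 2) ((q / (l + 1)) powr (1 / p))"
  have \<delta>: "0 < \<delta>" "\<delta> < m" using m(1) q l by (auto simp: \<delta>_def min_def)
  have \<delta>p: "l * s powr p \<le> q" if "0 \<le> s" "s \<le> \<delta>" for s
  proof -
    have "s powr p \<le> ((q / (l + 1)) powr (1 / p)) powr p"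
      using that p_pos by (intro powr_mono2) (auto simp: \<delta>_def)
    also have "\<dots> = q / (l + 1)" using q l p_pos by (simp add: powr_powr)
    finally have "l * s powr p \<le> l * (q / (l + 1))" using l by (rule mult_left_mono)
    also have "\<dots> = q * (l / (l + 1))" by simp
    also have "\<dots> \<le> q * 1" using q l by (intro mult_left_mono) auto
    finally show ?thesis by simp
  qed
  \<comment> \<open>As \<open>t \<ge> 1\<close>, \<open>\<beta> > 1\<close> and \<open>p \<ge> 2\<close>, the factor \<open>(t \<beta>)\<^sup>p\<^sup>-\<^sup>1\<close> is at least \<open>t\<close>.\<close>
  define t where "t = max 1 (\<bar>Ca\<bar> / q)"
  have t1: "1 \<le> t" by (simp add: t_def)
  then have t0: "0 < t" by simp
  define T where "T = (t * \<beta>) powr (p - 1)"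
  have tT: "t \<le> T"
  proof -
    have "t = t powr 1" using t0 by simp
    also have "\<dots> \<le> t powr (p - 1)" using t1 p_ge_2 by (intro powr_mono) auto
    also have "\<dots> \<le> (t * \<beta>) powr (p - 1)" using t0 \<beta> p_ge_2 by (intro powr_mono2) auto
    finally show ?thesis unfolding T_def .
  qed
  have T0: "0 < T" using tT t0 by simp
  have tg: "t powr (- \<gamma>) \<le> 1" using powr_mono2'[of "- \<gamma>" 1 t] t1 \<gamma> by simp
  have CaT: "Ca * t powr (- \<gamma>) \<le> T * q"
  proof -
    have "Ca * t powr (- \<gamma>) \<le> \<bar>Ca\<bar> * 1" using tg by (intro mult_mono) auto
    also have "\<dots> \<le> t * q" using q by (simp add: t_def max_def field_simps split: if_splits)
    also have "\<dots> \<le> T * q" using tT q by (intro mult_right_mono) auto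
    finally show ?thesis .
  qed
  define b where "b x = T * (l * \<phi> x powr p - \<kappa> * norm (G x) powr p) + a x * t powr (- \<gamma>)" for x
  have split: "T * \<phi> x powr (\<kappa> - 1) * (l * \<phi> x powr p - \<kappa> * norm (G x) powr p) = \<phi> x powr (\<kappa> - 1) * b x - a x * (t * \<phi> x powr \<beta>) powr (- \<gamma>)" for x
  proof -
    have "(t * \<phi> x powr \<beta>) powr (- \<gamma>) = t powr (- \<gamma>) * \<phi> x powr (\<kappa> - 1)"
      unfolding \<kappa>\<beta> using t0 by (simp add: powr_mult powr_powr)
    then show ?thesis by (simp add: b_def algebra_simps)
  qed
  have near: "b x \<le> 0" if x: "x \<in> \<Omega>" and "\<phi> x < \<delta>" and a: "a x \<le> Ca" for x
  proof -
    have "m \<le> norm (G x)" using m(2)[OF x] that(2) \<delta>(2) by auto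
    then have "m powr p \<le> norm (G x) powr p" using m(1) p_pos by (intro powr_mono2) auto
    then have "2 * q \<le> \<kappa> * norm (G x) powr p" unfolding q_def using \<kappa> by simp
    moreover have "l * \<phi> x powr p \<le> q" using that(2) phi_pos[OF x] by (intro \<delta>p) auto
    ultimately have "l * \<phi> x powr p - \<kappa> * norm (G x) powr p \<le> - q" by linarith
    then have "T * (l * \<phi> x powr p - \<kappa> * norm (G x) powr p) \<le> T * (- q)" using T0 by (intro mult_left_mono) auto
    moreover have "a x * t powr (- \<gamma>) \<le> Ca * t powr (- \<gamma>)" using a by (intro mult_right_mono) auto
    ultimately show ?thesis unfolding b_def using CaT by simp
  qed
  define Q where "Q = \<delta> powr (\<kappa> - 1) * (T * (l * B powr p) + \<bar>Ca\<bar>)"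
  have Q: "0 \<le> Q" unfolding Q_def using T0 l by (intro mult_nonneg_nonneg add_nonneg_nonneg) auto
  have k0: "\<kappa> - 1 \<le> 0" unfolding \<kappa>\<beta> using \<beta> \<gamma> by simp
  have far: "\<phi> x powr (\<kappa> - 1) * b x \<le> Q" if x: "x \<in> \<Omega>" and "\<delta> \<le> \<phi> x" and a: "0 \<le> a x" "a x \<le> Ca" for x
  proof -
    have "l * \<phi> x powr p - \<kappa> * norm (G x) powr p \<le> l * B powr p"
    proof -
      have "l * \<phi> x powr p \<le> l * B powr p" using B(2)[OF x] phi_pos[OF x] l p_pos by (intro mult_left_mono powr_mono2) auto
      moreover have "0 \<le> \<kappa> * norm (G x) powr p" using \<kappa> by simp
      ultimately show ?thesis by linarith
    qed
    then have "T * (l * \<phi> x powr p - \<kappa> * norm (G x) powr p) \<le> T * (l * B powr p)" using T0 by (intro mult_left_mono) auto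
    moreover have "a x * t powr (- \<gamma>) \<le> \<bar>Ca\<bar> * 1" using a tg by (intro mult_mono) auto
    ultimately have "b x \<le> T * (l * B powr p) + \<bar>Ca\<bar>" unfolding b_def by linarith
    then have "\<phi> x powr (\<kappa> - 1) * b x \<le> \<phi> x powr (\<kappa> - 1) * (T * (l * B powr p) + \<bar>Ca\<bar>)" by (intro mult_left_mono) auto
    also have "\<dots> \<le> Q" unfolding Q_def using that(2) \<delta>(1) k0 T0 l
      by (intro mult_right_mono powr_mono2') (auto intro!: add_nonneg_nonneg mult_nonneg_nonneg)
    finally show ?thesis .
  qed
  show thesis
  proof (rule that[OF t0])
    fix f :: "'a \<Rightarrow> real"
    assume f: "\<forall>\<omega>. compactly_contained \<omega> \<Omega> \<longrightarrow> (\<exists>c>0. AE x in M. x \<in> \<omega> \<longrightarrow> c \<le> f x)"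
    have f0: "AE x in M. 0 \<le> f x" by (rule superlevel_exhaustion[OF f])
    let ?\<omega> = "{x \<in> \<Omega>. \<delta> \<le> \<phi> x}"
    have "compactly_contained ?\<omega> \<Omega>"
      using superlevel_compact[OF \<delta>(1)] by (auto simp: compactly_contained_def compact_imp_closed closure_closed)
    from f[rule_format, OF this] obtain c where c: "0 < c" "AE x in M. x \<in> ?\<omega> \<longrightarrow> c \<le> f x" by blast
    define \<mu>0 where "\<mu>0 = Q / c + 1"
    have \<mu>0: "0 < \<mu>0" using Q c(1) by (simp add: \<mu>0_def add_nonneg_pos)
    have "AE x in M. T * \<phi> x powr (\<kappa> - 1) * (l * \<phi> x powr p - \<kappa> * norm (G x) powr p) \<le> \<mu> * f x - a x * (t * \<phi> x powr \<beta>) powr (- \<gamma>)"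
      if \<mu>: "\<mu>0 \<le> \<mu>" for \<mu>
      using f0 c(2) aC AE_space
    proof eventually_elim
      case (elim x)
      then have x: "x \<in> \<Omega>" by simp
      have "\<phi> x powr (\<kappa> - 1) * b x \<le> \<mu> * f x"
      proof (cases "\<phi> x < \<delta>")
        case True
        have "\<phi> x powr (\<kappa> - 1) * b x \<le> 0" using near[OF x True] elim by (simp add: mult_nonneg_nonpos)
        also have "0 \<le> \<mu> * f x" using elim \<mu> \<mu>0 by simp
        finally show ?thesis .
      next
        case False
        have "\<phi> x powr (\<kappa> - 1) * b x \<le> Q" using far[OF x] False elim by simp
        also have "\<dots> \<le> \<mu> * c"
        proof -
          have "Q / c \<le> \<mu>" using \<mu> unfolding \<mu>0_def by simp
          then show ?thesis using c(1) by (simp add: divide_le_eq)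
        qed
        also have "\<dots> \<le> \<mu> * f x" using elim x False \<mu> \<mu>0 by (intro mult_left_mono) auto
        finally show ?thesis .
      qed
      then show ?case unfolding split by simp
    qed
    then show "\<exists>\<mu>0>0. \<forall>\<mu>\<ge>\<mu>0. AE x in M. (t * \<beta>) powr (p - 1) * \<phi> x powr (\<kappa> - 1) * (l * \<phi> x powr p - \<kappa> * norm (G x) powr p)
         \<le> \<mu> * f x - a x * (t * \<phi> x powr \<beta>) powr (- \<gamma>)" using \<mu>0 unfolding T_def by blast
  qed
qed

theorem solution_above_phi_powr:
  assumes \<beta>: "1 < \<beta>" and t: "0 < t" and \<gamma>: "0 < \<gamma>" and am[measurable]: "a \<in> borel_measurable M"
    and aC: "AE x in M. 0 \<le> a x \<and> a x \<le> Ca" and f: "dual_weight f" "integrable M f"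
    and eigen: "\<And>\<psi>. \<psi> \<in> C1_c \<Omega> \<Longrightarrow> (LINT x|M. plap p (G x) \<bullet> gradient \<psi> x) = l * (LINT x|M. \<phi> x powr (p - 1) * \<psi> x)"
    and ineq: "AE x in M. (t * \<beta>) powr (p - 1) * \<phi> x powr ((\<beta> - 1) * (p - 1) - 1) * (l * \<phi> x powr p - (\<beta> - 1) * (p - 1) * norm (G x) powr p)
         \<le> \<mu> * f x - a x * (t * \<phi> x powr \<beta>) powr (- \<gamma>)"
  shows "\<exists>u. is_finite_energy_solution p \<gamma> \<Omega> a \<mu> f u \<and> is_positive \<Omega> u \<and>
             (\<lambda>x. a x * u x powr (- \<gamma>)) \<in> Lp 1 \<Omega> \<and> (AE x in M. u x \<ge> t * \<phi> x powr \<beta>)"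
proof -
  let ?w = "\<lambda>x. t * \<phi> x powr \<beta>" and ?z = "\<lambda>x. (t * \<beta> * \<phi> x powr (\<beta> - 1)) *\<^sub>R G x"
  let ?h = "\<lambda>x. a x * ?w x powr (- \<gamma>)"
  note w = phi_powr_sobolev0[OF \<beta> t]
  note [measurable] = sobolev0_measurable[OF w]
  note F = dual_weight_scale[OF f(1), of \<mu>]
  have sO: "\<Omega> \<in> sets lebesgue" using open_\<Omega> by simp
  have wpos: "0 < ?w x" if "x \<in> \<Omega>" for x using t phi_pos[OF that] by simp
  have h0: "AE x in M. 0 \<le> ?h x" using aC by eventually_elim auto
  have ih: "integrable M (\<lambda>x. ?h x * \<psi> x)" if \<psi>: "\<psi> \<in> C1_c \<Omega>" for \<psi>
  proof (rule Bochner_Integration.integrable_bound)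
    have wc: "continuous_on \<Omega> (\<lambda>x. \<bar>Ca\<bar> * ?w x powr (- \<gamma>))"
      by (intro continuous_intros phi_powr_cont) (use wpos in force)
    show "integrable M (\<lambda>x. (\<bar>Ca\<bar> * ?w x powr (- \<gamma>)) * \<psi> x)"
      by (rule C1_c_local_integrable(1)[OF open_\<Omega> bounded_\<Omega> \<psi> wc])
    show "(\<lambda>x. ?h x * \<psi> x) \<in> borel_measurable M" using C1_c_measurable[OF \<psi>] by measurable
    show "AE x in M. norm (?h x * \<psi> x) \<le> norm (\<bar>Ca\<bar> * ?w x powr (- \<gamma>) * \<psi> x)"
      using aC by eventually_elim (auto simp: abs_mult intro!: mult_right_mono)
  qed
  have sub: "(LINT x|M. plap p (?z x) \<bullet> gradient \<psi> x) \<le> (LINT x|M. (\<mu> * f x - ?h x) * \<psi> x)"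
    if \<psi>: "\<psi> \<in> C1_c \<Omega>" and nn: "\<And>x. 0 \<le> \<psi> x" for \<psi>
  proof -
    let ?e = "\<lambda>x. (t * \<beta>) powr (p - 1) * \<phi> x powr ((\<beta> - 1) * (p - 1) - 1) * (l * \<phi> x powr p - (\<beta> - 1) * (p - 1) * norm (G x) powr p)"
    have E: "(LINT x|M. plap p (?z x) \<bullet> gradient \<psi> x) = (LINT x|M. ?e x * \<psi> x)" "integrable M (\<lambda>x. ?e x * \<psi> x)"
      by (rule phi_powr_equation(1)[OF \<beta> t _ \<psi>], erule eigen, rule phi_powr_equation(2)[OF \<beta> t _ \<psi>], erule eigen)
    have "integrable M (\<lambda>x. (\<mu> * f x - ?h x) * \<psi> x)"
      unfolding left_diff_distrib by (rule Bochner_Integration.integrable_diff[OF dual_weight_integrable[OF F \<psi>] ih[OF \<psi>]])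
    then show ?thesis unfolding E(1)
      by (intro integral_mono_AE E(2)) (use ineq nn in \<open>auto elim!: eventually_mono intro: mult_right_mono\<close>)
  qed
  have h: "dual_weight ?h"
    by (rule dual_weight_of_subsolution[OF w _ h0 ih F sub]) measurable
  have a0: "AE x in M. 0 \<le> a x" using aC by eventually_elim simp
  obtain u v where uv: "sobolev0 u v" "AE x in M. ?w x \<le> u x" "dual_weight (\<lambda>x. a x * u x powr (- \<gamma>))"
    "weak_solution v (\<lambda>x. \<mu> * f x - a x * u x powr (- \<gamma>))"
    by (rule singular_problem_solvable[OF F am a0 w wpos \<gamma> h sub]) (blast intro: that)+
  have upos: "AE x in M. 0 < u x" using uv(2) AE_space by eventually_elim (use wpos in force)
  note S = finite_energy_solution[OF uv(1) f uv(3) a0 upos uv(4)]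
  show ?thesis using S upos uv(2) unfolding is_positive_def by blast
qed

end

text \<open>On a bounded domain the exponent may be lowered, so for \<open>p = N\<close> it is enough to treat some exponent in \<open>(1, p / (p - 1)]\<close>, the range
of the potential estimate.\<close>

lemma (in dirichlet_domain) Lp_data:
  fixes f :: "'a \<Rightarrow> real" and q :: ereal
  assumes f: "f \<in> Lp q \<Omega>" and q: "1 \<le> q"
    and cases: "p = real DIM('a) \<and> q > 1 \<or> p > real DIM('a) \<and> q = 1"
  shows "dual_weight f" "integrable M f"
proof -
  have fm[measurable]: "f \<in> borel_measurable M" using f by (simp add: Lp_def)
  have low: "integrable M (\<lambda>x. \<bar>f x\<bar> powr r)" if r: "1 \<le> r" "ereal r \<le> q" for r
  proof (cases "q = \<infinity>")
    case True
    then obtain C where C: "AE x in M. \<bar>f x\<bar> \<le> C" using f by (auto simp: Lp_def)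
    show ?thesis
      by (rule bounded_integrable_lebesgue_on[OF open_bounded_lmeasurable[OF open_\<Omega> bounded_\<Omega>], of _ "\<bar>C\<bar> powr r"])
        (use C r in \<open>auto elim!: eventually_mono intro!: powr_mono2\<close>)
  next
    case False
    then obtain s where s: "q = ereal s" using q by (cases q) auto
    then have rs: "r \<le> s" using r by simp
    have is': "integrable M (\<lambda>x. \<bar>f x\<bar> powr s)" using f s by (simp add: Lp_def)
    have i1: "integrable M (\<lambda>x. 1 + \<bar>f x\<bar> powr s)"
      using is' finite_measure.integrable_const[OF finite_M] by (intro Bochner_Integration.integrable_add)
    show ?thesis
    proof (rule Bochner_Integration.integrable_bound[OF i1])
      show "AE x in M. norm (\<bar>f x\<bar> powr r) \<le> norm (1 + \<bar>f x\<bar> powr s)"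
      proof (rule AE_I2)
        fix x
        have "\<bar>f x\<bar> powr r \<le> 1 + \<bar>f x\<bar> powr s"
        proof (cases "\<bar>f x\<bar> \<le> 1")
          case True
          then have "\<bar>f x\<bar> powr r \<le> 1" using r by (intro powr_le1) auto
          then show ?thesis by (simp add: add_increasing2)
        next
          case False
          then have "\<bar>f x\<bar> powr r \<le> \<bar>f x\<bar> powr s" using rs by (intro powr_mono) auto
          then show ?thesis by simp
        qed
        then show "norm (\<bar>f x\<bar> powr r) \<le> norm (1 + \<bar>f x\<bar> powr s)" by simp
      qed
    qed measurable
  qed
  have "integrable M (\<lambda>x. \<bar>f x\<bar> powr 1)" using low[of 1] q by (simp add: one_ereal_def)
  then have "integrable M (\<lambda>x. \<bar>f x\<bar>)" by simp
  then show "integrable M f" by (subst (asm) integrable_abs_iff) auto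
  show "dual_weight f"
  proof (cases "p > real DIM('a) \<and> q = 1")
    case True
    show ?thesis
      by (rule Lq_dual_weight[OF fm, of 1]) (use True low[of 1] in \<open>auto simp: one_ereal_def\<close>)
  next
    case False
    then have pN: "p = real DIM('a)" and q1: "q > 1" using cases by auto
    obtain s where s: "1 < s" "ereal s \<le> q"
    proof (cases q)
      case (real r)
      then show thesis using q1 that[of r] by (simp add: one_ereal_def)
    next
      case PInf
      then show thesis using that[of 2] by simp
    qed (use q1 in auto)
    define r where "r = min s (p / (p - 1))"
    have r: "1 < r" "r \<le> s" "r \<le> p / (p - 1)" using s p_ge_2 by (auto simp: r_def)
    then have rq: "ereal r \<le> q" using s(2) by (meson ereal_less_eq(3) order_trans)
    show ?thesis
    proof (rule Lq_dual_weight[OF fm low[OF less_imp_le[OF r(1)] rq]])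
      have "r * (p - 1) \<le> p" using r(3) p_ge_2 by (simp add: le_divide_eq)
      then show "0 \<le> 1 - (r - 1) * (p - 1)" by (simp add: algebra_simps)
      have "0 < (r - 1) * (p - 1)" using r p_ge_2 by simp
      then have "p * (1 - (r - 1) * (p - 1)) < p * 1" using p_pos by (intro mult_strict_left_mono) auto
      also have "\<dots> \<le> p * r" using r p_pos by (intro mult_left_mono) auto
      finally show "real DIM('a) * (1 - (r - 1) * (p - 1)) < p * r" unfolding pN .
    qed (use r in auto)
  qed
qed

theorem theorem2p3:
  fixes \<Omega> :: "(real ^ 'n) set" and p \<gamma> :: real and a \<phi>1 :: "real ^ 'n \<Rightarrow> real"
  assumes "2 \<le> CARD('n)"
    and "open \<Omega>" and "bounded \<Omega>" and "smooth_boundary \<Omega>"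
    and "real CARD('n) \<le> p"
    and "0 < \<gamma>" and "\<gamma> < 1"
    and "a \<in> Lp \<infinity> \<Omega>" and "AE x in lebesgue_on \<Omega>. 0 \<le> a x"
    and "\<not> (AE x in lebesgue_on \<Omega>. a x = 0)"
    and "is_first_eigenfunction p \<Omega> \<phi>1"
  shows "\<exists>t0>0. \<forall>(q::ereal) (f :: real ^ 'n \<Rightarrow> real).
    1 \<le> q \<and> f \<in> Lp q \<Omega> \<and>
    (\<forall>\<omega>. compactly_contained \<omega> \<Omega> \<longrightarrow>
       (\<exists>c>0. AE x in lebesgue_on \<Omega>. x \<in> \<omega> \<longrightarrow> c \<le> f x)) \<longrightarrow>
    (\<exists>\<mu>0>0. \<forall>\<mu>\<ge>\<mu>0.
      (p = real CARD('n) \<and> q > 1 \<longrightarrow>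
        (\<exists>u. is_finite_energy_solution p \<gamma> \<Omega> a \<mu> f u \<and> is_positive \<Omega> u \<and>
             (\<lambda>x. a x * u x powr (- \<gamma>)) \<in> Lp 1 \<Omega> \<and>
             (AE x in lebesgue_on \<Omega>. u x \<ge> t0 * \<phi>1 x powr (p / (p - 1 + \<gamma>))))) \<and>
      (p > real CARD('n) \<and> q = 1 \<longrightarrow>
        (\<exists>u. is_finite_energy_solution p \<gamma> \<Omega> a \<mu> f u \<and> is_positive \<Omega> u \<and>
             (\<lambda>x. a x * u x powr (- \<gamma>)) \<in> Lp 1 \<Omega> \<and>
             (AE x in lebesgue_on \<Omega>. u x \<ge> t0 * \<phi>1 x powr (p / (p - 1 + \<gamma>))))))"
proof -
  let ?\<beta> = "p / (p - 1 + \<gamma>)"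
  have p2: "2 \<le> p" using assms(1,5) by linarith
  note ef = assms(11)[unfolded is_first_eigenfunction_def C1_closure_def]
  obtain G where G: "continuous_on (closure \<Omega>) \<phi>1" "continuous_on (closure \<Omega>) G" "\<And>x. x \<in> \<Omega> \<Longrightarrow> GDERIV \<phi>1 x :> G x"
    using ef by blast
  obtain l where l: "is_first_eigenvalue p \<Omega> l"
    "\<And>\<psi>. \<psi> \<in> C1_c \<Omega> \<Longrightarrow> (LINT x|lebesgue_on \<Omega>. norm (gradient \<phi>1 x) powr (p - 2) * (gradient \<phi>1 x \<bullet> gradient \<psi> x))
           = l * (LINT x|lebesgue_on \<Omega>. \<phi>1 x powr (p - 1) * \<psi> x)"
    using ef by blast
  have l0: "0 \<le> l"
  proof -
    obtain u :: "real ^ 'n \<Rightarrow> real" and v :: "real ^ 'n \<Rightarrow> real ^ 'n" where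
      "l = (LINT x|lebesgue_on \<Omega>. norm (v x) powr p) / (LINT x|lebesgue_on \<Omega>. \<bar>u x\<bar> powr p)"
      using l(1) unfolding is_first_eigenvalue_def rayleigh_quotients_def by blast
    then show ?thesis by (simp add: Bochner_Integration.integral_nonneg)
  qed
  have eigen: "(LINT x|lebesgue_on \<Omega>. plap p (G x) \<bullet> gradient \<psi> x) = l * (LINT x|lebesgue_on \<Omega>. \<phi>1 x powr (p - 1) * \<psi> x)"
    if \<psi>: "\<psi> \<in> C1_c \<Omega>" for \<psi>
  proof -
    have "(LINT x|lebesgue_on \<Omega>. plap p (G x) \<bullet> gradient \<psi> x)
       = (LINT x|lebesgue_on \<Omega>. norm (gradient \<phi>1 x) powr (p - 2) * (gradient \<phi>1 x \<bullet> gradient \<psi> x))"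
      by (rule Bochner_Integration.integral_cong[OF refl]) (simp add: gradient_eqI[OF G(3)] plap_def)
    then show ?thesis using l(2)[OF \<psi>] by simp
  qed
  interpret p_superharmonic \<Omega> p \<phi>1 G
  proof unfold_locales
    show "0 \<le> (LINT x|lebesgue_on \<Omega>. plap p (G x) \<bullet> gradient \<psi> x)" if "\<psi> \<in> C1_c \<Omega>" "\<And>x. 0 \<le> \<psi> x" for \<psi>
      unfolding eigen[OF that(1)] using l0 that(2)
      by (intro mult_nonneg_nonneg Bochner_Integration.integral_nonneg) auto
  qed (use assms(2,3,5) p2 G ef in auto)
  have am: "a \<in> borel_measurable M" using assms(8) by (simp add: Lp_def)
  obtain Ca where Ca: "AE x in M. \<bar>a x\<bar> \<le> Ca" using assms(8) by (auto simp: Lp_def)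
  have aC: "AE x in M. 0 \<le> a x \<and> a x \<le> Ca" using Ca assms(9) by eventually_elim auto
  have \<beta>: "1 < ?\<beta>" using assms(6,7) p2 by (simp add: less_divide_eq)
  obtain t where t: "0 < t"
    "\<And>f. \<forall>\<omega>. compactly_contained \<omega> \<Omega> \<longrightarrow> (\<exists>c>0. AE x in M. x \<in> \<omega> \<longrightarrow> c \<le> f x) \<Longrightarrow>
      \<exists>\<mu>0>0. \<forall>\<mu>\<ge>\<mu>0. AE x in M. (t * ?\<beta>) powr (p - 1) * \<phi>1 x powr ((?\<beta> - 1) * (p - 1) - 1)
           * (l * \<phi>1 x powr p - (?\<beta> - 1) * (p - 1) * norm (G x) powr p)
         \<le> \<mu> * f x - a x * (t * \<phi>1 x powr ?\<beta>) powr (- \<gamma>)"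
    by (rule subsolution_inequality[OF assms(4,6,7) l0 aC]) (rule that)
  show ?thesis
  proof (rule exI[of _ t], intro conjI t(1) allI impI, elim conjE)
    fix q :: ereal and f :: "real ^ 'n \<Rightarrow> real"
    assume q: "1 \<le> q" and f: "f \<in> Lp q \<Omega>"
      and pos: "\<forall>\<omega>. compactly_contained \<omega> \<Omega> \<longrightarrow> (\<exists>c>0. AE x in lebesgue_on \<Omega>. x \<in> \<omega> \<longrightarrow> c \<le> f x)"
    obtain \<mu>0 where \<mu>0: "0 < \<mu>0" "\<And>\<mu>. \<mu>0 \<le> \<mu> \<Longrightarrow> AE x in M. (t * ?\<beta>) powr (p - 1) * \<phi>1 x powr ((?\<beta> - 1) * (p - 1) - 1)
           * (l * \<phi>1 x powr p - (?\<beta> - 1) * (p - 1) * norm (G x) powr p)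
         \<le> \<mu> * f x - a x * (t * \<phi>1 x powr ?\<beta>) powr (- \<gamma>)"
      using t(2)[OF pos] by blast
    have main: "\<exists>u. is_finite_energy_solution p \<gamma> \<Omega> a \<mu> f u \<and> is_positive \<Omega> u \<and>
             (\<lambda>x. a x * u x powr (- \<gamma>)) \<in> Lp 1 \<Omega> \<and> (AE x in lebesgue_on \<Omega>. u x \<ge> t * \<phi>1 x powr ?\<beta>)"
      if "\<mu>0 \<le> \<mu>" and c: "p = real CARD('n) \<and> q > 1 \<or> p > real CARD('n) \<and> q = 1" for \<mu>
    proof (rule solution_above_phi_powr[OF \<beta> t(1) assms(6) am aC _ _ eigen \<mu>0(2)[OF that(1)]])
      show "dual_weight f" "integrable M f" by (rule Lp_data[OF f q]; use c in simp)+
    qed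
    then show "\<exists>\<mu>0>0. \<forall>\<mu>\<ge>\<mu>0.
      (p = real CARD('n) \<and> q > 1 \<longrightarrow>
        (\<exists>u. is_finite_energy_solution p \<gamma> \<Omega> a \<mu> f u \<and> is_positive \<Omega> u \<and>
             (\<lambda>x. a x * u x powr (- \<gamma>)) \<in> Lp 1 \<Omega> \<and>
             (AE x in lebesgue_on \<Omega>. u x \<ge> t * \<phi>1 x powr (p / (p - 1 + \<gamma>))))) \<and>
      (p > real CARD('n) \<and> q = 1 \<longrightarrow>
        (\<exists>u. is_finite_energy_solution p \<gamma> \<Omega> a \<mu> f u \<and> is_positive \<Omega> u \<and>
             (\<lambda>x. a x * u x powr (- \<gamma>)) \<in> Lp 1 \<Omega> \<and>
             (AE x in lebesgue_on \<Omega>. u x \<ge> t * \<phi>1 x powr (p / (p - 1 + \<gamma>)))))"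
      using \<mu>0(1) by blast
  qed
qed


end
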